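(* Let $\Omega\subset\mathbb R^2$ be an open bounded polyhedral set, $T>0$, let $\beta:\mathbb R\to\mathbb R$ and $g:\mathbb R\to\mathbb R$ be locally Lipschitz-continuous, and let $q_0\in L^\infty(\Omega)$. Consider either the RT or the MAC staggered arrangement described in the context. Let $(\mathcal P^{(m)})_{m\in\mathbb N}$ and $(\mathcal T^{(m)})_{m\in\mathbb N}$ be a sequence of space and time discretisations with $\delta(\mathcal P^{(m)})$ and $\delta t^{(m)}$ tending to zero as $m\to+\infty$, and let $U^{(m)}=(q^{(m)},\mathbf v^{(m)})$, $m\in\mathbb N$, be the associated sequence of discrete functions, the initial values of $q^{(m)}$ being $(q^{(m)})_P^0=\frac1{|P|}\int_Pq_0(\mathbf x)\,d\mathbf x$ for $P\in\mathcal P^{(m)}$. Suppose that there exists $\theta\in\mathbb R$ such that $$\max\{\theta_1(\mathcal P^{(m)}),\ \theta_2(\mathcal P^{(m)}),\ \theta_3(\mathcal T^{(m)})\}\le\theta\quad\text{for all }m\in\mathbb N.$$ Suppose that $(q^{(m)})_{m\in\mathbb N}$ and $(\mathbf v^{(m)})_{m\in\mathbb N}$ are bounded in $L^\infty(\Omega\times(0,T))$ and $L^\infty(\Omega\times(0,T))^2$ respectively, and that, as $m\to+\infty$, they converge in $L^p(\Omega\times(0,T))$ and $L^p(\Omega\times(0,T))^2$, $1\le p<+\infty$, to $\bar q\in L^\infty(\Omega\times(0,T))$ and $\bar{\mathbf v}\in L^\infty(\Omega\times(0,T))^2$ respectively. Then, for any $\varphi\in C_c^\infty(\Omega\times[0,T))$,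 as $m\to+\infty$, $$\int_0^T\!\!\int_\Omega\mathcal C^{(m)}(U^{(m)})(\mathbf x,t)\,\mathcal I^{(m)}(\varphi)(\mathbf x,t)\,d\mathbf x\,dt\ \to\ -\int_\Omega\beta(q_0)(\mathbf x)\,\varphi(\mathbf x,0)\,d\mathbf x-\int_0^T\!\!\int_\Omega\Bigl(\beta(\bar q)(\mathbf x,t)\,\partial_t\varphi(\mathbf x,t)+\bigl(g(\bar q)\,\bar{\mathbf v}\bigr)(\mathbf x,t)\cdot\nabla\varphi(\mathbf x,t)\Bigr)d\mathbf x\,dt.$$
   Context: Primal mesh. A mesh $\mathcal P$ of $\Omega$ is a finite set of disjoint open cells whose union of closures is $\overline\Omega$, any pair of adjacent cells sharing a whole edge. The cells are general quadrangles (RT case), or rectangles with horizontal and vertical edges (MAC case). $\delta(\mathcal P)=\max_{P\in\mathcal P}\mathrm{diam}(P)$; $\mathfrak F$ is the set of edges, $\mathfrak F(P)$ the set of edges of $P$; $\zeta=P|Q$ denotes the internal edge separating $P$ and $Q$; $|P|$, $|\zeta|$ are the area of $P$ and the length of $\zeta$; $\mathbf n_{P,\zeta}$ is the unit normal to $\zeta$ outward to $P$. Time discretisation. $\mathcal T$: $0=t_0<t_1<\dots<t_N=T$, $\delta t=\max_{0\le n\le N-1}(t_{n+1}-t_n)$. A superscript $(m)$ refers to the $m$-th discretisation. Dual mesh, RT case. One partition $\Omega=\cup_{\zeta\in\mathfrak F}D_\zeta$ (up to boundaries). For $\zeta=P|Q$, $D_\zeta\subset P\cup Q$, $D_{P,\zeta}=D_\zeta\cap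 P$ and $D_\zeta=D_{P,\zeta}\cup D_{Q,\zeta}$; for an external edge $\zeta$ of $P$, $D_\zeta=D_{P,\zeta}\subset P$. If $P$ is a rectangle, $D_{P,\zeta}$ is the triangle with basis $\zeta$ and opposite vertex the mass center of $P$; for a general quadrangle $P$ it is only assumed that $|D_{P,\zeta}|=|P|/4$ and that the connectivities of the four sub-cells $D_{P,\zeta}$, $\zeta\in\mathfrak F(P)$ (the way they share common edges) are the same as in the rectangular case (the precise geometry is otherwise unspecified, and dual edges may be curved). Dual meshes, MAC case. $\mathfrak F^{(1)}$ (resp. $\mathfrak F^{(2)}$) is the set of vertical (resp. horizontal) edges. For $i=1,2$, $\Omega=\cup_{\zeta\in\mathfrak F^{(i)}}D_\zeta$ (up to boundaries), where $D_{P,\zeta}$ is the half of the rectangle $P$ having $\zeta$ as a side, $D_\zeta=D_{P,\zeta}\cup D_{Q,\zeta}$ for $\zeta=P|Q$, and $D_\zeta=D_{P,\zeta}$ for an external edge $\zeta$ of $P$. Discrete functions. The scalar unknowns are real numbers $q_P^n$, $P\in\mathcal P$, $0\le n\le N$, and $q(\mathbf x,t)=q_P^n$ for $\mathbf x\in P$, $t\in[t_n,t_{n+1})$, $0\le n\le N-1$. In the RT case, the vector unknowns are $\mathbf v_\zeta^n\in\mathbb R^2$, $\zeta\in\mathfrak F$, and $\mathbf v(\mathbf x,t)=\mathbf v_\zeta^n$ for $\mathbf x\in D_\zeta$, $t\in[t_n,t_{n+1})$, $0\le n\le N-1$. In the MAC case, the unknowns are $v_\zeta^n\in\mathbb R$,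 $\zeta\in\mathfrak F$, and $\mathbf v=(v_1,v_2)^t$ with $v_i(\mathbf x,t)=v_\zeta^n$ for $\mathbf x\in D_\zeta$, $\zeta\in\mathfrak F^{(i)}$, $t\in[t_n,t_{n+1})$; one then sets $\mathbf v_\zeta^n=v_\zeta^n\,\mathbf e^{(i)}$ for $\zeta\in\mathfrak F^{(i)}$, with $\mathbf e^{(i)}$ the $i$-th unit vector. Discrete convection operator (a discretisation of $\partial_t\beta(q)+\mathrm{div}(g(q)\mathbf v)$). For $U=(q,\mathbf v)$, $\mathcal C(U)(\mathbf x,t)=\mathcal C(U)_P^n$ for $\mathbf x\in P$, $t\in(t_n,t_{n+1})$, $0\le n\le N-1$, where $$\mathcal C(U)_P^n=\frac{\beta(q_P^{n+1})-\beta(q_P^n)}{t_{n+1}-t_n}+\frac1{|P|}\sum_{\zeta\in\mathfrak F(P)}|\zeta|\,\mathbf F_\zeta^n\cdot\mathbf n_{P,\zeta},\qquad\mathbf F_\zeta^n=g(q_\zeta^n)\,\mathbf v_\zeta^n,$$ and, for $\zeta=P|Q$, $q_\zeta^n$ is a convex combination of $q_P^n$ and $q_Q^n$ (for external edges, $q_\zeta^n$ is an arbitrary real number). $\mathcal C^{(m)}$ is this operator for the $m$-th discretisation. Regularity parameters. $$\theta_1(\mathcal P)=\max_{P\in\mathcal P}\frac{\mathrm{diam}(P)^2}{|P|},\qquad\theta_2(\mathcal P)=\max\Bigl\{\frac{|P|}{|Q|}:\ P,Q\text{ adjacent cells of }\mathcal P\Bigr\},$$ $$\theta_3(\mathcal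 T)=\max_{1\le n\le N-1}\max\Bigl\{\frac{t_{n+1}-t_n}{t_n-t_{n-1}},\ \frac{t_n-t_{n-1}}{t_{n+1}-t_n}\Bigr\}.$$ Interpolate. $\mathcal I^{(m)}(\varphi)(\mathbf x,t)=\varphi_P^n$ for $\mathbf x\in P$, $t\in(t_n,t_{n+1})$, with $\varphi_P^n=\frac1{|P|}\int_P\varphi(\mathbf x,t_n)\,d\mathbf x$, $P\in\mathcal P^{(m)}$. Notation. $\beta(q)$, $g(q)$ denote compositions. $C_c^\infty(\Omega\times[0,T))$ is the set of smooth functions with compact support in $\Omega\times[0,T)$ (not necessarily vanishing at $t=0$). *)

theory Defs
  imports "HOL-Analysis.Analysis"
begin

type_synonym point = "real^2"

(* Maximum of a finite set of nonnegative reals; the maximum of the empty set is 0. *)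
definition max0 :: "real set \<Rightarrow> real" where
  "max0 S = Max (insert 0 S)"

abbreviation area :: "point set \<Rightarrow> real" where
  "area \<equiv> measure lebesgue"

definition polyhedral :: "point set \<Rightarrow> bool" where
  "polyhedral \<Omega> \<longleftrightarrow>
     (\<exists>S. finite S \<and> frontier \<Omega> = (\<Union>(a, b)\<in>S. closed_segment a b))"

definition mass_center :: "point set \<Rightarrow> point" where
  "mass_center P = (1 / area P) *\<^sub>R (LINT x:P|lebesgue. x)"

(* P is the open quadrangle with consecutive vertices a, b, c, d, and E is the set of its four
   edges.  A simple quadrangle, convex or not, always has a diagonal inside it; the vertices are
   labelled so that this is the diagonal a c, which cuts the quadrangle into two triangles. *)
definition quadrangle ::
  "point \<Rightarrow> point \<Rightarrow> point \<Rightarrow> point \<Rightarrow> point set \<Rightarrow> point set set \<Rightarrow> bool" where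
  "quadrangle a b c d P E \<longleftrightarrow>
     \<not> collinear {a, b, c} \<and> \<not> collinear {b, c, d} \<and> \<not> collinear {c, d, a} \<and> \<not> collinear {d, a, b} \<and>
     convex hull {a, b, c} \<inter> convex hull {a, c, d} = closed_segment a c \<and>
     P = interior (convex hull {a, b, c} \<union> convex hull {a, c, d}) \<and>
     E = {closed_segment a b, closed_segment b c, closed_segment c d, closed_segment d a}"

definition is_quadrangle :: "point set \<Rightarrow> point set set \<Rightarrow> bool" where
  "is_quadrangle P E \<longleftrightarrow> (\<exists>a b c d. quadrangle a b c d P E)"

definition is_rectangle :: "point set \<Rightarrow> point set set \<Rightarrow> bool" where
  "is_rectangle P E \<longleftrightarrow>
     (\<exists>a b c d. quadrangle a b c d P E \<and> b - a = c - d \<and> (b - a) \<bullet> (d - a) = 0)"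

definition outward_normal :: "point set \<Rightarrow> point set \<Rightarrow> point" where
  "outward_normal P \<zeta> = (THE n. norm n = 1 \<and> (\<forall>x\<in>\<zeta>. \<forall>y\<in>\<zeta>. n \<bullet> (x - y) = 0) \<and>
     (\<forall>x\<in>rel_interior \<zeta>. \<exists>e>0. \<forall>s\<in>{0<..<e}. x - s *\<^sub>R n \<in> P \<and> x + s *\<^sub>R n \<notin> P))"

datatype arrangement = RT | MAC

(* A space and time discretisation with the discrete unknowns living on it.  The edges of a cell
   are determined by the cell; they are stored as a function for convenience.  In the MAC case the
   scalar unknown of an edge normal to the i-th axis is the i-th component of vval, and the other
   component is zero. *)
record scheme =
  cells :: "point set set"
  edges :: "point set \<Rightarrow> point set set"                (* the edges of P *)
  subcell :: "point set \<Rightarrow> point set \<Rightarrow> point set"    (* D_(P,zeta) *)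
  nsteps :: nat                                              (* N *)
  tm :: "nat \<Rightarrow> real"                                   (* t_n *)
  qval :: "point set \<Rightarrow> nat \<Rightarrow> real"                (* q_P^n *)
  qedge :: "point set \<Rightarrow> nat \<Rightarrow> real"               (* q_zeta^n *)
  vval :: "point set \<Rightarrow> nat \<Rightarrow> point"               (* v_zeta^n *)

definition all_edges :: "scheme \<Rightarrow> point set set" where
  "all_edges d = (\<Union>P\<in>cells d. edges d P)"

(* The edges normal to the i-th axis: vertical for i = 1, horizontal for i = 2. *)
definition dir_edges :: "scheme \<Rightarrow> 2 \<Rightarrow> point set set" where
  "dir_edges d i = {\<zeta> \<in> all_edges d. \<forall>x\<in>\<zeta>. \<forall>y\<in>\<zeta>. x $ i = y $ i}"

definition adjacent :: "scheme \<Rightarrow> point set \<Rightarrow> point set \<Rightarrow> bool" where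
  "adjacent d P Q \<longleftrightarrow>
     P \<in> cells d \<and> Q \<in> cells d \<and> P \<noteq> Q \<and> edges d P \<inter> edges d Q \<noteq> {}"

(* The last condition is conformity: as soon as two cells have more than a point in common along
   some of their edges, these are one and the same edge. *)
definition primal_mesh :: "point set \<Rightarrow> scheme \<Rightarrow> bool" where
  "primal_mesh \<Omega> d \<longleftrightarrow>
     finite (cells d) \<and>
     pairwise disjnt (cells d) \<and>
     (\<Union>P\<in>cells d. closure P) = closure \<Omega> \<and>
     (\<forall>P\<in>cells d. is_quadrangle P (edges d P)) \<and>
     (\<forall>P\<in>cells d. \<forall>Q\<in>cells d. P \<noteq> Q \<longrightarrow>
        (\<forall>\<zeta>\<in>edges d P. \<forall>\<eta>\<in>edges d Q. infinite (\<zeta> \<inter> \<eta>) \<longrightarrow> \<zeta> = \<eta>))"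

definition time_grid :: "real \<Rightarrow> scheme \<Rightarrow> bool" where
  "time_grid T d \<longleftrightarrow> tm d 0 = 0 \<and> tm d (nsteps d) = T \<and> (\<forall>n<nsteps d. tm d n < tm d (Suc n))"

(* D gives the four open sub-cells of P.  In a rectangle, two of the triangles share an edge iff
   their bases are consecutive sides; the same connectivity is required in a general quadrangle,
   where a common (possibly curved) edge is a nondegenerate arc contained in both closures. *)
definition RT_subcells ::
  "point set \<Rightarrow> point set set \<Rightarrow> (point set \<Rightarrow> point set) \<Rightarrow> bool" where
  "RT_subcells P E D \<longleftrightarrow>
     (\<forall>\<zeta>\<in>E. open (D \<zeta>) \<and> D \<zeta> \<subseteq> P \<and> area (D \<zeta>) = area P / 4) \<and>
     (\<forall>\<zeta>\<in>E. \<forall>\<eta>\<in>E. \<zeta> \<noteq> \<eta> \<longrightarrow> D \<zeta> \<inter> D \<eta> = {}) \<and>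
     (\<Union>\<zeta>\<in>E. closure (D \<zeta>)) = closure P \<and>
     (\<forall>\<zeta>\<in>E. \<forall>\<eta>\<in>E. \<zeta> \<noteq> \<eta> \<longrightarrow>
        ((\<exists>\<gamma>. arc \<gamma> \<and> path_image \<gamma> \<subseteq> closure (D \<zeta>) \<inter> closure (D \<eta>)) \<longleftrightarrow> \<zeta> \<inter> \<eta> \<noteq> {})) \<and>
     (is_rectangle P E \<longrightarrow>
        (\<forall>\<zeta>\<in>E. D \<zeta> = interior (convex hull (insert (mass_center P) \<zeta>))))"

definition MAC_subcells ::
  "point set \<Rightarrow> point set set \<Rightarrow> (point set \<Rightarrow> point set) \<Rightarrow> bool" where
  "MAC_subcells P E D \<longleftrightarrow>
     (\<forall>\<zeta>\<in>E. D \<zeta> = {x \<in> P. (x - mass_center P) \<bullet> outward_normal P \<zeta> > 0})"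

fun staggered :: "arrangement \<Rightarrow> scheme \<Rightarrow> bool" where
  "staggered RT d \<longleftrightarrow> (\<forall>P\<in>cells d. RT_subcells P (edges d P) (subcell d P))"
| "staggered MAC d \<longleftrightarrow>
     (\<forall>P\<in>cells d. is_rectangle P (edges d P) \<and>
        edges d P \<subseteq> dir_edges d 1 \<union> dir_edges d 2 \<and>
        MAC_subcells P (edges d P) (subcell d P)) \<and>
     (\<forall>i. \<forall>\<zeta>\<in>dir_edges d i. \<forall>n<nsteps d. vval d \<zeta> n = (vval d \<zeta> n $ i) *\<^sub>R axis i 1)"

definition admissible_scheme :: "arrangement \<Rightarrow> point set \<Rightarrow> real \<Rightarrow> scheme \<Rightarrow> bool" where
  "admissible_scheme A \<Omega> T d \<longleftrightarrow>
     primal_mesh \<Omega> d \<and> time_grid T d \<and> staggered A d \<and>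
     (\<forall>P\<in>cells d. \<forall>Q\<in>cells d. P \<noteq> Q \<longrightarrow>
        (\<forall>\<zeta>\<in>edges d P \<inter> edges d Q. \<forall>n<nsteps d.
           qedge d \<zeta> n \<in> closed_segment (qval d P n) (qval d Q n)))"

(* D_zeta: the union of D_(P,zeta) over the one or two cells having zeta as an edge *)
definition dual_cell :: "scheme \<Rightarrow> point set \<Rightarrow> point set" where
  "dual_cell d \<zeta> = (\<Union>P\<in>{P \<in> cells d. \<zeta> \<in> edges d P}. subcell d P \<zeta>)"

definition mesh_size :: "scheme \<Rightarrow> real" where
  "mesh_size d = max0 (diameter ` cells d)"

definition time_step :: "scheme \<Rightarrow> real" where
  "time_step d = max0 ((\<lambda>n. tm d (Suc n) - tm d n) ` {..<nsteps d})"

definition theta1 :: "scheme \<Rightarrow> real" where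
  "theta1 d = max0 ((\<lambda>P. (diameter P)\<^sup>2 / area P) ` cells d)"

definition theta2 :: "scheme \<Rightarrow> real" where
  "theta2 d = max0 {area P / area Q | P Q. adjacent d P Q}"

definition theta3 :: "scheme \<Rightarrow> real" where
  "theta3 d = max0 ((\<lambda>n. max ((tm d (n + 1) - tm d n) / (tm d n - tm d (n - 1)))
                              ((tm d n - tm d (n - 1)) / (tm d (n + 1) - tm d n)))
                     ` {1..<nsteps d})"

definition q_fun :: "scheme \<Rightarrow> point \<times> real \<Rightarrow> real" where
  "q_fun d z = (\<Sum>P\<in>cells d. \<Sum>n<nsteps d.
     qval d P n * indicator (P \<times> {tm d n..<tm d (Suc n)}) z)"

fun v_fun :: "arrangement \<Rightarrow> scheme \<Rightarrow> point \<times> real \<Rightarrow> point" where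
  "v_fun RT d z = (\<Sum>\<zeta>\<in>all_edges d. \<Sum>n<nsteps d.
     indicator (dual_cell d \<zeta> \<times> {tm d n..<tm d (Suc n)}) z *\<^sub>R vval d \<zeta> n)"
| "v_fun MAC d z = (\<chi> i. \<Sum>\<zeta>\<in>dir_edges d i. \<Sum>n<nsteps d.
     indicator (dual_cell d \<zeta> \<times> {tm d n..<tm d (Suc n)}) z * (vval d \<zeta> n $ i))"

(* The diameter of an edge is its length. *)
definition conv_val :: "(real \<Rightarrow> real) \<Rightarrow> (real \<Rightarrow> real) \<Rightarrow> scheme \<Rightarrow> point set \<Rightarrow> nat \<Rightarrow> real" where
  "conv_val \<beta> g d P n =
     (\<beta> (qval d P (Suc n)) - \<beta> (qval d P n)) / (tm d (Suc n) - tm d n) +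
     1 / area P * (\<Sum>\<zeta>\<in>edges d P.
        diameter \<zeta> * ((g (qedge d \<zeta> n) *\<^sub>R vval d \<zeta> n) \<bullet> outward_normal P \<zeta>))"

definition conv_fun :: "(real \<Rightarrow> real) \<Rightarrow> (real \<Rightarrow> real) \<Rightarrow> scheme \<Rightarrow> point \<times> real \<Rightarrow> real" where
  "conv_fun \<beta> g d z = (\<Sum>P\<in>cells d. \<Sum>n<nsteps d.
     conv_val \<beta> g d P n * indicator (P \<times> {tm d n<..<tm d (Suc n)}) z)"

definition interpolate :: "scheme \<Rightarrow> (point \<times> real \<Rightarrow> real) \<Rightarrow> point \<times> real \<Rightarrow> real" where
  "interpolate d \<phi> z = (\<Sum>P\<in>cells d. \<Sum>n<nsteps d.
     (1 / area P * (LINT x:P|lebesgue. \<phi> (x, tm d n))) *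
     indicator (P \<times> {tm d n<..<tm d (Suc n)}) z)"

definition in_Linf :: "'a measure \<Rightarrow> ('a \<Rightarrow> 'b::euclidean_space) \<Rightarrow> bool" where
  "in_Linf M f \<longleftrightarrow> f \<in> borel_measurable M \<and> (\<exists>C. AE z in M. norm (f z) \<le> C)"

definition bounded_in_Linf :: "'a measure \<Rightarrow> (nat \<Rightarrow> 'a \<Rightarrow> 'b::euclidean_space) \<Rightarrow> bool" where
  "bounded_in_Linf M f \<longleftrightarrow>
     (\<forall>m. f m \<in> borel_measurable M) \<and> (\<exists>C. \<forall>m. AE z in M. norm (f m z) \<le> C)"

definition in_Lp :: "real \<Rightarrow> 'a measure \<Rightarrow> ('a \<Rightarrow> 'b::euclidean_space) \<Rightarrow> bool" where
  "in_Lp p M f \<longleftrightarrow> f \<in> borel_measurable M \<and> integrable M (\<lambda>z. norm (f z) powr p)"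

definition Lp_norm :: "real \<Rightarrow> 'a measure \<Rightarrow> ('a \<Rightarrow> 'b::euclidean_space) \<Rightarrow> real" where
  "Lp_norm p M f = (LINT z|M. norm (f z) powr p) powr (1 / p)"

definition converges_in_Lp ::
  "real \<Rightarrow> 'a measure \<Rightarrow> (nat \<Rightarrow> 'a \<Rightarrow> 'b::euclidean_space) \<Rightarrow> ('a \<Rightarrow> 'b) \<Rightarrow> bool" where
  "converges_in_Lp p M f l \<longleftrightarrow>
     (\<forall>m. in_Lp p M (f m)) \<and> in_Lp p M l \<and>
     (\<lambda>m. Lp_norm p M (\<lambda>z. f m z - l z)) \<longlonglongrightarrow> 0"

(* k times continuously differentiable on S, with derivatives taken relatively to S, so that they
   are one-sided at those boundary points of S that belong to S; f' b is the partial derivative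
   in the direction b. *)
primrec Ck_on :: "nat \<Rightarrow> 'a::euclidean_space set \<Rightarrow> ('a \<Rightarrow> real) \<Rightarrow> bool" where
  "Ck_on 0 S f \<longleftrightarrow> continuous_on S f"
| "Ck_on (Suc k) S f \<longleftrightarrow>
     (\<exists>f'. (\<forall>z\<in>S. (f has_derivative (\<lambda>h. \<Sum>b\<in>Basis. (h \<bullet> b) * f' b z)) (at z within S)) \<and>
           (\<forall>b\<in>Basis. Ck_on k S (f' b)))"

(* C_c^infinity (Omega x [0,T)), the functions being extended by zero outside Omega x [0,T) *)
definition test_function :: "point set \<Rightarrow> real \<Rightarrow> (point \<times> real \<Rightarrow> real) \<Rightarrow> bool" where
  "test_function \<Omega> T \<phi> \<longleftrightarrow>
     (\<forall>k. Ck_on k (\<Omega> \<times> {0..<T}) \<phi>) \<and>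
     compact (closure {z. \<phi> z \<noteq> 0}) \<and> closure {z. \<phi> z \<noteq> 0} \<subseteq> \<Omega> \<times> {0..<T}"

definition time_deriv :: "(point \<times> real \<Rightarrow> real) \<Rightarrow> point \<Rightarrow> real \<Rightarrow> real" where
  "time_deriv \<phi> x t = deriv (\<lambda>s. \<phi> (x, s)) t"

definition space_grad :: "(point \<times> real \<Rightarrow> real) \<Rightarrow> point \<Rightarrow> real \<Rightarrow> point" where
  "space_grad \<phi> x t = (\<chi> i. deriv (\<lambda>h. \<phi> (x + h *\<^sub>R axis i 1, t)) 0)"

end

theory Submission
  imports Defs
begin

text \<open>
  The scheme is tested against the interpolate of a smooth \<open>\<phi>\<close>, and the discrete derivatives are moved to \<open>\<phi>\<close>. In time
  this is summation by parts; in space it is conservativity: the two cells at an edge see opposite normals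
  (\<open>common_edge_normals\<close>), so the value of \<open>\<phi>\<close> at the midpoint of an edge may be subtracted from its cell averages
  (\<open>flux_rearranged\<close>). What results (\<open>scheme_sum_decomposition\<close>) is a sum of values of the discrete functions against
  discrete derivatives of \<open>\<phi>\<close>.

  On general meshes these discrete derivatives converge only weakly, so they cannot simply be multiplied with the strongly
  convergent unknowns. The remedy is to compare the unknowns with one continuous function \<open>\<psi>\<close> that is close to their limit in
  $L^1$. Since a discrete value is the average of the discrete function over a box, the sum of \<open>\<bar>a k - \<psi> (p k)\<bar>\<close> with
  weights comparable to the measures of the boxes is controlled by the $L^1$ distance and the oscillation of \<open>\<psi>\<close>
  (\<open>sum_average_deviation\<close>). After this replacement all values around one cell coincide up to a small error, and only the
  sum of the discrete derivatives over the cell matters. The bounds on \<open>theta1\<close>, \<open>theta2\<close> and \<open>theta3\<close> are exactly what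
  makes the weights comparable to the measures. The principle has two consequences: \<open>weighted_sum_close\<close>, which gives the
  limits of the time sum (\<open>time_sum_close\<close>) and of each component of the flux sum (\<open>flux_sum_close\<close>), and \<open>jump_sum_small\<close>,
  by which the convective value on an edge may be replaced by that of a cell (\<open>q_jump_small\<close>, \<open>edge_value_error\<close>).

  Summed over a cell, the discrete space derivative is consistent because of the shoelace formula
  (\<open>ccw_quadrangle_normals_sum\<close>): the rule that evaluates \<open>\<phi>\<close> at the midpoints of the edges is exact for affine functions.
  Of the dual cells only their areas enter the estimates. Both arrangements are treated together by looking at one
  component of the velocity at a time: on the sub-cells of the edges that carry this component, the component of the discrete velocity is
  constant, and for the other edges the corresponding component of the normal vanishes (\<open>normal_component_zero\<close>).
  The support of \<open>\<phi>\<close> is compact in \<open>\<Omega> \<times> [0,T)\<close>, so on fine meshes neither external edges nor the last time level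
  contribute.
\<close>

section \<open>Weighted sums of cell averages\<close>

lemma sum_integral_indicator_le:
  fixes h :: "'a \<Rightarrow> real"
  assumes K: "finite K" and h: "integrable M h" and h0: "\<And>z. 0 \<le> h z"
    and A: "\<And>k. k \<in> K \<Longrightarrow> A k \<in> sets M"
    and ov: "\<And>z. z \<in> space M \<Longrightarrow> (\<Sum>k\<in>K. indicator (A k) z) \<le> (N::real)"
  shows "(\<Sum>k\<in>K. LINT z|M. indicator (A k) z * h z) \<le> N * (LINT z|M. h z)"
proof -
  have I: "integrable M (\<lambda>z. indicator (A k) z * h z)" if "k \<in> K" for k
    using integrable_mult_indicator[OF A[OF that] h] by simp
  have "(\<Sum>k\<in>K. LINT z|M. indicator (A k) z * h z) = (LINT z|M. (\<Sum>k\<in>K. indicator (A k) z * h z))"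
    using I by (subst Bochner_Integration.integral_sum) auto
  also have "\<dots> \<le> (LINT z|M. N * h z)"
  proof (rule integral_mono)
    show "integrable M (\<lambda>z. \<Sum>k\<in>K. indicator (A k) z * h z)" using I by auto
    show "integrable M (\<lambda>z. N * h z)" using h by auto
    fix z assume "z \<in> space M"
    then show "(\<Sum>k\<in>K. indicator (A k) z * h z) \<le> N * h z"
      using mult_right_mono[OF ov h0, of z z] by (simp add: sum_distrib_right)
  qed
  finally show ?thesis using h by simp
qed

text \<open>If \<open>a k\<close> is the average of \<open>f\<close> over \<open>A k\<close>, then \<open>\<bar>a k - y k\<bar>\<close> is at most the average of
  \<open>\<bar>f - \<psi>\<bar> + \<omega>\<close> over \<open>A k\<close>. Summing costs only the overlap number of the sets. This is the one place where
  an $L^1$ distance controls a sum over the mesh.\<close>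

lemma sum_average_deviation:
  fixes f \<psi> :: "'a \<Rightarrow> real"
  assumes M: "finite_measure M" and K: "finite K"
    and f: "integrable M f" and \<psi>: "integrable M \<psi>"
    and A: "\<And>k. k \<in> K \<Longrightarrow> A k \<in> sets M"
    and ov: "\<And>z. z \<in> space M \<Longrightarrow> (\<Sum>k\<in>K. indicator (A k) z) \<le> (N::real)"
    and w: "\<And>k. k \<in> K \<Longrightarrow> w k \<le> c * measure M (A k)" and c: "0 \<le> c"
    and avg: "\<And>k. k \<in> K \<Longrightarrow> measure M (A k) * a k = (LINT z|M. indicator (A k) z * f z)"
    and osc: "\<And>k z. k \<in> K \<Longrightarrow> z \<in> A k \<Longrightarrow> \<bar>\<psi> z - y k\<bar> \<le> \<omega>" and om: "0 \<le> \<omega>"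
  shows "(\<Sum>k\<in>K. w k * \<bar>a k - y k\<bar>)
    \<le> c * N * ((LINT z|M. \<bar>f z - \<psi> z\<bar>) + \<omega> * measure M (space M))"
proof -
  interpret finite_measure M by fact
  let ?h = "\<lambda>z. \<bar>f z - \<psi> z\<bar> + \<omega>"
  have h: "integrable M ?h" using f \<psi> by auto
  have If: "integrable M (\<lambda>z. indicator (A k) z * f z)" if "k \<in> K" for k
    using integrable_mult_indicator[OF A[OF that] f] by simp
  have Ih: "integrable M (\<lambda>z. indicator (A k) z * ?h z)" if "k \<in> K" for k
    using integrable_mult_indicator[OF A[OF that] h] by simp
  have I1: "integrable M (\<lambda>z. indicator (A k) z * y k)" if "k \<in> K" for k
    using integrable_mult_indicator[OF A[OF that], of "\<lambda>_. y k"] by simp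
  have 1: "w k * \<bar>a k - y k\<bar> \<le> c * (LINT z|M. indicator (A k) z * ?h z)" if k: "k \<in> K" for k
  proof -
    have "measure M (A k) * (a k - y k)
        = (LINT z|M. indicator (A k) z * f z) - (LINT z|M. indicator (A k) z * y k)"
      using A[OF k] avg[OF k] by (simp add: algebra_simps)
    also have "\<dots> = (LINT z|M. indicator (A k) z * f z - indicator (A k) z * y k)"
      using If[OF k] I1[OF k] by simp
    finally have "\<bar>measure M (A k) * (a k - y k)\<bar>
        \<le> (LINT z|M. \<bar>indicator (A k) z * f z - indicator (A k) z * y k\<bar>)"
      using integral_abs_bound by metis
    also have "\<dots> \<le> (LINT z|M. indicator (A k) z * ?h z)"
    proof (rule integral_mono)
      show "integrable M (\<lambda>z. \<bar>indicator (A k) z * f z - indicator (A k) z * y k\<bar>)"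
        using If[OF k] I1[OF k] by (intro integrable_abs Bochner_Integration.integrable_diff)
      show "integrable M (\<lambda>z. indicator (A k) z * ?h z)" by (rule Ih[OF k])
      fix z
      show "\<bar>indicator (A k) z * f z - indicator (A k) z * y k\<bar> \<le> indicator (A k) z * ?h z"
        using osc[OF k, of z] by (auto simp: indicator_def split: if_splits)
    qed
    finally have *: "measure M (A k) * \<bar>a k - y k\<bar> \<le> (LINT z|M. indicator (A k) z * ?h z)"
      by (simp add: abs_mult)
    have "w k * \<bar>a k - y k\<bar> \<le> c * (measure M (A k) * \<bar>a k - y k\<bar>)"
      using mult_right_mono[OF w[OF k], of "\<bar>a k - y k\<bar>"] by (simp add: mult_ac)
    also have "\<dots> \<le> c * (LINT z|M. indicator (A k) z * ?h z)"
      using * c by (rule mult_left_mono)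
    finally show ?thesis .
  qed
  have "(\<Sum>k\<in>K. w k * \<bar>a k - y k\<bar>) \<le> c * (\<Sum>k\<in>K. LINT z|M. indicator (A k) z * ?h z)"
    unfolding sum_distrib_left by (rule sum_mono) (rule 1)
  also have "\<dots> \<le> c * (N * (LINT z|M. ?h z))"
    by (intro mult_left_mono sum_integral_indicator_le K h A ov c) (auto simp: om)
  also have "(LINT z|M. ?h z) = (LINT z|M. \<bar>f z - \<psi> z\<bar>) + \<omega> * measure M (space M)"
    using f \<psi> by simp
  finally show ?thesis by (simp add: mult_ac)
qed

text \<open>Freezing the values to \<open>y k\<close> reduces the inner sums to \<open>y k\<close> times the sum of the weights \<open>\<gamma> k j\<close>.
  Only this sum has to be close to \<open>G\<close>: the single weights are merely bounded, as happens for discrete derivatives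
  on non-uniform grids, which converge weakly and not pointwise.\<close>

lemma weighted_sum_near_integral:
  fixes f \<psi> G :: "'a \<Rightarrow> real"
  assumes M: "finite_measure M" and K: "finite K" and J: "\<And>k. k \<in> K \<Longrightarrow> finite (J k)"
    and f: "integrable M f" and \<psi>: "integrable M \<psi>" and G: "G \<in> borel_measurable M"
    and Gb: "\<And>z. z \<in> space M \<Longrightarrow> \<bar>G z\<bar> \<le> g0" and \<psi>b: "\<And>z. z \<in> space M \<Longrightarrow> \<bar>\<psi> z\<bar> \<le> P"
    and A: "\<And>k j. k \<in> K \<Longrightarrow> j \<in> J k \<Longrightarrow> A k j \<in> sets M"
    and ov: "\<And>z. z \<in> space M \<Longrightarrow> (\<Sum>k\<in>K. \<Sum>j\<in>J k. indicator (A k j) z) \<le> (N::real)"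
    and B: "\<And>k. k \<in> K \<Longrightarrow> B k \<in> sets M" and Bd: "disjoint_family_on B K"
    and cover: "AE z in M. z \<in> (\<Union>k\<in>K. B k) \<or> G z = 0"
    and w: "\<And>k j. k \<in> K \<Longrightarrow> j \<in> J k \<Longrightarrow> measure M (B k) \<le> c * measure M (A k j)" and c: "0 \<le> c"
    and avg: "\<And>k j. k \<in> K \<Longrightarrow> j \<in> J k \<Longrightarrow>
                measure M (A k j) * a k j = (LINT z|M. indicator (A k j) z * f z)"
    and gb: "\<And>k j. k \<in> K \<Longrightarrow> j \<in> J k \<Longrightarrow> \<bar>\<gamma> k j\<bar> \<le> \<Gamma>" and \<Gamma>: "0 \<le> \<Gamma>"
    and gG: "\<And>k z. k \<in> K \<Longrightarrow> z \<in> B k \<Longrightarrow> \<bar>(\<Sum>j\<in>J k. \<gamma> k j) - G z\<bar> \<le> \<eta>" and eta: "0 \<le> \<eta>"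
    and oscA: "\<And>k j z. k \<in> K \<Longrightarrow> j \<in> J k \<Longrightarrow> z \<in> A k j \<Longrightarrow> \<bar>\<psi> z - y k\<bar> \<le> \<omega>"
    and oscB: "\<And>k z. k \<in> K \<Longrightarrow> z \<in> B k \<Longrightarrow> \<bar>\<psi> z - y k\<bar> \<le> \<omega>" and om: "0 \<le> \<omega>"
  shows "\<bar>(\<Sum>k\<in>K. measure M (B k) * (\<Sum>j\<in>J k. a k j * \<gamma> k j)) - (LINT z|M. f z * G z)\<bar>
    \<le> \<Gamma> * (c * N * ((LINT z|M. \<bar>f z - \<psi> z\<bar>) + \<omega> * measure M (space M)))
      + (\<omega> * (g0 + \<eta>) + P * \<eta>) * measure M (space M) + g0 * (LINT z|M. \<bar>f z - \<psi> z\<bar>)"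
proof -
  interpret finite_measure M by fact
  let ?D = "LINT z|M. \<bar>f z - \<psi> z\<bar>"
  let ?g = "\<lambda>k. \<Sum>j\<in>J k. \<gamma> k j"
  have IG: "integrable M (\<lambda>z. u z * G z)" if "integrable M u" for u :: "'a \<Rightarrow> real"
  proof (rule Bochner_Integration.integrable_bound[of M "\<lambda>z. g0 * u z"])
    show "integrable M (\<lambda>z. g0 * u z)" using that by auto
    show "(\<lambda>z. u z * G z) \<in> borel_measurable M" using that G by auto
    show "AE z in M. norm (u z * G z) \<le> norm (g0 * u z)"
    proof (rule AE_I2)
      fix z assume "z \<in> space M"
      from Gb[OF this] have "\<bar>u z\<bar> * \<bar>G z\<bar> \<le> \<bar>u z\<bar> * \<bar>g0\<bar>" by (intro mult_left_mono) auto
      then show "norm (u z * G z) \<le> norm (g0 * u z)" by (simp add: abs_mult mult.commute)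
    qed
  qed
  have 1: "\<bar>(\<Sum>k\<in>K. measure M (B k) * (\<Sum>j\<in>J k. a k j * \<gamma> k j)) - (\<Sum>k\<in>K. measure M (B k) * (y k * ?g k))\<bar>
     \<le> \<Gamma> * (c * N * (?D + \<omega> * measure M (space M)))"
  proof -
    have "(\<Sum>k\<in>K. measure M (B k) * (\<Sum>j\<in>J k. a k j * \<gamma> k j)) - (\<Sum>k\<in>K. measure M (B k) * (y k * ?g k))
      = (\<Sum>k\<in>K. \<Sum>j\<in>J k. measure M (B k) * (a k j - y k) * \<gamma> k j)"
      unfolding sum_subtractf[symmetric] sum_distrib_left
      by (intro sum.cong refl) (simp add: algebra_simps)
    also have "\<dots> = (\<Sum>x\<in>Sigma K J. measure M (B (fst x)) * (a (fst x) (snd x) - y (fst x)) * \<gamma> (fst x) (snd x))"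
      using K J by (subst sum.Sigma) (auto simp: case_prod_unfold)
    also have "\<bar>\<dots>\<bar> \<le> (\<Sum>x\<in>Sigma K J. \<Gamma> * (measure M (B (fst x)) * \<bar>a (fst x) (snd x) - y (fst x)\<bar>))"
    proof (rule order_trans[OF sum_abs sum_mono])
      fix x assume "x \<in> Sigma K J"
      then have "\<bar>\<gamma> (fst x) (snd x)\<bar> \<le> \<Gamma>" using gb by auto
      from mult_left_mono[OF this, of "measure M (B (fst x)) * \<bar>a (fst x) (snd x) - y (fst x)\<bar>"]
      show "\<bar>measure M (B (fst x)) * (a (fst x) (snd x) - y (fst x)) * \<gamma> (fst x) (snd x)\<bar>
         \<le> \<Gamma> * (measure M (B (fst x)) * \<bar>a (fst x) (snd x) - y (fst x)\<bar>)"
        by (simp add: abs_mult mult_ac)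
    qed
    also have "\<dots> = \<Gamma> * (\<Sum>x\<in>Sigma K J. measure M (B (fst x)) * \<bar>a (fst x) (snd x) - y (fst x)\<bar>)"
      by (simp add: sum_distrib_left)
    also have "\<dots> \<le> \<Gamma> * (c * N * (?D + \<omega> * measure M (space M)))"
    proof (intro mult_left_mono \<Gamma>
        sum_average_deviation[OF M _ f \<psi>, where A = "\<lambda>x. A (fst x) (snd x)"
           and w = "\<lambda>x. measure M (B (fst x))" and y = "\<lambda>x. y (fst x)"] c om)
      show "finite (Sigma K J)" using K J by auto
      fix z assume z: "z \<in> space M"
      show "(\<Sum>k\<in>Sigma K J. indicator (A (fst k) (snd k)) z) \<le> N"
        using ov[OF z] K J by (subst (asm) sum.Sigma) (auto simp: case_prod_unfold)
    qed (use A w avg oscA in auto)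
    finally show ?thesis .
  qed
  have 2: "\<bar>(\<Sum>k\<in>K. measure M (B k) * (y k * ?g k)) - (LINT z|M. \<psi> z * G z)\<bar>
     \<le> (\<omega> * (g0 + \<eta>) + P * \<eta>) * measure M (space M)"
  proof -
    let ?s = "\<lambda>z. \<Sum>k\<in>K. indicator (B k) z * (y k * ?g k)"
    have Is: "integrable M (\<lambda>z. indicator (B k) z * (y k * ?g k))" if "k \<in> K" for k
      using integrable_mult_indicator[OF B[OF that], of "\<lambda>_. y k * ?g k"] by simp
    have "(\<Sum>k\<in>K. measure M (B k) * (y k * ?g k)) = (\<Sum>k\<in>K. LINT z|M. indicator (B k) z * (y k * ?g k))"
      using B by (intro sum.cong) auto
    also have "\<dots> = (LINT z|M. ?s z)"
      using Is by (subst Bochner_Integration.integral_sum) auto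
    finally have "(\<Sum>k\<in>K. measure M (B k) * (y k * ?g k)) - (LINT z|M. \<psi> z * G z)
      = (LINT z|M. ?s z - \<psi> z * G z)"
      using Is IG[OF \<psi>] by (subst Bochner_Integration.integral_diff) auto
    also have "\<bar>\<dots>\<bar> \<le> (LINT z|M. \<bar>?s z - \<psi> z * G z\<bar>)" by (rule integral_abs_bound)
    also have "\<dots> \<le> (LINT z|M. \<omega> * (g0 + \<eta>) + P * \<eta>)"
    proof (rule integral_mono_AE)
      show "integrable M (\<lambda>z. \<bar>?s z - \<psi> z * G z\<bar>)"
        using Is IG[OF \<psi>] by (intro integrable_abs Bochner_Integration.integrable_diff) auto
      show "integrable M (\<lambda>z. \<omega> * (g0 + \<eta>) + P * \<eta>)" by simp
      show "AE z in M. \<bar>?s z - \<psi> z * G z\<bar> \<le> \<omega> * (g0 + \<eta>) + P * \<eta>"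
        using cover AE_space
      proof eventually_elim
        fix z assume cov: "z \<in> (\<Union>k\<in>K. B k) \<or> G z = 0" and z: "z \<in> space M"
        have g00: "0 \<le> g0" using Gb[OF z] by linarith
        have P0: "0 \<le> P" using \<psi>b[OF z] by linarith
        show "\<bar>?s z - \<psi> z * G z\<bar> \<le> \<omega> * (g0 + \<eta>) + P * \<eta>"
        proof (cases "z \<in> (\<Union>k\<in>K. B k)")
          case True
          then obtain k where k: "k \<in> K" "z \<in> B k" by auto
          have other: "z \<notin> B k'" if "k' \<in> K" "k' \<noteq> k" for k'
            using Bd k that by (auto simp: disjoint_family_on_def)
          have "?s z = y k * ?g k"
            using K k other by (subst sum.remove[of K k]) (auto intro!: sum.neutral)
          then have "\<bar>?s z - \<psi> z * G z\<bar> = \<bar>(y k - \<psi> z) * ?g k + \<psi> z * (?g k - G z)\<bar>"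
            by (simp add: algebra_simps)
          also have "\<dots> \<le> \<bar>y k - \<psi> z\<bar> * \<bar>?g k\<bar> + \<bar>\<psi> z\<bar> * \<bar>?g k - G z\<bar>"
            by (rule order_trans[OF abs_triangle_ineq]) (simp add: abs_mult)
          also have "\<dots> \<le> \<omega> * (g0 + \<eta>) + P * \<eta>"
          proof (intro add_mono mult_mono)
            show "\<bar>y k - \<psi> z\<bar> \<le> \<omega>" using oscB[OF k] by linarith
            show "\<bar>?g k\<bar> \<le> g0 + \<eta>" using gG[OF k] Gb[OF z] by linarith
            show "\<bar>?g k - G z\<bar> \<le> \<eta>" by (rule gG[OF k])
          qed (use \<psi>b[OF z] om eta g00 P0 in auto)
          finally show ?thesis .
        next
          case False
          then have "?s z = 0" by (auto intro!: sum.neutral)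
          moreover have "G z = 0" using cov False by blast
          ultimately show ?thesis using om g00 eta P0 by simp
        qed
      qed
    qed
    also have "\<dots> = (\<omega> * (g0 + \<eta>) + P * \<eta>) * measure M (space M)" by simp
    finally show ?thesis .
  qed
  have 3: "\<bar>(LINT z|M. \<psi> z * G z) - (LINT z|M. f z * G z)\<bar> \<le> g0 * ?D"
  proof -
    have "(LINT z|M. \<psi> z * G z) - (LINT z|M. f z * G z) = (LINT z|M. \<psi> z * G z - f z * G z)"
      using IG[OF \<psi>] IG[OF f] by simp
    also have "\<bar>\<dots>\<bar> \<le> (LINT z|M. \<bar>\<psi> z * G z - f z * G z\<bar>)" by (rule integral_abs_bound)
    also have "\<dots> \<le> (LINT z|M. g0 * \<bar>f z - \<psi> z\<bar>)"
    proof (rule integral_mono)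
      show "integrable M (\<lambda>z. \<bar>\<psi> z * G z - f z * G z\<bar>)" using IG[OF \<psi>] IG[OF f] by auto
      show "integrable M (\<lambda>z. g0 * \<bar>f z - \<psi> z\<bar>)" using f \<psi> by auto
      fix z assume "z \<in> space M"
      from mult_right_mono[OF Gb[OF this], of "\<bar>f z - \<psi> z\<bar>"]
      have "\<bar>G z * (f z - \<psi> z)\<bar> \<le> g0 * \<bar>f z - \<psi> z\<bar>" by (simp add: abs_mult)
      moreover have "\<bar>\<psi> z * G z - f z * G z\<bar> = \<bar>G z * (f z - \<psi> z)\<bar>"
        by (subst abs_minus_commute) (simp add: algebra_simps)
      ultimately show "\<bar>\<psi> z * G z - f z * G z\<bar> \<le> g0 * \<bar>f z - \<psi> z\<bar>" by simp
    qed
    also have "\<dots> = g0 * ?D" by simp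
    finally show ?thesis .
  qed
  from 1 2 3 show ?thesis by linarith
qed

text \<open>A measurable function is an almost everywhere limit of continuous functions; truncating them at the
  level \<open>C\<close> makes dominated convergence applicable.\<close>

lemma L1_approx_continuous:
  fixes f :: "'a::euclidean_space \<Rightarrow> real"
  assumes S: "S \<in> lmeasurable" and f: "f \<in> borel_measurable (lebesgue_on S)"
    and C: "AE z in lebesgue_on S. \<bar>f z\<bar> \<le> C" "0 \<le> C" and e: "0 < e"
  obtains \<psi> where "continuous_on UNIV \<psi>" "\<And>z. \<bar>\<psi> z\<bar> \<le> C" 
    "(LINT z|lebesgue_on S. \<bar>f z - \<psi> z\<bar>) < e"
proof -
  interpret finite_measure "lebesgue_on S" by (rule finite_measure_lebesgue_on[OF S])
  have Ss: "S \<in> sets lebesgue" using S by (simp add: fmeasurable_def)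
  from f have "f measurable_on S" using measurable_on_iff_borel_measurable[OF Ss] by blast
  then obtain N g where N: "negligible N" and g: "\<And>n. continuous_on UNIV (g n)"
    and lim: "\<And>x. x \<notin> N \<Longrightarrow> (\<lambda>n. g n x) \<longlonglongrightarrow> (if x \<in> S then f x else 0)"
    unfolding measurable_on_def by blast
  define h where "h n x = max (- C) (min C (g n x))" for n x
  have h: "continuous_on UNIV (h n)" for n
    unfolding h_def by (intro continuous_intros g)
  have hb: "\<bar>h n x\<bar> \<le> C" for n x using C(2) unfolding h_def by auto
  have hm: "h n \<in> borel_measurable (lebesgue_on S)" for n
    using continuous_imp_measurable_on_sets_lebesgue[OF continuous_on_subset[OF h subset_UNIV] Ss] .
  have AEN: "AE x in lebesgue_on S. x \<notin> N"
  proof -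
    have "AE x in lebesgue. x \<notin> N" using N by (intro AE_not_in) (simp add: negligible_iff_null_sets)
    then show ?thesis using Ss by (auto simp: AE_restrict_space_iff elim: eventually_mono)
  qed
  have "(\<lambda>n. LINT z|lebesgue_on S. \<bar>f z - h n z\<bar>) \<longlonglongrightarrow> (LINT z|lebesgue_on S. 0)"
  proof (rule integral_dominated_convergence[where w = "\<lambda>_. 2 * C"])
    show "(\<lambda>z. 0) \<in> borel_measurable (lebesgue_on S)" by simp
    show "(\<lambda>z. \<bar>f z - h n z\<bar>) \<in> borel_measurable (lebesgue_on S)" for n using f hm[of n] by measurable
    show "AE z in lebesgue_on S. (\<lambda>n. \<bar>f z - h n z\<bar>) \<longlonglongrightarrow> 0"
      using AEN C(1) AE_space
    proof eventually_elim
      fix z assume z: "z \<notin> N" "\<bar>f z\<bar> \<le> C" "z \<in> space (lebesgue_on S)"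
      then have "(\<lambda>n. g n z) \<longlonglongrightarrow> f z" using lim[of z] by simp
      then have "(\<lambda>n. max (- C) (min C (g n z))) \<longlonglongrightarrow> max (- C) (min C (f z))"
        by (intro tendsto_intros)
      also have "max (- C) (min C (f z)) = f z" using z by auto
      finally have "(\<lambda>n. h n z) \<longlonglongrightarrow> f z" by (simp add: h_def)
      then have "(\<lambda>n. f z - h n z) \<longlonglongrightarrow> 0"
        using tendsto_diff[OF tendsto_const, of _ "f z" sequentially "f z"] by simp
      then show "(\<lambda>n. \<bar>f z - h n z\<bar>) \<longlonglongrightarrow> 0" by (simp add: tendsto_rabs_zero_iff)
    qed
    show "AE z in lebesgue_on S. norm \<bar>f z - h n z\<bar> \<le> 2 * C" for n
      using C(1)
    proof eventually_elim
      fix z assume "\<bar>f z\<bar> \<le> C"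
      then show "norm \<bar>f z - h n z\<bar> \<le> 2 * C" using hb[of n z] by simp
    qed
    show "integrable (lebesgue_on S) (\<lambda>_. 2 * C)" by simp
  qed
  then have "\<forall>\<^sub>F n in sequentially. (LINT z|lebesgue_on S. \<bar>f z - h n z\<bar>) < e"
    by (rule order_tendstoD(2)) (simp add: e)
  from eventually_happens'[OF sequentially_bot this]
  obtain n where "(LINT z|lebesgue_on S. \<bar>f z - h n z\<bar>) < e" by blast
  with that[OF h hb] show thesis by blast
qed


text \<open>The approximation is packaged with its modulus of continuity on \<open>X\<close>, which is what sums over small
  boxes consume.\<close>

lemma L1_continuous_approximation:
  fixes f :: "'a::euclidean_space \<Rightarrow> real"
  assumes X: "compact X" and f: "f \<in> borel_measurable (lebesgue_on X)"
    and C: "AE z in lebesgue_on X. \<bar>f z\<bar> \<le> C" "0 \<le> C" and e: "0 < e"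
  obtains \<psi> \<delta> where "\<And>z. \<bar>\<psi> z\<bar> \<le> C" "integrable (lebesgue_on X) f" "integrable (lebesgue_on X) \<psi>"
    "0 < \<delta>" "\<And>z z'. z \<in> X \<Longrightarrow> z' \<in> X \<Longrightarrow> dist z z' \<le> \<delta> \<Longrightarrow> \<bar>\<psi> z - \<psi> z'\<bar> \<le> e"
    "(LINT z|lebesgue_on X. \<bar>f z - \<psi> z\<bar>) \<le> e"
proof -
  have XL: "X \<in> lmeasurable" using X by (rule lmeasurable_compact)
  then have Xs: "X \<in> sets lebesgue" by (simp add: fmeasurable_def)
  interpret finite_measure "lebesgue_on X" by (rule finite_measure_lebesgue_on[OF XL])
  obtain \<psi> where \<psi>: "continuous_on UNIV \<psi>" "\<And>z. \<bar>\<psi> z\<bar> \<le> C"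
    "(LINT z|lebesgue_on X. \<bar>f z - \<psi> z\<bar>) < e"
    using L1_approx_continuous[OF XL f C e] by blast
  have "uniformly_continuous_on X \<psi>"
    using \<psi>(1) X compact_uniformly_continuous continuous_on_subset by blast
  then obtain d where d: "d > 0" "\<And>z z'. z \<in> X \<Longrightarrow> z' \<in> X \<Longrightarrow> dist z' z < d \<Longrightarrow> dist (\<psi> z') (\<psi> z) < e"
    using e unfolding uniformly_continuous_on_def by metis
  have m: "\<psi> \<in> borel_measurable (lebesgue_on X)"
    using continuous_imp_measurable_on_sets_lebesgue[OF continuous_on_subset[OF \<psi>(1) subset_UNIV] Xs] .
  show thesis
  proof (rule that)
    show "0 < d / 2" using d by simp
    show "\<bar>\<psi> z - \<psi> z'\<bar> \<le> e" if "z \<in> X" "z' \<in> X" "dist z z' \<le> d / 2" for z z'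
      using d(1) d(2)[of z' z] that by (auto simp: dist_real_def)
    show "integrable (lebesgue_on X) f" using C f by (intro integrable_const_bound[of f C]) auto
    show "integrable (lebesgue_on X) \<psi>" using \<psi> m by (intro integrable_const_bound[of \<psi> C]) auto
  qed (use \<psi> in auto)
qed

text \<open>The values on neighbouring boxes are both compared with the same value \<open>\<psi> (p k)\<close> of a continuous
  approximation of the limit. So strong convergence alone, without any estimate on derivatives, makes the weighted jumps
  small. The bound depends on the boxes only through overlap, ratio of measures and size.\<close>

lemma jump_sum_small:
  fixes f :: "'a::euclidean_space \<Rightarrow> real" and N :: real
  assumes X: "compact X" and f: "f \<in> borel_measurable (lebesgue_on X)"
    and C: "AE z in lebesgue_on X. \<bar>f z\<bar> \<le> C" "0 \<le> C" and \<epsilon>: "0 < \<epsilon>"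
    and c: "0 \<le> c" and N: "0 \<le> N"
  obtains \<delta> where "0 < \<delta>" 
    "\<And>f' (K::'k set) A A' w a a' p.
      \<lbrakk>integrable (lebesgue_on X) f'; (LINT z|lebesgue_on X. \<bar>f' z - f z\<bar>) \<le> \<delta>; finite K;
       \<And>k. k \<in> K \<Longrightarrow> A k \<in> sets lebesgue \<and> A' k \<in> sets lebesgue \<and> A k \<subseteq> X \<and> A' k \<subseteq> X \<and> p k \<in> X;
       \<And>z. z \<in> X \<Longrightarrow> (\<Sum>k\<in>K. indicator (A k) z) \<le> N;
       \<And>z. z \<in> X \<Longrightarrow> (\<Sum>k\<in>K. indicator (A' k) z) \<le> N;
       \<And>k. k \<in> K \<Longrightarrow> w k \<le> c * measure lebesgue (A k);
       \<And>k. k \<in> K \<Longrightarrow> w k \<le> c * measure lebesgue (A' k);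
       \<And>k. k \<in> K \<Longrightarrow> 0 \<le> w k;
       \<And>k. k \<in> K \<Longrightarrow> measure lebesgue (A k) * a k = (LINT z|lebesgue_on X. indicator (A k) z * f' z);
       \<And>k. k \<in> K \<Longrightarrow> measure lebesgue (A' k) * a' k = (LINT z|lebesgue_on X. indicator (A' k) z * f' z);
       \<And>k z. k \<in> K \<Longrightarrow> z \<in> A k \<union> A' k \<Longrightarrow> dist z (p k) \<le> \<delta>\<rbrakk>
      \<Longrightarrow> (\<Sum>k\<in>K. w k * \<bar>a k - a' k\<bar>) \<le> \<epsilon>"
proof -
  have XL: "X \<in> lmeasurable" using X by (rule lmeasurable_compact)
  then have Xs: "X \<in> sets lebesgue" by (simp add: fmeasurable_def)
  have fin: "finite_measure (lebesgue_on X)" by (rule finite_measure_lebesgue_on[OF XL])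
  let ?V = "measure (lebesgue_on X) (space (lebesgue_on X))"
  define Q where "Q = 2 * (c * N * (2 + ?V))"
  have Q: "0 \<le> Q" unfolding Q_def using c N by simp
  define e where "e = \<epsilon> / (Q + 1)"
  have e: "0 < e" "Q * e \<le> \<epsilon>" using \<epsilon> Q by (auto simp: e_def field_simps)
  obtain \<psi> d where \<psi>: "\<And>z. \<bar>\<psi> z\<bar> \<le> C" "integrable (lebesgue_on X) f" "integrable (lebesgue_on X) \<psi>"
    "0 < d" "\<And>z z'. z \<in> X \<Longrightarrow> z' \<in> X \<Longrightarrow> dist z z' \<le> d \<Longrightarrow> \<bar>\<psi> z - \<psi> z'\<bar> \<le> e"
    "(LINT z|lebesgue_on X. \<bar>f z - \<psi> z\<bar>) \<le> e"
    using L1_continuous_approximation[OF X f C e(1)] by blast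
  show thesis
  proof (rule that)
    show "0 < min d e" using \<psi> e by simp
    fix f' and K :: "'k set" and A A' w a a' p
    assume f': "integrable (lebesgue_on X) f'" and D: "(LINT z|lebesgue_on X. \<bar>f' z - f z\<bar>) \<le> min d e"
     and K: "finite K"
     and A: "\<And>k. k \<in> K \<Longrightarrow> A k \<in> sets lebesgue \<and> A' k \<in> sets lebesgue \<and> A k \<subseteq> X \<and> A' k \<subseteq> X \<and> p k \<in> X"
     and ov: "\<And>z. z \<in> X \<Longrightarrow> (\<Sum>k\<in>K. indicator (A k) z) \<le> N"
       "\<And>z. z \<in> X \<Longrightarrow> (\<Sum>k\<in>K. indicator (A' k) z) \<le> N"
     and w: "\<And>k. k \<in> K \<Longrightarrow> w k \<le> c * measure lebesgue (A k)"
       "\<And>k. k \<in> K \<Longrightarrow> w k \<le> c * measure lebesgue (A' k)"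
     and w0: "\<And>k. k \<in> K \<Longrightarrow> 0 \<le> w k"
     and avg: "\<And>k. k \<in> K \<Longrightarrow> measure lebesgue (A k) * a k = (LINT z|lebesgue_on X. indicator (A k) z * f' z)"
       "\<And>k. k \<in> K \<Longrightarrow> measure lebesgue (A' k) * a' k = (LINT z|lebesgue_on X. indicator (A' k) z * f' z)"
     and p: "\<And>k z. k \<in> K \<Longrightarrow> z \<in> A k \<union> A' k \<Longrightarrow> dist z (p k) \<le> min d e"
    have As: "A k \<in> sets (lebesgue_on X)" "A' k \<in> sets (lebesgue_on X)"
       "measure (lebesgue_on X) (A k) = measure lebesgue (A k)"
       "measure (lebesgue_on X) (A' k) = measure lebesgue (A' k)" if "k \<in> K" for k
      using A[OF that] Xs by (auto simp: sets_restrict_space_iff measure_restrict_space)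
    have D2: "(LINT z|lebesgue_on X. \<bar>f' z - \<psi> z\<bar>) \<le> 2 * e"
    proof -
      have "(LINT z|lebesgue_on X. \<bar>f' z - \<psi> z\<bar>) \<le> (LINT z|lebesgue_on X. \<bar>f' z - f z\<bar> + \<bar>f z - \<psi> z\<bar>)"
        using f' \<psi> by (intro integral_mono) auto
      also have "\<dots> = (LINT z|lebesgue_on X. \<bar>f' z - f z\<bar>) + (LINT z|lebesgue_on X. \<bar>f z - \<psi> z\<bar>)"
        using f' \<psi> by (intro Bochner_Integration.integral_add) auto
      finally show ?thesis using D \<psi>(6) by linarith
    qed
    have osc: "\<bar>\<psi> z - \<psi> (p k)\<bar> \<le> e" if "k \<in> K" "z \<in> A k \<union> A' k" for k z
      using \<psi>(5)[of z "p k"] p[OF that] A[OF that(1)] that by auto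
    have b: "c * N * ((LINT z|lebesgue_on X. \<bar>f' z - \<psi> z\<bar>) + e * ?V) \<le> Q / 2 * e"
      unfolding Q_def using mult_left_mono[OF D2, of "c * N"] c N by (simp add: algebra_simps)
    have 1: "(\<Sum>k\<in>K. w k * \<bar>a k - \<psi> (p k)\<bar>) \<le> c * N * ((LINT z|lebesgue_on X. \<bar>f' z - \<psi> z\<bar>) + e * ?V)"
      by (rule sum_average_deviation[OF fin K f' \<psi>(3), where A = A])
         (use As ov w c avg osc e in auto)
    have 2: "(\<Sum>k\<in>K. w k * \<bar>a' k - \<psi> (p k)\<bar>) \<le> c * N * ((LINT z|lebesgue_on X. \<bar>f' z - \<psi> z\<bar>) + e * ?V)"
      by (rule sum_average_deviation[OF fin K f' \<psi>(3), where A = A'])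
         (use As ov w c avg osc e in auto)
    have "(\<Sum>k\<in>K. w k * \<bar>a k - a' k\<bar>) \<le> (\<Sum>k\<in>K. w k * \<bar>a k - \<psi> (p k)\<bar> + w k * \<bar>a' k - \<psi> (p k)\<bar>)"
    proof (rule sum_mono)
      fix k assume "k \<in> K"
      then have "w k * \<bar>a k - a' k\<bar> \<le> w k * (\<bar>a k - \<psi> (p k)\<bar> + \<bar>a' k - \<psi> (p k)\<bar>)"
        using w0 by (intro mult_left_mono) auto
      then show "w k * \<bar>a k - a' k\<bar> \<le> w k * \<bar>a k - \<psi> (p k)\<bar> + w k * \<bar>a' k - \<psi> (p k)\<bar>"
        by (simp add: algebra_simps)
    qed
    also have "\<dots> \<le> Q * e" using 1 2 b by (simp add: sum.distrib)
    finally show "(\<Sum>k\<in>K. w k * \<bar>a k - a' k\<bar>) \<le> \<epsilon>" using e by linarith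
  qed
qed

text \<open>The threshold \<open>\<delta>\<close> is uniform in the index sets and the function \<open>f'\<close>, so the statement
  can be applied along a sequence of meshes.\<close>

lemma weighted_sum_close:
  fixes f G :: "'a::euclidean_space \<Rightarrow> real" and N :: real
  assumes X: "compact X" and f: "f \<in> borel_measurable (lebesgue_on X)"
    and C: "AE z in lebesgue_on X. \<bar>f z\<bar> \<le> C" "0 \<le> C" and \<epsilon>: "0 < \<epsilon>"
    and G: "G \<in> borel_measurable (lebesgue_on X)" "\<And>z. z \<in> X \<Longrightarrow> \<bar>G z\<bar> \<le> g0" "0 \<le> g0"
    and c: "0 \<le> c" and N: "0 \<le> N" and \<Gamma>: "0 \<le> \<Gamma>"
  obtains \<delta> where "0 < \<delta>" 
    "\<And>f' (K::'k set) (J::'k \<Rightarrow> 'j set) A B a \<gamma> p.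
      \<lbrakk>integrable (lebesgue_on X) f'; (LINT z|lebesgue_on X. \<bar>f' z - f z\<bar>) \<le> \<delta>; finite K;
       \<And>k. k \<in> K \<Longrightarrow> finite (J k);
       \<And>k j. k \<in> K \<Longrightarrow> j \<in> J k \<Longrightarrow> A k j \<in> sets lebesgue \<and> A k j \<subseteq> X;
       \<And>k. k \<in> K \<Longrightarrow> B k \<in> sets lebesgue \<and> B k \<subseteq> X \<and> p k \<in> X;
       \<And>z. z \<in> X \<Longrightarrow> (\<Sum>k\<in>K. \<Sum>j\<in>J k. indicator (A k j) z) \<le> N;
       disjoint_family_on B K;
       AE z in lebesgue_on X. z \<in> (\<Union>k\<in>K. B k) \<or> G z = 0;
       \<And>k j. k \<in> K \<Longrightarrow> j \<in> J k \<Longrightarrow> measure lebesgue (B k) \<le> c * measure lebesgue (A k j);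
       \<And>k j. k \<in> K \<Longrightarrow> j \<in> J k \<Longrightarrow>
                measure lebesgue (A k j) * a k j = (LINT z|lebesgue_on X. indicator (A k j) z * f' z);
       \<And>k j. k \<in> K \<Longrightarrow> j \<in> J k \<Longrightarrow> \<bar>\<gamma> k j\<bar> \<le> \<Gamma>;
       \<And>k z. k \<in> K \<Longrightarrow> z \<in> B k \<Longrightarrow> \<bar>(\<Sum>j\<in>J k. \<gamma> k j) - G z\<bar> \<le> \<delta>;
       \<And>k j z. k \<in> K \<Longrightarrow> j \<in> J k \<Longrightarrow> z \<in> A k j \<Longrightarrow> dist z (p k) \<le> \<delta>;
       \<And>k z. k \<in> K \<Longrightarrow> z \<in> B k \<Longrightarrow> dist z (p k) \<le> \<delta>\<rbrakk>
      \<Longrightarrow> \<bar>(\<Sum>k\<in>K. measure lebesgue (B k) * (\<Sum>j\<in>J k. a k j * \<gamma> k j))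
            - (LINT z|lebesgue_on X. f z * G z)\<bar> \<le> \<epsilon>"
proof -
  have XL: "X \<in> lmeasurable" using X by (rule lmeasurable_compact)
  then have Xs: "X \<in> sets lebesgue" by (simp add: fmeasurable_def)
  have fin: "finite_measure (lebesgue_on X)" by (rule finite_measure_lebesgue_on[OF XL])
  let ?M = "lebesgue_on X"
  let ?V = "measure ?M (space ?M)"
  define Q where "Q = \<Gamma> * (c * N * (2 + ?V)) + (g0 + 1 + C) * ?V + 3 * g0"
  have Q: "0 \<le> Q" unfolding Q_def using c N G C \<Gamma> by simp
  define e where "e = min 1 (\<epsilon> / (Q + 1))"
  have e: "0 < e" "e \<le> 1" using \<epsilon> Q by (auto simp: e_def)
  have "Q * e \<le> Q * (\<epsilon> / (Q + 1))" using Q by (intro mult_left_mono) (auto simp: e_def)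
  also have "\<dots> \<le> \<epsilon>" using \<epsilon> Q by (simp add: field_simps)
  finally have Qe: "Q * e \<le> \<epsilon>" .
  obtain \<psi> d where \<psi>: "\<And>z. \<bar>\<psi> z\<bar> \<le> C" "integrable ?M f" "integrable ?M \<psi>"
    "0 < d" "\<And>z z'. z \<in> X \<Longrightarrow> z' \<in> X \<Longrightarrow> dist z z' \<le> d \<Longrightarrow> \<bar>\<psi> z - \<psi> z'\<bar> \<le> e"
    "(LINT z|?M. \<bar>f z - \<psi> z\<bar>) \<le> e"
    using L1_continuous_approximation[OF X f C e(1)] by blast
  show thesis
  proof (rule that)
    show "0 < min d e" using \<psi> e by simp
    fix f' and K :: "'k set" and J :: "'k \<Rightarrow> 'j set" and A B a \<gamma> p
    assume f': "integrable ?M f'" and D: "(LINT z|?M. \<bar>f' z - f z\<bar>) \<le> min d e"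
     and K: "finite K" and J: "\<And>k. k \<in> K \<Longrightarrow> finite (J k)"
     and A: "\<And>k j. k \<in> K \<Longrightarrow> j \<in> J k \<Longrightarrow> A k j \<in> sets lebesgue \<and> A k j \<subseteq> X"
     and B: "\<And>k. k \<in> K \<Longrightarrow> B k \<in> sets lebesgue \<and> B k \<subseteq> X \<and> p k \<in> X"
     and ov: "\<And>z. z \<in> X \<Longrightarrow> (\<Sum>k\<in>K. \<Sum>j\<in>J k. indicator (A k j) z) \<le> N"
     and Bd: "disjoint_family_on B K"
     and cover: "AE z in ?M. z \<in> (\<Union>k\<in>K. B k) \<or> G z = 0"
     and w: "\<And>k j. k \<in> K \<Longrightarrow> j \<in> J k \<Longrightarrow> measure lebesgue (B k) \<le> c * measure lebesgue (A k j)"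
     and avg: "\<And>k j. k \<in> K \<Longrightarrow> j \<in> J k \<Longrightarrow>
                measure lebesgue (A k j) * a k j = (LINT z|?M. indicator (A k j) z * f' z)"
     and gb: "\<And>k j. k \<in> K \<Longrightarrow> j \<in> J k \<Longrightarrow> \<bar>\<gamma> k j\<bar> \<le> \<Gamma>"
     and gG: "\<And>k z. k \<in> K \<Longrightarrow> z \<in> B k \<Longrightarrow> \<bar>(\<Sum>j\<in>J k. \<gamma> k j) - G z\<bar> \<le> min d e"
     and pA: "\<And>k j z. k \<in> K \<Longrightarrow> j \<in> J k \<Longrightarrow> z \<in> A k j \<Longrightarrow> dist z (p k) \<le> min d e"
     and pB: "\<And>k z. k \<in> K \<Longrightarrow> z \<in> B k \<Longrightarrow> dist z (p k) \<le> min d e"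
    have As: "A k j \<in> sets ?M" "measure ?M (A k j) = measure lebesgue (A k j)" if "k \<in> K" "j \<in> J k" for k j
      using A[OF that] Xs by (auto simp: sets_restrict_space_iff measure_restrict_space)
    have Bs: "B k \<in> sets ?M" "measure ?M (B k) = measure lebesgue (B k)" if "k \<in> K" for k
      using B[OF that] Xs by (auto simp: sets_restrict_space_iff measure_restrict_space)
    have D2: "(LINT z|?M. \<bar>f' z - \<psi> z\<bar>) \<le> 2 * e"
    proof -
      have "(LINT z|?M. \<bar>f' z - \<psi> z\<bar>) \<le> (LINT z|?M. \<bar>f' z - f z\<bar> + \<bar>f z - \<psi> z\<bar>)"
        using f' \<psi> by (intro integral_mono) auto
      also have "\<dots> = (LINT z|?M. \<bar>f' z - f z\<bar>) + (LINT z|?M. \<bar>f z - \<psi> z\<bar>)"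
        using f' \<psi> by (intro Bochner_Integration.integral_add) auto
      finally show ?thesis using D \<psi>(6) by linarith
    qed
    have "\<bar>(\<Sum>k\<in>K. measure ?M (B k) * (\<Sum>j\<in>J k. a k j * \<gamma> k j)) - (LINT z|?M. f' z * G z)\<bar>
    \<le> \<Gamma> * (c * N * ((LINT z|?M. \<bar>f' z - \<psi> z\<bar>) + e * ?V))
      + (e * (g0 + e) + C * e) * ?V + g0 * (LINT z|?M. \<bar>f' z - \<psi> z\<bar>)"
    proof (rule weighted_sum_near_integral[OF fin K J f' \<psi>(3) G(1), where A = A and y = "\<lambda>k. \<psi> (p k)"])
      show "\<bar>\<psi> z - \<psi> (p k)\<bar> \<le> e" if "k \<in> K" "j \<in> J k" "z \<in> A k j" for k j z
        using \<psi>(5)[of z "p k"] pA[OF that] A[OF that(1,2)] B[OF that(1)] that by auto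
      show "\<bar>\<psi> z - \<psi> (p k)\<bar> \<le> e" if "k \<in> K" "z \<in> B k" for k z
        using \<psi>(5)[of z "p k"] pB[OF that] B[OF that(1)] that by auto
      show "\<bar>(\<Sum>j\<in>J k. \<gamma> k j) - G z\<bar> \<le> e" if "k \<in> K" "z \<in> B k" for k z
        using gG[OF that] by simp
      show "\<bar>G z\<bar> \<le> g0" "\<bar>\<psi> z\<bar> \<le> C" if "z \<in> space ?M" for z using that G(2) \<psi>(1) by auto
      show "(\<Sum>k\<in>K. \<Sum>j\<in>J k. indicator (A k j) z) \<le> N" if "z \<in> space ?M" for z using ov that by simp
      show "A k j \<in> sets ?M" if "k \<in> K" "j \<in> J k" for k j by (rule As(1)[OF that])
      show "B k \<in> sets ?M" if "k \<in> K" for k by (rule Bs(1)[OF that])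
      show "measure ?M (B k) \<le> c * measure ?M (A k j)" if "k \<in> K" "j \<in> J k" for k j
        using w[OF that] As(2)[OF that] Bs(2)[OF that(1)] by simp
      show "measure ?M (A k j) * a k j = (LINT z|?M. indicator (A k j) z * f' z)" if "k \<in> K" "j \<in> J k" for k j
        using avg[OF that] As(2)[OF that] by simp
      show "0 \<le> e" using e by simp
      show "0 \<le> e" using e by simp
      show "\<bar>\<gamma> k j\<bar> \<le> \<Gamma>" if "k \<in> K" "j \<in> J k" for k j by (rule gb[OF that])
    qed (assumption | fact Bd cover c \<Gamma>)+
    moreover have "(\<Sum>k\<in>K. measure ?M (B k) * (\<Sum>j\<in>J k. a k j * \<gamma> k j)) =
        (\<Sum>k\<in>K. measure lebesgue (B k) * (\<Sum>j\<in>J k. a k j * \<gamma> k j))"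
      using Bs by simp
    moreover have "\<Gamma> * (c * N * ((LINT z|?M. \<bar>f' z - \<psi> z\<bar>) + e * ?V)) \<le> \<Gamma> * (c * N * (2 + ?V)) * e"
      using mult_left_mono[OF D2, of "\<Gamma> * (c * N)"] c N \<Gamma> by (simp add: algebra_simps)
    moreover have "(e * (g0 + e) + C * e) * ?V \<le> (g0 + 1 + C) * ?V * e"
    proof -
      have "e * e \<le> e * 1" using e by (intro mult_left_mono) auto
      then have "e * (g0 + e) + C * e \<le> (g0 + 1 + C) * e" by (simp add: algebra_simps)
      from mult_right_mono[OF this, of ?V] show ?thesis by (simp add: mult_ac)
    qed
    moreover have "g0 * (LINT z|?M. \<bar>f' z - \<psi> z\<bar>) \<le> 2 * g0 * e"
      using mult_left_mono[OF D2 G(3)] by simp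
    moreover have "\<bar>(LINT z|?M. f' z * G z) - (LINT z|?M. f z * G z)\<bar> \<le> g0 * e"
    proof -
      have IG: "integrable ?M (\<lambda>z. u z * G z)" if "integrable ?M u" for u :: "'a \<Rightarrow> real"
      proof (rule Bochner_Integration.integrable_bound[of ?M "\<lambda>z. g0 * u z"])
        show "integrable ?M (\<lambda>z. g0 * u z)" using that by auto
        show "(\<lambda>z. u z * G z) \<in> borel_measurable ?M" using that G by auto
        show "AE z in ?M. norm (u z * G z) \<le> norm (g0 * u z)"
        proof (rule AE_I2)
          fix z assume "z \<in> space ?M"
          then have "\<bar>u z\<bar> * \<bar>G z\<bar> \<le> \<bar>u z\<bar> * \<bar>g0\<bar>" using G by (intro mult_left_mono) auto
          then show "norm (u z * G z) \<le> norm (g0 * u z)" by (simp add: abs_mult mult.commute)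
        qed
      qed
      have "(LINT z|?M. f' z * G z) - (LINT z|?M. f z * G z) = (LINT z|?M. f' z * G z - f z * G z)"
        using IG[OF f'] IG[OF \<psi>(2)] by simp
      also have "\<bar>\<dots>\<bar> \<le> (LINT z|?M. \<bar>f' z * G z - f z * G z\<bar>)" by (rule integral_abs_bound)
      also have "\<dots> \<le> (LINT z|?M. g0 * \<bar>f' z - f z\<bar>)"
      proof (rule integral_mono)
        show "integrable ?M (\<lambda>z. \<bar>f' z * G z - f z * G z\<bar>)" using IG[OF f'] IG[OF \<psi>(2)] by auto
        show "integrable ?M (\<lambda>z. g0 * \<bar>f' z - f z\<bar>)" using f' \<psi> by auto
        fix z assume "z \<in> space ?M"
        then have "\<bar>G z\<bar> \<le> g0" using G by auto
        from mult_right_mono[OF this, of "\<bar>f' z - f z\<bar>"]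
        show "\<bar>f' z * G z - f z * G z\<bar> \<le> g0 * \<bar>f' z - f z\<bar>"
          by (simp add: abs_mult[symmetric] algebra_simps)
      qed
      also have "\<dots> = g0 * (LINT z|?M. \<bar>f' z - f z\<bar>)" by simp
      also have "\<dots> \<le> g0 * e" using D G by (intro mult_left_mono) auto
      finally show ?thesis .
    qed
    ultimately have "\<bar>(\<Sum>k\<in>K. measure lebesgue (B k) * (\<Sum>j\<in>J k. a k j * \<gamma> k j)) - (LINT z|?M. f z * G z)\<bar>
       \<le> \<Gamma> * (c * N * (2 + ?V)) * e + (g0 + 1 + C) * ?V * e + 2 * g0 * e + g0 * e"
      by linarith
    also have "\<dots> = Q * e" unfolding Q_def by (simp add: algebra_simps)
    finally show "\<bar>(\<Sum>k\<in>K. measure lebesgue (B k) * (\<Sum>j\<in>J k. a k j * \<gamma> k j))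
            - (LINT z|?M. f z * G z)\<bar> \<le> \<epsilon>" using Qe by linarith
  qed
qed

section \<open>Smooth test functions on the closed half-space\<close>

text \<open>The derivative relative to \<open>\<Omega> \<times> [0,T)\<close> vanishes off the support: inside the open cylinder because
  the derivative is unique there, and at the initial time by continuity. Hence its extension by zero is continuous on the whole
  closed half-space.\<close>

lemma test_function_gradient:
  assumes \<Omega>: "open \<Omega>" and T: "0 < T" and t: "test_function \<Omega> T \<phi>"
  obtains G :: "point \<times> real \<Rightarrow> point \<times> real" where
    "continuous_on (UNIV \<times> {0..}) G"
    "\<And>z. z \<in> UNIV \<times> {0..} \<Longrightarrow> (\<phi> has_derivative (\<lambda>h. h \<bullet> G z)) (at z within UNIV \<times> {0..})"
    "\<And>z. z \<notin> closure {z. \<phi> z \<noteq> 0} \<Longrightarrow> G z = 0"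
proof -
  define K where "K = closure {z. \<phi> z \<noteq> 0}"
  let ?S = "\<Omega> \<times> {0..<T}" and ?H = "UNIV \<times> {0..} :: (point \<times> real) set"
  have K: "compact K" "K \<subseteq> ?S" using t by (auto simp: test_function_def K_def)
  have "Ck_on (Suc 0) ?S \<phi>" using t by (simp add: test_function_def)
  then obtain f' where f': "\<And>z. z \<in> ?S \<Longrightarrow> (\<phi> has_derivative (\<lambda>h. \<Sum>b\<in>Basis. (h \<bullet> b) * f' b z)) (at z within ?S)"
    and cf': "\<And>b. b \<in> Basis \<Longrightarrow> continuous_on ?S (f' b)" by auto
  define F where "F z = (\<Sum>b\<in>Basis. f' b z *\<^sub>R b)" for z :: "point \<times> real"
  have cF: "continuous_on ?S F" unfolding F_def by (intro continuous_intros cf')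
  have dF: "(\<phi> has_derivative (\<lambda>h. h \<bullet> F z)) (at z within ?S)" if "z \<in> ?S" for z
    using f'[OF that] by (simp add: F_def inner_sum_right mult.commute)
  have zero: "\<phi> z = 0" if "z \<notin> K" for z using that closure_subset[of "{z. \<phi> z \<noteq> 0}"] unfolding K_def by blast
  have oK: "open (- K)" unfolding K_def by (rule open_Compl[OF closed_closure])
  have d0: "(\<phi> has_derivative (\<lambda>h. h \<bullet> 0)) (at z within A)" if "z \<notin> K" for z A
  proof -
    have "((\<lambda>_. 0) has_derivative (\<lambda>h. h \<bullet> 0)) (at z within UNIV)" by simp
    then have "(\<phi> has_derivative (\<lambda>h. h \<bullet> 0)) (at z)"
      proof (rule has_derivative_transform_within_open[OF _ oK])
      show "z \<in> - K" using that by blast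
      show "0 = \<phi> y" if "y \<in> - K" for y using zero[of y] that by (metis ComplD)
    qed
    then show ?thesis by (rule has_derivative_at_withinI)
  qed
  have int0: "F z = 0" if z: "z \<notin> K" "z \<in> \<Omega> \<times> {0<..<T}" for z
  proof -
    have o: "open (\<Omega> \<times> {0<..<T})" using \<Omega> by (intro open_Times) auto
    have "(\<phi> has_derivative (\<lambda>h. h \<bullet> F z)) (at z within \<Omega> \<times> {0<..<T})"
      using z by (intro has_derivative_subset[OF dF]) auto
    then have "(\<phi> has_derivative (\<lambda>h. h \<bullet> F z)) (at z)"
      using o z at_within_open by metis
    from has_derivative_unique[OF this d0[OF z(1), of UNIV]]
    have "F z \<bullet> F z = F z \<bullet> 0" by metis
    then show ?thesis by simp
  qed
  have F0: "F z = 0" if z: "z \<notin> K" "z \<in> ?S" for z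
  proof (cases "snd z > 0")
    case True then show ?thesis using int0[of z] z by auto
  next
    case False
    then obtain x where x: "z = (x, 0)" "x \<in> \<Omega>" using z by (cases z) auto
    let ?s = "\<lambda>n::nat. (x, T / (n + 2))"
    have l: "?s \<longlonglongrightarrow> z" unfolding x
    proof (intro tendsto_Pair tendsto_const)
      show "(\<lambda>n::nat. T / (n + 2)) \<longlonglongrightarrow> 0"
        using tendsto_mult[OF tendsto_const[of T] LIMSEQ_ignore_initial_segment[OF lim_1_over_n, of 2]]
        by (simp add: add.commute)
    qed
    have inS: "?s n \<in> \<Omega> \<times> {0<..<T}" for n
    proof -
      have "T / (n + 2) < T / 1" using T by (intro divide_strict_left_mono) auto
      then show ?thesis using x T by (auto simp: add.commute)
    qed
    have "((\<lambda>n. F (?s n)) \<longlongrightarrow> F z) sequentially"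
    proof (rule continuous_on_tendsto_compose[OF cF l z(2)])
      have "?s n \<in> ?S" for n using inS[of n] by (metis (no_types, lifting) SigmaE SigmaI 
            atLeastLessThan_iff greaterThanLessThan_iff less_imp_le)
      then show "\<forall>\<^sub>F n in sequentially. ?s n \<in> ?S" by simp
    qed
    moreover have "\<forall>\<^sub>F n in sequentially. ?s n \<in> - K"
      
      by (rule topological_tendstoD[OF l oK]) (use z(1) in blast)
    then have "\<forall>\<^sub>F n in sequentially. F (?s n) = 0"
      by eventually_elim (use int0 inS in auto)
    from tendsto_eventually[OF this]
    have "((\<lambda>n. F (?s n)) \<longlongrightarrow> 0) sequentially" .
    ultimately show ?thesis by (rule tendsto_unique[OF trivial_limit_sequentially])
  qed
  define G where "G z = (if z \<in> ?S then F z else 0)" for z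
  have G0: "G z = 0" if "z \<notin> K" for z using F0 that by (auto simp: G_def)
  show thesis
  proof
    show "G z = 0" if "z \<notin> closure {z. \<phi> z \<noteq> 0}" for z using G0 that unfolding K_def .
    have oS: "openin (top_of_set ?H) ?S"
    proof -
      have "?S = ?H \<inter> (\<Omega> \<times> {..<T})" by auto
      moreover have "open (\<Omega> \<times> {..<T})" using \<Omega> by (intro open_Times) auto
      ultimately show ?thesis by (metis openin_open_Int)
    qed
    have oC: "openin (top_of_set ?H) (?H - K)" using oK by (metis Diff_eq openin_open_Int)
    have un: "?H = ?S \<union> (?H - K)" using K by auto
    show "continuous_on ?H G"
    proof (subst un, rule continuous_on_Un_local_open)
      show "openin (top_of_set (?S \<union> (?H - K))) ?S" using oS un by simp
      show "openin (top_of_set (?S \<union> (?H - K))) (?H - K)" using oC un by simp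
      show "continuous_on ?S G" using cF by (simp add: G_def cong: continuous_on_cong)
      show "continuous_on (?H - K) G" using G0 by (subst continuous_on_cong[OF refl, of _ _ "\<lambda>_. 0"]) auto
    qed
    fix z assume z: "z \<in> ?H"
    show "(\<phi> has_derivative (\<lambda>h. h \<bullet> G z)) (at z within ?H)"
    proof (cases "z \<in> K")
      case True
      then have zS: "z \<in> ?S" using K by auto
      have "(\<phi> has_derivative (\<lambda>h. h \<bullet> G z)) (at z within ?S)" using dF[OF zS] zS by (simp add: G_def)
      moreover have "at z within ?S = at z within ?H"
      proof -
        have "open (\<Omega> \<times> {..<T})" using \<Omega> by (intro open_Times) auto
        moreover have "z \<in> \<Omega> \<times> {..<T}" using zS by auto
        ultimately show ?thesis by (intro at_within_nhd[of z "\<Omega> \<times> {..<T}"]) auto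
      qed
      ultimately show ?thesis by simp
    next
      case False then show ?thesis using d0 G0 by simp
    qed
  qed
qed

text \<open>A continuous gradient with compact support is uniformly continuous; the mean value inequality on a convex
  set then gives a Taylor bound that is uniform in the base point.\<close>

lemma gradient_uniform_linearization:
  fixes \<phi> :: "'a::euclidean_space \<Rightarrow> real"
  assumes H: "convex H" "closed H" and cG: "continuous_on H G"
    and d: "\<And>z. z \<in> H \<Longrightarrow> (\<phi> has_derivative (\<lambda>h. h \<bullet> G z)) (at z within H)"
    and K: "compact K" "\<And>z. z \<notin> K \<Longrightarrow> G z = 0" and \<epsilon>: "0 < \<epsilon>"
  obtains \<delta> where "0 < \<delta>"
    "\<And>z z' w. z \<in> H \<Longrightarrow> z' \<in> H \<Longrightarrow> w \<in> H \<Longrightarrow> dist z w \<le> \<delta> \<Longrightarrow> dist z' w \<le> \<delta> \<Longrightarrow>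
       \<bar>\<phi> z' - \<phi> z - (z' - z) \<bullet> G w\<bar> \<le> \<epsilon> * norm (z' - z)"
    "\<And>z w. z \<in> H \<Longrightarrow> w \<in> H \<Longrightarrow> dist z w \<le> \<delta> \<Longrightarrow> norm (G z - G w) \<le> \<epsilon>"
proof -
  obtain R where R0: "0 < R" "\<forall>x\<in>K. norm x \<le> R"
    using compact_imp_bounded[OF K(1)] unfolding bounded_pos by blast
  then have R: "K \<subseteq> cball 0 R" "0 < R" by auto
  let ?C = "H \<inter> cball 0 (R + 1)"
  have "compact ?C" using H by (simp add: closed_Int_compact)
  then have "uniformly_continuous_on ?C G"
    by (intro compact_uniformly_continuous continuous_on_subset[OF cG]) auto
  then obtain e where e: "e > 0" "\<And>z z'. z \<in> ?C \<Longrightarrow> z' \<in> ?C \<Longrightarrow> dist z' z < e \<Longrightarrow> dist (G z') (G z) < \<epsilon>"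
    using \<epsilon> unfolding uniformly_continuous_on_def by metis
  define \<delta> where "\<delta> = min 1 (e / 2)"
  have \<delta>: "0 < \<delta>" "\<delta> \<le> 1" "\<delta> < e" using e(1) by (auto simp: \<delta>_def)
  have u: "norm (G z - G w) \<le> \<epsilon>" if "z \<in> H" "w \<in> H" "dist z w \<le> \<delta>" for z w
  proof (cases "z \<in> ?C \<and> w \<in> ?C")
    case True
    then show ?thesis using e(2)[of w z] that \<delta> by (auto simp: dist_norm)
  next
    case False
    then have "norm z > R + 1 \<or> norm w > R + 1" using that by auto
    then have "norm z > R \<and> norm w > R" 
      using that(3) \<delta>(2) norm_triangle_ineq2[of z w] norm_triangle_ineq2[of w z]
      by (auto simp: dist_norm norm_minus_commute)
    then have "z \<notin> K" "w \<notin> K" using R by auto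
    then show ?thesis using K(2) \<epsilon> by simp
  qed
  show thesis
  proof (rule that[OF \<delta>(1)])
    fix z z' w assume z: "z \<in> H" "z' \<in> H" "w \<in> H" "dist z w \<le> \<delta>" "dist z' w \<le> \<delta>"
    let ?S = "H \<inter> cball w \<delta>"
    have cS: "convex ?S" using H by (intro convex_Int) auto
    have "norm (\<phi> z' - \<phi> z - (\<lambda>h. h \<bullet> G w) (z' - z)) \<le> norm (z' - z) * \<epsilon>"
    proof (rule differentiable_bound_linearization[where S = ?S and f' = "\<lambda>v h. h \<bullet> G v"])
      show "z + t *\<^sub>R (z' - z) \<in> ?S" if "t \<in> {0..1}" for t
      proof -
        have "(1 - t) *\<^sub>R z + t *\<^sub>R z' \<in> ?S"
          using cS that z by (intro convexD) (auto simp: dist_commute)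
        then show ?thesis by (simp add: algebra_simps)
      qed
      show "(\<phi> has_derivative (\<lambda>h. h \<bullet> G v)) (at v within ?S)" if "v \<in> ?S" for v
        using that by (intro has_derivative_subset[OF d]) auto
      show "onorm ((\<lambda>h. h \<bullet> G v) - (\<lambda>h. h \<bullet> G w)) \<le> \<epsilon>" if "v \<in> ?S" for v
      proof (rule onorm_le)
        fix h :: 'a
        have "norm (G v - G w) \<le> \<epsilon>" using u[of v w] that z by (auto simp: dist_commute)
        then have "norm h * norm (G v - G w) \<le> \<epsilon> * norm h" using mult_left_mono by (metis mult.commute norm_ge_zero)
        moreover have "norm (h \<bullet> (G v - G w)) \<le> norm h * norm (G v - G w)" by (simp add: Cauchy_Schwarz_ineq2)
        ultimately show "norm (((\<lambda>h. h \<bullet> G v) - (\<lambda>h. h \<bullet> G w)) h) \<le> \<epsilon> * norm h"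
          by (simp add: inner_diff_right)
      qed
      show "w \<in> ?S" using z \<delta> by auto
    qed
    then show "\<bar>\<phi> z' - \<phi> z - (z' - z) \<bullet> G w\<bar> \<le> \<epsilon> * norm (z' - z)" by (simp add: mult.commute)
  qed (rule u)
qed

lemma bounded_continuous_zero_outside_compact:
  fixes G :: "'a::metric_space \<Rightarrow> 'b::real_normed_vector"
  assumes "closed H" "continuous_on H G" "compact K" "\<And>z. z \<notin> K \<Longrightarrow> G z = 0"
  obtains g where "0 \<le> g" "\<And>z. z \<in> H \<Longrightarrow> norm (G z) \<le> g"
proof -
  have "compact (G ` (H \<inter> K))"
    using assms by (intro compact_continuous_image) (auto intro: continuous_on_subset closed_Int_compact)
  then obtain g where g: "\<And>y. y \<in> G ` (H \<inter> K) \<Longrightarrow> norm y \<le> g"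
    using compact_imp_bounded bounded_iff by metis
  show thesis
  proof (rule that[of "max 0 g"])
    fix z assume "z \<in> H"
    then show "norm (G z) \<le> max 0 g" using g[of "G z"] assms(4)[of z] by (cases "z \<in> K") auto
  qed simp
qed

text \<open>At positive times the relative derivative is a two-sided one, so the partial derivatives of the
  limit formula are its components.\<close>

lemma gradient_partials:
  fixes \<phi> :: "point \<times> real \<Rightarrow> real"
  assumes d: "(\<phi> has_derivative (\<lambda>h. h \<bullet> G)) (at (x, t) within UNIV \<times> {0..})" and t: "0 < t"
  shows "time_deriv \<phi> x t = snd G" and "space_grad \<phi> x t = fst G"
proof -
  have "(x, t) \<in> UNIV \<times> {0<..}" "open (UNIV \<times> {0<..} :: (point \<times> real) set)" using t by (auto intro: open_Times)
  moreover have "(\<phi> has_derivative (\<lambda>h. h \<bullet> G)) (at (x, t) within UNIV \<times> {0<..})"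
    by (rule has_derivative_subset[OF d]) auto
  ultimately have D: "(\<phi> has_derivative (\<lambda>h. h \<bullet> G)) (at (x, t))" using at_within_open by metis
  have "((\<lambda>s. \<phi> (x, s)) has_derivative (\<lambda>h. (0, h) \<bullet> G)) (at t)"
    by (rule has_derivative_compose[of "\<lambda>s. (x, s)" "\<lambda>h. (0, h)" t UNIV \<phi>, simplified])
       (use D in \<open>auto intro!: derivative_eq_intros\<close>)
  then have "((\<lambda>s. \<phi> (x, s)) has_field_derivative (snd G)) (at t)"
    by (simp add: has_field_derivative_def inner_prod_def mult_commute_abs)
  then show "time_deriv \<phi> x t = snd G" unfolding time_deriv_def by (rule DERIV_imp_deriv)
  have "deriv (\<lambda>h. \<phi> (x + h *\<^sub>R axis i 1, t)) 0 = fst G $ i" for i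
  proof -
    have "((\<lambda>h. \<phi> (x + h *\<^sub>R axis i 1, t)) has_derivative (\<lambda>h. (h *\<^sub>R axis i 1, 0) \<bullet> G)) (at 0)"
      by (rule has_derivative_compose[of "\<lambda>h. (x + h *\<^sub>R axis i 1, t)" "\<lambda>h. (h *\<^sub>R axis i 1, 0)" 0 UNIV \<phi>, simplified])
         (use D in \<open>auto intro!: derivative_eq_intros\<close>)
    then have "((\<lambda>h. \<phi> (x + h *\<^sub>R axis i 1, t)) has_field_derivative (fst G $ i)) (at 0)"
      by (simp add: has_field_derivative_def inner_prod_def inner_axis' mult_commute_abs)
    then show ?thesis by (rule DERIV_imp_deriv)
  qed
  then show "space_grad \<phi> x t = fst G" by (simp add: space_grad_def vec_eq_iff)
qed

section \<open>Plane geometry of quadrangles\<close>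

definition det2 :: "point \<Rightarrow> point \<Rightarrow> real" where
  "det2 u v = u $ 1 * v $ 2 - u $ 2 * v $ 1"

text \<open>Clockwise rotation by a right angle: it maps the edge vectors of a counterclockwise polygon to outward normals.\<close>

definition turn :: "point \<Rightarrow> point" where
  "turn u = vector [u $ 2, - u $ 1]"

lemma point_eq_iff: "(x::point) = y \<longleftrightarrow> x $ 1 = y $ 1 \<and> x $ 2 = y $ 2"
  by (simp add: vec_eq_iff forall_2)

lemma inner_point: "(x::point) \<bullet> y = x $ 1 * y $ 1 + x $ 2 * y $ 2"
  by (simp add: inner_vec_def sum_2)

lemma turn_component [simp]: "turn u $ 1 = u $ 2" "turn u $ 2 = - u $ 1"
  by (simp_all add: turn_def)

lemma turn_eq_0 [simp]: "turn u = 0 \<longleftrightarrow> u = 0"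
  by (auto simp: point_eq_iff)

lemma norm_turn [simp]: "norm (turn u) = norm u"
  by (simp add: norm_eq_sqrt_inner inner_point add.commute)

lemma cr_turn: "det2 u v = - (turn u \<bullet> v)"
  by (simp add: det2_def inner_point)

lemma continuous_on_cr [continuous_intros]:
  "continuous_on S f \<Longrightarrow> continuous_on S g \<Longrightarrow> continuous_on S (\<lambda>x. det2 (f x) (g x))"
  unfolding det2_def by (intro continuous_intros)

lemma cr_eq_0_imp_scaleR: "det2 u v = 0 \<Longrightarrow> u \<noteq> 0 \<Longrightarrow> \<exists>c. v = c *\<^sub>R u"
proof -
  assume c: "det2 u v = 0" and u: "u \<noteq> 0"
  have "u \<bullet> u \<noteq> 0" using u by simp
  have "v $ 1 * (u \<bullet> u) = (u \<bullet> v) * u $ 1" "v $ 2 * (u \<bullet> u) = (u \<bullet> v) * u $ 2"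
    using c unfolding det2_def inner_point by algebra+
  with \<open>u \<bullet> u \<noteq> 0\<close> have "v = ((u \<bullet> v) / (u \<bullet> u)) *\<^sub>R u"
    by (simp add: point_eq_iff field_simps)
  then show ?thesis by blast
qed

lemma not_collinear_imp_cr:
  assumes "\<not> collinear {a, b, c}" shows "det2 (b - a) (c - a) \<noteq> 0"
proof
  assume *: "det2 (b - a) (c - a) = 0"
  have "b \<noteq> a" using assms by (auto simp: insert_commute)
  then obtain k where k: "c - a = k *\<^sub>R (b - a)" using cr_eq_0_imp_scaleR[OF *] by auto
  have "collinear {a, b, c}"
    unfolding collinear_def
  proof (intro exI[of _ "b - a"] ballI)
    fix x y assume "x \<in> {a, b, c}" "y \<in> {a, b, c}"
    moreover have "\<exists>s. z = a + s *\<^sub>R (b - a)" if z: "z \<in> {a, b, c}" for z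
    proof -
      consider "z = a" | "z = b" | "z = c" using z by auto
      then show ?thesis
      proof cases
        case 1 then show ?thesis by (intro exI[of _ 0]) simp
      next
        case 2 then show ?thesis by (intro exI[of _ 1]) simp
      next
        case 3 then show ?thesis using k by (intro exI[of _ k]) (simp add: algebra_simps)
      qed
    qed
    ultimately obtain s t where xy: "x = a + s *\<^sub>R (b - a)" "y = a + t *\<^sub>R (b - a)" by meson
    show "\<exists>c. x - y = c *\<^sub>R (b - a)" unfolding xy by (intro exI[of _ "s - t"]) (simp add: algebra_simps)
  qed
  with assms show False by simp
qed


lemma triangle_barycentric:
  fixes a b c y :: point
  assumes "y = u *\<^sub>R a + v *\<^sub>R b + w *\<^sub>R c" "u + v + w = 1"
  shows "det2 (b - a) (y - a) = w * det2 (b - a) (c - a)"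
    "det2 (c - b) (y - b) = u * det2 (b - a) (c - a)"
    "det2 (a - c) (y - c) = v * det2 (b - a) (c - a)"
  using assms unfolding det2_def point_eq_iff by (simp_all, algebra+)

lemma triangle_barycentric_exists:
  fixes a b c y :: point
  assumes "det2 (b - a) (c - a) \<noteq> 0"
  shows "\<exists>u v w. y = u *\<^sub>R a + v *\<^sub>R b + w *\<^sub>R c \<and> u + v + w = 1"
proof -
  let ?D = "det2 (b - a) (c - a)"
  let ?u = "det2 (c - b) (y - b) / ?D" and ?v = "det2 (a - c) (y - c) / ?D" and ?w = "det2 (b - a) (y - a) / ?D"
  have s: "det2 (c - b) (y - b) + det2 (a - c) (y - c) + det2 (b - a) (y - a) = ?D"
    by (simp add: det2_def algebra_simps)
  then have 1: "?u + ?v + ?w = 1" using assms by (simp add: add_divide_distrib[symmetric])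
  have "?D *\<^sub>R y = det2 (c - b) (y - b) *\<^sub>R a + det2 (a - c) (y - c) *\<^sub>R b + det2 (b - a) (y - a) *\<^sub>R c"
    by (simp add: point_eq_iff det2_def algebra_simps)
  then have "(1 / ?D) *\<^sub>R (?D *\<^sub>R y) = (1 / ?D) *\<^sub>R (det2 (c - b) (y - b) *\<^sub>R a + det2 (a - c) (y - c) *\<^sub>R b + det2 (b - a) (y - a) *\<^sub>R c)"
    by simp
  then have "y = ?u *\<^sub>R a + ?v *\<^sub>R b + ?w *\<^sub>R c"
    using assms by (simp add: scaleR_add_right)
  with 1 show ?thesis by blast
qed

text \<open>The three expressions are the barycentric coordinates of \<open>y\<close>, up to the common factor
  \<open>det2 (b - a) (c - a)\<close>.\<close>

lemma mem_ccw_triangle_iff: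
  assumes "0 < det2 (b - a) (c - a)"
  shows "y \<in> convex hull {a, b, c} \<longleftrightarrow>
     0 \<le> det2 (b - a) (y - a) \<and> 0 \<le> det2 (c - b) (y - b) \<and> 0 \<le> det2 (a - c) (y - c)"
proof -
  obtain u v w where y: "y = u *\<^sub>R a + v *\<^sub>R b + w *\<^sub>R c" "u + v + w = 1"
    using triangle_barycentric_exists[of b a c y] assms by auto
  note E = triangle_barycentric[OF y]
  show ?thesis
  proof
    assume "y \<in> convex hull {a, b, c}"
    then obtain u v w where "y = u *\<^sub>R a + v *\<^sub>R b + w *\<^sub>R c" "u + v + w = 1" "0 \<le> u" "0 \<le> v" "0 \<le> w"
      unfolding convex_hull_3 by auto
    then show "0 \<le> det2 (b - a) (y - a) \<and> 0 \<le> det2 (c - b) (y - b) \<and> 0 \<le> det2 (a - c) (y - c)"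
      using triangle_barycentric[of y u a v b w c] assms by simp
  next
    assume "0 \<le> det2 (b - a) (y - a) \<and> 0 \<le> det2 (c - b) (y - b) \<and> 0 \<le> det2 (a - c) (y - c)"
    then have "0 \<le> u" "0 \<le> v" "0 \<le> w" using E assms by (simp_all add: zero_le_mult_iff)
    then show "y \<in> convex hull {a, b, c}" unfolding convex_hull_3 using y by blast
  qed
qed

lemma ccw_triangle_edge:
  assumes "0 < det2 (b - a) (c - a)" "y \<in> convex hull {a, b, c}" "det2 (b - a) (y - a) = 0"
  shows "y \<in> closed_segment a b"
proof -
  obtain u v w where y: "y = u *\<^sub>R a + v *\<^sub>R b + w *\<^sub>R c" "u + v + w = 1" "0 \<le> u" "0 \<le> v" "0 \<le> w"
    using assms(2) unfolding convex_hull_3 by auto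
  then have "w = 0" using triangle_barycentric(1)[OF y(1,2)] assms by simp
  then have "u = 1 - v" using y by simp
  then have "y = (1 - v) *\<^sub>R a + v *\<^sub>R b" "v \<le> 1" using y \<open>w = 0\<close> by auto
  then show ?thesis using y unfolding closed_segment_def by blast
qed

lemma triangle_rotate: "det2 (b - a) (c - a) = det2 (c - b) (a - b)"
  by (simp add: det2_def algebra_simps)

lemma open_cr_pos: "open {y. 0 < det2 u (y - p)}"
  by (intro open_Collect_less continuous_intros)

lemma compact_hull3: "compact (convex hull {a, b, c::point})"
  by (intro compact_convex_hull finite_imp_compact) auto

lemma ccw_triangle_interior:
  assumes "0 < det2 (b - a) (c - a)" "0 < det2 (b - a) (y - a)" "0 < det2 (c - b) (y - b)" "0 < det2 (a - c) (y - c)"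
    "convex hull {a, b, c} \<subseteq> C"
  shows "y \<in> interior C"
proof (rule interiorI[of "{y. 0 < det2 (b - a) (y - a)} \<inter> {y. 0 < det2 (c - b) (y - b)} \<inter> {y. 0 < det2 (a - c) (y - c)}"])
  show "{y. 0 < det2 (b - a) (y - a)} \<inter> {y. 0 < det2 (c - b) (y - b)} \<inter> {y. 0 < det2 (a - c) (y - c)} \<subseteq> C"
    using assms(5) mem_ccw_triangle_iff[OF assms(1)] by (fastforce simp: less_imp_le)
qed (use assms in \<open>auto intro!: open_Int open_cr_pos\<close>)

lemma measure_ccw_triangle:
  assumes "0 < det2 (b - a) (c - a)"
  shows "area (convex hull {a, b, c}) = det2 (b - a) (c - a) / 2"
proof -
  have "convex hull {a, b, c} \<in> sets borel"
    using compact_hull3 by (intro borel_closed compact_imp_closed)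
  then have "area (convex hull {a, b, c}) = measure lborel (convex hull {a, b, c})"
    by (simp add: measure_completion)
  also have "\<dots> = \<bar>(c $ 1 - a $ 1) * (b $ 2 - a $ 2) - (b $ 1 - a $ 1) * (c $ 2 - a $ 2)\<bar> / 2"
    by (rule content_triangle)
  also have "(c $ 1 - a $ 1) * (b $ 2 - a $ 2) - (b $ 1 - a $ 1) * (c $ 2 - a $ 2) = - det2 (b - a) (c - a)"
    by (simp add: det2_def algebra_simps)
  finally show ?thesis using assms by simp
qed


text \<open>The labelling of a quadrangle can be chosen counterclockwise with the diagonal \<open>a c\<close> inside. The condition is
  invariant under \<open>(a, b, c, d) \<mapsto> (c, d, a, b)\<close>, so statements about the first triangle transfer to the second.\<close>

definition ccw_quadrangle :: "point \<Rightarrow> point \<Rightarrow> point \<Rightarrow> point \<Rightarrow> point set \<Rightarrow> point set set \<Rightarrow> bool" where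
  "ccw_quadrangle a b c d P E \<longleftrightarrow>
     0 < det2 (b - a) (c - a) \<and> 0 < det2 (d - c) (a - c) \<and> b \<noteq> d \<and>
     P = interior (convex hull {a, b, c} \<union> convex hull {c, d, a}) \<and>
     E = {closed_segment a b, closed_segment b c, closed_segment c d, closed_segment d a}"

text \<open>If \<open>b\<close> and \<open>d\<close> were on the same side of the diagonal, then moving the midpoint of \<open>a c\<close>
  slightly towards \<open>b\<close> would stay in both triangles, which share only the diagonal.\<close>

lemma quadrangle_opposite:
  assumes q: "quadrangle a b c d P E"
  shows "det2 (c - a) (b - a) * det2 (c - a) (d - a) < 0"
proof (rule ccontr)
  assume n: "\<not> ?thesis"
  have nz: "det2 (c - a) (b - a) \<noteq> 0" "det2 (c - a) (d - a) \<noteq> 0"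
    using q not_collinear_imp_cr[of a c b] not_collinear_imp_cr[of a c d]
    by (auto simp: quadrangle_def insert_commute)
  with n have pos: "0 < det2 (c - a) (b - a) * det2 (c - a) (d - a)" by (metis linorder_neqE_linordered_idom mult_eq_0_iff)
  obtain u v w where b: "b = u *\<^sub>R a + v *\<^sub>R c + w *\<^sub>R d" "u + v + w = 1"
    using triangle_barycentric_exists[of c a d b] nz by auto
  have "det2 (c - a) (b - a) = w * det2 (c - a) (d - a)" by (rule triangle_barycentric[OF b])
  with pos have w: "0 < w"
    by (metis mult.assoc mult.commute mult_less_0_iff not_less_iff_gr_or_eq zero_less_mult_iff mult_zero_left)
  \<comment> \<open>small enough to keep the coefficients of \<open>a\<close> and \<open>c\<close> nonnegative\<close>
  define s where "s = 1 / (2 + 2 * \<bar>u\<bar> + 2 * \<bar>v\<bar>)"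
  have s: "0 < s" "s \<le> 1 / 2" "s * \<bar>u\<bar> \<le> 1/4 + (1/2 - s) / 2 " "s * \<bar>v\<bar> \<le> 1/4 + (1/2 - s) / 2"
    by (auto simp: s_def field_simps)
  have s3: "0 \<le> (1 - s) / 2 + s * u" "0 \<le> (1 - s) / 2 + s * v"
    using s abs_ge_minus_self[of u] abs_ge_minus_self[of v] mult_left_mono[of "- u" "\<bar>u\<bar>" s] mult_left_mono[of "- v" "\<bar>v\<bar>" s]
    by (auto simp: field_simps)
  let ?y = "((1 - s) / 2) *\<^sub>R a + ((1 - s) / 2) *\<^sub>R c + s *\<^sub>R b"
  have y2: "?y = ((1 - s) / 2 + s * u) *\<^sub>R a + ((1 - s) / 2 + s * v) *\<^sub>R c + (s * w) *\<^sub>R d"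
    unfolding b(1) by (simp add: algebra_simps)
  have "?y \<in> convex hull {a, c, d}"
    unfolding convex_hull_3
  proof (intro CollectI exI conjI)
    show "?y = ((1 - s) / 2 + s * u) *\<^sub>R a + ((1 - s) / 2 + s * v) *\<^sub>R c + (s * w) *\<^sub>R d" by (rule y2)
    have "(1 - s) / 2 + s * u + ((1 - s) / 2 + s * v) + s * w = (1 - s) + s * (u + v + w)"
      by (simp add: field_simps)
    then show "(1 - s) / 2 + s * u + ((1 - s) / 2 + s * v) + s * w = 1" using b(2) by simp
  qed (use s s3 w in auto)
  moreover have "?y \<in> convex hull {a, b, c}"
    unfolding convex_hull_3
    by (intro CollectI exI[of _ "(1 - s) / 2"] exI[of _ s] exI[of _ "(1 - s) / 2"]) (use s in \<open>auto simp: algebra_simps\<close>)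
  ultimately have "?y \<in> closed_segment a c" using q unfolding quadrangle_def by blast
  then obtain t where t: "?y = (1 - t) *\<^sub>R a + t *\<^sub>R c + 0 *\<^sub>R d" by (auto simp: closed_segment_def)
  have "det2 (c - a) (?y - a) = 0 * det2 (c - a) (d - a)" by (rule triangle_barycentric(1)[OF t]) simp
  moreover have "det2 (c - a) (?y - a) = (s * w) * det2 (c - a) (d - a)"
    by (rule triangle_barycentric(1)[OF y2]) (use b(2) in \<open>simp add: field_simps\<close>, algebra?)
  ultimately show False using s w nz by simp
qed

lemma ccw_quadrangleI:
  assumes q: "quadrangle a b c d P E" and pos: "0 < det2 (b - a) (c - a)"
  shows "ccw_quadrangle a b c d P E"
proof -
  have "det2 (c - a) (b - a) = - det2 (b - a) (c - a)" by (simp add: det2_def)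
  then have "det2 (c - a) (d - a) > 0" using quadrangle_opposite[OF q] pos by (simp add: zero_less_mult_iff)
  moreover have "b \<noteq> d" using q by (auto simp: quadrangle_def insert_commute)
  moreover have "det2 (c - a) (d - a) = det2 (d - c) (a - c)" by (simp add: det2_def algebra_simps)
  ultimately show ?thesis using q pos unfolding quadrangle_def ccw_quadrangle_def
    by (simp add: insert_commute)
qed

lemma quadrangle_swap: "quadrangle a b c d P E \<Longrightarrow> quadrangle c b a d P E"
  unfolding quadrangle_def by (simp add: insert_commute closed_segment_commute Int_commute)

lemma quadrangle_ccw_cases:
  assumes q: "quadrangle a b c d P E"
  shows "ccw_quadrangle a b c d P E \<or> ccw_quadrangle c b a d P E"
proof -
  have "det2 (b - a) (c - a) \<noteq> 0" using q not_collinear_imp_cr by (auto simp: quadrangle_def)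
  moreover have "det2 (b - a) (c - a) = - det2 (b - c) (a - c)" by (simp add: det2_def algebra_simps)
  ultimately consider "0 < det2 (b - a) (c - a)" | "0 < det2 (b - c) (a - c)" by linarith
  then show ?thesis using ccw_quadrangleI[OF q] ccw_quadrangleI[OF quadrangle_swap[OF q]] by cases auto
qed

lemma ccw_quadrangle_rotate: "ccw_quadrangle a b c d P E \<Longrightarrow> ccw_quadrangle c d a b P E"
  unfolding ccw_quadrangle_def by (auto simp: Un_commute insert_commute)

lemma is_quadrangle_ccw:
  assumes "is_quadrangle P E" obtains a b c d where "ccw_quadrangle a b c d P E"
  using assms quadrangle_ccw_cases unfolding is_quadrangle_def by blast

lemma ccw_quadrangle_interior:
  assumes q: "ccw_quadrangle a b c d P E"
    and "0 < det2 (b - a) (y - a)" "0 < det2 (c - b) (y - b)" "0 < det2 (d - c) (y - c)" "0 < det2 (a - d) (y - d)"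
  shows "y \<in> P"
proof -
  let ?O = "{y. 0 < det2 (b - a) (y - a)} \<inter> {y. 0 < det2 (c - b) (y - b)} \<inter> {y. 0 < det2 (d - c) (y - c)} \<inter> {y. 0 < det2 (a - d) (y - d)}"
  have pos: "0 < det2 (b - a) (c - a)" "0 < det2 (d - c) (a - c)" using q by (auto simp: ccw_quadrangle_def)
  have "?O \<subseteq> convex hull {a, b, c} \<union> convex hull {c, d, a}"
  proof
    fix z assume z: "z \<in> ?O"
    have "det2 (a - c) (z - c) = - det2 (c - a) (z - a)" by (simp add: det2_def algebra_simps)
    then consider "0 \<le> det2 (a - c) (z - c)" | "0 \<le> det2 (c - a) (z - a)" by linarith
    then show "z \<in> convex hull {a, b, c} \<union> convex hull {c, d, a}"
      using z mem_ccw_triangle_iff[OF pos(1)] mem_ccw_triangle_iff[OF pos(2)] by cases (auto simp: less_imp_le)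
  qed
  moreover have "open ?O" by (intro open_Int open_cr_pos)
  ultimately have "y \<in> interior (convex hull {a, b, c} \<union> convex hull {c, d, a})"
    using assms(2-) by (intro interiorI[of ?O]) auto
  then show ?thesis using q by (simp add: ccw_quadrangle_def)
qed

lemma ccw_quadrangle_closure:
  assumes q: "ccw_quadrangle a b c d P E"
  shows "closure P = convex hull {a, b, c} \<union> convex hull {c, d, a}" (is "_ = ?C")
proof
  have P: "P = interior ?C" and pos: "0 < det2 (b - a) (c - a)" "0 < det2 (d - c) (a - c)"
    using q by (auto simp: ccw_quadrangle_def)
  have cl: "closed (convex hull {a, b, c})" "closed (convex hull {c, d, a})"
    using compact_hull3 compact_imp_closed by blast+
  show "closure P \<subseteq> ?C" using cl unfolding P by (intro closure_minimal interior_subset closed_Un)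
  have tri: "convex hull {x, y, z} \<subseteq> closure (interior (convex hull {x, y, z}))" if "0 < det2 (y - x) (z - x)" for x y z
  proof -
    let ?m = "(1/3) *\<^sub>R x + (1/3) *\<^sub>R y + (1/3) *\<^sub>R z"
    have "?m \<in> interior (convex hull {x, y, z})"
      using triangle_barycentric[of ?m "1/3" x "1/3" y "1/3" z] that
      by (intro ccw_triangle_interior[OF that]) auto
    then have "closure (interior (convex hull {x, y, z})) = closure (convex hull {x, y, z})"
      by (intro convex_closure_interior) auto
    then show ?thesis using closure_subset by blast
  qed
  have "interior (convex hull {a, b, c}) \<subseteq> P" "interior (convex hull {c, d, a}) \<subseteq> P"
    unfolding P by (auto intro!: interior_mono)
  with tri[OF pos(1)] tri[OF pos(2)] show "?C \<subseteq> closure P"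
    by (meson Un_least closure_mono order_trans)
qed

lemma ccw_quadrangle_area:
  assumes q: "ccw_quadrangle a b c d P E"
  shows "area P = (det2 (b - a) (c - a) + det2 (d - c) (a - c)) / 2"
proof -
  have P: "P = interior (convex hull {a, b, c} \<union> convex hull {c, d, a})"
    and pos: "0 < det2 (b - a) (c - a)" "0 < det2 (d - c) (a - c)"
    using q by (auto simp: ccw_quadrangle_def)
  let ?S = "convex hull {a, b, c}" and ?T = "convex hull {c, d, a}"
  have L: "?S \<in> lmeasurable" "?T \<in> lmeasurable" using compact_hull3 lmeasurable_compact by blast+
  have "negligible (?S \<inter> ?T)"
  proof (rule negligible_subset)
    have "c - a \<noteq> 0" using pos by (auto simp: det2_def)
    then have "turn (c - a) \<noteq> 0" by simp
    then show "negligible {z. turn (c - a) \<bullet> z = turn (c - a) \<bullet> a}" using negligible_hyperplane by blast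
    show "?S \<inter> ?T \<subseteq> {z. turn (c - a) \<bullet> z = turn (c - a) \<bullet> a}"
    proof
      fix z assume "z \<in> ?S \<inter> ?T"
      then have "0 \<le> det2 (a - c) (z - c)" "0 \<le> det2 (c - a) (z - a)"
        using mem_ccw_triangle_iff[OF pos(1)] mem_ccw_triangle_iff[OF pos(2)] by auto
      moreover have "det2 (a - c) (z - c) = - det2 (c - a) (z - a)" by (simp add: det2_def algebra_simps)
      ultimately have "det2 (c - a) (z - a) = 0" by linarith
      then show "z \<in> {z. turn (c - a) \<bullet> z = turn (c - a) \<bullet> a}" by (simp add: cr_turn inner_diff_right)
    qed
  qed
  then have 0: "measure lebesgue (?S \<inter> ?T) = 0" by (simp add: negligible_imp_measure0)
  have fr: "negligible (frontier (?S \<union> ?T))"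
    using frontier_Un_subset[of ?S ?T] negligible_convex_frontier[of ?S] negligible_convex_frontier[of ?T]
    by (meson convex_convex_hull negligible_Un negligible_subset)
  have "measure lebesgue P = measure lebesgue (?S \<union> ?T)"
  proof (rule measure_negligible_symdiff)
    show "?S \<union> ?T \<in> lmeasurable" using L by (rule fmeasurable.Un)
    have sub: "(?S \<union> ?T - P) \<union> (P - (?S \<union> ?T)) \<subseteq> frontier (?S \<union> ?T)"
      unfolding P frontier_def using interior_subset closure_subset by blast
    show "negligible ((?S \<union> ?T - P) \<union> (P - (?S \<union> ?T)))"
      by (rule negligible_subset[OF fr sub])
  qed
  also have "\<dots> = area ?S + area ?T" using measure_Un3[OF L] 0 by simp
  finally show ?thesis using measure_ccw_triangle[OF pos(1)] measure_ccw_triangle[OF pos(2)]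
    by (simp add: add_divide_distrib)
qed

text \<open>A point of the triangle \<open>a b c\<close> outside \<open>P\<close> is on the boundary of the triangle. It cannot be
  inside the diagonal \<open>a c\<close>, since there the two triangles together form a neighbourhood.\<close>

lemma ccw_quadrangle_frontier_half:
  assumes q: "ccw_quadrangle a b c d P E" and y: "y \<in> convex hull {a, b, c}" "y \<notin> P"
  shows "y \<in> \<Union>E"
proof -
  have pos: "0 < det2 (b - a) (c - a)" "0 < det2 (d - c) (a - c)"
    and P: "P = interior (convex hull {a, b, c} \<union> convex hull {c, d, a})"
    and E: "E = {closed_segment a b, closed_segment b c, closed_segment c d, closed_segment d a}"
    using q by (auto simp: ccw_quadrangle_def)
  have pos': "0 < det2 (c - b) (a - b)" "0 < det2 (a - c) (b - c)" using pos(1) triangle_rotate by metis+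
  have nn: "0 \<le> det2 (b - a) (y - a)" "0 \<le> det2 (c - b) (y - b)" "0 \<le> det2 (a - c) (y - c)"
    using y(1) mem_ccw_triangle_iff[OF pos(1)] by auto
  have "\<not> (0 < det2 (b - a) (y - a) \<and> 0 < det2 (c - b) (y - b) \<and> 0 < det2 (a - c) (y - c))"
    using ccw_triangle_interior[OF pos(1)] y(2) unfolding P by blast
  with nn consider "det2 (b - a) (y - a) = 0" | "det2 (c - b) (y - b) = 0" | "det2 (a - c) (y - c) = 0" by linarith
  then show ?thesis
  proof cases
    case 1
    then show ?thesis using ccw_triangle_edge[OF pos(1) y(1)] E by auto
  next
    case 2
    have "y \<in> convex hull {b, c, a}" using y(1) by (simp add: insert_commute)
    then show ?thesis using ccw_triangle_edge[OF pos'(1) _ 2] E by auto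
  next
    case 3
    have "y \<in> convex hull {c, a, b}" using y(1) by (simp add: insert_commute)
    from ccw_triangle_edge[OF pos'(2) this 3]
    obtain t where t: "y = (1 - t) *\<^sub>R c + t *\<^sub>R a + 0 *\<^sub>R b" "0 \<le> t" "t \<le> 1" by (auto simp: closed_segment_def)
    show ?thesis
    proof (cases "t = 0 \<or> t = 1")
      case True
      then have "y = c \<or> y = a" using t by auto
      then show ?thesis using E by auto
    next
      case False
      then have t': "0 < t" "t < 1" using t by auto
      have "det2 (b - a) (y - a) = (1 - t) * det2 (b - a) (c - a)" "det2 (c - b) (y - b) = t * det2 (b - a) (c - a)"
        "det2 (d - c) (y - c) = t * det2 (d - c) (a - c)" "det2 (a - d) (y - d) = (1 - t) * det2 (d - c) (a - c)"
        unfolding t(1) by (simp_all add: det2_def algebra_simps)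
      then have "y \<in> P" using t' pos by (intro ccw_quadrangle_interior[OF q]) auto
      with y show ?thesis by simp
    qed
  qed
qed

lemma ccw_quadrangle_frontier:
  assumes q: "ccw_quadrangle a b c d P E" and y: "y \<in> closure P" "y \<notin> P"
  shows "y \<in> \<Union>E"
  using y ccw_quadrangle_frontier_half[OF q] ccw_quadrangle_frontier_half[OF ccw_quadrangle_rotate[OF q]]
  unfolding ccw_quadrangle_closure[OF q] by auto


text \<open>Walking from \<open>x\<close> across the edge changes the sign of one barycentric coordinate and keeps the
  other two positive for a short time; the second piece \<open>K\<close> is closed and does not contain \<open>x\<close>, so it does not interfere.
  This also covers quadrangles with a reflex corner.\<close>

lemma edge_local_sides:
  assumes pos: "0 < det2 (v - u) (w - u)" and C: "C = convex hull {u, v, w} \<union> K" and K: "closed K"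
    and x: "x \<in> open_segment u v" "x \<notin> K"
  shows "\<exists>e>0. \<forall>s\<in>{0<..<e}. x - s *\<^sub>R ((1 / norm (v - u)) *\<^sub>R turn (v - u)) \<in> interior C
     \<and> x + s *\<^sub>R ((1 / norm (v - u)) *\<^sub>R turn (v - u)) \<notin> C"
proof -
  let ?n = "(1 / norm (v - u)) *\<^sub>R turn (v - u)"
  have vu: "v - u \<noteq> 0" using pos by (auto simp: det2_def)
  obtain t where t: "x = (1 - t) *\<^sub>R u + t *\<^sub>R v + 0 *\<^sub>R w" "0 < t" "t < 1"
    using x(1) by (auto simp: in_segment)
  have L: "det2 (v - u) (x - u) = 0 * det2 (v - u) (w - u)" "det2 (w - v) (x - v) = (1 - t) * det2 (v - u) (w - u)"
      "det2 (u - w) (x - w) = t * det2 (v - u) (w - u)"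
    unfolding t(1) by (simp_all add: det2_def algebra_simps)
  have nn: "turn (v - u) \<bullet> ?n = norm (v - u)"
    using vu by (simp add: dot_square_norm power2_eq_square)
  have L1: "det2 (v - u) (x + s *\<^sub>R ?n - u) = - s * norm (v - u)" for s
  proof -
    have "det2 (v - u) (x + s *\<^sub>R ?n - u) = det2 (v - u) (x - u) - s * (turn (v - u) \<bullet> ?n)"
      by (simp add: cr_turn inner_diff_right inner_add_right)
    then show ?thesis unfolding nn using L(1) by simp
  qed
  have lim: "((\<lambda>s. x + s *\<^sub>R ?n) \<longlongrightarrow> x) (at_right 0)" "((\<lambda>s. x - s *\<^sub>R ?n) \<longlongrightarrow> x) (at_right 0)"
  proof -
    have "((\<lambda>s. x + s *\<^sub>R ?n) \<longlongrightarrow> x + 0 *\<^sub>R ?n) (at_right 0)" "((\<lambda>s. x - s *\<^sub>R ?n) \<longlongrightarrow> x - 0 *\<^sub>R ?n) (at_right 0)"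
      by (rule tendsto_add tendsto_diff tendsto_const tendsto_scaleR tendsto_ident_at)+
    then show "((\<lambda>s. x + s *\<^sub>R ?n) \<longlongrightarrow> x) (at_right 0)" "((\<lambda>s. x - s *\<^sub>R ?n) \<longlongrightarrow> x) (at_right 0)"
      by simp_all
  qed
  have "\<forall>\<^sub>F s in at_right 0. x + s *\<^sub>R ?n \<in> - K"
    using K x(2) by (intro topological_tendstoD[OF lim(1)]) auto
  moreover have "\<forall>\<^sub>F s in at_right 0. x - s *\<^sub>R ?n \<in> {y. 0 < det2 (w - v) (y - v)}"
    using L(2) t pos by (intro topological_tendstoD[OF lim(2)] open_cr_pos) auto
  moreover have "\<forall>\<^sub>F s in at_right 0. x - s *\<^sub>R ?n \<in> {y. 0 < det2 (u - w) (y - w)}"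
    using L(3) t pos by (intro topological_tendstoD[OF lim(2)] open_cr_pos) auto
  moreover have "\<forall>\<^sub>F s in at_right (0::real). 0 < s" by (simp add: eventually_at_right_less)
  ultimately have "\<forall>\<^sub>F s in at_right 0. x - s *\<^sub>R ?n \<in> interior C \<and> x + s *\<^sub>R ?n \<notin> C"
  proof eventually_elim
    fix s :: real
    assume s: "x + s *\<^sub>R ?n \<in> - K" "x - s *\<^sub>R ?n \<in> {y. 0 < det2 (w - v) (y - v)}"
      "x - s *\<^sub>R ?n \<in> {y. 0 < det2 (u - w) (y - w)}" "0 < s"
    have "det2 (v - u) (x + (- s) *\<^sub>R ?n - u) = s * norm (v - u)" by (subst L1) simp
    then have "0 < det2 (v - u) (x - s *\<^sub>R ?n - u)" using s(4) vu by simp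
    then have "x - s *\<^sub>R ?n \<in> interior C" using s by (intro ccw_triangle_interior[OF pos]) (auto simp: C)
    moreover have "det2 (v - u) (x + s *\<^sub>R ?n - u) < 0" using s(4) vu by (subst L1) simp
    then have "x + s *\<^sub>R ?n \<notin> convex hull {u, v, w}" using mem_ccw_triangle_iff[OF pos] by fastforce
    ultimately show "x - s *\<^sub>R ?n \<in> interior C \<and> x + s *\<^sub>R ?n \<notin> C" using s(1) by (simp add: C)
  qed
  then show ?thesis unfolding eventually_at_right_field by (auto simp: greaterThanLessThan_def)
qed

lemma unit_normal_2D:
  fixes w n :: point
  assumes "w \<noteq> 0" "norm n = 1" "n \<bullet> w = 0"
  shows "n = (1 / norm w) *\<^sub>R turn w \<or> n = - ((1 / norm w) *\<^sub>R turn w)"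
proof -
  let ?k = "det2 n w / (w \<bullet> w)"
  have ww: "w \<bullet> w \<noteq> 0" using assms by simp
  have "det2 (turn w) n = 0" using assms(3) by (simp add: det2_def inner_point algebra_simps)
  then obtain k where k: "n = k *\<^sub>R turn w" using cr_eq_0_imp_scaleR[of "turn w" n] assms(1) by auto
  then have "\<bar>k\<bar> * norm w = 1" using assms(2) by simp
  then have "k = 1 / norm w \<or> k = - (1 / norm w)" using assms(1) by (auto simp: field_simps abs_if split: if_splits)
  then show ?thesis using k by auto
qed

text \<open>Two unit vectors are orthogonal to the segment, and the opposite one would put the same points
  both inside and outside \<open>P\<close>.\<close>

lemma outward_normal_segment:
  assumes P: "P = interior C" and vu: "u \<noteq> v"
    and loc: "\<And>x. x \<in> open_segment u v \<Longrightarrow> \<exists>e>0. \<forall>s\<in>{0<..<e}. x - s *\<^sub>R ((1 / norm (v - u)) *\<^sub>R turn (v - u)) \<in> interior C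
     \<and> x + s *\<^sub>R ((1 / norm (v - u)) *\<^sub>R turn (v - u)) \<notin> C"
  shows "outward_normal P (closed_segment u v) = (1 / norm (v - u)) *\<^sub>R turn (v - u)"
proof -
  let ?n = "(1 / norm (v - u)) *\<^sub>R turn (v - u)"
  let ?Q = "\<lambda>n. norm n = 1 \<and> (\<forall>x\<in>closed_segment u v. \<forall>y\<in>closed_segment u v. n \<bullet> (x - y) = 0) \<and>
     (\<forall>x\<in>rel_interior (closed_segment u v). \<exists>e>0. \<forall>s\<in>{0<..<e}. x - s *\<^sub>R n \<in> P \<and> x + s *\<^sub>R n \<notin> P)"
  have ri: "rel_interior (closed_segment u v) = open_segment u v" using vu by (simp add: rel_interior_closed_segment)
  have Q: "?Q ?n"
  proof (intro conjI ballI)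
    show "norm ?n = 1" using vu by simp
    fix x y assume "x \<in> closed_segment u v" "y \<in> closed_segment u v"
    then obtain s t where xy: "x = (1 - s) *\<^sub>R u + s *\<^sub>R v" "y = (1 - t) *\<^sub>R u + t *\<^sub>R v"
      unfolding closed_segment_def by auto
    have "x - y = (s - t) *\<^sub>R (v - u)" unfolding xy by (simp add: algebra_simps)
    then have "?n \<bullet> (x - y) = (s - t) * (?n \<bullet> (v - u))" by simp
    moreover have "turn (v - u) \<bullet> (v - u) = 0" by (simp add: inner_point algebra_simps)
    ultimately show "?n \<bullet> (x - y) = 0" by simp
  next
    fix x assume "x \<in> rel_interior (closed_segment u v)"
    then obtain e where e: "e > 0" "\<forall>s\<in>{0<..<e}. x - s *\<^sub>R ?n \<in> interior C \<and> x + s *\<^sub>R ?n \<notin> C"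
      using loc[of x] unfolding ri by blast
    then show "\<exists>e>0. \<forall>s\<in>{0<..<e}. x - s *\<^sub>R ?n \<in> P \<and> x + s *\<^sub>R ?n \<notin> P"
      using interior_subset[of C] unfolding P by blast
  qed
  have uniq: "n = ?n" if n: "?Q n" for n
  proof (rule ccontr)
    assume ne: "n \<noteq> ?n"
    have "n \<bullet> (v - u) = 0" using n by auto
    with n ne unit_normal_2D[of "v - u" n] vu have m: "n = - ?n" by auto
    have x: "midpoint u v \<in> rel_interior (closed_segment u v)" using vu ri by auto
    obtain e where e: "e > 0" "\<forall>s\<in>{0<..<e}. midpoint u v - s *\<^sub>R ?n \<in> P" using Q x by blast
    obtain e' where e': "e' > 0" "\<forall>s\<in>{0<..<e'}. midpoint u v + s *\<^sub>R n \<notin> P" using n x by blast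
    have "min e e' / 2 \<in> {0<..<e}" "min e e' / 2 \<in> {0<..<e'}" using e e' by auto
    then have "midpoint u v - (min e e' / 2) *\<^sub>R ?n \<in> P" "midpoint u v + (min e e' / 2) *\<^sub>R n \<notin> P"
      using e(2) e'(2) by blast+
    then show False unfolding m by simp
  qed
  show ?thesis unfolding outward_normal_def by (rule the_equality[of ?Q ?n, OF Q]) (rule uniq)
qed

lemma ccw_quadrangle_edge_sides:
  assumes q: "ccw_quadrangle a b c d P E" and uv: "(u, v) \<in> {(a, b), (b, c)}" and x: "x \<in> open_segment u v"
  shows "\<exists>e>0. \<forall>s\<in>{0<..<e}. x - s *\<^sub>R ((1 / norm (v - u)) *\<^sub>R turn (v - u)) \<in> P
     \<and> x + s *\<^sub>R ((1 / norm (v - u)) *\<^sub>R turn (v - u)) \<notin> closure P"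
proof -
  have P: "P = interior (convex hull {a, b, c} \<union> convex hull {c, d, a})"
    and pos: "0 < det2 (b - a) (c - a)" "0 < det2 (d - c) (a - c)"
    using q by (auto simp: ccw_quadrangle_def)
  have cl: "closed (convex hull {c, d, a})" using compact_hull3 compact_imp_closed by blast
  have notK: "x \<notin> convex hull {c, d, a}"
  proof
    assume "x \<in> convex hull {c, d, a}"
    then have "0 \<le> det2 (a - d) (x - d)" "0 \<le> det2 (c - a) (x - a)" using mem_ccw_triangle_iff[OF pos(2)] by auto
    moreover obtain t where t: "0 < t" "t < 1" "x = (1 - t) *\<^sub>R u + t *\<^sub>R v" using x by (auto simp: in_segment)
    have "det2 (c - a) (x - a) < 0"
    proof (cases "(u, v) = (a, b)")
      case True
      then have "det2 (c - a) (x - a) = - (t * det2 (b - a) (c - a))" unfolding t(3) by (simp add: det2_def algebra_simps)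
      then show ?thesis using t pos by simp
    next
      case False
      then have "(u, v) = (b, c)" using uv by auto
      then have "det2 (c - a) (x - a) = - ((1 - t) * det2 (b - a) (c - a))" unfolding t(3) by (simp add: det2_def algebra_simps)
      then show ?thesis using t pos by simp
    qed
    ultimately show False by linarith
  qed
  show ?thesis
  proof (cases "(u, v) = (a, b)")
    case True
    then have uv: "u = a" "v = b" by auto
    show ?thesis using edge_local_sides[OF pos(1) refl cl x[unfolded uv] notK]
      unfolding ccw_quadrangle_closure[OF q] unfolding P uv .
  next
    case False
    then have uv: "u = b" "v = c" using assms(2) by auto
    have pos': "0 < det2 (c - b) (a - b)" using pos(1) triangle_rotate by metis
    have *: "{b, c, a} = {a, b, c}" by auto
    show ?thesis using edge_local_sides[OF pos' refl cl x[unfolded uv] notK]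
      unfolding ccw_quadrangle_closure[OF q] unfolding P uv * .
  qed
qed

lemma ccw_quadrangle_edge_sides4:
  assumes q: "ccw_quadrangle a b c d P E" and uv: "(u, v) \<in> {(a, b), (b, c), (c, d), (d, a)}" and x: "x \<in> open_segment u v"
  shows "\<exists>e>0. \<forall>s\<in>{0<..<e}. x - s *\<^sub>R ((1 / norm (v - u)) *\<^sub>R turn (v - u)) \<in> P
     \<and> x + s *\<^sub>R ((1 / norm (v - u)) *\<^sub>R turn (v - u)) \<notin> closure P"
  using ccw_quadrangle_edge_sides[OF q _ x] ccw_quadrangle_edge_sides[OF ccw_quadrangle_rotate[OF q] _ x] uv by auto

lemma ccw_quadrangle_vertices:
  assumes q: "ccw_quadrangle a b c d P E"
  shows "a \<noteq> b" "b \<noteq> c" "c \<noteq> d" "d \<noteq> a" "a \<noteq> c" "b \<noteq> d"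
  using q by (auto simp: ccw_quadrangle_def det2_def)

lemma ccw_quadrangle_outward_normal:
  assumes q: "ccw_quadrangle a b c d P E" and uv: "(u, v) \<in> {(a, b), (b, c), (c, d), (d, a)}"
  shows "outward_normal P (closed_segment u v) = (1 / norm (v - u)) *\<^sub>R turn (v - u)"
proof (rule outward_normal_segment)
  have cl: "closure P = convex hull {a, b, c} \<union> convex hull {c, d, a}" by (rule ccw_quadrangle_closure[OF q])
  show P: "P = interior (closure P)" unfolding cl using q by (simp add: ccw_quadrangle_def)
  show "u \<noteq> v" using ccw_quadrangle_vertices[OF q] uv by auto
  show "\<exists>e>0. \<forall>s\<in>{0<..<e}. x - s *\<^sub>R ((1 / norm (v - u)) *\<^sub>R turn (v - u)) \<in> interior (closure P)
     \<and> x + s *\<^sub>R ((1 / norm (v - u)) *\<^sub>R turn (v - u)) \<notin> closure P" if "x \<in> open_segment u v" for x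
    using ccw_quadrangle_edge_sides4[OF q uv that] unfolding P[symmetric] .
qed

lemma diameter_segment: "diameter (closed_segment a b) = dist a (b::'a::euclidean_space)"
proof (rule antisym)
  show "diameter (closed_segment a b) \<le> dist a b"
  proof (rule diameter_le)
    fix x y assume x: "x \<in> closed_segment a b" and y: "y \<in> closed_segment a b"
    have "norm (x - y) \<le> max (norm (x - a)) (norm (x - b))"
      using segment_furthest_le[OF y, of x] by (auto simp: norm_minus_commute)
    moreover have "norm (x - a) \<le> dist a b" "norm (x - b) \<le> dist a b"
      using segment_bound[OF x] by (auto simp: dist_norm norm_minus_commute)
    ultimately show "norm (x - y) \<le> dist a b" by linarith
  qed simp
  show "dist a b \<le> diameter (closed_segment a b)"
    by (rule diameter_bounded_bound) (auto intro: compact_imp_bounded)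
qed

text \<open>The two endpoints are determined by the segment up to order, so the description is unambiguous.\<close>

definition edge_mid :: "point set \<Rightarrow> point" where
  "edge_mid \<zeta> = (THE m. \<exists>a b. \<zeta> = closed_segment a b \<and> m = midpoint a b)"

lemma edge_mid_segment [simp]: "edge_mid (closed_segment a b) = midpoint a b"
  unfolding edge_mid_def
  by (rule the_equality) (auto simp: doubleton_eq_iff midpoint_sym)

lemma ccw_quadrangle_edges_sum:
  assumes q: "ccw_quadrangle a b c d P E"
  shows "(\<Sum>\<zeta>\<in>E. f \<zeta>) = f (closed_segment a b) + f (closed_segment b c) + f (closed_segment c d) + f (closed_segment d a)"
proof -
  note n = ccw_quadrangle_vertices[OF q]
  have E: "E = {closed_segment a b, closed_segment b c, closed_segment c d, closed_segment d a}"
    using q by (simp add: ccw_quadrangle_def)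
  show ?thesis unfolding E using n by (auto simp: doubleton_eq_iff add.assoc)
qed

lemma ccw_quadrangle_scaled_normal:
  assumes q: "ccw_quadrangle a b c d P E" and uv: "(u, v) \<in> {(a, b), (b, c), (c, d), (d, a)}"
  shows "diameter (closed_segment u v) *\<^sub>R outward_normal P (closed_segment u v) = turn (v - u)"
proof -
  have "u \<noteq> v" using ccw_quadrangle_vertices[OF q] uv by auto
  then show ?thesis unfolding ccw_quadrangle_outward_normal[OF q uv] diameter_segment
    by (simp add: dist_norm norm_minus_commute)
qed


text \<open>Since \<open>|\<zeta>|\<close> times the normal is the rotated edge vector, the first sum telescopes. The second is the
  shoelace formula: the midpoint rule is exact for affine functions, so it is the divergence theorem for the function
  \<open>x \<mapsto> x \<bullet> w\<close>.\<close>

lemma ccw_quadrangle_normals_sum: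
  assumes q: "ccw_quadrangle a b c d P E"
  shows "(\<Sum>\<zeta>\<in>E. diameter \<zeta> * outward_normal P \<zeta> $ i) = 0"
    and "(\<Sum>\<zeta>\<in>E. diameter \<zeta> * outward_normal P \<zeta> $ i * (edge_mid \<zeta> \<bullet> w)) = area P * w $ i"
proof -
  have s: "diameter (closed_segment u v) * outward_normal P (closed_segment u v) $ i = turn (v - u) $ i"
    if "(u, v) \<in> {(a, b), (b, c), (c, d), (d, a)}" for u v
    using arg_cong[OF ccw_quadrangle_scaled_normal[OF q that], of "\<lambda>x. x $ i"] by simp
  have e: "diameter (closed_segment a b) * outward_normal P (closed_segment a b) $ i = turn (b - a) $ i"
    "diameter (closed_segment b c) * outward_normal P (closed_segment b c) $ i = turn (c - b) $ i"
    "diameter (closed_segment c d) * outward_normal P (closed_segment c d) $ i = turn (d - c) $ i"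
    "diameter (closed_segment d a) * outward_normal P (closed_segment d a) $ i = turn (a - d) $ i"
    by (rule s, simp)+
  have i: "i = 1 \<or> i = 2" by (rule exhaust_2)
  show "(\<Sum>\<zeta>\<in>E. diameter \<zeta> * outward_normal P \<zeta> $ i) = 0"
    unfolding ccw_quadrangle_edges_sum[OF q] e using i by auto
  show "(\<Sum>\<zeta>\<in>E. diameter \<zeta> * outward_normal P \<zeta> $ i * (edge_mid \<zeta> \<bullet> w)) = area P * w $ i"
    unfolding ccw_quadrangle_edges_sum[OF q] e ccw_quadrangle_area[OF q] edge_mid_segment
    using i by (auto simp: midpoint_def inner_point det2_def field_simps)
qed

lemma lebesgue_integral_reflect:
  fixes f :: "'a::euclidean_space \<Rightarrow> 'b::euclidean_space"
  assumes f: "f \<in> borel_measurable borel"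
  shows "(LINT x|lebesgue. f (s - x)) = (LINT x|lebesgue. f x)"
proof -
  have m: "(\<lambda>x. s - x) \<in> borel_measurable (borel :: 'a measure)" by simp
  have "lborel = distr lborel borel (\<lambda>x. s + (-1) *\<^sub>R x)"
    using lborel_affine[of "-1" s] by (simp add: density_1)
  then have d: "lborel = distr lborel borel (\<lambda>x. s - x)" by simp
  have "(LINT x|lebesgue. f x) = (LINT x|lborel. f x)" using f by (simp add: integral_completion)
  also have "\<dots> = (LINT x|distr lborel borel (\<lambda>x. s - x). f x)" using d by simp
  also have "\<dots> = (LINT x|lborel. f (s - x))" using f by (intro integral_distr) auto
  also have "\<dots> = (LINT x|lebesgue. f (s - x))"
    using measurable_compose[OF m f] by (simp add: integral_completion)
  finally show ?thesis by simp
qed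

lemma parallelogram_symmetric:
  assumes q: "ccw_quadrangle a b c d P E" and par: "b - a = c - d" and y: "y \<in> P"
  shows "a + c - y \<in> P"
proof -
  let ?C = "convex hull {a, b, c} \<union> convex hull {c, d, a}"
  have pos: "0 < det2 (b - a) (c - a)" "0 < det2 (d - c) (a - c)"
    and P: "P = interior ?C" using q by (auto simp: ccw_quadrangle_def)
  have b: "b = a + c - d" using par by (simp add: algebra_simps)
  have C: "a + c - z \<in> ?C" if z: "z \<in> ?C" for z
  proof -
    have "det2 (d - c) (a + c - z - c) = det2 (b - a) (z - a)" "det2 (a - d) (a + c - z - d) = det2 (c - b) (z - b)"
      "det2 (c - a) (a + c - z - a) = det2 (a - c) (z - c)"
      "det2 (b - a) (a + c - z - a) = det2 (d - c) (z - c)" "det2 (c - b) (a + c - z - b) = det2 (a - d) (z - d)"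
      "det2 (a - c) (a + c - z - c) = det2 (c - a) (z - a)"
      unfolding b by (simp_all add: det2_def algebra_simps)
    then show ?thesis using z mem_ccw_triangle_iff[OF pos(1)] mem_ccw_triangle_iff[OF pos(2)] by auto
  qed
  show ?thesis unfolding P
  proof (rule interiorI[of "(\<lambda>z. a + c - z) -` interior ?C"])
    show "open ((\<lambda>z. a + c - z) -` interior ?C)"
      by (intro open_vimage open_interior continuous_intros)
    show "a + c - y \<in> (\<lambda>z. a + c - z) -` interior ?C" using y P by simp
    show "(\<lambda>z. a + c - z) -` interior ?C \<subseteq> ?C"
    proof
      fix z assume "z \<in> (\<lambda>z. a + c - z) -` interior ?C"
      then have "a + c - z \<in> ?C" using interior_subset by blast
      from C[OF this] show "z \<in> ?C" by simp
    qed
  qed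
qed

lemma ccw_quadrangle_open: "ccw_quadrangle a b c d P E \<Longrightarrow> open P"
  by (simp add: ccw_quadrangle_def)

lemma ccw_quadrangle_bounded:
  assumes q: "ccw_quadrangle a b c d P E" shows "bounded P"
proof (rule bounded_subset[OF _ closure_subset])
  show "bounded (closure P)" unfolding ccw_quadrangle_closure[OF q]
    using compact_imp_bounded[OF compact_hull3] by simp
qed

lemma ccw_quadrangle_area_pos: "ccw_quadrangle a b c d P E \<Longrightarrow> 0 < area P"
  using ccw_quadrangle_area[of a b c d P E] by (auto simp: ccw_quadrangle_def)

lemma parallelogram_mass_center:
  assumes q: "ccw_quadrangle a b c d P E" and par: "b - a = c - d"
  shows "mass_center P = (1 / 2) *\<^sub>R (a + c)"
proof -
  let ?s = "a + c"
  have P: "open P" "bounded P" using ccw_quadrangle_open[OF q] ccw_quadrangle_bounded[OF q] .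
  then have L: "P \<in> lmeasurable" by (rule lmeasurable_open[rotated])
  have pm: "P \<in> sets borel" using P by auto
  have sym: "?s - x \<in> P \<longleftrightarrow> x \<in> P" for x
    using parallelogram_symmetric[OF q par, of x] parallelogram_symmetric[OF q par, of "?s - x"] by auto
  obtain B where B: "\<And>x. x \<in> P \<Longrightarrow> norm x \<le> B" using P(2) unfolding bounded_iff by blast
  have I0: "integrable lebesgue (\<lambda>x. indicator P x *\<^sub>R ?s)"
    using L by (intro integrable_scaleR_left integrable_real_indicator) (auto simp: fmeasurable_def)
  have I1: "integrable lebesgue (\<lambda>x. indicator P x *\<^sub>R x)"
  proof (rule Bochner_Integration.integrable_bound[of lebesgue "\<lambda>x. indicator P x * \<bar>B\<bar>"])
    show "integrable lebesgue (\<lambda>x. indicator P x * \<bar>B\<bar>)"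
      using L by (intro integrable_mult_left integrable_real_indicator) (auto simp: fmeasurable_def)
    have "(\<lambda>x. indicator P x *\<^sub>R x) \<in> borel_measurable borel" using pm by measurable
    then show "(\<lambda>x. indicator P x *\<^sub>R x) \<in> borel_measurable lebesgue"
      by (simp add: measurable_completion)
    show "AE x in lebesgue. norm (indicator P x *\<^sub>R x) \<le> norm (indicator P x * \<bar>B\<bar>)"
      using B by (intro AE_I2) (auto simp: indicator_def intro: order_trans[OF B abs_ge_self])
  qed
  let ?I = "LINT x|lebesgue. indicator P x *\<^sub>R x"
  have "(\<lambda>x. indicator P x *\<^sub>R x) \<in> borel_measurable borel" using pm by measurable
  from lebesgue_integral_reflect[OF this, of ?s]
  have "?I = (LINT x|lebesgue. indicator P (?s - x) *\<^sub>R (?s - x))" by simp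
  also have "\<dots> = (LINT x|lebesgue. indicator P x *\<^sub>R ?s - indicator P x *\<^sub>R x)"
  proof -
    have "indicator P (?s - x) *\<^sub>R (?s - x) = indicator P x *\<^sub>R ?s - indicator P x *\<^sub>R x" for x
      using sym[of x] by (simp add: indicator_def scaleR_diff_right)
    then show ?thesis by presburger
  qed
  also have "\<dots> = area P *\<^sub>R ?s - ?I"
    using I0 I1 L by (subst Bochner_Integration.integral_diff) (auto simp: fmeasurable_def)
  finally have "2 *\<^sub>R ?I = area P *\<^sub>R ?s" by (simp add: scaleR_2 algebra_simps)
  then have "(1 / 2) *\<^sub>R (2 *\<^sub>R ?I) = (1 / 2) *\<^sub>R (area P *\<^sub>R ?s)" by (rule arg_cong)
  then have "?I = (area P / 2) *\<^sub>R ?s" by simp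
  then show ?thesis using ccw_quadrangle_area_pos[OF q]
    unfolding mass_center_def set_lebesgue_integral_def by simp
qed

text \<open>The point reflection in the centre exchanges the two sides of the line through the centre.\<close>

lemma parallelogram_half_area:
  assumes q: "ccw_quadrangle a b c d P E" and par: "b - a = c - d" and n: "n \<noteq> 0"
  shows "area {x \<in> P. 0 < (x - mass_center P) \<bullet> n} = area P / 2"
proof -
  let ?s = "a + c" and ?m = "mass_center P"
  have m2: "?s - x - ?m = - (x - ?m)" for x
    unfolding parallelogram_mass_center[OF q par] by (simp add: point_eq_iff algebra_simps)
  have P: "open P" "bounded P" using ccw_quadrangle_open[OF q] ccw_quadrangle_bounded[OF q] .
  have sym: "?s - x \<in> P \<longleftrightarrow> x \<in> P" for x
    using parallelogram_symmetric[OF q par, of x] parallelogram_symmetric[OF q par, of "?s - x"] by auto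
  let ?D = "{x \<in> P. 0 < (x - ?m) \<bullet> n}" and ?D' = "{x \<in> P. (x - ?m) \<bullet> n < 0}" and ?Z = "{x \<in> P. (x - ?m) \<bullet> n = 0}"
  have o: "open ?D" "open ?D'"
    using P(1) by (auto simp: Collect_conj_eq intro!: open_Int open_Collect_less continuous_intros)
  have b: "bounded ?D" "bounded ?D'" by (auto intro: bounded_subset[OF P(2)])
  have L: "?D \<in> lmeasurable" "?D' \<in> lmeasurable" using o b lmeasurable_open by blast+
  have "negligible {x. n \<bullet> x = n \<bullet> ?m}" using n negligible_hyperplane by blast
  moreover have "?Z \<subseteq> {x. n \<bullet> x = n \<bullet> ?m}" by (auto simp: inner_diff_left inner_commute[of n])
  ultimately have Z: "negligible ?Z" by (rule negligible_subset)
  have "area P = area ?D + area ?D' + area ?Z"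
  proof (rule measure_Un3_negligible)
    show "?Z \<in> lmeasurable" using Z by (rule negligible_imp_measurable)
    have "?D \<inter> ?D' = {}" by auto
    then show "negligible (?D \<inter> ?D')" by simp
    show "negligible (?D \<inter> ?Z)" "negligible (?D' \<inter> ?Z)" by (auto intro: negligible_subset[OF Z])
    show "?D \<union> ?D' \<union> ?Z = P" by auto
  qed (use L in auto)
  moreover have "area ?Z = 0" using Z by (rule negligible_imp_measure0)
  moreover have "area ?D' = area ?D"
  proof -
    have "(indicator ?D :: point \<Rightarrow> real) \<in> borel_measurable borel" using o by (intro borel_measurable_indicator) auto
    from lebesgue_integral_reflect[OF this, of ?s]
    have "(LINT x|lebesgue. indicator ?D (?s - x)) = (area ?D :: real)" using L by (simp add: fmeasurable_def)
    moreover have "indicator ?D (?s - x) = (indicator ?D' x :: real)" for x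
    proof -
      have "?s - x \<in> ?D \<longleftrightarrow> x \<in> ?D'"
        unfolding mem_Collect_eq sym m2 inner_minus_left by simp
      then show ?thesis unfolding indicator_def by presburger
    qed
    ultimately show ?thesis using L by (simp add: fmeasurable_def)
  qed
  ultimately show ?thesis by simp
qed

lemma is_rectangle_ccw:
  assumes "is_rectangle P E" obtains a b c d where "ccw_quadrangle a b c d P E" "b - a = c - d"
proof -
  obtain a b c d where q: "quadrangle a b c d P E" and par: "b - a = c - d"
    using assms unfolding is_rectangle_def by blast
  have par': "b - c = a - d" using par by (simp add: algebra_simps)
  from quadrangle_ccw_cases[OF q] show thesis
    using that par that[OF _ par'] by blast
qed

text \<open>Two sides orthogonal to the same axis cannot meet in a corner, so they are opposite sides.\<close>

lemma rectangle_opposite_normals: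
  assumes r: "is_rectangle P E" and e: "\<zeta> \<in> E" "\<eta> \<in> E" "\<zeta> \<noteq> \<eta>"
    and i: "\<And>x y. x \<in> \<zeta> \<Longrightarrow> y \<in> \<zeta> \<Longrightarrow> x $ i = y $ i" "\<And>x y. x \<in> \<eta> \<Longrightarrow> y \<in> \<eta> \<Longrightarrow> x $ i = y $ i"
  shows "outward_normal P \<eta> = - outward_normal P \<zeta>"
proof -
  obtain a b c d where q: "ccw_quadrangle a b c d P E" and par: "b - a = c - d" using is_rectangle_ccw[OF r] .
  have E: "E = {closed_segment a b, closed_segment b c, closed_segment c d, closed_segment d a}"
    and pos: "0 < det2 (b - a) (c - a)" "0 < det2 (d - c) (a - c)"
    using q by (auto simp: ccw_quadrangle_def)
  have ends: "u $ i = v $ i" if "closed_segment u v \<in> {\<zeta>, \<eta>}" for u v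
    using i(1)[of u v] i(2)[of u v] that by auto
  have nocorner: False if "p $ i = r $ i" "r $ i = t $ i" "0 < det2 (r - p) (t - p)" for p r t :: point
  proof -
    have "i = 1 \<or> i = 2" by (rule exhaust_2)
    then show False using that by (auto simp: det2_def)
  qed
  have cr2: "0 < det2 (c - b) (d - b)" "0 < det2 (a - d) (b - d)"
  proof -
    have b: "b = a + c - d" using par by (simp add: algebra_simps)
    show "0 < det2 (c - b) (d - b)" "0 < det2 (a - d) (b - d)"
      using pos unfolding b by (simp_all add: det2_def algebra_simps)
  qed
  have n: "outward_normal P (closed_segment a b) = (1 / norm (b - a)) *\<^sub>R turn (b - a)"
    "outward_normal P (closed_segment b c) = (1 / norm (c - b)) *\<^sub>R turn (c - b)"
    "outward_normal P (closed_segment c d) = (1 / norm (d - c)) *\<^sub>R turn (d - c)"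
    "outward_normal P (closed_segment d a) = (1 / norm (a - d)) *\<^sub>R turn (a - d)"
    by (rule ccw_quadrangle_outward_normal[OF q], simp)+
  have e1: "d - c = - (b - a)" "a - d = - (c - b)" using par by (auto simp: algebra_simps)
  have t: "turn (- u) = - turn u" for u by (simp add: point_eq_iff)
  have op: "outward_normal P (closed_segment c d) = - outward_normal P (closed_segment a b)"
    "outward_normal P (closed_segment d a) = - outward_normal P (closed_segment b c)"
    unfolding n e1 t norm_minus_cancel by simp_all
  have cases4: "{x, y} = {p, r} \<or> {x, y} = {s, t} \<or> p \<in> {x, y} \<and> s \<in> {x, y} \<or> s \<in> {x, y} \<and> r \<in> {x, y}
     \<or> r \<in> {x, y} \<and> t \<in> {x, y} \<or> t \<in> {x, y} \<and> p \<in> {x, y}"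
    if "x \<in> {p, s, r, t}" "y \<in> {p, s, r, t}" "x \<noteq> y" for x y p r s t :: "point set"
  proof -
    have x: "x = p \<or> x = s \<or> x = r \<or> x = t" and y: "y = p \<or> y = s \<or> y = r \<or> y = t" using that by simp_all
    show ?thesis using x y that(3) by (elim disjE) (simp_all add: insert_commute)
  qed
  note nc = nocorner[OF ends ends pos(1)] nocorner[OF ends ends pos(2)]
    nocorner[OF ends ends cr2(1)] nocorner[OF ends ends cr2(2)]
  from cases4[OF e(1)[unfolded E] e(2)[unfolded E] e(3)] show ?thesis
  proof (elim disjE conjE)
    assume "{\<zeta>, \<eta>} = {closed_segment a b, closed_segment c d}"
    then have "\<zeta> = closed_segment a b \<and> \<eta> = closed_segment c d \<or> \<zeta> = closed_segment c d \<and> \<eta> = closed_segment a b"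
      by (simp only: doubleton_eq_iff)
    then show ?thesis using op by (elim disjE) (simp_all only: minus_minus)
  next
    assume "{\<zeta>, \<eta>} = {closed_segment b c, closed_segment d a}"
    then have "\<zeta> = closed_segment b c \<and> \<eta> = closed_segment d a \<or> \<zeta> = closed_segment d a \<and> \<eta> = closed_segment b c"
      by (simp only: doubleton_eq_iff)
    then show ?thesis using op by (elim disjE) (simp_all only: minus_minus)
  qed (erule (1) nc[THEN FalseE])+
qed

section \<open>Meshes: shared edges, conservativity, covering\<close>

lemma negligible_closed_segment: "negligible (closed_segment a (b::point))"
proof (cases "a = b")
  case False
  then have "turn (b - a) \<noteq> 0" by simp
  then have "negligible {z. turn (b - a) \<bullet> z = turn (b - a) \<bullet> a}" using negligible_hyperplane by blast
  moreover have "closed_segment a b \<subseteq> {z. turn (b - a) \<bullet> z = turn (b - a) \<bullet> a}"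
  proof
    fix x assume "x \<in> closed_segment a b"
    then obtain t where x: "x = (1 - t) *\<^sub>R a + t *\<^sub>R b" by (auto simp: closed_segment_def)
    show "x \<in> {z. turn (b - a) \<bullet> z = turn (b - a) \<bullet> a}" unfolding x by (simp add: inner_point algebra_simps)
  qed
  ultimately show ?thesis by (rule negligible_subset)
qed simp

lemma polyhedral_negligible_frontier: "polyhedral \<Omega> \<Longrightarrow> negligible (frontier \<Omega>)"
  unfolding polyhedral_def by (auto intro!: negligible_Union negligible_closed_segment)

lemma quadrangle_facts:
  assumes q: "is_quadrangle P E"
  shows "open P" "bounded P" "0 < area P" "finite E" "card E = 4" "negligible (closure P - P)" "closure P - P \<subseteq> \<Union>E"
    "(\<Sum>\<zeta>\<in>E. diameter \<zeta> * outward_normal P \<zeta> $ i) = 0"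
    "(\<Sum>\<zeta>\<in>E. diameter \<zeta> * outward_normal P \<zeta> $ i * (edge_mid \<zeta> \<bullet> w)) = area P * w $ i"
proof -
  obtain a b c d where c: "ccw_quadrangle a b c d P E" using is_quadrangle_ccw[OF q] .
  show "open P" "bounded P" "0 < area P"
    using ccw_quadrangle_open[OF c] ccw_quadrangle_bounded[OF c] ccw_quadrangle_area_pos[OF c] .
  have E: "E = {closed_segment a b, closed_segment b c, closed_segment c d, closed_segment d a}"
    using c by (simp add: ccw_quadrangle_def)
  show "finite E" unfolding E by simp
  show "card E = 4" using ccw_quadrangle_edges_sum[OF c, of "\<lambda>_. 1::nat"] by simp
  show f: "closure P - P \<subseteq> \<Union>E" using ccw_quadrangle_frontier[OF c] by blast
  have "negligible (\<Union>E)" unfolding E by (simp add: negligible_closed_segment)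
  then show "negligible (closure P - P)" using f by (rule negligible_subset)
  show "(\<Sum>\<zeta>\<in>E. diameter \<zeta> * outward_normal P \<zeta> $ i) = 0"
    "(\<Sum>\<zeta>\<in>E. diameter \<zeta> * outward_normal P \<zeta> $ i * (edge_mid \<zeta> \<bullet> w)) = area P * w $ i"
    by (rule ccw_quadrangle_normals_sum[OF c])+
qed

lemma quadrangle_edge:
  assumes q: "is_quadrangle P E" and z: "\<zeta> \<in> E"
  obtains u v where "\<zeta> = closed_segment u v" "u \<noteq> v" 
    "outward_normal P \<zeta> = (1 / norm (v - u)) *\<^sub>R turn (v - u)"
    "\<And>x. x \<in> open_segment u v \<Longrightarrow> \<exists>e>0. \<forall>s\<in>{0<..<e}.
        x - s *\<^sub>R outward_normal P \<zeta> \<in> P \<and> x + s *\<^sub>R outward_normal P \<zeta> \<notin> closure P"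
    "\<zeta> \<subseteq> closure P"
proof -
  obtain a b c d where c: "ccw_quadrangle a b c d P E" using is_quadrangle_ccw[OF q] .
  have E: "E = {closed_segment a b, closed_segment b c, closed_segment c d, closed_segment d a}"
    using c by (simp add: ccw_quadrangle_def)
  obtain u v where uv: "(u, v) \<in> {(a, b), (b, c), (c, d), (d, a)}" and zeta: "\<zeta> = closed_segment u v"
    using z unfolding E by blast
  have ne: "u \<noteq> v" using ccw_quadrangle_vertices[OF c] uv by auto
  note n = ccw_quadrangle_outward_normal[OF c uv]
  have sub: "\<zeta> \<subseteq> closure P"
  proof -
    have "closed_segment u v \<subseteq> convex hull {a, b, c} \<or> closed_segment u v \<subseteq> convex hull {c, d, a}"
      using uv unfolding segment_convex_hull by (auto intro!: hull_mono)
    then show ?thesis unfolding ccw_quadrangle_closure[OF c] zeta by blast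
  qed
  show thesis
  proof (rule that[OF zeta ne _ _ sub])
    show "outward_normal P \<zeta> = (1 / norm (v - u)) *\<^sub>R turn (v - u)" unfolding zeta by (rule n)
    show "\<exists>e>0. \<forall>s\<in>{0<..<e}. x - s *\<^sub>R outward_normal P \<zeta> \<in> P \<and> x + s *\<^sub>R outward_normal P \<zeta> \<notin> closure P"
      if "x \<in> open_segment u v" for x
      using ccw_quadrangle_edge_sides4[OF c uv that] unfolding zeta n .
  qed
qed

lemma quadrangle_edge_facts:
  assumes q: "is_quadrangle P E" and z: "\<zeta> \<in> E"
  shows "norm (outward_normal P \<zeta>) = 1" "\<zeta> \<subseteq> closure P" "edge_mid \<zeta> \<in> closure P" 
    "diameter \<zeta> \<le> diameter P" "0 \<le> diameter \<zeta>" "infinite \<zeta>"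
    "\<And>x y. x \<in> \<zeta> \<Longrightarrow> y \<in> \<zeta> \<Longrightarrow> outward_normal P \<zeta> \<bullet> (x - y) = 0"
proof -
  obtain u v where uv: "\<zeta> = closed_segment u v" "u \<noteq> v" 
    "outward_normal P \<zeta> = (1 / norm (v - u)) *\<^sub>R turn (v - u)" and sub: "\<zeta> \<subseteq> closure P"
    using quadrangle_edge[OF q z] by metis
  show "norm (outward_normal P \<zeta>) = 1" using uv by simp
  show "\<zeta> \<subseteq> closure P" by (rule sub)
  then show "edge_mid \<zeta> \<in> closure P" unfolding uv(1) by (auto simp: subset_iff midpoint_in_closed_segment)
  have b: "bounded P" using quadrangle_facts(2)[OF q] .
  show "diameter \<zeta> \<le> diameter P" using diameter_subset[OF sub] bounded_closure[OF b] diameter_closure[OF b] by simp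
  show "0 \<le> diameter \<zeta>" unfolding uv(1) diameter_segment by simp
  show "infinite \<zeta>" unfolding uv(1) using uv(2) by (simp add: finite_closed_segment)
  fix x y assume "x \<in> \<zeta>" "y \<in> \<zeta>"
  then obtain s t where xy: "x = (1 - s) *\<^sub>R u + s *\<^sub>R v" "y = (1 - t) *\<^sub>R u + t *\<^sub>R v"
    unfolding uv(1) closed_segment_def by auto
  have e: "x - y = (s - t) *\<^sub>R (v - u)" unfolding xy by (simp add: algebra_simps)
  have "turn (v - u) \<bullet> (v - u) = 0" by (simp add: inner_point algebra_simps)
  then show "outward_normal P \<zeta> \<bullet> (x - y) = 0" unfolding e uv(3) by simp
qed

text \<open>Both normals are unit and orthogonal to the edge. If they were equal, the cells would overlap next to
  the midpoint of the edge.\<close>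

lemma common_edge_normals:
  assumes P: "is_quadrangle P E" "\<zeta> \<in> E" and Q: "is_quadrangle Q F" "\<zeta> \<in> F" and dis: "disjnt P Q"
  shows "outward_normal Q \<zeta> = - outward_normal P \<zeta>"
proof (rule ccontr)
  assume ne: "outward_normal Q \<zeta> \<noteq> - outward_normal P \<zeta>"
  obtain u v where uv: "\<zeta> = closed_segment u v" "u \<noteq> v" 
    "outward_normal P \<zeta> = (1 / norm (v - u)) *\<^sub>R turn (v - u)"
    and s: "\<And>x. x \<in> open_segment u v \<Longrightarrow> \<exists>e>0. \<forall>s\<in>{0<..<e}.
        x - s *\<^sub>R outward_normal P \<zeta> \<in> P \<and> x + s *\<^sub>R outward_normal P \<zeta> \<notin> closure P"
    using quadrangle_edge[OF P] by metis
  obtain u' v' where uv': "\<zeta> = closed_segment u' v'" 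
    and s': "\<And>x. x \<in> open_segment u' v' \<Longrightarrow> \<exists>e>0. \<forall>s\<in>{0<..<e}.
        x - s *\<^sub>R outward_normal Q \<zeta> \<in> Q \<and> x + s *\<^sub>R outward_normal Q \<zeta> \<notin> closure Q"
    using quadrangle_edge[OF Q] by metis
  have "outward_normal Q \<zeta> \<bullet> (v - u) = 0" using quadrangle_edge_facts(7)[OF Q, of v u] uv by simp
  then have same: "outward_normal Q \<zeta> = outward_normal P \<zeta>"
    using unit_normal_2D[of "v - u" "outward_normal Q \<zeta>"] quadrangle_edge_facts(1)[OF Q] ne uv by auto
  have "{u, v} = {u', v'}" using uv(1) uv' by simp
  then have os: "open_segment u' v' = open_segment u v"
    unfolding doubleton_eq_iff by (elim disjE conjE) (simp_all only: open_segment_commute)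
  have m1: "midpoint u v \<in> open_segment u v" using uv(2) by simp
  note m = m1 m1[folded os]
  from s[OF m(1)] obtain e where e: "e > 0"
    "\<forall>s\<in>{0<..<e}. midpoint u v - s *\<^sub>R outward_normal P \<zeta> \<in> P \<and>
       midpoint u v + s *\<^sub>R outward_normal P \<zeta> \<notin> closure P" by (elim exE conjE)
  from s'[OF m(2)] obtain e' where e': "e' > 0"
    "\<forall>s\<in>{0<..<e'}. midpoint u v - s *\<^sub>R outward_normal Q \<zeta> \<in> Q \<and>
       midpoint u v + s *\<^sub>R outward_normal Q \<zeta> \<notin> closure Q" by (elim exE conjE)
  have k: "min e e' / 2 \<in> {0<..<e}" "min e e' / 2 \<in> {0<..<e'}" using e(1) e'(1) by auto
  have "midpoint u v - (min e e' / 2) *\<^sub>R outward_normal P \<zeta> \<in> P" using bspec[OF e(2) k(1)] by (rule conjunct1)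
  moreover have "midpoint u v - (min e e' / 2) *\<^sub>R outward_normal P \<zeta> \<in> Q"
    using bspec[OF e'(2) k(2)] unfolding same by (rule conjunct1)
  ultimately show False using dis unfolding disjnt_iff by blast
qed

lemma primal_meshD:
  assumes "primal_mesh \<Omega> d"
  shows "finite (cells d)" "\<And>P Q. P \<in> cells d \<Longrightarrow> Q \<in> cells d \<Longrightarrow> P \<noteq> Q \<Longrightarrow> disjnt P Q"
    "(\<Union>P\<in>cells d. closure P) = closure \<Omega>" "\<And>P. P \<in> cells d \<Longrightarrow> is_quadrangle P (edges d P)"
    "\<And>P Q \<zeta> \<eta>. P \<in> cells d \<Longrightarrow> Q \<in> cells d \<Longrightarrow> P \<noteq> Q \<Longrightarrow> \<zeta> \<in> edges d P \<Longrightarrow> \<eta> \<in> edges d Q \<Longrightarrow>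
       infinite (\<zeta> \<inter> \<eta>) \<Longrightarrow> \<zeta> = \<eta>"
proof -
  note H = assms[unfolded primal_mesh_def pairwise_def]
  note 1 = H[THEN conjunct1] and 2 = H[THEN conjunct2, THEN conjunct1]
    and 3 = H[THEN conjunct2, THEN conjunct2, THEN conjunct1]
    and 4 = H[THEN conjunct2, THEN conjunct2, THEN conjunct2, THEN conjunct1]
    and 5 = H[THEN conjunct2, THEN conjunct2, THEN conjunct2, THEN conjunct2]
  show "finite (cells d)" by (rule 1)
  show "disjnt P Q" if "P \<in> cells d" "Q \<in> cells d" "P \<noteq> Q" for P Q using 2 that by meson
  show "(\<Union>P\<in>cells d. closure P) = closure \<Omega>" by (rule 3)
  show "is_quadrangle P (edges d P)" if "P \<in> cells d" for P using 4 that by meson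
  show "\<zeta> = \<eta>" if "P \<in> cells d" "Q \<in> cells d" "P \<noteq> Q" "\<zeta> \<in> edges d P" "\<eta> \<in> edges d Q" "infinite (\<zeta> \<inter> \<eta>)"
    for P Q \<zeta> \<eta> using 5 that by meson
qed

text \<open>Points just outside \<open>P\<close> near the edge are still in \<open>\<Omega>\<close>, hence in the closure of another cell. There are
  finitely many cells and edges, so one edge of one of them contains infinitely many points of \<open>\<zeta>\<close>, and conformity applies.\<close>

lemma interior_edge_has_neighbour:
  assumes m: "primal_mesh \<Omega> d" and o: "open \<Omega>" and P: "P \<in> cells d" "closure P \<subseteq> \<Omega>" and z: "\<zeta> \<in> edges d P"
  shows "\<exists>Q\<in>cells d. Q \<noteq> P \<and> \<zeta> \<in> edges d Q"
proof -
  note M = primal_meshD[OF m]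
  obtain u v where uv: "\<zeta> = closed_segment u v" "u \<noteq> v" 
    and s: "\<And>x. x \<in> open_segment u v \<Longrightarrow> \<exists>e>0. \<forall>s\<in>{0<..<e}.
        x - s *\<^sub>R outward_normal P \<zeta> \<in> P \<and> x + s *\<^sub>R outward_normal P \<zeta> \<notin> closure P"
    and sub: "\<zeta> \<subseteq> closure P"
    using quadrangle_edge[OF M(4)[OF P(1)] z] by metis
  let ?n = "outward_normal P \<zeta>"
  define X where "X = (\<Union>Q\<in>cells d - {P}. closure Q)"
  have clX: "closed X" unfolding X_def using M(1) by (intro closed_UN) auto
  have inX: "x \<in> X" if x: "x \<in> open_segment u v" for x
  proof -
    have lim: "((\<lambda>s. x + s *\<^sub>R ?n) \<longlongrightarrow> x) (at_right (0::real))"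
    proof -
      have "((\<lambda>s. x + s *\<^sub>R ?n) \<longlongrightarrow> x + 0 *\<^sub>R ?n) (at_right 0)"
        by (rule tendsto_add tendsto_const tendsto_scaleR tendsto_ident_at)+
      then show ?thesis by simp
    qed
    have "x \<in> \<Omega>" using x sub P(2) uv(1) segment_open_subset_closed by blast
    then have "\<forall>\<^sub>F s in at_right 0. x + s *\<^sub>R ?n \<in> \<Omega>" by (rule topological_tendstoD[OF lim o])
    moreover from s[OF x] obtain e where e: "e > 0"
      "\<forall>s\<in>{0<..<e}. x - s *\<^sub>R ?n \<in> P \<and> x + s *\<^sub>R ?n \<notin> closure P" by (elim exE conjE)
    have "\<forall>\<^sub>F s in at_right 0. x + s *\<^sub>R ?n \<notin> closure P"
      unfolding eventually_at_right_field using e by (intro exI[of _ e]) simp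
    ultimately have ev: "\<forall>\<^sub>F s in at_right 0. x + s *\<^sub>R ?n \<in> X"
    proof eventually_elim
      fix s :: real assume "x + s *\<^sub>R ?n \<in> \<Omega>" "x + s *\<^sub>R ?n \<notin> closure P"
      moreover have "\<Omega> \<subseteq> (\<Union>P\<in>cells d. closure P)" unfolding M(3) by (rule closure_subset)
      ultimately show "x + s *\<^sub>R ?n \<in> X" unfolding X_def by blast
    qed
    show ?thesis by (rule Lim_in_closed_set[OF clX ev _ lim]) simp
  qed
  have "infinite (open_segment u v)" using uv(2) by simp
  moreover have "open_segment u v \<subseteq> (\<Union>Q\<in>cells d - {P}. \<Union>\<eta>\<in>edges d Q. \<zeta> \<inter> \<eta>)"
  proof
    fix x assume x: "x \<in> open_segment u v"
    then obtain Q where Q: "Q \<in> cells d" "Q \<noteq> P" "x \<in> closure Q" using inX unfolding X_def by blast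
    have xz: "x \<in> \<zeta>" "x \<in> closure P" using x sub uv(1) segment_open_subset_closed by blast+
    have "x \<notin> Q"
    proof
      assume "x \<in> Q"
      moreover have "open Q" using quadrangle_facts(1)[OF M(4)[OF Q(1)]] .
      ultimately have "Q \<inter> P \<noteq> {}" using xz(2) open_Int_closure_eq_empty by blast
      then show False using M(2)[OF Q(1) P(1) Q(2)] by (simp add: disjnt_def)
    qed
    then have "x \<in> \<Union>(edges d Q)" using Q(3) quadrangle_facts(7)[OF M(4)[OF Q(1)]] by blast
    then show "x \<in> (\<Union>Q\<in>cells d - {P}. \<Union>\<eta>\<in>edges d Q. \<zeta> \<inter> \<eta>)" using Q xz by blast
  qed
  ultimately have "infinite (\<Union>Q\<in>cells d - {P}. \<Union>\<eta>\<in>edges d Q. \<zeta> \<inter> \<eta>)" using finite_subset by blast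
  then have "\<exists>Q\<in>cells d - {P}. \<exists>\<eta>\<in>edges d Q. infinite (\<zeta> \<inter> \<eta>)"
    using M(1) quadrangle_facts(4)[OF M(4)] by (meson DiffD1 finite_Diff finite_UN_I)
  then obtain Q \<eta> where "Q \<in> cells d" "Q \<noteq> P" "\<eta> \<in> edges d Q" "infinite (\<zeta> \<inter> \<eta>)" by blast
  with M(5)[of P Q \<zeta> \<eta>] P(1) z show ?thesis by blast
qed

text \<open>Every edge with a nonzero coefficient belongs to exactly two cells, and they see it with opposite normals.\<close>

lemma flux_conservation:
  fixes F :: "point set \<Rightarrow> point" and c :: "point set \<Rightarrow> real"
  assumes m: "primal_mesh \<Omega> d"
    and bd: "\<And>P \<zeta>. P \<in> cells d \<Longrightarrow> \<zeta> \<in> edges d P \<Longrightarrow> (\<And>Q. Q \<in> cells d \<Longrightarrow> \<zeta> \<in> edges d Q \<Longrightarrow> Q = P) \<Longrightarrow> c \<zeta> = 0"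
  shows "(\<Sum>P\<in>cells d. \<Sum>\<zeta>\<in>edges d P. c \<zeta> * (F \<zeta> \<bullet> outward_normal P \<zeta>)) = 0"
proof -
  note M = primal_meshD[OF m]
  have fe: "finite (edges d P)" if "P \<in> cells d" for P using quadrangle_facts(4)[OF M(4)[OF that]] .
  have fa: "finite (all_edges d)" unfolding all_edges_def using M(1) fe by auto
  have "(\<Sum>P\<in>cells d. \<Sum>\<zeta>\<in>edges d P. c \<zeta> * (F \<zeta> \<bullet> outward_normal P \<zeta>))
     = (\<Sum>P\<in>cells d. \<Sum>\<zeta>\<in>{\<zeta> \<in> all_edges d. \<zeta> \<in> edges d P}. c \<zeta> * (F \<zeta> \<bullet> outward_normal P \<zeta>))"
    by (intro sum.cong refl) (auto simp: all_edges_def)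
  also have "\<dots> = (\<Sum>\<zeta>\<in>all_edges d. \<Sum>P\<in>{P \<in> cells d. \<zeta> \<in> edges d P}. c \<zeta> * (F \<zeta> \<bullet> outward_normal P \<zeta>))"
    by (rule sum.swap_restrict[OF M(1) fa])
  also have "\<dots> = 0"
  proof (rule sum.neutral, rule ballI)
    fix \<zeta> assume "\<zeta> \<in> all_edges d"
    then obtain P where P: "P \<in> cells d" "\<zeta> \<in> edges d P" by (auto simp: all_edges_def)
    show "(\<Sum>P\<in>{P \<in> cells d. \<zeta> \<in> edges d P}. c \<zeta> * (F \<zeta> \<bullet> outward_normal P \<zeta>)) = 0"
    proof (cases "\<exists>Q\<in>cells d. \<zeta> \<in> edges d Q \<and> Q \<noteq> P")
      case False
      then have "c \<zeta> = 0" using bd[OF P] by blast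
      then show ?thesis by simp
    next
      case True
      then obtain Q where Q: "Q \<in> cells d" "\<zeta> \<in> edges d Q" "Q \<noteq> P" by blast
      have op: "outward_normal B \<zeta> = - outward_normal A \<zeta>"
        if "A \<in> cells d" "\<zeta> \<in> edges d A" "B \<in> cells d" "\<zeta> \<in> edges d B" "B \<noteq> A" for A B
        using common_edge_normals[OF M(4) that(2) M(4) that(4)] M(2) that by blast
      have "{P \<in> cells d. \<zeta> \<in> edges d P} = {P, Q}"
      proof (rule ccontr)
        assume "{P \<in> cells d. \<zeta> \<in> edges d P} \<noteq> {P, Q}"
        then obtain R where R: "R \<in> cells d" "\<zeta> \<in> edges d R" "R \<noteq> P" "R \<noteq> Q" using P Q by blast
        have "outward_normal R \<zeta> = - outward_normal P \<zeta>" "outward_normal R \<zeta> = - outward_normal Q \<zeta>"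
          "outward_normal Q \<zeta> = - outward_normal P \<zeta>"
          using op[OF P R(1,2,3)] op[OF Q(1,2) R(1,2,4)] op[OF P Q] .
        then have "outward_normal P \<zeta> = - outward_normal P \<zeta>" by simp
        then have "outward_normal P \<zeta> = 0" by (simp add: point_eq_iff)
        then show False using quadrangle_edge_facts(1)[OF M(4)[OF P(1)] P(2)] by simp
      qed
      then show ?thesis using op[OF P Q] Q(3) by (simp add: inner_minus_right)
    qed
  qed
  finally show ?thesis .
qed

lemma cells_cover:
  assumes m: "primal_mesh \<Omega> d" and o: "polyhedral \<Omega>"
  shows "negligible (closure \<Omega> - \<Union>(cells d))" "negligible (closure \<Omega> - \<Omega>)" "\<Union>(cells d) \<subseteq> closure \<Omega>"
proof -
  note M = primal_meshD[OF m]
  have "closure \<Omega> - \<Union>(cells d) \<subseteq> (\<Union>P\<in>cells d. closure P - P)" unfolding M(3)[symmetric] by blast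
  moreover have "negligible (\<Union>P\<in>cells d. closure P - P)"
    using M(1) quadrangle_facts(6)[OF M(4)] by (intro negligible_Union) auto
  ultimately show "negligible (closure \<Omega> - \<Union>(cells d))" by (rule negligible_subset[rotated])
  show "negligible (closure \<Omega> - \<Omega>)"
    using polyhedral_negligible_frontier[OF o] by (rule negligible_subset) (auto simp: frontier_def interior_subset[THEN subsetD])
  show "\<Union>(cells d) \<subseteq> closure \<Omega>" unfolding M(3)[symmetric] using closure_subset by blast
qed

lemma time_gridD:
  assumes g: "time_grid T d" and T: "0 < T"
  shows "\<And>m n. m \<le> n \<Longrightarrow> n \<le> nsteps d \<Longrightarrow> tm d m \<le> tm d n" "\<And>m n. m < n \<Longrightarrow> n \<le> nsteps d \<Longrightarrow> tm d m < tm d n"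
    "\<And>n. n \<le> nsteps d \<Longrightarrow> 0 \<le> tm d n" "\<And>n. n \<le> nsteps d \<Longrightarrow> tm d n \<le> T" "0 < nsteps d"
    "\<And>t. 0 \<le> t \<Longrightarrow> t < T \<Longrightarrow> \<exists>n<nsteps d. t \<in> {tm d n..<tm d (Suc n)}"
    "\<And>m n t. m < nsteps d \<Longrightarrow> n < nsteps d \<Longrightarrow> t \<in> {tm d m..<tm d (Suc m)} \<Longrightarrow> t \<in> {tm d n..<tm d (Suc n)} \<Longrightarrow> m = n"
proof -
  have S: "tm d n < tm d (Suc n)" if "n < nsteps d" for n using g that by (simp add: time_grid_def)
  show L: "tm d m < tm d n" if "m < n" "n \<le> nsteps d" for m n
    using that
  proof (induction n)
    case (Suc n)
    then show ?case using S[of n] by (cases "m = n") (auto intro: less_trans)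
  qed simp
  show Le: "tm d m \<le> tm d n" if "m \<le> n" "n \<le> nsteps d" for m n
    using L[of m n] that by (cases "m = n") auto
  show "0 \<le> tm d n" if "n \<le> nsteps d" for n using Le[of 0 n] that g by (simp add: time_grid_def)
  show "tm d n \<le> T" if "n \<le> nsteps d" for n using Le[of n "nsteps d"] that g by (simp add: time_grid_def)
  show N: "0 < nsteps d" using g T by (cases "nsteps d") (auto simp: time_grid_def)
  show "\<exists>n<nsteps d. t \<in> {tm d n..<tm d (Suc n)}" if t: "0 \<le> t" "t < T" for t
  proof -
    define n where "n = (LEAST k. t < tm d k)"
    have "t < tm d (nsteps d)" using t g by (simp add: time_grid_def)
    then have n: "t < tm d n" "n \<le> nsteps d" unfolding n_def by (rule LeastI) (rule Least_le, fact)
    have "tm d 0 = 0" using g by (simp add: time_grid_def)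
    then have "n \<noteq> 0" using n(1) t by (intro notI) simp
    then obtain k where k: "n = Suc k" by (cases n) auto
    have "\<not> t < tm d k" using not_less_Least[of k "\<lambda>k. t < tm d k"] k unfolding n_def by simp
    then show ?thesis using n k by (intro exI[of _ k]) auto
  qed
  show "m = n" if "m < nsteps d" "n < nsteps d" "t \<in> {tm d m..<tm d (Suc m)}" "t \<in> {tm d n..<tm d (Suc n)}" for m n t
  proof (rule ccontr)
    assume "m \<noteq> n"
    then consider "Suc m \<le> n" | "Suc n \<le> m" by linarith
    then show False using Le[of "Suc m" n] Le[of "Suc n" m] that by cases auto
  qed
qed

section \<open>Lebesgue measure on space-time\<close>

lemma negligible_Times_UNIV:
  fixes N :: "'a::euclidean_space set"
  assumes "negligible N" shows "negligible (N \<times> (UNIV :: 'b::euclidean_space set))"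
proof -
  obtain N' where N': "N' \<in> null_sets lborel" "N \<subseteq> N'"
    using assms unfolding negligible_iff_null_sets null_sets_completion_iff2 by blast
  then have s: "N' \<in> sets lborel" "emeasure lborel N' = 0" by (auto simp: null_sets_def)
  have "emeasure (lborel \<Otimes>\<^sub>M lborel) (N' \<times> (UNIV :: 'b set)) = 0"
    using lborel.emeasure_pair_measure_Times[OF s(1), of "UNIV :: 'b set"] s(2) by simp
  moreover have "N' \<times> (UNIV :: 'b set) \<in> sets (lborel \<Otimes>\<^sub>M lborel)" by (rule pair_measureI[OF s(1)]) simp
  ultimately have "N' \<times> (UNIV :: 'b set) \<in> null_sets lborel" unfolding lborel_prod by (rule null_setsI)
  then show ?thesis unfolding negligible_iff_null_sets null_sets_completion_iff2
    by (rule rev_bexI) (use N'(2) in auto)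
qed

lemma lmeasurable_box:
  fixes P :: "'a::euclidean_space set"
  assumes "open P" "bounded P" "s \<le> (t::real)"
  shows "P \<times> {s..<t} \<in> lmeasurable" "measure lebesgue (P \<times> {s..<t}) = measure lebesgue P * (t - s)"
proof -
  have b: "P \<in> sets borel" "{s..<t} \<in> sets borel" using assms by auto
  have p: "P \<times> {s..<t} \<in> sets (lborel \<Otimes>\<^sub>M lborel)" by (rule pair_measureI) (simp_all only: b sets_lborel)
  then have pl: "P \<times> {s..<t} \<in> sets lborel" unfolding lborel_prod .
  have eP: "emeasure lborel P = ennreal (measure lborel P)"
    using assms(2) by (intro emeasure_eq_ennreal_measure) (metis emeasure_bounded_finite ennreal_top_neq_one infinity_ennreal_def less_irrefl)
  have "emeasure lborel (P \<times> {s..<t}) = emeasure (lborel \<Otimes>\<^sub>M lborel) (P \<times> {s..<t})" unfolding lborel_prod ..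
  also have "\<dots> = emeasure lborel P * emeasure lborel {s..<t}"
    using b by (intro lborel.emeasure_pair_measure_Times) auto
  also have "\<dots> = ennreal (measure lborel P * (t - s))"
    unfolding eP using assms(3) by (simp add: ennreal_mult)
  finally have e: "emeasure lborel (P \<times> {s..<t}) = ennreal (measure lborel P * (t - s))" .
  then have e2: "emeasure lebesgue (P \<times> {s..<t}) = ennreal (measure lborel P * (t - s))"
    using pl by (simp add: emeasure_completion)
  show "P \<times> {s..<t} \<in> lmeasurable" using pl e2 by (intro fmeasurableI) (auto simp: sets_completionI_sets)
  show "measure lebesgue (P \<times> {s..<t}) = measure lebesgue P * (t - s)"
    using e2 assms(3) b by (simp add: measure_def[of lebesgue "P \<times> {s..<t}"] measure_completion enn2real_ennreal)
qed

text \<open>Lebesgue measure on the product is the completion of the product measure. Passing to a Borel version changes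
  almost all slices only on null sets.\<close>

lemma lebesgue_integral_iterated:
  fixes f :: "'a::euclidean_space \<times> 'b::euclidean_space \<Rightarrow> real"
  assumes f: "integrable lebesgue f"
  shows "(LINT t|lebesgue. LINT x|lebesgue. f (x, t)) = (LINT z|lebesgue. f z)"
proof -
  have "f \<in> borel_measurable lebesgue" using f by simp
  then obtain g where g: "g \<in> borel_measurable lborel" and ae: "AE z in lborel. f z = g z"
    using completion_ex_borel_measurable_real by blast
  have gl: "g \<in> borel_measurable lebesgue" using g by (rule measurable_completion)
  have aeL: "AE z in lebesgue. f z = g z" using ae by (rule AE_completion)
  have "integrable lebesgue g" using f gl aeL integrable_cong_AE[OF _ gl aeL] by auto
  then have ig: "integrable lborel g" using g by (simp add: integrable_completion)
  have ig2: "integrable (lborel \<Otimes>\<^sub>M lborel) (case_prod (\<lambda>x t. g (x, t)))" unfolding lborel_prod using ig by simp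
  obtain N where N: "\<And>z. z \<in> space lborel - N \<Longrightarrow> f z = g z" "N \<in> null_sets lborel" using AE_E3[OF ae] by blast
  have Ns: "N \<in> sets (lborel \<Otimes>\<^sub>M lborel)" using N(2) unfolding lborel_prod by auto
  have m: "{z \<in> space (lborel \<Otimes>\<^sub>M lborel). (fst z, snd z) \<notin> N} \<in> sets (lborel \<Otimes>\<^sub>M lborel)"
  proof -
    have "{z \<in> space (lborel \<Otimes>\<^sub>M lborel). (fst z, snd z) \<notin> N} = space (lborel \<Otimes>\<^sub>M lborel) - N" by auto
    then show ?thesis using sets.compl_sets[OF Ns] by simp
  qed
  have "AE z in lborel \<Otimes>\<^sub>M lborel. z \<notin> N" unfolding lborel_prod using N(2) by (rule AE_not_in)
  then have "AE x in lborel. AE t in lborel. (x, t) \<notin> N" by (rule lborel_pair.AE_pair)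
  then have "AE t in lborel. AE x in lborel. (x, t) \<notin> N"
    using lborel_pair.AE_commute[OF m] by simp
  then have "AE t in lborel. (LINT x|lebesgue. f (x, t)) = (LINT x|lborel. g (x, t))"
  proof eventually_elim
    fix t assume "AE x in lborel. (x, t) \<notin> N"
    then have "AE x in lborel. g (x, t) = f (x, t)" by eventually_elim (use N(1) in auto)
    then have a: "AE x in lebesgue. g (x, t) = f (x, t)" by (rule AE_completion)
    have gm: "(\<lambda>x. g (x, t)) \<in> borel_measurable lborel" using g by measurable
    then have gm': "(\<lambda>x. g (x, t)) \<in> borel_measurable lebesgue" by (rule measurable_completion)
    have fm: "(\<lambda>x. f (x, t)) \<in> borel_measurable lebesgue" by (rule borel_measurable_AE[OF gm' a])
    have "(LINT x|lebesgue. f (x, t)) = (LINT x|lebesgue. g (x, t))"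
      using a by (intro integral_cong_AE fm gm') auto
    then show "(LINT x|lebesgue. f (x, t)) = (LINT x|lborel. g (x, t))" using gm by (simp add: integral_completion)
  qed
  then have a: "AE t in lebesgue. (LINT x|lborel. g (x, t)) = (LINT x|lebesgue. f (x, t))"
    by (intro AE_completion) (auto elim: eventually_mono)
  have im: "(\<lambda>t. LINT x|lborel. g (x, t)) \<in> borel_measurable lborel"
    using lborel_pair.integrable_snd[OF ig2] by simp
  then have im': "(\<lambda>t. LINT x|lborel. g (x, t)) \<in> borel_measurable lebesgue" by (rule measurable_completion)
  have fm: "(\<lambda>t. LINT x|lebesgue. f (x, t)) \<in> borel_measurable lebesgue" by (rule borel_measurable_AE[OF im' a])
  have "(LINT t|lebesgue. LINT x|lebesgue. f (x, t)) = (LINT t|lebesgue. LINT x|lborel. g (x, t))"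
    using a by (intro integral_cong_AE fm im') auto
  also have "\<dots> = (LINT t|lborel. LINT x|lborel. g (x, t))" using im by (simp add: integral_completion)
  also have "\<dots> = (LINT z|lborel. g z)"
    using lborel_pair.integral_snd[OF ig2] unfolding lborel_prod by simp
  also have "\<dots> = (LINT z|lebesgue. g z)" using g by (simp add: integral_completion)
  also have "\<dots> = (LINT z|lebesgue. f z)" using f gl aeL by (intro integral_cong_AE) auto
  finally show ?thesis .
qed

text \<open>The cells cover \<open>\<Omega>\<close> only up to a null set and may contain points of its boundary, so all functions are
  moved to the compact closure.\<close>

lemma lebesgue_on_extend:
  fixes f :: "'a::euclidean_space \<Rightarrow> 'b::euclidean_space"
  assumes S: "S \<in> sets lebesgue" "S \<subseteq> X" and n: "negligible (X - S)"
  shows "X \<in> sets lebesgue"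
    and "f \<in> borel_measurable (lebesgue_on S) \<Longrightarrow> f \<in> borel_measurable (lebesgue_on X)"
    and "(AE z in lebesgue_on S. Q z) \<Longrightarrow> (AE z in lebesgue_on X. Q z)"
    and "f \<in> borel_measurable (lebesgue_on S) \<Longrightarrow> (LINT z|lebesgue_on S. f z) = (LINT z|lebesgue_on X. f z)"
proof -
  have nz: "X - S \<in> sets lebesgue" using n by (simp add: negligible_imp_sets)
  have "X = S \<union> (X - S)" using S by blast
  then show X: "X \<in> sets lebesgue" using S(1) nz by (metis sets.Un)
  have AEn: "AE z in lebesgue. z \<notin> X - S" using n by (intro AE_not_in) (simp add: negligible_iff_null_sets)
  show m: "f \<in> borel_measurable (lebesgue_on X)" if "f \<in> borel_measurable (lebesgue_on S)"
  proof -
    have "f measurable_on S" using that measurable_on_iff_borel_measurable[OF S(1)] by blast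
    moreover have "(S - X) \<union> (X - S) = X - S" using S(2) by blast
    ultimately have "f measurable_on X" using measurable_on_spike_set[of f S X] n by simp
    then show ?thesis using measurable_on_iff_borel_measurable[OF X] by blast
  qed
  show "AE z in lebesgue_on X. Q z" if "AE z in lebesgue_on S. Q z"
  proof -
    have "AE z in lebesgue. z \<in> S \<longrightarrow> Q z" using that S(1) by (simp add: AE_restrict_space_iff)
    with AEn have "AE z in lebesgue. z \<in> X \<longrightarrow> Q z" by eventually_elim blast
    then show ?thesis using X by (simp add: AE_restrict_space_iff)
  qed
  show "(LINT z|lebesgue_on S. f z) = (LINT z|lebesgue_on X. f z)" if f: "f \<in> borel_measurable (lebesgue_on S)"
  proof -
    have "(LINT z|lebesgue_on S. f z) = (LINT z|lebesgue. indicator S z *\<^sub>R f z)"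
      using S(1) by (subst integral_restrict_space) auto
    also have "\<dots> = (LINT z|lebesgue. indicator X z *\<^sub>R f z)"
    proof (rule integral_cong_AE)
      show "(\<lambda>z. indicator S z *\<^sub>R f z) \<in> borel_measurable lebesgue"
        using f S(1) by (simp add: borel_measurable_restrict_space_iff)
      show "(\<lambda>z. indicator X z *\<^sub>R f z) \<in> borel_measurable lebesgue"
        using m[OF f] X by (simp add: borel_measurable_restrict_space_iff)
      show "AE z in lebesgue. indicator S z *\<^sub>R f z = indicator X z *\<^sub>R f z"
        using AEn by eventually_elim (use S(2) in \<open>auto simp: indicator_def\<close>)
    qed
    also have "\<dots> = (LINT z|lebesgue_on X. f z)" using X by (subst integral_restrict_space) auto
    finally show ?thesis .
  qed
qed

lemma integral_indicator_const_on:
  fixes f :: "'a::euclidean_space \<Rightarrow> real"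
  assumes X: "X \<in> sets lebesgue" and A: "A \<in> lmeasurable" "A \<subseteq> X" and f: "\<And>z. z \<in> A \<Longrightarrow> f z = a"
  shows "measure lebesgue A * a = (LINT z|lebesgue_on X. indicator A z * f z)"
proof -
  have "(LINT z|lebesgue_on X. indicator A z * f z) = (LINT z|lebesgue. indicator X z *\<^sub>R (indicator A z * f z))"
    using X by (subst integral_restrict_space) auto
  also have "\<dots> = (LINT z|lebesgue. indicator A z * a)"
    using A f by (intro Bochner_Integration.integral_cong) (auto simp: indicator_def)
  also have "\<dots> = measure lebesgue A * a" using A by (simp add: fmeasurableD)
  finally show ?thesis by simp
qed

lemma AE_bound_on_constant:
  assumes X: "X \<in> sets lebesgue" and ae: "AE z in lebesgue_on X. \<bar>f z\<bar> \<le> (C::real)"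
    and A: "A \<in> sets lebesgue" "A \<subseteq> X" "0 < measure lebesgue A" and f: "\<And>z. z \<in> A \<Longrightarrow> f z = a"
  shows "\<bar>a\<bar> \<le> C"
proof (rule ccontr)
  assume n: "\<not> ?thesis"
  have "AE z in lebesgue. z \<in> X \<longrightarrow> \<bar>f z\<bar> \<le> C" using ae X by (simp add: AE_restrict_space_iff)
  then have "AE z in lebesgue. z \<notin> A" by eventually_elim (use A f n in auto)
  then have "A \<in> null_sets lebesgue" using A(1) by (subst AE_iff_null_sets) auto
  then have "measure lebesgue A = 0" by (simp add: measure_def null_setsD1)
  with A(3) show False by simp
qed

text \<open>For every \<open>e > 0\<close> one has \<open>x \<le> e + e powr (1 - p) * x powr p\<close>, which avoids Hoelder's inequality.\<close>

lemma Lp_limit_imp_L1_limit: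
  fixes f :: "nat \<Rightarrow> 'a \<Rightarrow> 'b::euclidean_space"
  assumes M: "finite_measure M" and p: "1 \<le> p" and c: "converges_in_Lp p M f l"
    and m: "\<And>n. f n \<in> borel_measurable M" "l \<in> borel_measurable M"
    and b: "\<And>n. AE z in M. norm (f n z) \<le> C" "AE z in M. norm (l z) \<le> C"
  shows "(\<lambda>n. LINT z|M. norm (f n z - l z)) \<longlonglongrightarrow> 0"
proof (rule LIMSEQ_I)
  interpret finite_measure M by fact
  fix r :: real assume r: "0 < r"
  let ?V = "measure M (space M)"
  define e where "e = r / (2 * (?V + 1))"
  have V: "0 \<le> ?V" by simp
  have e: "0 < e" proof -
    have "0 < ?V + 1" using V by linarith
    then show ?thesis unfolding e_def using r by (intro divide_pos_pos mult_pos_pos) simp_all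
  qed
  have e2: "e * ?V \<le> r / 2"
  proof -
    have "e * ?V \<le> e * (?V + 1)" using e by (intro mult_left_mono) auto
    also have "\<dots> = r / 2" proof -
      have "?V + 1 \<noteq> 0" using V by linarith
      then show ?thesis unfolding e_def by (simp add: field_simps)
    qed
    finally show ?thesis .
  qed
  let ?I = "\<lambda>n. LINT z|M. norm (f n z - l z) powr p"
  have "(\<lambda>n. ?I n powr (1 / p)) \<longlonglongrightarrow> 0" using c unfolding converges_in_Lp_def Lp_norm_def by simp
  then have "(\<lambda>n. (?I n powr (1 / p)) powr p) \<longlonglongrightarrow> 0 powr p"
    using p by (intro tendsto_powr' tendsto_const) auto
  then have "(\<lambda>n. ?I n) \<longlonglongrightarrow> 0" using p by (simp add: powr_powr integral_nonneg_AE)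
  then have "(\<lambda>n. e powr (1 - p) * ?I n) \<longlonglongrightarrow> 0" by (rule tendsto_mult_right_zero)
  then have "\<forall>\<^sub>F n in sequentially. e powr (1 - p) * ?I n < r / 2" using r by (intro order_tendstoD(2)) auto
  then obtain n0 where n0: "\<And>n. n \<ge> n0 \<Longrightarrow> e powr (1 - p) * ?I n < r / 2" by (auto simp: eventually_sequentially)
  have "norm ((LINT z|M. norm (f n z - l z)) - 0) < r" if n: "n \<ge> n0" for n
  proof -
    have bd: "AE z in M. norm (f n z - l z) \<le> 2 * C"
      using b(1)[of n] b(2)
    proof eventually_elim
      fix z assume "norm (f n z) \<le> C" "norm (l z) \<le> C"
      then show "norm (f n z - l z) \<le> 2 * C" using norm_triangle_ineq4[of "f n z" "l z"] by linarith
    qed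
    have mm: "(\<lambda>z. norm (f n z - l z)) \<in> borel_measurable M" using m by measurable
    have i1: "integrable M (\<lambda>z. norm (f n z - l z))"
      using bd mm by (intro integrable_const_bound[of _ "2 * C"]) auto
    have i2: "integrable M (\<lambda>z. norm (f n z - l z) powr p)"
    proof (rule integrable_const_bound[of _ "(2 * C) powr p"])
      show "AE z in M. norm (norm (f n z - l z) powr p) \<le> (2 * C) powr p"
        using bd by eventually_elim (use p in \<open>auto intro!: powr_mono2\<close>)
      show "(\<lambda>z. norm (f n z - l z) powr p) \<in> borel_measurable M" using mm by measurable
    qed
    have "(LINT z|M. norm (f n z - l z)) \<le> (LINT z|M. e + e powr (1 - p) * norm (f n z - l z) powr p)"
    proof (rule integral_mono[OF i1])
      show "integrable M (\<lambda>z. e + e powr (1 - p) * norm (f n z - l z) powr p)" using i2 by auto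
      fix z
      let ?x = "norm (f n z - l z)"
      show "?x \<le> e + e powr (1 - p) * ?x powr p"
      proof (cases "?x \<le> e")
        case True
        moreover have "0 \<le> e powr (1 - p) * ?x powr p" by simp
        ultimately show ?thesis by linarith
      next
        case False
        then have x: "e < ?x" "0 < ?x" using e by auto
        have "?x = ?x powr (1 - p) * ?x powr p" using x by (simp add: powr_add[symmetric])
        also have "\<dots> \<le> e powr (1 - p) * ?x powr p"
          using x e p by (intro mult_right_mono powr_mono2') auto
        finally show ?thesis using e by linarith
      qed
    qed
    also have "\<dots> = e * ?V + e powr (1 - p) * ?I n" using i2 by simp
    also have "\<dots> < r" using e2 n0[OF n] by linarith
    finally show ?thesis by (simp add: integral_nonneg_AE)
  qed
  then show "\<exists>no. \<forall>n\<ge>no. norm ((LINT z|M. norm (f n z - l z)) - 0) < r" by blast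
qed

section \<open>Values of the discrete functions\<close>

text \<open>The edges whose unknown contributes to the \<open>i\<close>-th component of the velocity. Working component by
  component lets one argument treat both arrangements.\<close>

definition component_edges :: "arrangement \<Rightarrow> scheme \<Rightarrow> 2 \<Rightarrow> point set \<Rightarrow> point set set" where
  "component_edges A d i P = (case A of RT \<Rightarrow> edges d P | MAC \<Rightarrow> edges d P \<inter> dir_edges d i)"

locale staggered_scheme =
  fixes A :: arrangement and \<Omega> :: "point set" and T :: real and d :: scheme
  assumes open_dom: "open \<Omega>" and bounded_dom: "bounded \<Omega>" and polyhedral_dom: "polyhedral \<Omega>"
    and T_pos: "0 < T" and admissible: "admissible_scheme A \<Omega> T d"
begin

abbreviation slab :: "nat \<Rightarrow> real set" where "slab n \<equiv> {tm d n..<tm d (Suc n)}"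
abbreviation dt :: "nat \<Rightarrow> real" where "dt n \<equiv> tm d (Suc n) - tm d n"
abbreviation cyl :: "(point \<times> real) set" where "cyl \<equiv> closure \<Omega> \<times> {0..T}"

abbreviation comp_edges :: "2 \<Rightarrow> point set \<Rightarrow> point set set" where "comp_edges \<equiv> component_edges A d"

lemma mesh: "primal_mesh \<Omega> d" and grid: "time_grid T d" and stag: "staggered A d"
  using admissible by (simp_all add: admissible_scheme_def)

lemma qedge_between: "P \<in> cells d \<Longrightarrow> Q \<in> cells d \<Longrightarrow> P \<noteq> Q \<Longrightarrow> \<zeta> \<in> edges d P \<Longrightarrow> \<zeta> \<in> edges d Q \<Longrightarrow> n < nsteps d \<Longrightarrow>
    qedge d \<zeta> n \<in> closed_segment (qval d P n) (qval d Q n)"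
  using admissible by (simp add: admissible_scheme_def)

lemmas cell_mesh = primal_meshD[OF mesh]
lemmas grid_facts = time_gridD[OF grid T_pos]
lemmas cell_facts = quadrangle_facts[OF cell_mesh(4)]
lemmas edge_facts = quadrangle_edge_facts[OF cell_mesh(4)]

lemma dt_pos: "n < nsteps d \<Longrightarrow> 0 < dt n"
  using grid_facts(2)[of n "Suc n"] by simp

lemma cell_unique: "P \<in> cells d \<Longrightarrow> Q \<in> cells d \<Longrightarrow> x \<in> P \<Longrightarrow> x \<in> Q \<Longrightarrow> P = Q"
  using cell_mesh(2)[of P Q] by (auto simp: disjnt_iff)

lemma cell_sub: "P \<in> cells d \<Longrightarrow> P \<subseteq> closure \<Omega>"
  using cells_cover(3)[OF mesh polyhedral_dom] by blast

lemma cell_closure_sub: "P \<in> cells d \<Longrightarrow> closure P \<subseteq> closure \<Omega>"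
  using cell_mesh(3) by blast

lemma piecewise_value:
  assumes "P \<in> cells d" "n < nsteps d" "x \<in> P" "t \<in> slab n"
    and S: "\<And>k. S k \<subseteq> slab k" "t \<in> S n"
  shows "(\<Sum>P\<in>cells d. \<Sum>n<nsteps d. c P n * indicator (P \<times> S n) (x, t)) = (c P n :: real)"
proof -
  have "indicator (Q \<times> S k) (x, t) = (if Q = P then if k = n then 1 else (0::real) else 0)"
    if "Q \<in> cells d" "k < nsteps d" for Q k
  proof (cases "x \<in> Q \<and> t \<in> S k")
    case True
    then have "t \<in> slab k" using S(1)[of k] by blast
    then have "Q = P" "k = n" using cell_unique[OF that(1) assms(1)] grid_facts(7)[OF that(2) assms(2) _ assms(4)] assms(3) True
      by auto
    with True show ?thesis by simp
  next
    case False
    then have "\<not> (Q = P \<and> k = n)" using assms by auto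
    with False show ?thesis by (auto simp: indicator_def)
  qed
  then have "(\<Sum>P\<in>cells d. \<Sum>n<nsteps d. c P n * indicator (P \<times> S n) (x, t))
    = (\<Sum>Q\<in>cells d. \<Sum>k<nsteps d. if Q = P then if k = n then c Q k else 0 else 0)"
    by (intro sum.cong refl) auto
  also have "\<dots> = (\<Sum>Q\<in>cells d. if Q = P then c Q n else 0)"
    using assms(2) by (intro sum.cong refl) (auto simp: sum.delta)
  also have "\<dots> = c P n" using assms(1) cell_mesh(1) by (simp add: sum.delta)
  finally show ?thesis .
qed

lemma q_fun_value: "P \<in> cells d \<Longrightarrow> n < nsteps d \<Longrightarrow> x \<in> P \<Longrightarrow> t \<in> slab n \<Longrightarrow> q_fun d (x, t) = qval d P n"
  unfolding q_fun_def by (rule piecewise_value) auto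

lemma comp_edges_sub: "comp_edges i P \<subseteq> edges d P"
  by (cases A) (auto simp: component_edges_def)

lemma finite_comp_edges: "P \<in> cells d \<Longrightarrow> finite (comp_edges i P)" "P \<in> cells d \<Longrightarrow> card (comp_edges i P) \<le> 4"
  using cell_facts(4,5)[of P] comp_edges_sub[of i P] by (auto intro: finite_subset card_mono[THEN order_trans])

lemma subcell_MAC:
  assumes "A = MAC" "P \<in> cells d" "\<zeta> \<in> edges d P"
  shows "subcell d P \<zeta> = {x \<in> P. 0 < (x - mass_center P) \<bullet> outward_normal P \<zeta>}" "is_rectangle P (edges d P)"
  using stag assms by (auto simp: MAC_subcells_def)

lemma subcell_RT:
  assumes "A = RT" "P \<in> cells d"
  shows "RT_subcells P (edges d P) (subcell d P)"
  using stag assms by simp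

text \<open>A quarter of the cell in the RT case, a half in the MAC case: the constant 4 serves both.\<close>

lemma subcell_facts:
  assumes P: "P \<in> cells d" and z: "\<zeta> \<in> comp_edges i P"
  shows "open (subcell d P \<zeta>)" "subcell d P \<zeta> \<subseteq> P" "area P \<le> 4 * area (subcell d P \<zeta>)"
proof -
  have ze: "\<zeta> \<in> edges d P" using z comp_edges_sub by blast
  have "open (subcell d P \<zeta>) \<and> subcell d P \<zeta> \<subseteq> P \<and> area P \<le> 4 * area (subcell d P \<zeta>)"
  proof (cases A)
    case RT
    note H = subcell_RT[OF RT P, unfolded RT_subcells_def, THEN conjunct1, rule_format, OF ze]
    then have "area (subcell d P \<zeta>) = area P / 4" by blast
    then have "area P \<le> 4 * area (subcell d P \<zeta>)" by linarith
    with H show ?thesis by blast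
  next
    case MAC
    note S = subcell_MAC[OF MAC P ze]
    obtain a b c e where r: "ccw_quadrangle a b c e P (edges d P)" "b - a = c - e" using is_rectangle_ccw[OF S(2)] .
    have "norm (outward_normal P \<zeta>) = 1" using edge_facts(1)[OF P ze] .
    then have "outward_normal P \<zeta> \<noteq> 0" by auto
    from parallelogram_half_area[OF r this] have "area (subcell d P \<zeta>) = area P / 2" unfolding S(1) .
    moreover have "open (subcell d P \<zeta>)" unfolding S(1) using cell_facts(1)[OF P]
      by (auto simp: Collect_conj_eq intro!: open_Int open_Collect_less continuous_intros)
    moreover have "subcell d P \<zeta> \<subseteq> P" unfolding S(1) by blast
    ultimately show ?thesis using cell_facts(3)[OF P] by simp
  qed
  then show "open (subcell d P \<zeta>)" "subcell d P \<zeta> \<subseteq> P" "area P \<le> 4 * area (subcell d P \<zeta>)" by blast+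
qed

lemma subcell_disjoint:
  assumes P: "P \<in> cells d" and z: "\<zeta> \<in> comp_edges i P" "\<eta> \<in> comp_edges i P" "\<zeta> \<noteq> \<eta>"
  shows "subcell d P \<zeta> \<inter> subcell d P \<eta> = {}"
proof -
  have ze: "\<zeta> \<in> edges d P" "\<eta> \<in> edges d P" using z comp_edges_sub by blast+
  show ?thesis
  proof (cases A)
    case RT
    then show ?thesis using subcell_RT[OF RT P] ze z(3) unfolding RT_subcells_def by simp
  next
    case MAC
    note S = subcell_MAC[OF MAC P]
    have "\<zeta> \<in> dir_edges d i" "\<eta> \<in> dir_edges d i" using z(1,2) MAC by (auto simp: component_edges_def)
    then have op: "outward_normal P \<eta> = - outward_normal P \<zeta>"
      unfolding dir_edges_def
      by (intro rectangle_opposite_normals[OF S(2)[OF ze(1)] ze z(3), of i]) blast+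
    show ?thesis
    proof (rule equals0I)
      fix x assume "x \<in> subcell d P \<zeta> \<inter> subcell d P \<eta>"
      then have "0 < (x - mass_center P) \<bullet> outward_normal P \<zeta>" "0 < (x - mass_center P) \<bullet> outward_normal P \<eta>"
        unfolding S(1)[OF ze(1)] S(1)[OF ze(2)] by blast+
      then show False unfolding op inner_minus_right by linarith
    qed
  qed
qed

text \<open>The sub-cells belonging to one component are pairwise disjoint, so a point lies in at most one dual cell
  of that component.\<close>

lemma mem_dual_cell_iff:
  assumes P: "P \<in> cells d" and z: "\<zeta> \<in> comp_edges i P" and x: "x \<in> subcell d P \<zeta>"
    and e: "\<eta> \<in> (case A of RT \<Rightarrow> all_edges d | MAC \<Rightarrow> dir_edges d i)"
  shows "x \<in> dual_cell d \<eta> \<longleftrightarrow> \<eta> = \<zeta>"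
proof
  assume "\<eta> = \<zeta>"
  then show "x \<in> dual_cell d \<eta>" using P z x comp_edges_sub unfolding dual_cell_def by blast
next
  assume "x \<in> dual_cell d \<eta>"
  then obtain Q where Q: "Q \<in> cells d" "\<eta> \<in> edges d Q" "x \<in> subcell d Q \<eta>" unfolding dual_cell_def by blast
  have eQ: "\<eta> \<in> comp_edges i Q" using e Q(2) by (cases A) (auto simp: component_edges_def)
  have "x \<in> Q" "x \<in> P" using subcell_facts(2)[OF Q(1) eQ] subcell_facts(2)[OF P z] Q(3) x by blast+
  then have "Q = P" using cell_unique[OF Q(1) P] by blast
  then show "\<eta> = \<zeta>" using subcell_disjoint[OF P z] eQ Q(3) x by blast
qed

lemma finite_all_edges: "finite (all_edges d)"
  unfolding all_edges_def using cell_mesh(1) cell_facts(4) by auto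

lemma v_fun_value:
  assumes P: "P \<in> cells d" and z: "\<zeta> \<in> comp_edges i P" and n: "n < nsteps d"
    and x: "x \<in> subcell d P \<zeta>" and t: "t \<in> slab n"
  shows "v_fun A d (x, t) $ i = vval d \<zeta> n $ i"
proof -
  let ?S = "case A of RT \<Rightarrow> all_edges d | MAC \<Rightarrow> dir_edges d i"
  have fS: "finite ?S" using finite_all_edges by (cases A) (auto simp: dir_edges_def)
  have zS: "\<zeta> \<in> ?S" using z P by (cases A) (auto simp: component_edges_def all_edges_def)
  have "v_fun A d (x, t) $ i = (\<Sum>\<eta>\<in>?S. \<Sum>k<nsteps d. indicator (dual_cell d \<eta> \<times> slab k) (x, t) * vval d \<eta> k $ i)"
    by (cases A) (simp_all add: sum_component)
  also have "\<dots> = (\<Sum>\<eta>\<in>?S. \<Sum>k<nsteps d. if \<eta> = \<zeta> then if k = n then vval d \<eta> k $ i else 0 else 0)"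
  proof (intro sum.cong refl)
    fix \<eta> k assume e: "\<eta> \<in> ?S" and k: "k \<in> {..<nsteps d}"
    have "t \<in> slab k \<longleftrightarrow> k = n" using grid_facts(7)[of k n t] k n t by auto
    with mem_dual_cell_iff[OF P z x e]
    show "indicator (dual_cell d \<eta> \<times> slab k) (x, t) * vval d \<eta> k $ i
        = (if \<eta> = \<zeta> then if k = n then vval d \<eta> k $ i else 0 else 0)"
      by (simp add: indicator_def)
  qed
  also have "\<dots> = (\<Sum>\<eta>\<in>?S. if \<eta> = \<zeta> then vval d \<eta> n $ i else 0)"
    using n by (intro sum.cong refl) (auto simp: sum.delta)
  also have "\<dots> = vval d \<zeta> n $ i" using zS fS by (simp add: sum.delta)
  finally show ?thesis .
qed

text \<open>In the MAC case the flux through an edge involves one component of the velocity only, because the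
  normal is parallel to an axis.\<close>

lemma normal_component_zero:
  assumes P: "P \<in> cells d" and z: "\<zeta> \<in> edges d P" "\<zeta> \<notin> comp_edges i P"
  shows "outward_normal P \<zeta> $ i = 0"
proof -
  have MAC: "A = MAC" using z by (cases A) (auto simp: component_edges_def)
  then have "\<zeta> \<notin> dir_edges d i" using z by (simp add: component_edges_def)
  moreover have "\<zeta> \<in> dir_edges d 1 \<union> dir_edges d 2" using stag MAC P z(1) by auto
  ultimately obtain j where j: "j \<noteq> i" "\<zeta> \<in> dir_edges d j" by (metis UnE)
  have inf: "infinite \<zeta>" using edge_facts(6)[OF P z(1)] .
  obtain x where x: "x \<in> \<zeta>" using inf by fastforce
  have "infinite (\<zeta> - {x})" using inf by simp
  then have "\<zeta> - {x} \<noteq> {}" by (intro notI) simp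
  then obtain y where y: "y \<in> \<zeta>" "y \<noteq> x" by blast
  have ij: "(i = 1 \<and> j = 2) \<or> (i = 2 \<and> j = 1)" using j(1) exhaust_2[of i] exhaust_2[of j] by auto
  have xj: "x $ j = y $ j" using j(2) x y(1) unfolding dir_edges_def by blast
  have "x $ i \<noteq> y $ i" using y(2) xj ij point_eq_iff[of x y] by metis
  moreover have "outward_normal P \<zeta> $ i * (x $ i - y $ i) + outward_normal P \<zeta> $ j * (x $ j - y $ j) = 0"
    using edge_facts(7)[OF P z(1) x y(1)] ij unfolding inner_point by (elim disjE) simp_all
  ultimately show ?thesis using xj by simp
qed

lemma flux_components:
  assumes P: "P \<in> cells d" 
  shows "(\<Sum>\<zeta>\<in>edges d P. c \<zeta> * (w \<zeta> \<bullet> outward_normal P \<zeta>))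
    = (\<Sum>i\<in>UNIV. \<Sum>\<zeta>\<in>comp_edges i P. c \<zeta> * w \<zeta> $ i * outward_normal P \<zeta> $ i)"
proof -
  have "(\<Sum>\<zeta>\<in>edges d P. c \<zeta> * (w \<zeta> \<bullet> outward_normal P \<zeta>))
    = (\<Sum>\<zeta>\<in>edges d P. \<Sum>i\<in>UNIV. c \<zeta> * w \<zeta> $ i * outward_normal P \<zeta> $ i)"
    by (intro sum.cong refl) (simp add: inner_vec_def sum_distrib_left mult.assoc)
  also have "\<dots> = (\<Sum>i\<in>UNIV. \<Sum>\<zeta>\<in>edges d P. c \<zeta> * w \<zeta> $ i * outward_normal P \<zeta> $ i)"
    by (rule sum.swap)
  also have "\<dots> = (\<Sum>i\<in>UNIV. \<Sum>\<zeta>\<in>comp_edges i P. c \<zeta> * w \<zeta> $ i * outward_normal P \<zeta> $ i)"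
    by (intro sum.cong refl sum.mono_neutral_right comp_edges_sub cell_facts(4)[OF P])
       (use normal_component_zero[OF P] in auto)
  finally show ?thesis .
qed

lemma comp_edges_normal_sum:
  assumes P: "P \<in> cells d"
  shows "(\<Sum>\<zeta>\<in>comp_edges i P. c \<zeta> * outward_normal P \<zeta> $ i) = (\<Sum>\<zeta>\<in>edges d P. c \<zeta> * outward_normal P \<zeta> $ i)"
  by (intro sum.mono_neutral_left comp_edges_sub cell_facts(4)[OF P]) (use normal_component_zero[OF P] in auto)

lemma compact_cyl: "compact cyl"
  using bounded_dom by (intro compact_Times) auto

lemma box_facts:
  assumes "open S" "S \<subseteq> P" "P \<in> cells d" "n < nsteps d"
  shows "S \<times> slab n \<in> lmeasurable" "measure lebesgue (S \<times> slab n) = area S * dt n" "S \<times> slab n \<subseteq> cyl"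
proof -
  have b: "bounded S" using cell_facts(2)[OF assms(3)] assms(2) by (rule bounded_subset)
  have le: "tm d n \<le> tm d (Suc n)" using dt_pos[OF assms(4)] by simp
  show "S \<times> slab n \<in> lmeasurable" "measure lebesgue (S \<times> slab n) = area S * dt n"
    using lmeasurable_box[OF assms(1) b le] .
  have "slab n \<subseteq> {0..T}" using grid_facts(3)[of n] grid_facts(4)[of "Suc n"] assms(4) by auto
  then show "S \<times> slab n \<subseteq> cyl" using assms(2) cell_sub[OF assms(3)] by blast
qed

lemma cyl_difference_negligible: "negligible (cyl - \<Omega> \<times> {0<..<T})" "negligible (cyl - \<Union>(cells d) \<times> {0..<T})"
proof -
  have h: "negligible {z :: point \<times> real. (0, 1) \<bullet> z = c}" for c
    by (rule negligible_hyperplane) (simp add: prod_eq_iff)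
  have e: "negligible (UNIV \<times> {c} :: (point \<times> real) set)" for c
    by (rule negligible_subset[OF h[of c]]) (auto simp: inner_prod_def)
  have n1: "negligible ((closure \<Omega> - \<Omega>) \<times> (UNIV::real set) \<union> (UNIV \<times> {0} \<union> UNIV \<times> {T}))"
    by (intro negligible_Un e negligible_Times_UNIV cells_cover(2)[OF mesh polyhedral_dom])
  show "negligible (cyl - \<Omega> \<times> {0<..<T})" by (rule negligible_subset[OF n1]) auto
  have n2: "negligible ((closure \<Omega> - \<Union>(cells d)) \<times> (UNIV::real set) \<union> UNIV \<times> {T})"
    by (intro negligible_Un e negligible_Times_UNIV cells_cover(1)[OF mesh polyhedral_dom])
  show "negligible (cyl - \<Union>(cells d) \<times> {0..<T})" by (rule negligible_subset[OF n2]) auto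
qed

lemma cylinder_sets: "cyl \<in> sets lebesgue" "\<Omega> \<times> {0<..<T} \<in> sets lebesgue" "\<Omega> \<times> {0<..<T} \<subseteq> cyl"
proof -
  show "cyl \<in> sets lebesgue" using lmeasurable_compact[OF compact_cyl] by (simp add: fmeasurable_def)
  have "open (\<Omega> \<times> {0<..<T})" using open_dom by (intro open_Times) auto
  then show "\<Omega> \<times> {0<..<T} \<in> sets lebesgue" by (simp add: borel_open sets_completionI_sets)
  show "\<Omega> \<times> {0<..<T} \<subseteq> cyl" using closure_subset by auto
qed

lemma AE_in_boxes: "AE z in lebesgue_on cyl. \<exists>P\<in>cells d. \<exists>n<nsteps d. z \<in> P \<times> slab n"
proof -
  have "AE z in lebesgue. z \<notin> cyl - \<Union>(cells d) \<times> {0..<T}"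
    using cyl_difference_negligible(2) by (intro AE_not_in) (simp add: negligible_iff_null_sets)
  then have "AE z in lebesgue. z \<in> cyl \<longrightarrow> (\<exists>P\<in>cells d. \<exists>n<nsteps d. z \<in> P \<times> slab n)"
  proof eventually_elim
    fix z assume z: "z \<notin> cyl - \<Union>(cells d) \<times> {0..<T}"
    show "z \<in> cyl \<longrightarrow> (\<exists>P\<in>cells d. \<exists>n<nsteps d. z \<in> P \<times> slab n)"
    proof
      assume "z \<in> cyl"
      with z obtain P where P: "P \<in> cells d" "fst z \<in> P" and t: "0 \<le> snd z" "snd z < T" by (cases z) auto
      from grid_facts(6)[OF t] obtain n where "n < nsteps d" "snd z \<in> slab n" by blast
      with P show "\<exists>P\<in>cells d. \<exists>n<nsteps d. z \<in> P \<times> slab n" by (metis mem_Times_iff)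
    qed
  qed
  then show ?thesis using cylinder_sets(1) by (simp add: AE_restrict_space_iff)
qed

end

section \<open>Test functions against one scheme\<close>

lemma le_max0: "finite S \<Longrightarrow> x \<in> S \<Longrightarrow> x \<le> max0 S"
  unfolding max0_def by (intro Max_ge) auto

lemma max0_nonneg: "finite S \<Longrightarrow> 0 \<le> max0 S"
  unfolding max0_def by (intro Max_ge) auto

lemma summation_by_parts:
  fixes b \<phi> :: "nat \<Rightarrow> real"
  shows "(\<Sum>n<Suc N. (b (Suc n) - b n) * \<phi> n) = b (Suc N) * \<phi> N - b 0 * \<phi> 0 - (\<Sum>n=1..<Suc N. b n * (\<phi> n - \<phi> (n - 1)))"
proof (induction N)
  case (Suc N)
  then show ?case by (simp add: algebra_simps)
qed (simp add: algebra_simps)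

lemma integral_double_sum:
  fixes f :: "'i \<Rightarrow> 'j \<Rightarrow> 'a \<Rightarrow> real"
  assumes "\<And>i j. i \<in> I \<Longrightarrow> j \<in> J \<Longrightarrow> integrable M (f i j)"
  shows "(LINT x|M. (\<Sum>i\<in>I. \<Sum>j\<in>J. f i j x)) = (\<Sum>i\<in>I. \<Sum>j\<in>J. (LINT x|M. f i j x))"
proof -
  have "(LINT x|M. (\<Sum>i\<in>I. \<Sum>j\<in>J. f i j x)) = (\<Sum>i\<in>I. (LINT x|M. (\<Sum>j\<in>J. f i j x)))"
    by (intro Bochner_Integration.integral_sum Bochner_Integration.integrable_sum assms)
  also have "\<dots> = (\<Sum>i\<in>I. \<Sum>j\<in>J. (LINT x|M. f i j x))"
    by (intro sum.cong refl Bochner_Integration.integral_sum assms)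
  finally show ?thesis .
qed

locale test_fun =
  fixes \<Omega> :: "point set" and T :: real and \<phi> :: "point \<times> real \<Rightarrow> real" and G :: "point \<times> real \<Rightarrow> point \<times> real"
    and K :: "(point \<times> real) set"
  assumes open_dom': "open \<Omega>" and K: "compact K" "K \<subseteq> \<Omega> \<times> {0..<T}"
    and phi_0: "\<And>z. z \<notin> K \<Longrightarrow> \<phi> z = 0" and G_0: "\<And>z. z \<notin> K \<Longrightarrow> G z = 0"
    and G_cont: "continuous_on (UNIV \<times> {0..}) G"
    and deriv: "\<And>z. z \<in> UNIV \<times> {0..} \<Longrightarrow> (\<phi> has_derivative (\<lambda>h. h \<bullet> G z)) (at z within UNIV \<times> {0..})"
begin

abbreviation halfspace :: "(point \<times> real) set" where "halfspace \<equiv> UNIV \<times> {0..}"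

lemma halfspace: "convex halfspace" "closed halfspace"
  by (auto intro: convex_Times closed_Times)

lemma gradient_bound: obtains g where "0 \<le> g" "\<And>z. z \<in> halfspace \<Longrightarrow> norm (G z) \<le> g"
  by (rule bounded_continuous_zero_outside_compact[OF halfspace(2) G_cont K(1) G_0]) (assumption, rule that, blast+)

lemma linearize:
  assumes "0 < \<epsilon>"
  obtains \<delta> where "0 < \<delta>"
    "\<And>z z' w. z \<in> halfspace \<Longrightarrow> z' \<in> halfspace \<Longrightarrow> w \<in> halfspace \<Longrightarrow> dist z w \<le> \<delta> \<Longrightarrow> dist z' w \<le> \<delta> \<Longrightarrow>
       \<bar>\<phi> z' - \<phi> z - (z' - z) \<bullet> G w\<bar> \<le> \<epsilon> * norm (z' - z)"
  by (rule gradient_uniform_linearization[OF halfspace G_cont deriv K(1) G_0 assms]) (assumption, assumption, rule that, blast+)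

lemma lipschitz:
  assumes g: "\<And>z. z \<in> halfspace \<Longrightarrow> norm (G z) \<le> g" and z: "z \<in> halfspace" "z' \<in> halfspace"
  shows "\<bar>\<phi> z' - \<phi> z\<bar> \<le> g * norm (z' - z)"
proof -
  have "norm (\<phi> z' - \<phi> z) \<le> g * norm (z' - z)"
  proof (rule differentiable_bound[OF halfspace(1) deriv _ z(2,1)])
    fix w assume w: "w \<in> halfspace"
    show "onorm (\<lambda>h. h \<bullet> G w) \<le> g"
    proof (rule onorm_le)
      fix h
      have "norm (h \<bullet> G w) \<le> norm h * norm (G w)" by (simp add: Cauchy_Schwarz_ineq2)
      also have "\<dots> \<le> norm h * g" using g[OF w] by (intro mult_left_mono) auto
      finally show "norm (h \<bullet> G w) \<le> g * norm h" by (simp add: mult.commute)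
    qed
  qed
  then show ?thesis by (simp only: real_norm_def)
qed

lemma phi_cont: "continuous_on halfspace \<phi>"
  by (rule has_derivative_continuous_on[OF deriv])

lemma phi_cont_slice: "0 \<le> t \<Longrightarrow> continuous_on UNIV (\<lambda>x. \<phi> (x, t))"
  by (rule continuous_on_compose2[OF phi_cont]) (auto intro!: continuous_intros)

lemma phi_bound: obtains B where "0 \<le> B" "\<And>z. z \<in> halfspace \<Longrightarrow> \<bar>\<phi> z\<bar> \<le> B"
  by (rule bounded_continuous_zero_outside_compact[OF halfspace(2) phi_cont K(1) phi_0])
     (assumption, rule that, simp_all only: real_norm_def)

lemma space_margin: obtains \<rho> where "0 < \<rho>" "\<And>x t. (x, t) \<in> K \<Longrightarrow> cball x \<rho> \<subseteq> \<Omega>"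
proof -
  have c: "compact (fst ` K)" using K(1) by (intro compact_continuous_image continuous_intros)
  have "fst ` K \<subseteq> \<Omega>" using K(2) by auto
  from compact_subset_open_imp_cball_epsilon_subset[OF c open_dom' this]
  obtain e where "e > 0" "(\<Union>x\<in>fst ` K. cball x e) \<subseteq> \<Omega>" by blast
  then show thesis by (intro that[of e]) force+
qed

lemma time_margin: obtains \<tau> where "0 < \<tau>" "\<And>x t. T - \<tau> \<le> t \<Longrightarrow> (x, t) \<notin> K"
proof (cases "K = {}")
  case False
  have c: "compact (snd ` K)" using K(1) by (intro compact_continuous_image continuous_intros)
  obtain s where s: "s \<in> snd ` K" "\<And>t. t \<in> snd ` K \<Longrightarrow> t \<le> s"
    using compact_attains_sup[OF c] False by auto
  have "s < T" using s(1) K(2) by auto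
  show thesis
  proof (rule that[of "(T - s) / 2"])
    show "0 < (T - s) / 2" using \<open>s < T\<close> by simp
    show "(x, t) \<notin> K" if "T - (T - s) / 2 \<le> t" for x t
    proof
      assume "(x, t) \<in> K"
      then have "t \<le> s" using s(2) by force
      then show False using that \<open>s < T\<close> by (simp add: field_simps)
    qed
  qed
qed (rule that[of 1], auto)

end

definition cell_average :: "scheme \<Rightarrow> (point \<times> real \<Rightarrow> real) \<Rightarrow> point set \<Rightarrow> nat \<Rightarrow> real" where
  "cell_average d \<phi> P n = 1 / area P * (LINT x:P|lebesgue. \<phi> (x, tm d n))"

context staggered_scheme
begin

abbreviation avg :: "(point \<times> real \<Rightarrow> real) \<Rightarrow> point set \<Rightarrow> nat \<Rightarrow> real" where
  "avg \<equiv> cell_average d"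

lemma cell_lmeasurable: "P \<in> cells d \<Longrightarrow> P \<in> lmeasurable"
  using cell_facts(1,2) by (simp add: lmeasurable_open)

lemma cell_integrable:
  assumes P: "P \<in> cells d" and f: "continuous_on UNIV (f :: point \<Rightarrow> real)"
  shows "set_integrable lebesgue P f"
proof -
  have c: "compact (closure P)" using cell_facts(2)[OF P] by simp
  have i: "integrable lborel (\<lambda>x. indicator (closure P) x *\<^sub>R f x)"
    by (rule borel_integrable_compact[OF c]) (rule continuous_on_subset[OF f], simp)
  then have "set_integrable lebesgue (closure P) f"
    unfolding set_integrable_def using integrable_completion[OF borel_measurable_integrable[OF i]] by blast
  then show ?thesis
    using cell_facts(1)[OF P] closure_subset by (elim set_integrable_subset) (auto simp: sets_completionI_sets)
qed

text \<open>Applied to increments of \<open>\<phi>\<close>: a bound at every point of a cell passes to the cell averages.\<close>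

lemma average_near:
  assumes P: "P \<in> cells d" and f: "continuous_on UNIV (f :: point \<Rightarrow> real)" and b: "\<And>x. x \<in> P \<Longrightarrow> \<bar>f x - c\<bar> \<le> e"
  shows "\<bar>1 / area P * (LINT x:P|lebesgue. f x) - c\<bar> \<le> e"
proof -
  have L: "P \<in> lmeasurable" by (rule cell_lmeasurable[OF P])
  have a: "0 < area P" by (rule cell_facts(3)[OF P])
  have I: "set_integrable lebesgue P f" by (rule cell_integrable[OF P f])
  have Ic: "set_integrable lebesgue P (\<lambda>_. k::real)" for k using L
    by (simp add: set_integrable_def lmeasurable_iff_integrable)
  have k: "(LINT x:P|lebesgue. k) = area P * k" for k :: real
    using L by (simp add: set_lebesgue_integral_def fmeasurable_def)
  have "(LINT x:P|lebesgue. f x) \<le> (LINT x:P|lebesgue. c + e)"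
    by (rule set_integral_mono[OF I Ic]) (use b in fastforce)
  moreover have "(LINT x:P|lebesgue. c - e) \<le> (LINT x:P|lebesgue. f x)"
    by (rule set_integral_mono[OF Ic I]) (use b in fastforce)
  ultimately have "area P * (c - e) \<le> (LINT x:P|lebesgue. f x)" "(LINT x:P|lebesgue. f x) \<le> area P * (c + e)"
    unfolding k by auto
  then have "c - e \<le> (LINT x:P|lebesgue. f x) / area P" "(LINT x:P|lebesgue. f x) / area P \<le> c + e"
    using a by (auto simp: field_simps)
  then show ?thesis by (simp add: abs_le_iff)
qed

lemma cell_area_in_domain: "P \<in> cells d \<Longrightarrow> area (P \<inter> \<Omega>) = area P"
proof -
  assume P: "P \<in> cells d"
  have "negligible ((P - P \<inter> \<Omega>) \<union> (P \<inter> \<Omega> - P))"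
    by (rule negligible_subset[OF cells_cover(2)[OF mesh polyhedral_dom]]) (use cell_sub[OF P] in auto)
  then show ?thesis by (rule measure_negligible_symdiff[OF cell_lmeasurable[OF P]])
qed

text \<open>Both factors are constant on the same boxes, and the open time intervals differ from the half-open
  ones by null sets.\<close>

lemma scheme_integral:
  "(LINT t:{0<..<T}|lebesgue. LINT x:\<Omega>|lebesgue. conv_fun \<beta> g d (x, t) * interpolate d \<phi> (x, t))
    = (\<Sum>P\<in>cells d. \<Sum>n<nsteps d. dt n * area P * (conv_val \<beta> g d P n * avg \<phi> P n))"
proof -
  let ?c = "\<lambda>P n. conv_val \<beta> g d P n * avg \<phi> P n"
  let ?o = "\<lambda>n. {tm d n<..<tm d (Suc n)}"
  have oS: "?o n \<subseteq> slab n" for n by auto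
  have prod: "conv_fun \<beta> g d (x, t) * interpolate d \<phi> (x, t)
      = (\<Sum>P\<in>cells d. \<Sum>n<nsteps d. ?c P n * (indicator P x * indicator (?o n) t))" for x t
  proof (cases "\<exists>P\<in>cells d. \<exists>n<nsteps d. x \<in> P \<and> t \<in> ?o n")
    case True
    then obtain P n where P: "P \<in> cells d" "n < nsteps d" "x \<in> P" "t \<in> ?o n" by blast
    have tS: "t \<in> slab n" using P(4) by auto
    note pv = piecewise_value[where S = ?o, OF P(1,2,3) tS oS P(4)]
    show ?thesis
      unfolding conv_fun_def interpolate_def indicator_times[symmetric] cell_average_def
      using pv[of "conv_val \<beta> g d"] pv[of "avg \<phi>"] pv[of ?c] by (simp add: cell_average_def indicator_times)
  next
    case False
    have "conv_fun \<beta> g d (x, t) = 0" unfolding conv_fun_def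
      by (intro sum.neutral ballI) (use False in \<open>auto simp: indicator_def\<close>)
    moreover have "(\<Sum>P\<in>cells d. \<Sum>n<nsteps d. ?c P n * (indicator P x * indicator (?o n) t)) = 0"
      by (intro sum.neutral ballI) (use False in \<open>auto simp: indicator_def\<close>)
    ultimately show ?thesis by simp
  qed
  have iP: "integrable lebesgue (\<lambda>x. indicator \<Omega> x *\<^sub>R (k * (indicator P x * m)))" 
    "(LINT x|lebesgue. indicator \<Omega> x *\<^sub>R (k * (indicator P x * m))) = area P * (k * m)" if P: "P \<in> cells d" for P and k m :: real
  proof -
    have "open (P \<inter> \<Omega>)" "bounded (P \<inter> \<Omega>)" using cell_facts(1,2)[OF P] open_dom bounded_dom by auto
    then have L: "P \<inter> \<Omega> \<in> lmeasurable" by (intro lmeasurable_open)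
    have e: "(\<lambda>x. indicator \<Omega> x *\<^sub>R (k * (indicator P x * m))) = (\<lambda>x. indicator (P \<inter> \<Omega>) x * (k * m))"
      by (auto simp: indicator_def)
    show "integrable lebesgue (\<lambda>x. indicator \<Omega> x *\<^sub>R (k * (indicator P x * m)))"
      unfolding e using L by (intro integrable_mult_left integrable_real_indicator) (auto simp: fmeasurable_def)
    show "(LINT x|lebesgue. indicator \<Omega> x *\<^sub>R (k * (indicator P x * m))) = area P * (k * m)"
      unfolding e using L cell_area_in_domain[OF P] by (simp add: fmeasurable_def)
  qed
  have inner: "(LINT x:\<Omega>|lebesgue. conv_fun \<beta> g d (x, t) * interpolate d \<phi> (x, t))
    = (\<Sum>P\<in>cells d. \<Sum>n<nsteps d. area P * ?c P n * indicator (?o n) t)" for t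
  proof -
    have "(LINT x:\<Omega>|lebesgue. conv_fun \<beta> g d (x, t) * interpolate d \<phi> (x, t))
      = (LINT x|lebesgue. (\<Sum>P\<in>cells d. \<Sum>n<nsteps d. indicator \<Omega> x *\<^sub>R (?c P n * (indicator P x * indicator (?o n) t))))"
      unfolding prod set_lebesgue_integral_def real_scaleR_def sum_distrib_left ..
    also have "\<dots> = (\<Sum>P\<in>cells d. \<Sum>n<nsteps d. (LINT x|lebesgue. indicator \<Omega> x *\<^sub>R (?c P n * (indicator P x * indicator (?o n) t))))"
      by (rule integral_double_sum) (rule iP(1))
    also have "\<dots> = (\<Sum>P\<in>cells d. \<Sum>n<nsteps d. area P * (?c P n * indicator (?o n) t))"
      using iP(2) by (intro sum.cong refl) auto
    finally show ?thesis by (simp add: mult.assoc)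
  qed
  have it: "integrable lebesgue (\<lambda>t. indicator {0<..<T} t *\<^sub>R (k * indicator (?o n) t))"
    "(LINT t|lebesgue. indicator {0<..<T} t *\<^sub>R (k * indicator (?o n) t)) = dt n * k" if n: "n < nsteps d" for n and k :: real
  proof -
    have "?o n \<subseteq> {0<..<T}" using grid_facts(3)[of n] grid_facts(4)[of "Suc n"] n by auto
    then have e: "(\<lambda>t. indicator {0<..<T} t *\<^sub>R (k * indicator (?o n) t)) = (\<lambda>t. indicator (?o n) t * k)"
      by (auto simp: indicator_def fun_eq_iff)
    have L: "?o n \<in> lmeasurable" by (intro lmeasurable_open) auto
    show "integrable lebesgue (\<lambda>t. indicator {0<..<T} t *\<^sub>R (k * indicator (?o n) t))"
      unfolding e using L by (intro integrable_mult_left integrable_real_indicator) (auto simp: fmeasurable_def)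
    show "(LINT t|lebesgue. indicator {0<..<T} t *\<^sub>R (k * indicator (?o n) t)) = dt n * k"
      unfolding e using L dt_pos[OF n] by (simp add: fmeasurable_def measure_completion)
  qed
  have "(LINT t:{0<..<T}|lebesgue. LINT x:\<Omega>|lebesgue. conv_fun \<beta> g d (x, t) * interpolate d \<phi> (x, t))
    = (LINT t|lebesgue. (\<Sum>P\<in>cells d. \<Sum>n<nsteps d. indicator {0<..<T} t *\<^sub>R (area P * ?c P n * indicator (?o n) t)))"
    unfolding inner unfolding set_lebesgue_integral_def real_scaleR_def sum_distrib_left ..
  also have "\<dots> = (\<Sum>P\<in>cells d. \<Sum>n<nsteps d. (LINT t|lebesgue. indicator {0<..<T} t *\<^sub>R (area P * ?c P n * indicator (?o n) t)))"
    by (rule integral_double_sum) (rule it(1), simp)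
  also have "\<dots> = (\<Sum>P\<in>cells d. \<Sum>n<nsteps d. dt n * (area P * ?c P n))"
    using it(2) by (intro sum.cong refl) auto
  finally show ?thesis by (simp add: mult.assoc)
qed

lemma diameter_le_mesh_size: "P \<in> cells d \<Longrightarrow> diameter P \<le> mesh_size d"
  unfolding mesh_size_def using cell_mesh(1) by (intro le_max0) auto

lemma dt_le_time_step: "n < nsteps d \<Longrightarrow> dt n \<le> time_step d"
  unfolding time_step_def by (intro le_max0) auto

lemma diameter_square_le: "P \<in> cells d \<Longrightarrow> theta1 d \<le> \<theta> \<Longrightarrow> (diameter P)\<^sup>2 \<le> \<theta> * area P"
proof -
  assume P: "P \<in> cells d" and t: "theta1 d \<le> \<theta>"
  have "(diameter P)\<^sup>2 / area P \<le> theta1 d" unfolding theta1_def using cell_mesh(1) P by (intro le_max0) auto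
  then have "(diameter P)\<^sup>2 / area P \<le> \<theta>" using t by linarith
  then show ?thesis using cell_facts(3)[OF P] by (simp add: field_simps)
qed

lemma adjacent_area_le: "adjacent d P Q \<Longrightarrow> theta2 d \<le> \<theta> \<Longrightarrow> area P \<le> \<theta> * area Q"
proof -
  assume a: "adjacent d P Q" and t: "theta2 d \<le> \<theta>"
  have "finite {area P / area Q | P Q. adjacent d P Q}"
    by (rule finite_subset[of _ "(\<lambda>(P, Q). area P / area Q) ` (cells d \<times> cells d)"])
       (use cell_mesh(1) in \<open>auto simp: adjacent_def\<close>)
  then have "area P / area Q \<le> theta2 d" unfolding theta2_def using a by (intro le_max0) auto
  then have "area P / area Q \<le> \<theta>" using t by linarith
  moreover have "0 < area Q" using a cell_facts(3) by (auto simp: adjacent_def)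
  ultimately show ?thesis by (simp add: field_simps)
qed

lemma dt_ratio: "1 \<le> n \<Longrightarrow> n < nsteps d \<Longrightarrow> theta3 d \<le> \<theta> \<Longrightarrow> dt (n - 1) \<le> \<theta> * dt n"
proof -
  assume n: "1 \<le> n" "n < nsteps d" and t: "theta3 d \<le> \<theta>"
  have "max ((tm d (n + 1) - tm d n) / (tm d n - tm d (n - 1))) ((tm d n - tm d (n - 1)) / (tm d (n + 1) - tm d n)) \<le> theta3 d"
    unfolding theta3_def using n by (intro le_max0 finite_imageI imageI) auto
  then have "(tm d n - tm d (n - 1)) / (tm d (n + 1) - tm d n) \<le> \<theta>" using t by linarith
  then show ?thesis using dt_pos[OF n(2)] n(1) by (simp add: field_simps)
qed

lemma theta_nonneg: "theta1 d \<le> \<theta> \<Longrightarrow> 0 \<le> \<theta>"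
  using max0_nonneg[of "(\<lambda>P. (diameter P)\<^sup>2 / area P) ` cells d"] cell_mesh(1) by (simp add: theta1_def)

lemma box_overlap:
  assumes S: "S \<subseteq> {..<nsteps d}"
  shows "(\<Sum>k\<in>cells d \<times> S. indicator (fst k \<times> slab (snd k)) z) \<le> (1::real)"
proof (cases "\<exists>k\<in>cells d \<times> S. z \<in> fst k \<times> slab (snd k)")
  case True
  then obtain P n where k: "P \<in> cells d" "n \<in> S" "z \<in> P \<times> slab n" by auto
  have f: "finite (cells d \<times> S)" using cell_mesh(1) S finite_subset by blast
  have "(\<Sum>k\<in>cells d \<times> S. indicator (fst k \<times> slab (snd k)) z) = (\<Sum>k\<in>cells d \<times> S. if k = (P, n) then (1::real) else 0)"
  proof (intro sum.cong refl)
    fix k assume "k \<in> cells d \<times> S"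
    then obtain Q m where q: "k = (Q, m)" "Q \<in> cells d" "m \<in> S" by auto
    have "z \<in> Q \<times> slab m \<longleftrightarrow> k = (P, n)"
      using q k cell_unique[of Q P "fst z"] grid_facts(7)[of m n "snd z"] S by (auto simp: mem_Times_iff)
    then show "indicator (fst k \<times> slab (snd k)) z = (if k = (P, n) then (1::real) else 0)"
      using q(1) by (simp add: indicator_def)
  qed
  also have "\<dots> = 1" using f k by (simp add: sum.delta)
  finally show ?thesis by simp
next
  case False
  then have "(\<Sum>k\<in>cells d \<times> S. indicator (fst k \<times> slab (snd k)) z) = (0::real)"
    by (intro sum.neutral) (auto simp: indicator_def)
  then show ?thesis by simp
qed

lemma box_disjoint: "disjoint_family_on (\<lambda>k. fst k \<times> slab (snd k)) (cells d \<times> {..<nsteps d})"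
  unfolding disjoint_family_on_def
proof (intro ballI impI, rule equals0I)
  fix k l z assume k: "k \<in> cells d \<times> {..<nsteps d}" and l: "l \<in> cells d \<times> {..<nsteps d}" and kl: "k \<noteq> l"
    and z: "z \<in> fst k \<times> slab (snd k) \<inter> fst l \<times> slab (snd l)"
  have "fst k = fst l" using cell_unique[of "fst k" "fst l" "fst z"] k l z by auto
  moreover have "snd k = snd l" using grid_facts(7)[of "snd k" "snd l" "snd z"] k l z by auto
  ultimately show False using kl by (simp add: prod_eq_iff)
qed

lemma subcell_overlap:
  "(\<Sum>k\<in>cells d \<times> {..<nsteps d}. \<Sum>\<zeta>\<in>comp_edges i (fst k). indicator (subcell d (fst k) \<zeta> \<times> slab (snd k)) z) \<le> (4::real)"
proof -
  have "(\<Sum>k\<in>cells d \<times> {..<nsteps d}. \<Sum>\<zeta>\<in>comp_edges i (fst k). indicator (subcell d (fst k) \<zeta> \<times> slab (snd k)) z)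
    \<le> (\<Sum>k\<in>cells d \<times> {..<nsteps d}. 4 * indicator (fst k \<times> slab (snd k)) z :: real)"
  proof (rule sum_mono)
    fix k assume k: "k \<in> cells d \<times> {..<nsteps d}"
    then have P: "fst k \<in> cells d" by auto
    have "(\<Sum>\<zeta>\<in>comp_edges i (fst k). indicator (subcell d (fst k) \<zeta> \<times> slab (snd k)) z)
      \<le> (\<Sum>\<zeta>\<in>comp_edges i (fst k). indicator (fst k \<times> slab (snd k)) z :: real)"
      using subcell_facts(2)[OF P] by (intro sum_mono) (auto simp: indicator_def)
    also have "\<dots> = real (card (comp_edges i (fst k))) * indicator (fst k \<times> slab (snd k)) z" by simp
    also have "\<dots> \<le> 4 * indicator (fst k \<times> slab (snd k)) z"
      using finite_comp_edges(2)[OF P, of i] by (intro mult_right_mono) auto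
    finally show "(\<Sum>\<zeta>\<in>comp_edges i (fst k). indicator (subcell d (fst k) \<zeta> \<times> slab (snd k)) z)
       \<le> (4 * indicator (fst k \<times> slab (snd k)) z :: real)" .
  qed
  also have "\<dots> = 4 * (\<Sum>k\<in>cells d \<times> {..<nsteps d}. indicator (fst k \<times> slab (snd k)) z)"
    by (simp add: sum_distrib_left)
  also have "\<dots> \<le> 4 * 1" by (intro mult_left_mono box_overlap) auto
  finally show ?thesis by simp
qed

lemma dist_box:
  assumes P: "P \<in> cells d" and n: "m < nsteps d" and x: "x \<in> closure P" "y \<in> closure P" and t: "t \<in> {tm d m..tm d (Suc m)}" "s \<in> {tm d m..tm d (Suc m)}"
  shows "dist (x, t) (y, s) \<le> mesh_size d + time_step d"
proof -
  have b: "bounded (closure P)" using cell_facts(2)[OF P] by (rule bounded_closure)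
  have "dist x y \<le> diameter P" using diameter_bounded_bound[OF b x] diameter_closure[OF cell_facts(2)[OF P]] by simp
  then have "dist x y \<le> mesh_size d" using diameter_le_mesh_size[OF P] by linarith
  moreover have "dist t s \<le> time_step d" using t dt_le_time_step[OF n] by (auto simp: dist_real_def)
  moreover have "dist (x, t) (y, s) \<le> dist x y + dist t s"
    unfolding dist_Pair_Pair by (rule sqrt_sum_squares_le_sum) auto
  ultimately show ?thesis by linarith
qed

end

section \<open>Jumps across edges\<close>

text \<open>Pairs of a cell and one of its shared edges: each shared edge is counted once from either side.\<close>

definition inner_edges :: "scheme \<Rightarrow> (point set \<times> point set) set" where
  "inner_edges d = {(P, \<zeta>). P \<in> cells d \<and> \<zeta> \<in> edges d P \<and> (\<exists>Q\<in>cells d. Q \<noteq> P \<and> \<zeta> \<in> edges d Q)}"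

definition neighbour :: "scheme \<Rightarrow> point set \<Rightarrow> point set \<Rightarrow> point set" where
  "neighbour d P \<zeta> = (SOME Q. Q \<in> cells d \<and> Q \<noteq> P \<and> \<zeta> \<in> edges d Q)"

context staggered_scheme
begin

text \<open>Of three normals at least two would coincide.\<close>

lemma edge_two_cells:
  assumes P: "P \<in> cells d" "\<zeta> \<in> edges d P" and Q: "Q \<in> cells d" "\<zeta> \<in> edges d Q" "Q \<noteq> P"
    and R: "R \<in> cells d" "\<zeta> \<in> edges d R" "R \<noteq> P"
  shows "R = Q"
proof (rule ccontr)
  assume RQ: "R \<noteq> Q"
  have op: "outward_normal B \<zeta> = - outward_normal A \<zeta>"
    if "A \<in> cells d" "\<zeta> \<in> edges d A" "B \<in> cells d" "\<zeta> \<in> edges d B" "B \<noteq> A" for A B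
    using common_edge_normals[OF cell_mesh(4)[OF that(1)] that(2) cell_mesh(4)[OF that(3)] that(4)]
      cell_mesh(2)[OF that(1,3)] that(5) by blast
  have "outward_normal R \<zeta> = - outward_normal P \<zeta>" "outward_normal R \<zeta> = - outward_normal Q \<zeta>"
    "outward_normal Q \<zeta> = - outward_normal P \<zeta>"
    using op[OF P R] op[OF Q(1,2) R(1,2) RQ] op[OF P Q] .
  then have "outward_normal P \<zeta> = - outward_normal P \<zeta>" by simp
  then have "outward_normal P \<zeta> = 0" by (simp add: point_eq_iff)
  then show False using edge_facts(1)[OF P] by simp
qed

lemma neighbour:
  assumes "(P, \<zeta>) \<in> inner_edges d"
  shows "neighbour d P \<zeta> \<in> cells d" "neighbour d P \<zeta> \<noteq> P" "\<zeta> \<in> edges d (neighbour d P \<zeta>)"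
    "adjacent d P (neighbour d P \<zeta>)" "(neighbour d P \<zeta>, \<zeta>) \<in> inner_edges d"
    "neighbour d (neighbour d P \<zeta>) \<zeta> = P"
proof -
  have P: "P \<in> cells d" "\<zeta> \<in> edges d P" using assms by (auto simp: inner_edges_def)
  have "\<exists>Q. Q \<in> cells d \<and> Q \<noteq> P \<and> \<zeta> \<in> edges d Q" using assms by (auto simp: inner_edges_def)
  from someI_ex[OF this] have n: "neighbour d P \<zeta> \<in> cells d \<and> neighbour d P \<zeta> \<noteq> P \<and> \<zeta> \<in> edges d (neighbour d P \<zeta>)"
    unfolding neighbour_def .
  then show "neighbour d P \<zeta> \<in> cells d" "neighbour d P \<zeta> \<noteq> P" "\<zeta> \<in> edges d (neighbour d P \<zeta>)" by blast+
  show "adjacent d P (neighbour d P \<zeta>)" using n P by (auto simp: adjacent_def)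
  show i: "(neighbour d P \<zeta>, \<zeta>) \<in> inner_edges d" using n P by (auto simp: inner_edges_def)
  have "\<exists>Q. Q \<in> cells d \<and> Q \<noteq> neighbour d P \<zeta> \<and> \<zeta> \<in> edges d Q" using n P by metis
  from someI_ex[OF this] have "neighbour d (neighbour d P \<zeta>) \<zeta> \<in> cells d"
    "neighbour d (neighbour d P \<zeta>) \<zeta> \<noteq> neighbour d P \<zeta>" "\<zeta> \<in> edges d (neighbour d (neighbour d P \<zeta>) \<zeta>)"
    unfolding neighbour_def by blast+
  then show "neighbour d (neighbour d P \<zeta>) \<zeta> = P"
    using edge_two_cells[of "neighbour d P \<zeta>" \<zeta> P "neighbour d (neighbour d P \<zeta>) \<zeta>"] n P by blast
qed

lemma inner_edges_sub: "inner_edges d \<subseteq> Sigma (cells d) (edges d)"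
  by (auto simp: inner_edges_def)

lemma finite_inner_edges: "finite (inner_edges d)"
  by (rule finite_subset[OF inner_edges_sub]) (use cell_mesh(1) cell_facts(4) in auto)

lemma inner_edges_overlap:
  "(\<Sum>k\<in>inner_edges d \<times> {..<nsteps d}. indicator (fst (fst k) \<times> slab (snd k)) z) \<le> (4::real)"
    (is "?L \<le> _")
proof -
  have f: "finite (Sigma (cells d) (edges d))" using cell_mesh(1) cell_facts(4) by auto
  have "?L \<le> (\<Sum>k\<in>Sigma (cells d) (edges d) \<times> {..<nsteps d}. indicator (fst (fst k) \<times> slab (snd k)) z)"
    using f inner_edges_sub by (intro sum_mono2) auto
  also have "\<dots> = (\<Sum>e\<in>Sigma (cells d) (edges d). \<Sum>n<nsteps d. indicator (fst e \<times> slab n) z)"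
    by (subst sum.cartesian_product) (simp add: case_prod_unfold)
  also have "\<dots> = (\<Sum>P\<in>cells d. \<Sum>\<zeta>\<in>edges d P. \<Sum>n<nsteps d. indicator (P \<times> slab n) z)"
    using cell_mesh(1) cell_facts(4) by (subst sum.Sigma) (auto simp: case_prod_unfold)
  also have "\<dots> = (\<Sum>P\<in>cells d. 4 * (\<Sum>n<nsteps d. indicator (P \<times> slab n) z))"
    using cell_facts(5) by (intro sum.cong refl) simp
  also have "\<dots> = 4 * (\<Sum>P\<in>cells d. \<Sum>n<nsteps d. indicator (P \<times> slab n) z)"
    by (simp only: sum_distrib_left)
  also have "(\<Sum>P\<in>cells d. \<Sum>n<nsteps d. indicator (P \<times> slab n) z)
     = (\<Sum>k\<in>cells d \<times> {..<nsteps d}. indicator (fst k \<times> slab (snd k)) z)"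
    by (subst sum.cartesian_product) (simp add: case_prod_unfold)
  also have "4 * \<dots> \<le> 4 * (1::real)" by (intro mult_left_mono box_overlap) auto
  finally show ?thesis by simp
qed

lemma inner_edges_overlap':
  "(\<Sum>k\<in>inner_edges d \<times> {..<nsteps d}. indicator (neighbour d (fst (fst k)) (snd (fst k)) \<times> slab (snd k)) z) \<le> (4::real)"
proof -
  \<comment> \<open>step to the other side of the edge\<close>
  let ?s = "\<lambda>k :: (point set \<times> point set) \<times> nat. ((neighbour d (fst (fst k)) (snd (fst k)), snd (fst k)), snd k)"
  have inv: "?s k \<in> inner_edges d \<times> {..<nsteps d}" "?s (?s k) = k" if "k \<in> inner_edges d \<times> {..<nsteps d}" for k
    using that neighbour(5,6)[of "fst (fst k)" "snd (fst k)"] by (auto simp: prod_eq_iff mem_Times_iff)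
  have "(\<Sum>k\<in>inner_edges d \<times> {..<nsteps d}. indicator (neighbour d (fst (fst k)) (snd (fst k)) \<times> slab (snd k)) z)
    = (\<Sum>k\<in>inner_edges d \<times> {..<nsteps d}. indicator (fst (fst k) \<times> slab (snd k)) z :: real)"
    by (rule sum.reindex_bij_witness[of _ ?s ?s]) (use inv in auto)
  then show ?thesis using inner_edges_overlap[of z] by simp
qed

end

text \<open>The boxes of the two cells at an inner edge have comparable areas by the bound on \<open>theta2\<close>.
  The map sending a cell and an edge to the cell on the other side is an involution, so both families have overlap at most 4.\<close>

lemma q_jump_small:
  fixes f :: "point \<times> real \<Rightarrow> real" and \<Omega> T
  defines "X \<equiv> closure \<Omega> \<times> {0..T}"
  assumes bd: "bounded \<Omega>" and f: "f \<in> borel_measurable (lebesgue_on X)"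
    and C: "AE z in lebesgue_on X. \<bar>f z\<bar> \<le> C" "0 \<le> C" and \<epsilon>: "0 < \<epsilon>"
  obtains \<delta> where "0 < \<delta>" 
    "\<And>A d. \<lbrakk>staggered_scheme A \<Omega> T d; theta2 d \<le> \<theta>; mesh_size d + time_step d \<le> \<delta>;
        integrable (lebesgue_on X) (q_fun d); (LINT z|lebesgue_on X. \<bar>q_fun d z - f z\<bar>) \<le> \<delta>\<rbrakk>
      \<Longrightarrow> (\<Sum>k\<in>inner_edges d \<times> {..<nsteps d}. area (fst (fst k)) * (tm d (Suc (snd k)) - tm d (snd k)) *
            \<bar>qval d (fst (fst k)) (snd k) - qval d (neighbour d (fst (fst k)) (snd (fst k))) (snd k)\<bar>) \<le> \<epsilon>"
proof -
  have X: "compact X" unfolding X_def using bd by (intro compact_Times) auto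
  have Xs: "X \<in> sets lebesgue" using lmeasurable_compact[OF X] by (simp add: fmeasurable_def)
  have c0: "0 \<le> max 1 \<theta>" by simp
  show thesis
  proof (rule jump_sum_small[where 'k = "(point set \<times> point set) \<times> nat", OF X f C \<epsilon> c0, of 4], goal_cases)
    case (2 \<delta>)
    note \<delta> = 2(1) and J = 2(2)
  show thesis
  proof (rule that[OF \<delta>])
    fix A d assume "staggered_scheme A \<Omega> T d" and th: "theta2 d \<le> \<theta>" and h: "mesh_size d + time_step d \<le> \<delta>"
      and i: "integrable (lebesgue_on X) (q_fun d)" "(LINT z|lebesgue_on X. \<bar>q_fun d z - f z\<bar>) \<le> \<delta>"
    then interpret staggered_scheme A \<Omega> T d by simp
    let ?nb = "\<lambda>k :: (point set \<times> point set) \<times> nat. neighbour d (fst (fst k)) (snd (fst k))"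
    have k: "fst (fst k) \<in> cells d" "?nb k \<in> cells d" "snd (fst k) \<in> edges d (fst (fst k))" "snd (fst k) \<in> edges d (?nb k)"
      "adjacent d (fst (fst k)) (?nb k)" "snd k < nsteps d"
      if "k \<in> inner_edges d \<times> {..<nsteps d}" for k
    proof -
      have e: "(fst (fst k), snd (fst k)) \<in> inner_edges d" using that by (auto simp: mem_Times_iff)
      show "?nb k \<in> cells d" "snd (fst k) \<in> edges d (?nb k)" "adjacent d (fst (fst k)) (?nb k)"
        by (rule neighbour[OF e])+
      show "fst (fst k) \<in> cells d" "snd (fst k) \<in> edges d (fst (fst k))"
        using e unfolding inner_edges_def by blast+
      show "snd k < nsteps d" using that by auto
    qed
    note b1 = box_facts[OF cell_facts(1)[OF k(1)] subset_refl k(1) k(6)]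
    note b2 = box_facts[OF cell_facts(1)[OF k(2)] subset_refl k(2) k(6)]
    show "(\<Sum>k\<in>inner_edges d \<times> {..<nsteps d}. area (fst (fst k)) * dt (snd k) * \<bar>qval d (fst (fst k)) (snd k) - qval d (?nb k) (snd k)\<bar>) \<le> \<epsilon>"
    proof (rule J[OF i, where A = "\<lambda>k. fst (fst k) \<times> slab (snd k)" and A' = "\<lambda>k. ?nb k \<times> slab (snd k)"
          and p = "\<lambda>k. (edge_mid (snd (fst k)), tm d (snd k))"])
      show "finite (inner_edges d \<times> {..<nsteps d})" using finite_inner_edges by simp
      fix z
      show "(\<Sum>k\<in>inner_edges d \<times> {..<nsteps d}. indicator (fst (fst k) \<times> slab (snd k)) z) \<le> (4::real)"
        by (rule inner_edges_overlap)
      show "(\<Sum>k\<in>inner_edges d \<times> {..<nsteps d}. indicator (?nb k \<times> slab (snd k)) z) \<le> (4::real)"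
        by (rule inner_edges_overlap')
    next
      fix k assume kk: "k \<in> inner_edges d \<times> {..<nsteps d}"
      have dtp: "0 < dt (snd k)" by (rule dt_pos[OF k(6)[OF kk]])
      have ap: "0 < area (fst (fst k))" by (rule cell_facts(3)[OF k(1)[OF kk]])
      have "edge_mid (snd (fst k)) \<in> closure (fst (fst k))" by (rule edge_facts(3)[OF k(1)[OF kk] k(3)[OF kk]])
      then have m1: "edge_mid (snd (fst k)) \<in> closure \<Omega>" using cell_closure_sub[OF k(1)[OF kk]] by blast
      have "0 \<le> tm d (snd k)" "tm d (snd k) \<le> T" using grid_facts(3,4)[of "snd k"] k(6)[OF kk] by auto
      then have pX: "(edge_mid (snd (fst k)), tm d (snd k)) \<in> X" unfolding X_def using m1 by simp
      show "fst (fst k) \<times> slab (snd k) \<in> sets lebesgue \<and> ?nb k \<times> slab (snd k) \<in> sets lebesgue \<and>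
          fst (fst k) \<times> slab (snd k) \<subseteq> X \<and> ?nb k \<times> slab (snd k) \<subseteq> X \<and> (edge_mid (snd (fst k)), tm d (snd k)) \<in> X"
        using b1(1,3)[OF kk kk kk] b2(1,3)[OF kk kk kk] pX unfolding X_def by (auto dest: fmeasurableD)
      show "0 \<le> area (fst (fst k)) * dt (snd k)" using dtp ap by simp
      show "area (fst (fst k)) * dt (snd k) \<le> max 1 \<theta> * measure lebesgue (fst (fst k) \<times> slab (snd k))"
        unfolding b1(2)[OF kk kk kk] using dtp ap mult_right_mono[of 1 "max 1 \<theta>" "area (fst (fst k)) * dt (snd k)"] by simp
      have "area (fst (fst k)) \<le> \<theta> * area (?nb k)" by (rule adjacent_area_le[OF k(5)[OF kk] th])
      also have "\<dots> \<le> max 1 \<theta> * area (?nb k)" by (intro mult_right_mono) auto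
      finally have "area (fst (fst k)) * dt (snd k) \<le> max 1 \<theta> * area (?nb k) * dt (snd k)" using dtp by (intro mult_right_mono) auto
      then show "area (fst (fst k)) * dt (snd k) \<le> max 1 \<theta> * measure lebesgue (?nb k \<times> slab (snd k))"
        unfolding b2(2)[OF kk kk kk] by (simp add: mult.assoc)
      show "measure lebesgue (fst (fst k) \<times> slab (snd k)) * qval d (fst (fst k)) (snd k)
         = (LINT z|lebesgue_on X. indicator (fst (fst k) \<times> slab (snd k)) z * q_fun d z)"
        by (rule integral_indicator_const_on[OF Xs])
           (use b1(1,3)[OF kk kk kk] q_fun_value[OF k(1)[OF kk] k(6)[OF kk]] in \<open>auto simp: X_def\<close>)
      show "measure lebesgue (?nb k \<times> slab (snd k)) * qval d (?nb k) (snd k)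
         = (LINT z|lebesgue_on X. indicator (?nb k \<times> slab (snd k)) z * q_fun d z)"
        by (rule integral_indicator_const_on[OF Xs])
           (use b2(1,3)[OF kk kk kk] q_fun_value[OF k(2)[OF kk] k(6)[OF kk]] in \<open>auto simp: X_def\<close>)
      fix z assume "z \<in> fst (fst k) \<times> slab (snd k) \<union> ?nb k \<times> slab (snd k)"
      then obtain Q where Q: "Q \<in> cells d" "snd (fst k) \<in> edges d Q" "fst z \<in> Q" and t: "snd z \<in> slab (snd k)"
        using k(1-4)[OF kk] by (auto simp: mem_Times_iff)
      have "dist (fst z, snd z) (edge_mid (snd (fst k)), tm d (snd k)) \<le> mesh_size d + time_step d"
        by (rule dist_box[OF Q(1) k(6)[OF kk] _ edge_facts(3)[OF Q(1,2)]])
           (use t Q(3) closure_subset dtp in auto)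
      then show "dist z (edge_mid (snd (fst k)), tm d (snd k)) \<le> \<delta>" using h by simp
    qed
  qed
  qed simp
qed

section \<open>The limit of the time-derivative sum\<close>

context test_fun
begin

lemma gradient_measurable:
  assumes "compact X" "X \<subseteq> halfspace"
  shows "(\<lambda>z. snd (G z)) \<in> borel_measurable (lebesgue_on X)" "(\<lambda>z. fst (G z) $ i) \<in> borel_measurable (lebesgue_on X)"
proof -
  have Xs: "X \<in> sets lebesgue" using lmeasurable_compact[OF assms(1)] by (simp add: fmeasurable_def)
  have c: "continuous_on X G" by (rule continuous_on_subset[OF G_cont assms(2)])
  show "(\<lambda>z. snd (G z)) \<in> borel_measurable (lebesgue_on X)" "(\<lambda>z. fst (G z) $ i) \<in> borel_measurable (lebesgue_on X)"
    by (rule continuous_imp_measurable_on_sets_lebesgue[OF _ Xs], intro continuous_intros c)+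
qed

text \<open>The value at step \<open>n\<close> lives on the box after \<open>t\<^sub>n\<close>, the increment of \<open>\<phi>\<close> on the box before it. The bound on
  \<open>theta3\<close> compares the two boxes; the last box contributes nothing as \<open>\<phi>\<close> vanishes near \<open>T\<close>.\<close>

lemma time_sum_close:
  fixes b :: "point \<times> real \<Rightarrow> real"
  defines "X \<equiv> closure \<Omega> \<times> {0..T}"
  assumes bd: "bounded \<Omega>" and b: "b \<in> borel_measurable (lebesgue_on X)"
    and C: "AE z in lebesgue_on X. \<bar>b z\<bar> \<le> C" "0 \<le> C" and \<epsilon>: "0 < \<epsilon>" and \<theta>: "0 \<le> \<theta>"
  obtains \<delta> where "0 < \<delta>" 
    "\<And>A d f' a. \<lbrakk>staggered_scheme A \<Omega> T d; theta3 d \<le> \<theta>; mesh_size d + time_step d \<le> \<delta>;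
        integrable (lebesgue_on X) f'; (LINT z|lebesgue_on X. \<bar>f' z - b z\<bar>) \<le> \<delta>;
        \<And>P n x t. P \<in> cells d \<Longrightarrow> n < nsteps d \<Longrightarrow> x \<in> P \<Longrightarrow> t \<in> {tm d n..<tm d (Suc n)} \<Longrightarrow> f' (x, t) = a P n\<rbrakk>
      \<Longrightarrow> \<bar>(\<Sum>k\<in>cells d \<times> {1..<nsteps d}. area (fst k) * a (fst k) (snd k) *
              (cell_average d \<phi> (fst k) (snd k) - cell_average d \<phi> (fst k) (snd k - 1)))
            - (LINT z|lebesgue_on X. b z * snd (G z))\<bar> \<le> \<epsilon>"
proof -
  have X: "compact X" unfolding X_def using bd by (intro compact_Times) auto
  have Xh: "X \<subseteq> halfspace" unfolding X_def by auto
  have Xs: "X \<in> sets lebesgue" using lmeasurable_compact[OF X] by (simp add: fmeasurable_def)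
  obtain g where g: "0 \<le> g" "\<And>z. z \<in> halfspace \<Longrightarrow> norm (G z) \<le> g" by (rule gradient_bound, rule that, blast+)
  obtain \<tau> where \<tau>: "0 < \<tau>" "\<And>x t. T - \<tau> \<le> t \<Longrightarrow> (x, t) \<notin> K" by (rule time_margin, rule that, blast+)
  have gb: "\<bar>snd (G z)\<bar> \<le> g" if "z \<in> halfspace" for z
    using g(2)[OF that] norm_snd_le[of "snd (G z)" "fst (G z)"] by simp
  have gX: "\<bar>snd (G z)\<bar> \<le> g" if "z \<in> X" for z using gb[of z] that Xh by blast
  show thesis
  proof (rule weighted_sum_close[where 'k = "point set \<times> nat" and 'j = unit,
        OF X b C \<epsilon> gradient_measurable(1)[OF X Xh] gX g(1) \<theta>, of 1 g], goal_cases)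
    case (4 \<delta>0)
    note \<delta>0 = 4(1) and W = 4(2)
    obtain \<delta>1 where \<delta>1: "0 < \<delta>1" "\<And>z z' w. z \<in> halfspace \<Longrightarrow> z' \<in> halfspace \<Longrightarrow> w \<in> halfspace \<Longrightarrow> dist z w \<le> \<delta>1 \<Longrightarrow> dist z' w \<le> \<delta>1 \<Longrightarrow>
       \<bar>\<phi> z' - \<phi> z - (z' - z) \<bullet> G w\<bar> \<le> \<delta>0 * norm (z' - z)" by (rule linearize[OF \<delta>0], rule that, blast+)
    \<comment> \<open>half, because a box is compared with the preceding one in time\<close>
    define \<delta> where "\<delta> = min (min \<delta>0 \<delta>1) (\<tau>) / 2"
    have \<delta>: "0 < \<delta>" "2 * \<delta> \<le> \<delta>0" "2 * \<delta> \<le> \<delta>1" "2 * \<delta> \<le> \<tau>" using \<delta>0 \<delta>1 \<tau> by (auto simp: \<delta>_def)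
    show thesis
    proof (rule that[OF \<delta>(1)])
      fix A d f' a
      assume S: "staggered_scheme A \<Omega> T d" and th: "theta3 d \<le> \<theta>" and h: "mesh_size d + time_step d \<le> \<delta>"
        and i: "integrable (lebesgue_on X) f'" and D: "(LINT z|lebesgue_on X. \<bar>f' z - b z\<bar>) \<le> \<delta>"
        and val: "\<And>P n x t. P \<in> cells d \<Longrightarrow> n < nsteps d \<Longrightarrow> x \<in> P \<Longrightarrow> t \<in> {tm d n..<tm d (Suc n)} \<Longrightarrow> f' (x, t) = a P n"
      interpret staggered_scheme A \<Omega> T d by (rule S)
      have mt0: "0 \<le> mesh_size d" "0 \<le> time_step d" unfolding mesh_size_def time_step_def
        using cell_mesh(1) by (auto intro!: max0_nonneg)
      let ?K = "cells d \<times> {1..<nsteps d}"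
      let ?pt = "\<lambda>k :: point set \<times> nat. (SOME x. x \<in> fst k, tm d (snd k))"
      let ?\<gamma> = "\<lambda>k :: point set \<times> nat. (avg \<phi> (fst k) (snd k) - avg \<phi> (fst k) (snd k - 1)) / dt (snd k - 1)"
      have k: "fst k \<in> cells d" "1 \<le> snd k" "snd k < nsteps d" "snd k - 1 < nsteps d" "Suc (snd k - 1) = snd k"
        if "k \<in> ?K" for k using that by auto
      note bA = box_facts[OF cell_facts(1)[OF k(1)] subset_refl k(1) k(3)]
      note bB = box_facts[OF cell_facts(1)[OF k(1)] subset_refl k(1) k(4)]
      have dB: "0 < dt (snd k - 1)" if "k \<in> ?K" for k by (rule dt_pos[OF k(4)[OF that]])
      have pt: "(SOME x. x \<in> fst k) \<in> fst k" if kk: "k \<in> ?K" for k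
      proof -
        have "fst k \<noteq> {}" using cell_facts(3)[OF k(1)[OF kk]] by auto
        then show ?thesis by (simp add: some_in_eq)
      qed
      have inc: "\<bar>(\<phi> (x, tm d (snd k)) - \<phi> (x, tm d (snd k - 1))) - dt (snd k - 1) * snd (G z)\<bar> \<le> \<delta>0 * dt (snd k - 1)"
        if kk: "k \<in> ?K" and x: "x \<in> fst k" and z: "z \<in> fst k \<times> slab (snd k - 1)" for k x z
      proof -
        let ?z0 = "(x, tm d (snd k - 1))" and ?z1 = "(x, tm d (snd k))"
        have t0: "0 \<le> tm d (snd k - 1)" "0 \<le> tm d (snd k)" using grid_facts(3) k(3,4)[OF kk] by auto
        have zz: "fst z \<in> fst k" "snd z \<in> slab (snd k - 1)" using z by (auto simp: mem_Times_iff)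
        have H: "?z0 \<in> halfspace" "?z1 \<in> halfspace" "z \<in> halfspace" using t0 zz(2) by (auto simp: mem_Times_iff)
        have cl: "x \<in> closure (fst k)" "fst z \<in> closure (fst k)" using x zz closure_subset by blast+
        have "dist ?z0 (fst z, snd z) \<le> mesh_size d + time_step d"
          by (rule dist_box[OF k(1)[OF kk] k(4)[OF kk] cl]) (use dB[OF kk] zz(2) k(5)[OF kk] in simp_all)
        moreover have "dist ?z1 (fst z, snd z) \<le> mesh_size d + time_step d"
          by (rule dist_box[OF k(1)[OF kk] k(4)[OF kk] cl]) (use dB[OF kk] zz(2) k(5)[OF kk] in simp_all)
        ultimately have dd: "dist ?z0 z \<le> \<delta>1" "dist ?z1 z \<le> \<delta>1" using h \<delta> by simp_all
        have e: "?z1 - ?z0 = (0, dt (snd k - 1))" using k(5)[OF kk] by simp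
        have "(?z1 - ?z0) \<bullet> G z = dt (snd k - 1) * snd (G z)" unfolding e by (simp add: inner_prod_def)
        moreover have "norm (?z1 - ?z0) = dt (snd k - 1)" unfolding e using dB[OF kk] by (simp add: norm_Pair)
        ultimately show ?thesis using \<delta>1(2)[OF H dd] by simp
      qed
      have incb: "\<bar>(\<phi> (x, tm d (snd k)) - \<phi> (x, tm d (snd k - 1))) - 0\<bar> \<le> g * dt (snd k - 1)"
        if kk: "k \<in> ?K" for k x
      proof -
        have t0: "0 \<le> tm d (snd k - 1)" "0 \<le> tm d (snd k)" using grid_facts(3) k(3,4)[OF kk] by auto
        have e: "(x, tm d (snd k)) - (x, tm d (snd k - 1)) = (0, dt (snd k - 1))" using k(5)[OF kk] by simp
        have n: "norm ((x, tm d (snd k)) - (x, tm d (snd k - 1))) = dt (snd k - 1)"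
          unfolding e using dB[OF kk] by (simp add: norm_Pair)
        have "\<bar>\<phi> (x, tm d (snd k)) - \<phi> (x, tm d (snd k - 1))\<bar> \<le> g * norm ((x, tm d (snd k)) - (x, tm d (snd k - 1)))"
          by (rule lipschitz[OF g(2)]) (use t0 in auto)
        then show ?thesis unfolding n by simp
      qed
      have diffavg: "avg \<phi> (fst k) (snd k) - avg \<phi> (fst k) (snd k - 1)
          = 1 / area (fst k) * (LINT x:fst k|lebesgue. \<phi> (x, tm d (snd k)) - \<phi> (x, tm d (snd k - 1)))" if kk: "k \<in> ?K" for k
      proof -
        have t0: "0 \<le> tm d (snd k - 1)" "0 \<le> tm d (snd k)" using grid_facts(3) k(3,4)[OF kk] by auto
        show ?thesis unfolding cell_average_def
          using set_integral_diff(2)[OF cell_integrable[OF k(1)[OF kk] phi_cont_slice[OF t0(2)]]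
              cell_integrable[OF k(1)[OF kk] phi_cont_slice[OF t0(1)]]]
          by (simp add: right_diff_distrib)
      qed
      have contd: "continuous_on UNIV (\<lambda>x. \<phi> (x, tm d (snd k)) - \<phi> (x, tm d (snd k - 1)))" if kk: "k \<in> ?K" for k
      proof -
        have t0: "0 \<le> tm d (snd k - 1)" "0 \<le> tm d (snd k)" using grid_facts(3) k(3,4)[OF kk] by auto
        show ?thesis by (intro continuous_on_diff phi_cont_slice t0)
      qed
      have "\<bar>(\<Sum>k\<in>?K. measure lebesgue (fst k \<times> slab (snd k - 1)) * (\<Sum>j\<in>{()}. a (fst k) (snd k) * ?\<gamma> k))
            - (LINT z|lebesgue_on X. b z * snd (G z))\<bar> \<le> \<epsilon>"
      proof (rule W[OF i, where A = "\<lambda>k _. fst k \<times> slab (snd k)" and p = ?pt])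
        show "(LINT z|lebesgue_on X. \<bar>f' z - b z\<bar>) \<le> \<delta>0" using D \<delta> by linarith
        show "finite ?K" using cell_mesh(1) by simp
        show "finite {()}" by simp
        show "(\<Sum>k\<in>?K. \<Sum>j\<in>{()}. indicator (fst k \<times> slab (snd k)) z) \<le> (1::real)" for z
        proof -
          have "{1..<nsteps d} \<subseteq> {..<nsteps d}" by auto
          from box_overlap[OF this, of z] show ?thesis by simp
        qed
        show "disjoint_family_on (\<lambda>k. fst k \<times> slab (snd k - 1)) ?K"
          unfolding disjoint_family_on_def
        proof (intro ballI impI)
          fix k l assume kl: "k \<in> ?K" "l \<in> ?K" "k \<noteq> l"
          have "(fst k, snd k - 1) \<noteq> (fst l, snd l - 1)" using kl k(5)[OF kl(1)] k(5)[OF kl(2)] by (metis prod.collapse prod.inject)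
          then show "fst k \<times> slab (snd k - 1) \<inter> fst l \<times> slab (snd l - 1) = {}"
            using disjoint_family_onD[OF box_disjoint, of "(fst k, snd k - 1)" "(fst l, snd l - 1)"]
              k(1,4)[OF kl(1)] k(1,4)[OF kl(2)] by simp
        qed
        show "AE z in lebesgue_on X. z \<in> (\<Union>k\<in>?K. fst k \<times> slab (snd k - 1)) \<or> snd (G z) = 0"
          using AE_in_boxes unfolding X_def
        proof eventually_elim
          fix z assume "\<exists>P\<in>cells d. \<exists>n<nsteps d. z \<in> P \<times> slab n"
          then obtain P n where P: "P \<in> cells d" "n < nsteps d" "z \<in> P \<times> slab n" by blast
          show "z \<in> (\<Union>k\<in>?K. fst k \<times> slab (snd k - 1)) \<or> snd (G z) = 0"
          proof (cases "Suc n < nsteps d")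
            case True
            then have "(P, Suc n) \<in> ?K" "z \<in> fst (P, Suc n) \<times> slab (snd (P, Suc n) - 1)" using P by auto
            then show ?thesis by blast
          next
            case False
            then have n: "Suc n = nsteps d" using P(2) by simp
            have "tm d (Suc n) = T" using n grid by (simp add: time_grid_def)
            moreover have "dt n \<le> \<delta>" using dt_le_time_step[OF P(2)] h mt0 by linarith
            moreover have "tm d n \<le> snd z" using P(3) by (auto simp: mem_Times_iff)
            ultimately have "T - \<tau> \<le> snd z" using \<delta> \<tau> by linarith
            then have "z \<notin> K" using \<tau>(2)[of "snd z" "fst z"] by simp
            then show ?thesis using G_0 by simp
          qed
        qed
      next
        fix z k assume kk: "k \<in> ?K" and z: "z \<in> fst k \<times> slab (snd k - 1)"
        have "\<bar>1 / area (fst k) * (LINT x:fst k|lebesgue. \<phi> (x, tm d (snd k)) - \<phi> (x, tm d (snd k - 1))) - dt (snd k - 1) * snd (G z)\<bar>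
           \<le> \<delta>0 * dt (snd k - 1)"
          by (rule average_near[OF k(1)[OF kk] contd[OF kk] inc[OF kk _ z]])
        then have "\<bar>avg \<phi> (fst k) (snd k) - avg \<phi> (fst k) (snd k - 1) - dt (snd k - 1) * snd (G z)\<bar> \<le> \<delta>0 * dt (snd k - 1)"
          unfolding diffavg[OF kk] .
        moreover have "?\<gamma> k - snd (G z) = (avg \<phi> (fst k) (snd k) - avg \<phi> (fst k) (snd k - 1) - dt (snd k - 1) * snd (G z)) / dt (snd k - 1)"
          using dB[OF kk] by (simp add: field_simps)
        ultimately have "\<bar>?\<gamma> k - snd (G z)\<bar> \<le> \<delta>0" using dB[OF kk] by (simp add: abs_divide pos_divide_le_eq)
        then show "\<bar>(\<Sum>j\<in>{()}. ?\<gamma> k) - snd (G z)\<bar> \<le> \<delta>0" by simp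
        have "dist (fst z, snd z) (SOME x. x \<in> fst k, tm d (snd k)) \<le> mesh_size d + time_step d"
        proof (rule dist_box[OF k(1)[OF kk] k(4)[OF kk]])
          show "fst z \<in> closure (fst k)" "(SOME x. x \<in> fst k) \<in> closure (fst k)"
            using z pt[OF kk] closure_subset by (auto simp: mem_Times_iff)
        qed (use dB[OF kk] z k(5)[OF kk] in \<open>auto simp: mem_Times_iff\<close>)
        then show "dist z (?pt k) \<le> \<delta>0" using h \<delta> by simp
      next
        fix k :: "point set \<times> nat" and j :: unit assume kk: "k \<in> ?K"
        show "measure lebesgue (fst k \<times> slab (snd k - 1)) \<le> \<theta> * measure lebesgue (fst k \<times> slab (snd k))"
          unfolding bA(2)[OF kk kk kk] bB(2)[OF kk kk kk]
          using mult_left_mono[OF dt_ratio[OF k(2)[OF kk] k(3)[OF kk] th], of "area (fst k)"] by (simp add: mult_ac)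
        show "measure lebesgue (fst k \<times> slab (snd k)) * a (fst k) (snd k) = (LINT z|lebesgue_on X. indicator (fst k \<times> slab (snd k)) z * f' z)"
          by (rule integral_indicator_const_on[OF Xs])
            (use bA(1,3)[OF kk kk kk] val[OF k(1)[OF kk] k(3)[OF kk]] in \<open>auto simp: X_def\<close>)
        have "\<bar>1 / area (fst k) * (LINT x:fst k|lebesgue. \<phi> (x, tm d (snd k)) - \<phi> (x, tm d (snd k - 1))) - 0\<bar> \<le> g * dt (snd k - 1)"
          by (rule average_near[OF k(1)[OF kk] contd[OF kk] incb[OF kk]])
        then have "\<bar>avg \<phi> (fst k) (snd k) - avg \<phi> (fst k) (snd k - 1)\<bar> \<le> g * dt (snd k - 1)"
          unfolding diffavg[OF kk] by simp
        then show "\<bar>?\<gamma> k\<bar> \<le> g" using dB[OF kk] by (simp add: abs_divide pos_divide_le_eq)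
        fix z assume z: "z \<in> fst k \<times> slab (snd k)"
        have "dist (fst z, snd z) (SOME x. x \<in> fst k, tm d (snd k)) \<le> mesh_size d + time_step d"
        proof (rule dist_box[OF k(1)[OF kk] k(3)[OF kk]])
          show "fst z \<in> closure (fst k)" "(SOME x. x \<in> fst k) \<in> closure (fst k)"
            using z pt[OF kk] closure_subset by (auto simp: mem_Times_iff)
        qed (use dt_pos[OF k(3)[OF kk]] z in \<open>auto simp: mem_Times_iff\<close>)
        then show "dist z (?pt k) \<le> \<delta>0" using h \<delta> by simp
      next
        fix k :: "point set \<times> nat" assume kk: "k \<in> ?K"
        have "(SOME x. x \<in> fst k) \<in> closure \<Omega>" using pt[OF kk] cell_sub[OF k(1)[OF kk]] by blast
        moreover have "0 \<le> tm d (snd k)" "tm d (snd k) \<le> T" using grid_facts(3,4)[of "snd k"] k(3)[OF kk] by auto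
        ultimately have "?pt k \<in> X" unfolding X_def by simp
        then show "fst k \<times> slab (snd k - 1) \<in> sets lebesgue \<and> fst k \<times> slab (snd k - 1) \<subseteq> X \<and> ?pt k \<in> X"
          using bB(1,3)[OF kk kk kk] unfolding X_def by (auto dest: fmeasurableD)
        show "fst k \<times> slab (snd k) \<in> sets lebesgue \<and> fst k \<times> slab (snd k) \<subseteq> X"
          using bA(1,3)[OF kk kk kk] unfolding X_def by (auto dest: fmeasurableD)
      qed
      moreover have "(\<Sum>k\<in>?K. measure lebesgue (fst k \<times> slab (snd k - 1)) * (\<Sum>j\<in>{()}. a (fst k) (snd k) * ?\<gamma> k))
        = (\<Sum>k\<in>?K. area (fst k) * a (fst k) (snd k) * (avg \<phi> (fst k) (snd k) - avg \<phi> (fst k) (snd k - 1)))"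
      proof (rule sum.cong[OF refl])
        fix k assume kk: "k \<in> ?K"
        show "measure lebesgue (fst k \<times> slab (snd k - 1)) * (\<Sum>j\<in>{()}. a (fst k) (snd k) * ?\<gamma> k)
          = area (fst k) * a (fst k) (snd k) * (avg \<phi> (fst k) (snd k) - avg \<phi> (fst k) (snd k - 1))"
          unfolding bB(2)[OF kk kk kk] using dB[OF kk] by simp
      qed
      ultimately show "\<bar>(\<Sum>k\<in>?K. area (fst k) * a (fst k) (snd k) * (avg \<phi> (fst k) (snd k) - avg \<phi> (fst k) (snd k - 1)))
            - (LINT z|lebesgue_on X. b z * snd (G z))\<bar> \<le> \<epsilon>" by simp
    qed
  qed (use g in auto)
qed

end

section \<open>The limit of the flux sum\<close>

context test_fun
begin

lemma edge_increment_bound: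
  assumes S: "staggered_scheme A \<Omega> T d" and g: "0 \<le> g" "\<And>z. z \<in> halfspace \<Longrightarrow> norm (G z) \<le> g"
    and P: "P \<in> cells d" and z: "\<zeta> \<in> edges d P" and n: "n < nsteps d" and th: "theta1 d \<le> \<theta>"
  shows "\<bar>diameter \<zeta> * outward_normal P \<zeta> $ i * (\<phi> (edge_mid \<zeta>, tm d n) - cell_average d \<phi> P n)\<bar> \<le> \<theta> * g * area P"
proof -
  interpret staggered_scheme A \<Omega> T d by (rule S)
  have t0: "0 \<le> tm d n" using grid_facts(3) n by simp
  have D0: "0 \<le> diameter P" using cell_facts(2)[OF P] by (rule diameter_ge_0)
  have "\<bar>avg \<phi> P n - \<phi> (edge_mid \<zeta>, tm d n)\<bar> \<le> g * diameter P"
    unfolding cell_average_def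
  proof (rule average_near[OF P phi_cont_slice[OF t0]])
    fix x assume x: "x \<in> P"
    have "\<bar>\<phi> (x, tm d n) - \<phi> (edge_mid \<zeta>, tm d n)\<bar> \<le> g * norm ((x, tm d n) - (edge_mid \<zeta>, tm d n))"
      by (rule lipschitz[OF g(2)]) (use t0 in auto)
    also have "norm ((x, tm d n) - (edge_mid \<zeta>, tm d n)) = dist x (edge_mid \<zeta>)" by (simp add: norm_Pair dist_norm)
    also have "g * dist x (edge_mid \<zeta>) \<le> g * diameter P"
    proof (rule mult_left_mono[OF _ g(1)])
      have "x \<in> closure P" using x closure_subset by blast
      then show "dist x (edge_mid \<zeta>) \<le> diameter P"
        using diameter_bounded_bound[OF bounded_closure[OF cell_facts(2)[OF P]] _ edge_facts(3)[OF P z]]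
          diameter_closure[OF cell_facts(2)[OF P]] by metis
    qed
    finally show "\<bar>\<phi> (x, tm d n) - \<phi> (edge_mid \<zeta>, tm d n)\<bar> \<le> g * diameter P" .
  qed
  then have 1: "\<bar>\<phi> (edge_mid \<zeta>, tm d n) - avg \<phi> P n\<bar> \<le> g * diameter P" by (simp add: abs_minus_commute)
  have 2: "\<bar>outward_normal P \<zeta> $ i\<bar> \<le> 1" using component_le_norm_cart[of "outward_normal P \<zeta>" i] edge_facts(1)[OF P z] by simp
  have 3: "0 \<le> diameter \<zeta>" "diameter \<zeta> \<le> diameter P" using edge_facts(4,5)[OF P z] by auto
  have "\<bar>diameter \<zeta> * outward_normal P \<zeta> $ i * (\<phi> (edge_mid \<zeta>, tm d n) - avg \<phi> P n)\<bar>
    = diameter \<zeta> * \<bar>outward_normal P \<zeta> $ i\<bar> * \<bar>\<phi> (edge_mid \<zeta>, tm d n) - avg \<phi> P n\<bar>"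
    using 3 by (simp add: abs_mult)
  also have "\<dots> \<le> diameter P * 1 * (g * diameter P)"
    using 1 2 3 D0 g by (intro mult_mono) auto
  also have "\<dots> = g * (diameter P)\<^sup>2" by (simp add: power2_eq_square)
  also have "\<dots> \<le> g * (\<theta> * area P)" by (rule mult_left_mono[OF diameter_square_le[OF P th] g(1)])
  finally show ?thesis by (simp add: mult_ac)
qed

text \<open>Linearize \<open>\<phi>\<close> at a point of the cell: the constant part is killed by the first identity for the
  normals, the linear part gives the gradient by the second, and the remainder is of order \<open>diam(P)\<^sup>2\<close> times a small
  factor, hence small relative to the area by the bound on \<open>theta1\<close>.\<close>

lemma edge_increments_near_gradient:
  assumes S: "staggered_scheme A \<Omega> T d" and P: "P \<in> cells d" and n: "n < nsteps d" and th: "theta1 d \<le> \<theta>"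
    and z: "z \<in> P \<times> {tm d n..<tm d (Suc n)}" and h: "mesh_size d + time_step d \<le> \<delta>" and e: "0 \<le> e"
    and lin: "\<And>z z' w. z \<in> halfspace \<Longrightarrow> z' \<in> halfspace \<Longrightarrow> w \<in> halfspace \<Longrightarrow> dist z w \<le> \<delta> \<Longrightarrow> dist z' w \<le> \<delta> \<Longrightarrow>
       \<bar>\<phi> z' - \<phi> z - (z' - z) \<bullet> G w\<bar> \<le> e * norm (z' - z)"
  shows "\<bar>(\<Sum>\<zeta>\<in>component_edges A d i P. diameter \<zeta> * outward_normal P \<zeta> $ i * (\<phi> (edge_mid \<zeta>, tm d n) - cell_average d \<phi> P n) / area P)
      - fst (G z) $ i\<bar> \<le> 4 * \<theta> * e"
proof -
  interpret staggered_scheme A \<Omega> T d by (rule S)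
  have t0: "0 \<le> tm d n" using grid_facts(3) n by simp
  have a: "0 < area P" by (rule cell_facts(3)[OF P])
  have D0: "0 \<le> diameter P" using cell_facts(2)[OF P] by (rule diameter_ge_0)
  let ?x = "fst z" and ?w = "fst (G z)"
  let ?N = "\<lambda>\<zeta>. diameter \<zeta> * outward_normal P \<zeta> $ i"
  let ?r = "\<lambda>\<zeta>. \<phi> (edge_mid \<zeta>, tm d n) - \<phi> (?x, tm d n) - (edge_mid \<zeta> - ?x) \<bullet> ?w"
  have x: "?x \<in> P" and tz: "snd z \<in> slab n" using z by (auto simp: mem_Times_iff)
  then have xc: "?x \<in> closure P" using closure_subset by blast
  have s0: "(\<Sum>\<zeta>\<in>edges d P. ?N \<zeta>) = 0" by (rule cell_facts(8)[OF P])
  have "(\<Sum>\<zeta>\<in>comp_edges i P. ?N \<zeta> * (\<phi> (edge_mid \<zeta>, tm d n) - avg \<phi> P n))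
     = (\<Sum>\<zeta>\<in>comp_edges i P. (diameter \<zeta> * (\<phi> (edge_mid \<zeta>, tm d n) - avg \<phi> P n)) * outward_normal P \<zeta> $ i)"
    by (intro sum.cong refl) (simp add: mult_ac)
  also have "\<dots> = (\<Sum>\<zeta>\<in>edges d P. (diameter \<zeta> * (\<phi> (edge_mid \<zeta>, tm d n) - avg \<phi> P n)) * outward_normal P \<zeta> $ i)"
    by (rule comp_edges_normal_sum[OF P])
  also have "\<dots> = (\<Sum>\<zeta>\<in>edges d P. ?N \<zeta> * (edge_mid \<zeta> \<bullet> ?w) + (\<phi> (?x, tm d n) - avg \<phi> P n - ?x \<bullet> ?w) * ?N \<zeta> + ?N \<zeta> * ?r \<zeta>)"
    by (intro sum.cong refl) (simp add: inner_diff_left algebra_simps)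
  also have "\<dots> = (\<Sum>\<zeta>\<in>edges d P. ?N \<zeta> * (edge_mid \<zeta> \<bullet> ?w)) + (\<phi> (?x, tm d n) - avg \<phi> P n - ?x \<bullet> ?w) * (\<Sum>\<zeta>\<in>edges d P. ?N \<zeta>)
      + (\<Sum>\<zeta>\<in>edges d P. ?N \<zeta> * ?r \<zeta>)"
    by (simp only: sum.distrib sum_distrib_left)
  also have "\<dots> = area P * ?w $ i + (\<Sum>\<zeta>\<in>edges d P. ?N \<zeta> * ?r \<zeta>)"
    unfolding s0 cell_facts(9)[OF P] by simp
  finally have main: "(\<Sum>\<zeta>\<in>comp_edges i P. ?N \<zeta> * (\<phi> (edge_mid \<zeta>, tm d n) - avg \<phi> P n))
      = area P * ?w $ i + (\<Sum>\<zeta>\<in>edges d P. ?N \<zeta> * ?r \<zeta>)" .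
  have r: "\<bar>?N \<zeta> * ?r \<zeta>\<bar> \<le> e * (\<theta> * area P)" if zeta: "\<zeta> \<in> edges d P" for \<zeta>
  proof -
    note mc = edge_facts(3)[OF P zeta]
    have dx: "dist (edge_mid \<zeta>) ?x \<le> diameter P"
      using diameter_bounded_bound[OF bounded_closure[OF cell_facts(2)[OF P]] mc xc] diameter_closure[OF cell_facts(2)[OF P]] by simp
    have ts: "tm d n \<in> {tm d n..tm d (Suc n)}" "snd z \<in> {tm d n..tm d (Suc n)}" using dt_pos[OF n] tz by auto
    have d1: "dist (?x, tm d n) z \<le> \<delta>" "dist (edge_mid \<zeta>, tm d n) z \<le> \<delta>"
      using dist_box[OF P n xc xc ts] dist_box[OF P n mc xc ts] h by simp_all
    have e1: "(edge_mid \<zeta>, tm d n) - (?x, tm d n) = (edge_mid \<zeta> - ?x, 0)" by simp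
    have "\<bar>\<phi> (edge_mid \<zeta>, tm d n) - \<phi> (?x, tm d n) - ((edge_mid \<zeta>, tm d n) - (?x, tm d n)) \<bullet> G z\<bar>
        \<le> e * norm ((edge_mid \<zeta>, tm d n) - (?x, tm d n))"
      by (rule lin[OF _ _ _ d1]) (use t0 tz in \<open>auto simp: mem_Times_iff\<close>)
    moreover have "((edge_mid \<zeta>, tm d n) - (?x, tm d n)) \<bullet> G z = (edge_mid \<zeta> - ?x) \<bullet> ?w" unfolding e1 by (simp add: inner_prod_def)
    moreover have "norm ((edge_mid \<zeta>, tm d n) - (?x, tm d n)) = dist (edge_mid \<zeta>) ?x" unfolding e1 by (simp add: norm_Pair dist_norm)
    ultimately have "\<bar>?r \<zeta>\<bar> \<le> e * dist (edge_mid \<zeta>) ?x" by simp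
    also have "\<dots> \<le> e * diameter P" by (rule mult_left_mono[OF dx e])
    finally have 1: "\<bar>?r \<zeta>\<bar> \<le> e * diameter P" .
    have 2: "\<bar>outward_normal P \<zeta> $ i\<bar> \<le> 1" using component_le_norm_cart[of "outward_normal P \<zeta>" i] edge_facts(1)[OF P zeta] by simp
    have 3: "0 \<le> diameter \<zeta>" "diameter \<zeta> \<le> diameter P" using edge_facts(4,5)[OF P zeta] by auto
    have "\<bar>?N \<zeta> * ?r \<zeta>\<bar> = diameter \<zeta> * \<bar>outward_normal P \<zeta> $ i\<bar> * \<bar>?r \<zeta>\<bar>" using 3 by (simp add: abs_mult)
    also have "\<dots> \<le> diameter P * 1 * (e * diameter P)" using 1 2 3 D0 e by (intro mult_mono) auto
    also have "\<dots> = e * (diameter P)\<^sup>2" by (simp add: power2_eq_square)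
    also have "\<dots> \<le> e * (\<theta> * area P)" by (rule mult_left_mono[OF diameter_square_le[OF P th] e])
    finally show ?thesis .
  qed
  have "\<bar>\<Sum>\<zeta>\<in>edges d P. ?N \<zeta> * ?r \<zeta>\<bar> \<le> (\<Sum>\<zeta>\<in>edges d P. e * (\<theta> * area P))"
    by (rule order_trans[OF sum_abs sum_mono]) (rule r)
  also have "\<dots> = 4 * \<theta> * e * area P" using cell_facts(5)[OF P] by simp
  finally have b: "\<bar>\<Sum>\<zeta>\<in>edges d P. ?N \<zeta> * ?r \<zeta>\<bar> \<le> 4 * \<theta> * e * area P" .
  have "(\<Sum>\<zeta>\<in>comp_edges i P. ?N \<zeta> * (\<phi> (edge_mid \<zeta>, tm d n) - avg \<phi> P n) / area P) - ?w $ i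
     = (\<Sum>\<zeta>\<in>edges d P. ?N \<zeta> * ?r \<zeta>) / area P"
    unfolding sum_divide_distrib[symmetric] main using a by (simp add: field_simps)
  then show ?thesis using b a by (simp add: abs_divide pos_divide_le_eq)
qed

text \<open>The weights of the single edges do not converge, only their sum over a cell does. The sub-cells carry
  the velocity values, and the cell is at most four times as large as each of them.\<close>

lemma flux_sum_close:
  fixes b :: "point \<times> real \<Rightarrow> real"
  defines "X \<equiv> closure \<Omega> \<times> {0..T}"
  assumes bd: "bounded \<Omega>" and b: "b \<in> borel_measurable (lebesgue_on X)"
    and C: "AE z in lebesgue_on X. \<bar>b z\<bar> \<le> C" "0 \<le> C" and \<epsilon>: "0 < \<epsilon>" and \<theta>: "0 \<le> \<theta>"
  obtains \<delta> where "0 < \<delta>" 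
    "\<And>A d f' a. \<lbrakk>staggered_scheme A \<Omega> T d; theta1 d \<le> \<theta>; mesh_size d + time_step d \<le> \<delta>;
        integrable (lebesgue_on X) f'; (LINT z|lebesgue_on X. \<bar>f' z - b z\<bar>) \<le> \<delta>;
        \<And>P \<zeta> n x t. P \<in> cells d \<Longrightarrow> \<zeta> \<in> component_edges A d i P \<Longrightarrow> n < nsteps d \<Longrightarrow> x \<in> subcell d P \<zeta> \<Longrightarrow>
            t \<in> {tm d n..<tm d (Suc n)} \<Longrightarrow> f' (x, t) = a P \<zeta> n\<rbrakk>
      \<Longrightarrow> \<bar>(\<Sum>k\<in>cells d \<times> {..<nsteps d}. (tm d (Suc (snd k)) - tm d (snd k)) *
              (\<Sum>\<zeta>\<in>component_edges A d i (fst k). a (fst k) \<zeta> (snd k) *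
                 (diameter \<zeta> * outward_normal (fst k) \<zeta> $ i * (\<phi> (edge_mid \<zeta>, tm d (snd k)) - cell_average d \<phi> (fst k) (snd k)))))
            - (LINT z|lebesgue_on X. b z * fst (G z) $ i)\<bar> \<le> \<epsilon>"
proof -
  have X: "compact X" unfolding X_def using bd by (intro compact_Times) auto
  have Xh: "X \<subseteq> halfspace" unfolding X_def by auto
  have Xs: "X \<in> sets lebesgue" using lmeasurable_compact[OF X] by (simp add: fmeasurable_def)
  obtain g where g: "0 \<le> g" "\<And>z. z \<in> halfspace \<Longrightarrow> norm (G z) \<le> g" by (rule gradient_bound, rule that, blast+)
  have gX: "\<bar>fst (G z) $ i\<bar> \<le> g" if "z \<in> X" for z
  proof -
    have "\<bar>fst (G z) $ i\<bar> \<le> norm (fst (G z))" by (rule component_le_norm_cart)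
    also have "\<dots> \<le> norm (G z)" using norm_fst_le[of "fst (G z)" "snd (G z)"] by simp
    also have "\<dots> \<le> g" using g(2)[of z] that Xh by blast
    finally show ?thesis .
  qed
  show thesis
  proof (rule weighted_sum_close[where 'k = "point set \<times> nat" and 'j = "point set",
        OF X b C \<epsilon> gradient_measurable(2)[OF X Xh] gX g(1), of 4 4 "\<theta> * g"], goal_cases)
    case (5 \<delta>0)
    note \<delta>0 = 5(1) and W = 5(2)
    \<comment> \<open>the accumulated linearization error of a cell is \<open>4 * \<theta> * e\<close>\<close>
    define e where "e = \<delta>0 / (4 * \<theta> + 1)"
    have e: "0 < e" "4 * \<theta> * e \<le> \<delta>0" using \<delta>0 \<theta> by (auto simp: e_def field_simps)
    obtain \<delta>1 where \<delta>1: "0 < \<delta>1" "\<And>z z' w. z \<in> halfspace \<Longrightarrow> z' \<in> halfspace \<Longrightarrow> w \<in> halfspace \<Longrightarrow> dist z w \<le> \<delta>1 \<Longrightarrow> dist z' w \<le> \<delta>1 \<Longrightarrow>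
       \<bar>\<phi> z' - \<phi> z - (z' - z) \<bullet> G w\<bar> \<le> e * norm (z' - z)" by (rule linearize[OF e(1)], rule that, blast+)
    define \<delta> where "\<delta> = min \<delta>0 \<delta>1"
    have \<delta>: "0 < \<delta>" "\<delta> \<le> \<delta>0" "\<delta> \<le> \<delta>1" using \<delta>0 \<delta>1 by (auto simp: \<delta>_def)
    show thesis
    proof (rule that[OF \<delta>(1)])
      fix A d f' a
      assume S: "staggered_scheme A \<Omega> T d" and th: "theta1 d \<le> \<theta>" and h: "mesh_size d + time_step d \<le> \<delta>"
        and i: "integrable (lebesgue_on X) f'" and D: "(LINT z|lebesgue_on X. \<bar>f' z - b z\<bar>) \<le> \<delta>"
        and val: "\<And>P \<zeta> n x t. P \<in> cells d \<Longrightarrow> \<zeta> \<in> component_edges A d i P \<Longrightarrow> n < nsteps d \<Longrightarrow> x \<in> subcell d P \<zeta> \<Longrightarrow>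
            t \<in> {tm d n..<tm d (Suc n)} \<Longrightarrow> f' (x, t) = a P \<zeta> n"
      interpret staggered_scheme A \<Omega> T d by (rule S)
      let ?K = "cells d \<times> {..<nsteps d}"
      let ?pt = "\<lambda>k :: point set \<times> nat. (SOME x. x \<in> fst k, tm d (snd k))"
      let ?c = "\<lambda>k \<zeta>. diameter \<zeta> * outward_normal (fst k) \<zeta> $ i * (\<phi> (edge_mid \<zeta>, tm d (snd k)) - avg \<phi> (fst k) (snd k))"
      have k: "fst k \<in> cells d" "snd k < nsteps d" if "k \<in> ?K" for k using that by auto
      note bB = box_facts[OF cell_facts(1)[OF k(1)] subset_refl k(1) k(2)]
      have bA: "subcell d (fst k) \<zeta> \<times> slab (snd k) \<in> lmeasurable"
        "measure lebesgue (subcell d (fst k) \<zeta> \<times> slab (snd k)) = area (subcell d (fst k) \<zeta>) * dt (snd k)"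
        "subcell d (fst k) \<zeta> \<times> slab (snd k) \<subseteq> cyl" if kk: "k \<in> ?K" and z: "\<zeta> \<in> comp_edges i (fst k)" for k \<zeta>
        by (rule box_facts[OF subcell_facts(1,2)[OF k(1)[OF kk] z] k(1)[OF kk] k(2)[OF kk]])+
      have pt: "(SOME x. x \<in> fst k) \<in> fst k" if kk: "k \<in> ?K" for k
      proof -
        have "fst k \<noteq> {}" using cell_facts(3)[OF k(1)[OF kk]] by auto
        then show ?thesis by (simp add: some_in_eq)
      qed
      have near: "dist z (?pt k) \<le> \<delta>0" if kk: "k \<in> ?K" and z: "z \<in> fst k \<times> slab (snd k)" for k z
      proof -
        have "dist (fst z, snd z) (SOME x. x \<in> fst k, tm d (snd k)) \<le> mesh_size d + time_step d"
        proof (rule dist_box[OF k(1)[OF kk] k(2)[OF kk]])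
          show "fst z \<in> closure (fst k)" "(SOME x. x \<in> fst k) \<in> closure (fst k)"
            using z pt[OF kk] closure_subset by (auto simp: mem_Times_iff)
        qed (use dt_pos[OF k(2)[OF kk]] z in \<open>auto simp: mem_Times_iff\<close>)
        then show ?thesis using h \<delta> by simp
      qed
      have "\<bar>(\<Sum>k\<in>?K. measure lebesgue (fst k \<times> slab (snd k)) * (\<Sum>\<zeta>\<in>comp_edges i (fst k). a (fst k) \<zeta> (snd k) * (?c k \<zeta> / area (fst k))))
            - (LINT z|lebesgue_on X. b z * fst (G z) $ i)\<bar> \<le> \<epsilon>"
      proof (rule W[OF i, where A = "\<lambda>k \<zeta>. subcell d (fst k) \<zeta> \<times> slab (snd k)" and p = ?pt])
        show "(LINT z|lebesgue_on X. \<bar>f' z - b z\<bar>) \<le> \<delta>0" using D \<delta> by linarith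
        show "finite ?K" using cell_mesh(1) by simp
        show "(\<Sum>k\<in>?K. \<Sum>\<zeta>\<in>comp_edges i (fst k). indicator (subcell d (fst k) \<zeta> \<times> slab (snd k)) z) \<le> (4::real)" for z
          by (rule subcell_overlap)
        show "disjoint_family_on (\<lambda>k. fst k \<times> slab (snd k)) ?K" by (rule box_disjoint)
        show "AE z in lebesgue_on X. z \<in> (\<Union>k\<in>?K. fst k \<times> slab (snd k)) \<or> fst (G z) $ i = 0"
          using AE_in_boxes unfolding X_def
        proof eventually_elim
          fix z assume "\<exists>P\<in>cells d. \<exists>n<nsteps d. z \<in> P \<times> slab n"
          then obtain P n where P: "P \<in> cells d" "n < nsteps d" "z \<in> P \<times> slab n" by blast
          then have "(P, n) \<in> ?K" "z \<in> fst (P, n) \<times> slab (snd (P, n))" by auto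
          then show "z \<in> (\<Union>k\<in>?K. fst k \<times> slab (snd k)) \<or> fst (G z) $ i = 0" by blast
        qed
      next
        fix k :: "point set \<times> nat" assume kk: "k \<in> ?K"
        show "finite (comp_edges i (fst k))" by (rule finite_comp_edges(1)[OF k(1)[OF kk]])
        have "(SOME x. x \<in> fst k) \<in> closure \<Omega>" using pt[OF kk] cell_sub[OF k(1)[OF kk]] by blast
        moreover have "0 \<le> tm d (snd k)" "tm d (snd k) \<le> T" using grid_facts(3,4)[of "snd k"] k(2)[OF kk] by auto
        ultimately have "?pt k \<in> X" unfolding X_def by simp
        then show "fst k \<times> slab (snd k) \<in> sets lebesgue \<and> fst k \<times> slab (snd k) \<subseteq> X \<and> ?pt k \<in> X"
          using bB(1,3)[OF kk kk kk] unfolding X_def by (auto dest: fmeasurableD)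
        fix z assume z: "z \<in> fst k \<times> slab (snd k)"
        show "dist z (?pt k) \<le> \<delta>0" by (rule near[OF kk z])
        have h1: "mesh_size d + time_step d \<le> \<delta>1" using h \<delta> by linarith
        have e0: "0 \<le> e" using e by simp
        from edge_increments_near_gradient[OF S k(1)[OF kk] k(2)[OF kk] th z h1 e0 \<delta>1(2), of i]
        show "\<bar>(\<Sum>\<zeta>\<in>comp_edges i (fst k). ?c k \<zeta> / area (fst k)) - fst (G z) $ i\<bar> \<le> \<delta>0"
          using e(2) by linarith
      next
        fix k :: "point set \<times> nat" and \<zeta> assume kk: "k \<in> ?K" and z: "\<zeta> \<in> comp_edges i (fst k)"
        note A = bA[OF kk z]
        have ze: "\<zeta> \<in> edges d (fst k)" using z comp_edges_sub by blast
        show "subcell d (fst k) \<zeta> \<times> slab (snd k) \<in> sets lebesgue \<and> subcell d (fst k) \<zeta> \<times> slab (snd k) \<subseteq> X"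
          using A(1,3) unfolding X_def by (auto dest: fmeasurableD)
        show "measure lebesgue (fst k \<times> slab (snd k)) \<le> 4 * measure lebesgue (subcell d (fst k) \<zeta> \<times> slab (snd k))"
          unfolding A(2) bB(2)[OF kk kk kk]
          using mult_right_mono[OF subcell_facts(3)[OF k(1)[OF kk] z], of "dt (snd k)"] dt_pos[OF k(2)[OF kk]] by simp
        show "measure lebesgue (subcell d (fst k) \<zeta> \<times> slab (snd k)) * a (fst k) \<zeta> (snd k)
          = (LINT z|lebesgue_on X. indicator (subcell d (fst k) \<zeta> \<times> slab (snd k)) z * f' z)"
          by (rule integral_indicator_const_on[OF Xs])
            (use A(1,3) val[OF k(1)[OF kk] z k(2)[OF kk]] in \<open>auto simp: X_def\<close>)
        have "\<bar>?c k \<zeta>\<bar> \<le> \<theta> * g * area (fst k)"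
          by (rule edge_increment_bound[OF S g k(1)[OF kk] ze k(2)[OF kk] th])
        then show "\<bar>?c k \<zeta> / area (fst k)\<bar> \<le> \<theta> * g"
          using cell_facts(3)[OF k(1)[OF kk]] by (simp add: abs_divide pos_divide_le_eq)
        fix y assume "y \<in> subcell d (fst k) \<zeta> \<times> slab (snd k)"
        then have "y \<in> fst k \<times> slab (snd k)" using subcell_facts(2)[OF k(1)[OF kk] z] by blast
        then show "dist y (?pt k) \<le> \<delta>0" by (rule near[OF kk])
      qed
      moreover have "(\<Sum>k\<in>?K. measure lebesgue (fst k \<times> slab (snd k)) * (\<Sum>\<zeta>\<in>comp_edges i (fst k). a (fst k) \<zeta> (snd k) * (?c k \<zeta> / area (fst k))))
        = (\<Sum>k\<in>?K. dt (snd k) * (\<Sum>\<zeta>\<in>comp_edges i (fst k). a (fst k) \<zeta> (snd k) * ?c k \<zeta>))"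
      proof (rule sum.cong[OF refl])
        fix k assume kk: "k \<in> ?K"
        have "(\<Sum>\<zeta>\<in>comp_edges i (fst k). a (fst k) \<zeta> (snd k) * (?c k \<zeta> / area (fst k)))
            = (\<Sum>\<zeta>\<in>comp_edges i (fst k). a (fst k) \<zeta> (snd k) * ?c k \<zeta>) / area (fst k)"
          unfolding sum_divide_distrib by simp
        then show "measure lebesgue (fst k \<times> slab (snd k)) * (\<Sum>\<zeta>\<in>comp_edges i (fst k). a (fst k) \<zeta> (snd k) * (?c k \<zeta> / area (fst k)))
          = dt (snd k) * (\<Sum>\<zeta>\<in>comp_edges i (fst k). a (fst k) \<zeta> (snd k) * ?c k \<zeta>)"
          unfolding bB(2)[OF kk kk kk] using cell_facts(3)[OF k(1)[OF kk]] by simp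
      qed
      ultimately show "\<bar>(\<Sum>k\<in>?K. dt (snd k) * (\<Sum>\<zeta>\<in>comp_edges i (fst k). a (fst k) \<zeta> (snd k) * ?c k \<zeta>))
            - (LINT z|lebesgue_on X. b z * fst (G z) $ i)\<bar> \<le> \<epsilon>" by simp
    qed
  qed (use g \<theta> in auto)
qed

end

section \<open>Initial values, conservativity and edge values\<close>

lemma (in staggered_scheme) sum_indicator_cells:
  "(\<Sum>P\<in>cells d. indicator P x) = (indicator (\<Union>(cells d)) x :: real)"
proof (cases "\<exists>P\<in>cells d. x \<in> P")
  case True
  then obtain P where P: "P \<in> cells d" "x \<in> P" by blast
  have "indicator Q x = (if Q = P then (1::real) else 0)" if "Q \<in> cells d" for Q
  proof (cases "x \<in> Q")
    case True
    then have "Q = P" using cell_unique[OF that P(1) _ P(2)] by blast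
    then show ?thesis using P(2) by simp
  next
    case False
    then have "Q \<noteq> P" using P(2) by blast
    then show ?thesis using False by simp
  qed
  then have "(\<Sum>Q\<in>cells d. indicator Q x) = (\<Sum>Q\<in>cells d. if Q = P then (1::real) else 0)"
    by (rule sum.cong[OF refl])
  also have "\<dots> = 1" using P cell_mesh(1) by (simp add: sum.delta)
  also have "\<dots> = indicator (\<Union>(cells d)) x" using P by (simp add: indicator_def) blast
  finally show ?thesis .
next
  case False
  then have "(\<Sum>Q\<in>cells d. indicator Q x) = (0::real)" by (intro sum.neutral) simp
  also have "\<dots> = indicator (\<Union>(cells d)) x" using False by (simp add: indicator_def)
  finally show ?thesis .
qed

context test_fun
begin

text \<open>Cell averages of the initial datum converge to it in $L^1$, again by comparison with a continuous function;
  the Lipschitz bound transfers this to \<open>\<beta>\<close>.\<close>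

lemma initial_sum_close:
  fixes q0 :: "point \<Rightarrow> real" and \<beta> :: "real \<Rightarrow> real"
  defines "X \<equiv> closure \<Omega>"
  assumes bd: "bounded \<Omega>" and q0: "q0 \<in> borel_measurable (lebesgue_on X)"
    and C: "AE x in lebesgue_on X. \<bar>q0 x\<bar> \<le> C" "0 \<le> C" and \<epsilon>: "0 < \<epsilon>"
    and L: "\<And>a b. \<bar>a\<bar> \<le> C \<Longrightarrow> \<bar>b\<bar> \<le> C \<Longrightarrow> \<bar>\<beta> a - \<beta> b\<bar> \<le> L * \<bar>a - b\<bar>" "0 \<le> L"
    and \<beta>: "continuous_on UNIV \<beta>"
  obtains \<delta> where "0 < \<delta>" 
    "\<And>A d a. \<lbrakk>staggered_scheme A \<Omega> T d; mesh_size d \<le> \<delta>;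
        \<And>P. P \<in> cells d \<Longrightarrow> a P = 1 / area P * (LINT x:P|lebesgue. q0 x)\<rbrakk>
      \<Longrightarrow> \<bar>(\<Sum>P\<in>cells d. area P * \<beta> (a P) * cell_average d \<phi> P 0)
            - (LINT x|lebesgue_on X. \<beta> (q0 x) * \<phi> (x, 0))\<bar> \<le> \<epsilon>"
proof -
  have X: "compact X" unfolding X_def using bd by simp
  have XL: "X \<in> lmeasurable" by (rule lmeasurable_compact[OF X])
  have Xs: "X \<in> sets lebesgue" using XL by (simp add: fmeasurable_def)
  have fin: "finite_measure (lebesgue_on X)" by (rule finite_measure_lebesgue_on[OF XL])
  interpret finite_measure "lebesgue_on X" by (rule fin)
  let ?M = "lebesgue_on X"
  let ?V = "measure ?M (space ?M)"
  obtain B where B: "0 \<le> B" "\<And>z. z \<in> halfspace \<Longrightarrow> \<bar>\<phi> z\<bar> \<le> B" by (rule phi_bound, rule that, blast+)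
  define Q where "Q = L * B * (2 + 2 * ?V)"
  have Q: "0 \<le> Q" unfolding Q_def using L B by simp
  define e where "e = \<epsilon> / (Q + 1)"
  have e: "0 < e" "Q * e \<le> \<epsilon>" using \<epsilon> Q by (auto simp: e_def field_simps)
  show thesis
  proof (rule L1_continuous_approximation[OF X q0 C e(1)], goal_cases)
    case (1 \<psi> \<delta>)
    note \<psi> = 1
    have i0: "integrable ?M q0" by (rule \<psi>(2))
    show thesis
    proof (rule that[OF \<psi>(4)])
      fix A d a
      assume S: "staggered_scheme A \<Omega> T d" and h: "mesh_size d \<le> \<delta>"
        and a: "\<And>P. P \<in> cells d \<Longrightarrow> a P = 1 / area P * (LINT x:P|lebesgue. q0 x)"
      interpret staggered_scheme A \<Omega> T d by (rule S)
      let ?y = "\<lambda>P. \<psi> (SOME x. x \<in> P)"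
      have tm0: "tm d 0 = 0" using grid by (simp add: time_grid_def)
      have pt: "(SOME x. x \<in> P) \<in> P" if P: "P \<in> cells d" for P
      proof -
        have "P \<noteq> {}" using cell_facts(3)[OF P] by auto
        then show ?thesis by (simp add: some_in_eq)
      qed
      have PX: "P \<subseteq> X" if P: "P \<in> cells d" for P using cell_sub[OF P] unfolding X_def .
      have PM: "P \<in> sets ?M" "measure ?M P = area P" if P: "P \<in> cells d" for P
        using cell_lmeasurable[OF P] PX[OF P] Xs by (auto simp: sets_restrict_space_iff measure_restrict_space fmeasurable_def)
      have toM: "(LINT x:P|lebesgue. f x) = (LINT x|?M. indicator P x * f x)" if P: "P \<in> cells d" for P and f :: "point \<Rightarrow> real"
      proof -
        have "(LINT x|?M. indicator P x * f x) = (LINT x|lebesgue. indicator X x *\<^sub>R (indicator P x * f x))"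
          using Xs by (subst integral_restrict_space) auto
        also have "(\<lambda>x. indicator X x *\<^sub>R (indicator P x * f x)) = (\<lambda>x. indicator P x *\<^sub>R f x)"
          using PX[OF P] by (auto simp: indicator_def fun_eq_iff)
        finally show ?thesis by (simp add: set_lebesgue_integral_def)
      qed
      have ov: "(\<Sum>P\<in>cells d. indicator P x) \<le> (1::real)" for x
        unfolding sum_indicator_cells by (rule indicator_le_1)
      have avgP: "measure ?M P * a P = (LINT x|?M. indicator P x * q0 x)" if P: "P \<in> cells d" for P
        unfolding PM(2)[OF P] a[OF P] toM[OF P] using cell_facts(3)[OF P] by simp
      have osc: "\<bar>\<psi> x - ?y P\<bar> \<le> e" if P: "P \<in> cells d" and x: "x \<in> P" for P x
      proof -
        have "dist x (SOME x. x \<in> P) \<le> diameter P"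
          using diameter_bounded_bound[OF cell_facts(2)[OF P] x pt[OF P]] .
        then have "dist x (SOME x. x \<in> P) \<le> \<delta>" using diameter_le_mesh_size[OF P] h by linarith
        then show ?thesis using \<psi>(5)[of x "SOME x. x \<in> P"] PX[OF P] x pt[OF P] by blast
      qed
      have e0: "0 \<le> e" using e by simp
      have I: "integrable ?M (\<lambda>x. indicator P x * f x)" if P: "P \<in> cells d" and f: "integrable ?M f" for P and f :: "point \<Rightarrow> real"
        using integrable_mult_indicator[OF PM(1)[OF P] f] by simp
      have dev: "(\<Sum>P\<in>cells d. area P * \<bar>a P - ?y P\<bar>) \<le> 1 * 1 * ((LINT x|?M. \<bar>q0 x - \<psi> x\<bar>) + e * ?V)"
      proof (rule sum_average_deviation[OF fin cell_mesh(1) i0 \<psi>(3), where A = "\<lambda>P. P"])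
        show "area P \<le> 1 * measure ?M P" if "P \<in> cells d" for P using PM(2)[OF that] by simp
      qed (use PM(1) ov avgP osc e0 in auto)
      have aC: "\<bar>a P\<bar> \<le> C" if P: "P \<in> cells d" for P
      proof -
        have "\<bar>measure ?M P * a P\<bar> \<le> (LINT x|?M. \<bar>indicator P x * q0 x\<bar>)"
          unfolding avgP[OF P] by (rule integral_abs_bound)
        also have "\<dots> \<le> (LINT x|?M. indicator P x * C)"
        proof (rule integral_mono_AE)
          show "integrable ?M (\<lambda>x. \<bar>indicator P x * q0 x\<bar>)" using I[OF P i0] by (rule integrable_abs)
          show "integrable ?M (\<lambda>x. indicator P x * C)" by (rule I[OF P]) simp
          show "AE x in ?M. \<bar>indicator P x * q0 x\<bar> \<le> indicator P x * C"
            using C(1) by eventually_elim (auto simp: indicator_def)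
        qed
        also have "\<dots> = measure ?M P * C" using PM(1)[OF P] PX[OF P] by (simp add: Int_absorb2)
        finally show ?thesis using cell_facts(3)[OF P] unfolding PM(2)[OF P] by (simp add: abs_mult)
      qed
      have phi_m: "(\<lambda>x. \<phi> (x, 0)) \<in> borel_measurable ?M"
        by (rule continuous_imp_measurable_on_sets_lebesgue[OF continuous_on_subset[OF phi_cont_slice] Xs]) auto
      have phiB: "\<bar>\<phi> (x, 0)\<bar> \<le> B" for x by (rule B(2)) simp
      have \<beta>m: "(\<lambda>x. \<beta> (q0 x)) \<in> borel_measurable ?M"
        using borel_measurable_continuous_on[OF \<beta> q0] .
      have i1: "integrable ?M (\<lambda>x. k * \<phi> (x, 0))" for k
        using phi_m phiB by (intro integrable_mult_right integrable_const_bound[of _ B]) auto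
      have \<beta>b: "\<bar>\<beta> y\<bar> \<le> \<bar>\<beta> 0\<bar> + L * C" if "\<bar>y\<bar> \<le> C" for y
      proof -
        have "\<bar>\<beta> y - \<beta> 0\<bar> \<le> L * \<bar>y - 0\<bar>" by (rule L(1)) (use that C in auto)
        also have "\<dots> \<le> L * C" using that L by (intro mult_left_mono) auto
        finally show ?thesis by linarith
      qed
      have i2: "integrable ?M (\<lambda>x. \<beta> (q0 x) * \<phi> (x, 0))"
      proof (rule integrable_const_bound[of _ "(\<bar>\<beta> 0\<bar> + L * C) * B"])
        show "(\<lambda>x. \<beta> (q0 x) * \<phi> (x, 0)) \<in> borel_measurable ?M" using \<beta>m phi_m by measurable
        show "AE x in ?M. norm (\<beta> (q0 x) * \<phi> (x, 0)) \<le> (\<bar>\<beta> 0\<bar> + L * C) * B"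
          using C(1)
        proof eventually_elim
          fix x assume "\<bar>q0 x\<bar> \<le> C"
          from mult_mono[OF \<beta>b[OF this] phiB[of x]] L C
          show "norm (\<beta> (q0 x) * \<phi> (x, 0)) \<le> (\<bar>\<beta> 0\<bar> + L * C) * B" by (simp add: abs_mult)
        qed
      qed
      have AEc: "AE x in ?M. (\<Sum>P\<in>cells d. indicator P x) = (1::real)"
      proof -
        have "AE x in lebesgue. x \<notin> closure \<Omega> - \<Union>(cells d)"
          using cells_cover(1)[OF mesh polyhedral_dom] by (intro AE_not_in) (simp add: negligible_iff_null_sets)
        then have "AE x in lebesgue. x \<in> X \<longrightarrow> (\<Sum>P\<in>cells d. indicator P x) = (1::real)"
        proof eventually_elim
          fix x assume x: "x \<notin> closure \<Omega> - \<Union>(cells d)"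
          show "x \<in> X \<longrightarrow> (\<Sum>P\<in>cells d. indicator P x) = (1::real)"
          proof
            assume "x \<in> X"
            with x have "x \<in> \<Union>(cells d)" unfolding X_def by blast
            then show "(\<Sum>Q\<in>cells d. indicator Q x) = (1::real)" unfolding sum_indicator_cells by (rule indicator_simps(1))
          qed
        qed
        then show ?thesis using Xs by (simp add: AE_restrict_space_iff)
      qed
      have "(LINT x|?M. \<beta> (q0 x) * \<phi> (x, 0)) = (LINT x|?M. (\<Sum>P\<in>cells d. indicator P x * (\<beta> (q0 x) * \<phi> (x, 0))))"
      proof (rule integral_cong_AE)
        show "(\<lambda>x. \<beta> (q0 x) * \<phi> (x, 0)) \<in> borel_measurable ?M" using i2 by simp
        show "(\<lambda>x. \<Sum>P\<in>cells d. indicator P x * (\<beta> (q0 x) * \<phi> (x, 0))) \<in> borel_measurable ?M"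
          by (intro borel_measurable_sum borel_measurable_integrable[OF I[OF _ i2]])
        show "AE x in ?M. \<beta> (q0 x) * \<phi> (x, 0) = (\<Sum>P\<in>cells d. indicator P x * (\<beta> (q0 x) * \<phi> (x, 0)))"
          using AEc by eventually_elim (simp add: sum_distrib_right[symmetric])
      qed
      also have "\<dots> = (\<Sum>P\<in>cells d. LINT x|?M. indicator P x * (\<beta> (q0 x) * \<phi> (x, 0)))"
        by (rule Bochner_Integration.integral_sum) (rule I[OF _ i2])
      finally have R: "(LINT x|?M. \<beta> (q0 x) * \<phi> (x, 0)) = (\<Sum>P\<in>cells d. LINT x|?M. indicator P x * (\<beta> (q0 x) * \<phi> (x, 0)))" .
      have Lh: "area P * \<beta> (a P) * avg \<phi> P 0 = (LINT x|?M. indicator P x * (\<beta> (a P) * \<phi> (x, 0)))" if P: "P \<in> cells d" for P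
      proof -
        have "area P * \<beta> (a P) * avg \<phi> P 0 = \<beta> (a P) * (LINT x|?M. indicator P x * \<phi> (x, 0))"
          unfolding cell_average_def tm0 toM[OF P] using cell_facts(3)[OF P] by simp
        also have "\<dots> = (LINT x|?M. \<beta> (a P) * (indicator P x * \<phi> (x, 0)))" by simp
        finally show ?thesis by (simp add: mult_ac)
      qed
      have cellwise: "\<bar>area P * \<beta> (a P) * avg \<phi> P 0 - (LINT x|?M. indicator P x * (\<beta> (q0 x) * \<phi> (x, 0)))\<bar>
         \<le> L * B * ((LINT x|?M. indicator P x * (\<bar>q0 x - \<psi> x\<bar> + e)) + area P * \<bar>a P - ?y P\<bar>)" if P: "P \<in> cells d" for P
      proof -
        let ?h = "\<lambda>x. indicator P x * (L * B * ((\<bar>q0 x - \<psi> x\<bar> + e) + \<bar>a P - ?y P\<bar>))"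
        have ih: "integrable ?M ?h" using i0 \<psi>(3) by (intro I[OF P]) auto
        have ii: "integrable ?M (\<lambda>x. indicator P x * (\<bar>q0 x - \<psi> x\<bar> + e))" using i0 \<psi>(3) by (intro I[OF P]) auto
        have ij: "integrable ?M (\<lambda>x. indicator P x * \<bar>a P - ?y P\<bar>)" by (intro I[OF P]) auto
        have "area P * \<beta> (a P) * avg \<phi> P 0 - (LINT x|?M. indicator P x * (\<beta> (q0 x) * \<phi> (x, 0)))
          = (LINT x|?M. indicator P x * (\<beta> (a P) * \<phi> (x, 0)) - indicator P x * (\<beta> (q0 x) * \<phi> (x, 0)))"
          unfolding Lh[OF P] using I[OF P i1] I[OF P i2] by (subst Bochner_Integration.integral_diff) auto
        also have "\<bar>\<dots>\<bar> \<le> (LINT x|?M. \<bar>indicator P x * (\<beta> (a P) * \<phi> (x, 0)) - indicator P x * (\<beta> (q0 x) * \<phi> (x, 0))\<bar>)"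
          by (rule integral_abs_bound)
        also have "\<dots> \<le> (LINT x|?M. ?h x)"
        proof (rule integral_mono_AE[OF _ ih])
          show "integrable ?M (\<lambda>x. \<bar>indicator P x * (\<beta> (a P) * \<phi> (x, 0)) - indicator P x * (\<beta> (q0 x) * \<phi> (x, 0))\<bar>)"
            by (intro integrable_abs Bochner_Integration.integrable_diff I[OF P i1] I[OF P i2])
          show "AE x in ?M. \<bar>indicator P x * (\<beta> (a P) * \<phi> (x, 0)) - indicator P x * (\<beta> (q0 x) * \<phi> (x, 0))\<bar> \<le> ?h x"
            using C(1)
          proof eventually_elim
            fix x assume qx: "\<bar>q0 x\<bar> \<le> C"
            show "\<bar>indicator P x * (\<beta> (a P) * \<phi> (x, 0)) - indicator P x * (\<beta> (q0 x) * \<phi> (x, 0))\<bar> \<le> ?h x"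
            proof (cases "x \<in> P")
              case True
              have "\<bar>\<beta> (a P) * \<phi> (x, 0) - \<beta> (q0 x) * \<phi> (x, 0)\<bar> = \<bar>\<beta> (a P) - \<beta> (q0 x)\<bar> * \<bar>\<phi> (x, 0)\<bar>"
                by (simp add: left_diff_distrib abs_mult[symmetric])
              also have "\<dots> \<le> (L * \<bar>a P - q0 x\<bar>) * B"
                using L(1)[OF aC[OF P] qx] phiB[of x] L(2) by (intro mult_mono) auto
              also have "\<dots> \<le> (L * ((\<bar>q0 x - \<psi> x\<bar> + e) + \<bar>a P - ?y P\<bar>)) * B"
                using osc[OF P True] L(2) B(1) by (intro mult_right_mono mult_left_mono) auto
              finally show ?thesis using True by (simp add: mult_ac)
            qed simp
          qed
        qed
        also have "(\<lambda>x. ?h x) = (\<lambda>x. L * B * (indicator P x * (\<bar>q0 x - \<psi> x\<bar> + e) + indicator P x * \<bar>a P - ?y P\<bar>))"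
          by (simp add: algebra_simps)
        also have "(LINT x|?M. L * B * (indicator P x * (\<bar>q0 x - \<psi> x\<bar> + e) + indicator P x * \<bar>a P - ?y P\<bar>))
          = L * B * ((LINT x|?M. indicator P x * (\<bar>q0 x - \<psi> x\<bar> + e)) + area P * \<bar>a P - ?y P\<bar>)"
          using Bochner_Integration.integral_add[OF ii ij] PM[OF P] PX[OF P] by (simp add: Int_absorb2)
        finally show ?thesis .
      qed
      have s1: "(\<Sum>P\<in>cells d. LINT x|?M. indicator P x * (\<bar>q0 x - \<psi> x\<bar> + e)) \<le> 1 * (LINT x|?M. \<bar>q0 x - \<psi> x\<bar> + e)"
        by (rule sum_integral_indicator_le[OF cell_mesh(1)]) (use i0 \<psi>(3) e0 PM(1) ov in auto)
      have s2: "(LINT x|?M. \<bar>q0 x - \<psi> x\<bar> + e) = (LINT x|?M. \<bar>q0 x - \<psi> x\<bar>) + e * ?V"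
        using i0 \<psi>(3) by simp
      have "\<bar>(\<Sum>P\<in>cells d. area P * \<beta> (a P) * avg \<phi> P 0) - (LINT x|?M. \<beta> (q0 x) * \<phi> (x, 0))\<bar>
        = \<bar>\<Sum>P\<in>cells d. (area P * \<beta> (a P) * avg \<phi> P 0 - (LINT x|?M. indicator P x * (\<beta> (q0 x) * \<phi> (x, 0))))\<bar>"
        unfolding R sum_subtractf ..
      also have "\<dots> \<le> (\<Sum>P\<in>cells d. L * B * ((LINT x|?M. indicator P x * (\<bar>q0 x - \<psi> x\<bar> + e)) + area P * \<bar>a P - ?y P\<bar>))"
        by (rule order_trans[OF sum_abs sum_mono]) (rule cellwise)
      also have "\<dots> = L * B * ((\<Sum>P\<in>cells d. LINT x|?M. indicator P x * (\<bar>q0 x - \<psi> x\<bar> + e)) + (\<Sum>P\<in>cells d. area P * \<bar>a P - ?y P\<bar>))"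
        unfolding sum.distrib[symmetric] sum_distrib_left ..
      also have "\<dots> \<le> L * B * (2 * e + 2 * (e * ?V))"
        using s1 s2 dev \<psi>(6) L(2) B(1) by (intro mult_left_mono) auto
      also have "\<dots> = Q * e" unfolding Q_def by (simp add: algebra_simps)
      finally show "\<bar>(\<Sum>P\<in>cells d. area P * \<beta> (a P) * avg \<phi> P 0) - (LINT x|?M. \<beta> (q0 x) * \<phi> (x, 0))\<bar> \<le> \<epsilon>"
        using e(2) by linarith
    qed
  qed
qed

text \<open>A small cell meeting the support of \<open>\<phi>\<close> lies in \<open>\<Omega>\<close>, so each of its edges is shared. Hence the arbitrary
  values on external edges never enter.\<close>

lemma boundary_cell_vanish:
  assumes S: "staggered_scheme A \<Omega> T d" and \<rho>: "\<forall>z\<in>K. cball (fst z) \<rho> \<subseteq> \<Omega>" and h: "mesh_size d \<le> \<rho>"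
    and P: "P \<in> cells d" and z: "\<zeta> \<in> edges d P" and ni: "(P, \<zeta>) \<notin> inner_edges d"
  shows "\<And>y t. y \<in> closure P \<Longrightarrow> \<phi> (y, t) = 0" and "cell_average d \<phi> P n = 0"
proof -
  interpret staggered_scheme A \<Omega> T d by (rule S)
  show v: "\<phi> (y, t) = 0" if y: "y \<in> closure P" for y t
  proof (rule ccontr)
    assume "\<phi> (y, t) \<noteq> 0"
    then have "(y, t) \<in> K" using phi_0 by blast
    then have "cball y \<rho> \<subseteq> \<Omega>" using bspec[OF \<rho>, of "(y, t)"] by simp
    moreover have "closure P \<subseteq> cball y \<rho>"
    proof
      fix x assume "x \<in> closure P"
      then have "dist y x \<le> diameter P"
        using diameter_bounded_bound[OF bounded_closure[OF cell_facts(2)[OF P]] y] diameter_closure[OF cell_facts(2)[OF P]] by simp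
      then show "x \<in> cball y \<rho>" using diameter_le_mesh_size[OF P] h by simp
    qed
    ultimately have "closure P \<subseteq> \<Omega>" by blast
    from interior_edge_has_neighbour[OF mesh open_dom P this z] show False
      using ni P z unfolding inner_edges_def by blast
  qed
  have "(LINT x:P|lebesgue. \<phi> (x, tm d n)) = 0"
  proof -
    have "\<phi> (x, tm d n) = 0" if "x \<in> P" for x using v[of x] that closure_subset by blast
    then have "(\<lambda>x. indicator P x *\<^sub>R \<phi> (x, tm d n)) = (\<lambda>x. 0)" by (auto simp: indicator_def fun_eq_iff)
    then show ?thesis unfolding set_lebesgue_integral_def by simp
  qed
  then show "avg \<phi> P n = 0" unfolding cell_average_def by simp
qed

text \<open>Conservativity allows one to subtract from the cell average of \<open>\<phi>\<close> any value depending on the edge only;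
  the midpoint value is chosen for the shoelace formula.\<close>

lemma flux_rearranged:
  assumes S: "staggered_scheme A \<Omega> T d" and \<rho>: "\<forall>z\<in>K. cball (fst z) \<rho> \<subseteq> \<Omega>" and h: "mesh_size d \<le> \<rho>"
  shows "(\<Sum>P\<in>cells d. cell_average d \<phi> P n * (\<Sum>\<zeta>\<in>edges d P. diameter \<zeta> * (w \<zeta> \<bullet> outward_normal P \<zeta>)))
    = - (\<Sum>i\<in>UNIV. \<Sum>P\<in>cells d. \<Sum>\<zeta>\<in>component_edges A d i P. w \<zeta> $ i *
           (diameter \<zeta> * outward_normal P \<zeta> $ i * (\<phi> (edge_mid \<zeta>, tm d n) - cell_average d \<phi> P n)))"
proof -
  interpret staggered_scheme A \<Omega> T d by (rule S)
  have cons: "(\<Sum>P\<in>cells d. \<Sum>\<zeta>\<in>edges d P. (diameter \<zeta> * \<phi> (edge_mid \<zeta>, tm d n)) * (w \<zeta> \<bullet> outward_normal P \<zeta>)) = 0"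
  proof (rule flux_conservation[OF mesh])
    fix P \<zeta> assume P: "P \<in> cells d" and z: "\<zeta> \<in> edges d P" and u: "\<And>Q. Q \<in> cells d \<Longrightarrow> \<zeta> \<in> edges d Q \<Longrightarrow> Q = P"
    have "(P, \<zeta>) \<notin> inner_edges d" unfolding inner_edges_def using u by blast
    from boundary_cell_vanish(1)[OF S \<rho> h P z this edge_facts(3)[OF P z]]
    show "diameter \<zeta> * \<phi> (edge_mid \<zeta>, tm d n) = 0" by simp
  qed
  have "(\<Sum>P\<in>cells d. avg \<phi> P n * (\<Sum>\<zeta>\<in>edges d P. diameter \<zeta> * (w \<zeta> \<bullet> outward_normal P \<zeta>)))
    = (\<Sum>P\<in>cells d. \<Sum>\<zeta>\<in>edges d P. (diameter \<zeta> * avg \<phi> P n) * (w \<zeta> \<bullet> outward_normal P \<zeta>))"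
    by (simp add: sum_distrib_left mult_ac)
  also have "\<dots> = (\<Sum>P\<in>cells d. \<Sum>\<zeta>\<in>edges d P. (diameter \<zeta> * avg \<phi> P n) * (w \<zeta> \<bullet> outward_normal P \<zeta>))
     - (\<Sum>P\<in>cells d. \<Sum>\<zeta>\<in>edges d P. (diameter \<zeta> * \<phi> (edge_mid \<zeta>, tm d n)) * (w \<zeta> \<bullet> outward_normal P \<zeta>))"
    unfolding cons by simp
  also have "\<dots> = - (\<Sum>P\<in>cells d. \<Sum>\<zeta>\<in>edges d P. (diameter \<zeta> * (\<phi> (edge_mid \<zeta>, tm d n) - avg \<phi> P n)) * (w \<zeta> \<bullet> outward_normal P \<zeta>))"
    unfolding sum_subtractf[symmetric] sum_negf[symmetric]
    by (intro sum.cong refl) (simp add: algebra_simps)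
  also have "(\<Sum>P\<in>cells d. \<Sum>\<zeta>\<in>edges d P. (diameter \<zeta> * (\<phi> (edge_mid \<zeta>, tm d n) - avg \<phi> P n)) * (w \<zeta> \<bullet> outward_normal P \<zeta>))
    = (\<Sum>P\<in>cells d. \<Sum>i\<in>UNIV. \<Sum>\<zeta>\<in>comp_edges i P. (diameter \<zeta> * (\<phi> (edge_mid \<zeta>, tm d n) - avg \<phi> P n)) * w \<zeta> $ i * outward_normal P \<zeta> $ i)"
    by (intro sum.cong refl flux_components)
  also have "\<dots> = (\<Sum>i\<in>UNIV. \<Sum>P\<in>cells d. \<Sum>\<zeta>\<in>comp_edges i P. (diameter \<zeta> * (\<phi> (edge_mid \<zeta>, tm d n) - avg \<phi> P n)) * w \<zeta> $ i * outward_normal P \<zeta> $ i)"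
    by (rule sum.swap)
  also have "\<dots> = (\<Sum>i\<in>UNIV. \<Sum>P\<in>cells d. \<Sum>\<zeta>\<in>comp_edges i P. w \<zeta> $ i *
           (diameter \<zeta> * outward_normal P \<zeta> $ i * (\<phi> (edge_mid \<zeta>, tm d n) - avg \<phi> P n)))"
    by (intro sum.cong refl) (simp add: mult_ac)
  finally show ?thesis .
qed

text \<open>The edge value lies between the two cell values, so replacing it by one of them costs at most the jump
  across the edge.\<close>

lemma edge_value_error:
  assumes S: "staggered_scheme A \<Omega> T d" and \<rho>: "\<forall>z\<in>K. cball (fst z) \<rho> \<subseteq> \<Omega>" and h: "mesh_size d \<le> \<rho>"
    and g0: "0 \<le> g0" "\<And>z. z \<in> halfspace \<Longrightarrow> norm (G z) \<le> g0" and th: "theta1 d \<le> \<theta>" and \<theta>: "0 \<le> \<theta>"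
    and L: "\<And>a b. \<bar>a\<bar> \<le> C \<Longrightarrow> \<bar>b\<bar> \<le> C \<Longrightarrow> \<bar>g a - g b\<bar> \<le> L * \<bar>a - b\<bar>" "0 \<le> L" and C: "0 \<le> C"
    and q: "\<And>P n. P \<in> cells d \<Longrightarrow> n < nsteps d \<Longrightarrow> \<bar>qval d P n\<bar> \<le> C"
    and v: "\<And>P \<zeta> n. P \<in> cells d \<Longrightarrow> \<zeta> \<in> component_edges A d i P \<Longrightarrow> n < nsteps d \<Longrightarrow> \<bar>vval d \<zeta> n $ i\<bar> \<le> C"
  shows "\<bar>\<Sum>k\<in>cells d \<times> {..<nsteps d}. (tm d (Suc (snd k)) - tm d (snd k)) * (\<Sum>\<zeta>\<in>component_edges A d i (fst k).
       (g (qedge d \<zeta> (snd k)) - g (qval d (fst k) (snd k))) * vval d \<zeta> (snd k) $ i *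
       (diameter \<zeta> * outward_normal (fst k) \<zeta> $ i * (\<phi> (edge_mid \<zeta>, tm d (snd k)) - cell_average d \<phi> (fst k) (snd k))))\<bar>
    \<le> L * C * \<theta> * g0 * (\<Sum>k\<in>inner_edges d \<times> {..<nsteps d}. area (fst (fst k)) * (tm d (Suc (snd k)) - tm d (snd k)) *
            \<bar>qval d (fst (fst k)) (snd k) - qval d (neighbour d (fst (fst k)) (snd (fst k))) (snd k)\<bar>)"
proof -
  interpret staggered_scheme A \<Omega> T d by (rule S)
  let ?c = "\<lambda>P \<zeta> n. diameter \<zeta> * outward_normal P \<zeta> $ i * (\<phi> (edge_mid \<zeta>, tm d n) - avg \<phi> P n)"
  let ?t = "\<lambda>P \<zeta> n. dt n * ((g (qedge d \<zeta> n) - g (qval d P n)) * vval d \<zeta> n $ i * ?c P \<zeta> n)"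
  let ?u = "\<lambda>P \<zeta> n. area P * dt n * \<bar>qval d P n - qval d (neighbour d P \<zeta>) n\<bar>"
  let ?J = "\<lambda>P. {\<zeta> \<in> edges d P. (P, \<zeta>) \<in> inner_edges d}"
  have u0: "0 \<le> ?u P \<zeta> n" if "P \<in> cells d" "n < nsteps d" for P \<zeta> n
    using cell_facts(3)[OF that(1)] dt_pos[OF that(2)] by simp
  have b: "\<bar>?t P \<zeta> n\<bar> \<le> (if (P, \<zeta>) \<in> inner_edges d then L * C * \<theta> * g0 * ?u P \<zeta> n else 0)"
    if P: "P \<in> cells d" and z: "\<zeta> \<in> comp_edges i P" and n: "n < nsteps d" for P \<zeta> n
  proof -
    have ze: "\<zeta> \<in> edges d P" using z comp_edges_sub by blast
    show ?thesis
    proof (cases "(P, \<zeta>) \<in> inner_edges d")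
      case False
      note V = boundary_cell_vanish[OF S \<rho> h P ze False]
      have "?c P \<zeta> n = 0" using V(1)[OF edge_facts(3)[OF P ze], of "tm d n"] V(2)[of n] by simp
      then show ?thesis using False by simp
    next
      case True
      note N = neighbour[OF True]
      have seg: "qedge d \<zeta> n \<in> closed_segment (qval d P n) (qval d (neighbour d P \<zeta>) n)"
        using qedge_between[OF P N(1) _ ze N(3) n] N(2) by metis
      have qb: "\<bar>qval d P n\<bar> \<le> C" "\<bar>qval d (neighbour d P \<zeta>) n\<bar> \<le> C" using q P N(1) n by auto
      have qe: "\<bar>qedge d \<zeta> n\<bar> \<le> C" "\<bar>qedge d \<zeta> n - qval d P n\<bar> \<le> \<bar>qval d P n - qval d (neighbour d P \<zeta>) n\<bar>"
        using seg qb by (auto simp: closed_segment_eq_real_ivl split: if_splits)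
      have "\<bar>g (qedge d \<zeta> n) - g (qval d P n)\<bar> \<le> L * \<bar>qedge d \<zeta> n - qval d P n\<bar>" by (rule L(1)[OF qe(1) qb(1)])
      also have "\<dots> \<le> L * \<bar>qval d P n - qval d (neighbour d P \<zeta>) n\<bar>" by (rule mult_left_mono[OF qe(2) L(2)])
      finally have 1: "\<bar>g (qedge d \<zeta> n) - g (qval d P n)\<bar> \<le> L * \<bar>qval d P n - qval d (neighbour d P \<zeta>) n\<bar>" .
      have 2: "\<bar>?c P \<zeta> n\<bar> \<le> \<theta> * g0 * area P" by (rule edge_increment_bound[OF S g0 P ze n th])
      have "\<bar>?t P \<zeta> n\<bar> = dt n * (\<bar>g (qedge d \<zeta> n) - g (qval d P n)\<bar> * \<bar>vval d \<zeta> n $ i\<bar> * \<bar>?c P \<zeta> n\<bar>)"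
        unfolding abs_mult using dt_pos[OF n] by (simp only: abs_of_pos)
      also have "\<dots> \<le> dt n * (L * \<bar>qval d P n - qval d (neighbour d P \<zeta>) n\<bar> * C * (\<theta> * g0 * area P))"
        using 1 2 v[OF P z n] dt_pos[OF n] L(2) C by (intro mult_left_mono mult_mono) auto
      also have "\<dots> = L * C * \<theta> * g0 * ?u P \<zeta> n" by (simp only: mult_ac)
      finally show ?thesis using True by simp
    qed
  qed
  have "\<bar>\<Sum>k\<in>cells d \<times> {..<nsteps d}. dt (snd k) * (\<Sum>\<zeta>\<in>comp_edges i (fst k).
       (g (qedge d \<zeta> (snd k)) - g (qval d (fst k) (snd k))) * vval d \<zeta> (snd k) $ i * ?c (fst k) \<zeta> (snd k))\<bar>
    \<le> (\<Sum>k\<in>cells d \<times> {..<nsteps d}. \<Sum>\<zeta>\<in>comp_edges i (fst k). \<bar>?t (fst k) \<zeta> (snd k)\<bar>)"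
    unfolding sum_distrib_left by (rule order_trans[OF sum_abs sum_mono]) (rule sum_abs)
  also have "\<dots> \<le> (\<Sum>k\<in>cells d \<times> {..<nsteps d}. \<Sum>\<zeta>\<in>comp_edges i (fst k). if (fst k, \<zeta>) \<in> inner_edges d then L * C * \<theta> * g0 * ?u (fst k) \<zeta> (snd k) else 0)"
    by (intro sum_mono b) auto
  also have "\<dots> \<le> (\<Sum>k\<in>cells d \<times> {..<nsteps d}. \<Sum>\<zeta>\<in>edges d (fst k). if (fst k, \<zeta>) \<in> inner_edges d then L * C * \<theta> * g0 * ?u (fst k) \<zeta> (snd k) else 0)"
  proof (intro sum_mono sum_mono2 comp_edges_sub)
    fix k assume k: "k \<in> cells d \<times> {..<nsteps d}"
    then show "finite (edges d (fst k))" using cell_facts(4) by auto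
    fix \<zeta>
    show "0 \<le> (if (fst k, \<zeta>) \<in> inner_edges d then L * C * \<theta> * g0 * ?u (fst k) \<zeta> (snd k) else 0)"
      using u0[of "fst k" "snd k" \<zeta>] k L(2) C \<theta> g0(1) by (auto simp: mem_Times_iff intro!: mult_nonneg_nonneg)
  qed
  also have "\<dots> = (\<Sum>P\<in>cells d. \<Sum>n<nsteps d. \<Sum>\<zeta>\<in>edges d P. if (P, \<zeta>) \<in> inner_edges d then L * C * \<theta> * g0 * ?u P \<zeta> n else 0)"
    by (subst sum.cartesian_product) (simp add: case_prod_unfold)
  also have "\<dots> = (\<Sum>P\<in>cells d. \<Sum>\<zeta>\<in>edges d P. \<Sum>n<nsteps d. if (P, \<zeta>) \<in> inner_edges d then L * C * \<theta> * g0 * ?u P \<zeta> n else 0)"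
    by (intro sum.cong refl sum.swap)
  also have "\<dots> = (\<Sum>e\<in>Sigma (cells d) (edges d). \<Sum>n<nsteps d. if e \<in> inner_edges d then L * C * \<theta> * g0 * ?u (fst e) (snd e) n else 0)"
    using cell_mesh(1) cell_facts(4) by (subst sum.Sigma) (auto simp: case_prod_unfold)
  also have "\<dots> = (\<Sum>e\<in>Sigma (cells d) (edges d). if e \<in> inner_edges d then \<Sum>n<nsteps d. L * C * \<theta> * g0 * ?u (fst e) (snd e) n else 0)"
    by (intro sum.cong refl) auto
  also have "\<dots> = (\<Sum>e\<in>inner_edges d. \<Sum>n<nsteps d. L * C * \<theta> * g0 * ?u (fst e) (snd e) n)"
  proof -
    have "finite (Sigma (cells d) (edges d))" using cell_mesh(1) cell_facts(4) by auto
    then show ?thesis using inner_edges_sub by (subst sum.inter_restrict[symmetric]) (auto simp: Int_absorb1)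
  qed
  also have "\<dots> = (\<Sum>k\<in>inner_edges d \<times> {..<nsteps d}. L * C * \<theta> * g0 * ?u (fst (fst k)) (snd (fst k)) (snd k))"
    by (subst sum.cartesian_product) (simp add: case_prod_unfold)
  finally show ?thesis unfolding sum_distrib_left .
qed

end

section \<open>The discrete weak form\<close>

context test_fun
begin

text \<open>The value of the scalar unknown at the final time is not controlled by the bounds; it is multiplied
  by this average.\<close>

lemma late_average_zero:
  assumes S: "staggered_scheme A \<Omega> T d" and \<tau>: "\<And>x t. T - \<tau> \<le> t \<Longrightarrow> (x, t) \<notin> K" and h: "time_step d \<le> \<tau>"
  shows "cell_average d \<phi> P (nsteps d - 1) = 0"
proof -
  interpret staggered_scheme A \<Omega> T d by (rule S)
  obtain N where N: "nsteps d = Suc N" using grid_facts(5) by (cases "nsteps d") auto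
  have "tm d (Suc N) = T" using grid N by (simp add: time_grid_def)
  moreover have "dt N \<le> time_step d" by (rule dt_le_time_step) (simp add: N)
  ultimately have "T - \<tau> \<le> tm d N" using h by linarith
  then have "\<phi> (x, tm d N) = 0" for x using \<tau> phi_0 by blast
  then have "(\<lambda>x. indicator P x *\<^sub>R \<phi> (x, tm d N)) = (\<lambda>x. 0)" by (auto simp: fun_eq_iff)
  then show ?thesis unfolding cell_average_def set_lebesgue_integral_def N by simp
qed

text \<open>Summation by parts in time, conservativity in space, and the splitting of the edge values
  \<open>g (qedge d \<zeta> n)\<close> into the cell value and a jump term.\<close>

lemma scheme_sum_decomposition:
  assumes S: "staggered_scheme A \<Omega> T d" and \<rho>: "\<forall>z\<in>K. cball (fst z) \<rho> \<subseteq> \<Omega>" and h: "mesh_size d \<le> \<rho>"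
    and \<tau>: "\<And>x t. T - \<tau> \<le> t \<Longrightarrow> (x, t) \<notin> K" and h': "time_step d \<le> \<tau>"
  shows "(\<Sum>P\<in>cells d. \<Sum>n<nsteps d. (tm d (Suc n) - tm d n) * area P * (conv_val \<beta> g d P n * cell_average d \<phi> P n))
    = - (\<Sum>P\<in>cells d. area P * \<beta> (qval d P 0) * cell_average d \<phi> P 0)
      - (\<Sum>k\<in>cells d \<times> {1..<nsteps d}. area (fst k) * \<beta> (qval d (fst k) (snd k)) *
              (cell_average d \<phi> (fst k) (snd k) - cell_average d \<phi> (fst k) (snd k - 1)))
      - (\<Sum>i\<in>UNIV. \<Sum>k\<in>cells d \<times> {..<nsteps d}. (tm d (Suc (snd k)) - tm d (snd k)) *
              (\<Sum>\<zeta>\<in>component_edges A d i (fst k). (g (qval d (fst k) (snd k)) * vval d \<zeta> (snd k) $ i) *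
                 (diameter \<zeta> * outward_normal (fst k) \<zeta> $ i * (\<phi> (edge_mid \<zeta>, tm d (snd k)) - cell_average d \<phi> (fst k) (snd k)))))
      - (\<Sum>i\<in>UNIV. \<Sum>k\<in>cells d \<times> {..<nsteps d}. (tm d (Suc (snd k)) - tm d (snd k)) *
              (\<Sum>\<zeta>\<in>component_edges A d i (fst k). (g (qedge d \<zeta> (snd k)) - g (qval d (fst k) (snd k))) * vval d \<zeta> (snd k) $ i *
                 (diameter \<zeta> * outward_normal (fst k) \<zeta> $ i * (\<phi> (edge_mid \<zeta>, tm d (snd k)) - cell_average d \<phi> (fst k) (snd k)))))"
proof -
  interpret staggered_scheme A \<Omega> T d by (rule S)
  let ?c = "\<lambda>i P \<zeta> n. diameter \<zeta> * outward_normal P \<zeta> $ i * (\<phi> (edge_mid \<zeta>, tm d n) - avg \<phi> P n)"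
  let ?w = "\<lambda>n \<zeta>. g (qedge d \<zeta> n) *\<^sub>R vval d \<zeta> n"
  let ?F = "\<lambda>P n. \<Sum>\<zeta>\<in>edges d P. diameter \<zeta> * (?w n \<zeta> \<bullet> outward_normal P \<zeta>)"
  obtain N where N: "nsteps d = Suc N" using grid_facts(5) by (cases "nsteps d") auto
  have split: "dt n * area P * (conv_val \<beta> g d P n * avg \<phi> P n)
     = area P * ((\<beta> (qval d P (Suc n)) - \<beta> (qval d P n)) * avg \<phi> P n) + dt n * (avg \<phi> P n * ?F P n)"
    if P: "P \<in> cells d" and n: "n < nsteps d" for P n
  proof -
    have nz: "dt n \<noteq> 0" "area P \<noteq> 0" using dt_pos[OF n] cell_facts(3)[OF P] by auto
    have "dt n * area P * (a / dt n + 1 / area P * b) = area P * a + dt n * b" for a b :: real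
      using nz by (simp add: field_simps)
    then have eq: "dt n * area P * conv_val \<beta> g d P n = area P * (\<beta> (qval d P (Suc n)) - \<beta> (qval d P n)) + dt n * ?F P n"
      unfolding conv_val_def .
    have "dt n * area P * (conv_val \<beta> g d P n * avg \<phi> P n) = dt n * area P * conv_val \<beta> g d P n * avg \<phi> P n"
      by (simp only: mult.assoc)
    also have "\<dots> = (area P * (\<beta> (qval d P (Suc n)) - \<beta> (qval d P n)) + dt n * ?F P n) * avg \<phi> P n"
      by (simp only: eq)
    also have "\<dots> = area P * ((\<beta> (qval d P (Suc n)) - \<beta> (qval d P n)) * avg \<phi> P n) + dt n * (avg \<phi> P n * ?F P n)"
    proof -
      have "(a * b + c * e) * f = a * (b * f) + c * (f * e)" for a b c e f :: real by (simp add: algebra_simps)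
      then show ?thesis .
    qed
    finally show ?thesis .
  qed
  have "(\<Sum>P\<in>cells d. \<Sum>n<nsteps d. dt n * area P * (conv_val \<beta> g d P n * avg \<phi> P n))
    = (\<Sum>P\<in>cells d. \<Sum>n<nsteps d. area P * ((\<beta> (qval d P (Suc n)) - \<beta> (qval d P n)) * avg \<phi> P n) + dt n * (avg \<phi> P n * ?F P n))"
    by (intro sum.cong refl split) auto
  also have "\<dots> = (\<Sum>P\<in>cells d. \<Sum>n<nsteps d. area P * ((\<beta> (qval d P (Suc n)) - \<beta> (qval d P n)) * avg \<phi> P n))
      + (\<Sum>P\<in>cells d. \<Sum>n<nsteps d. dt n * (avg \<phi> P n * ?F P n))"
    unfolding sum.distrib ..
  finally have 0: "(\<Sum>P\<in>cells d. \<Sum>n<nsteps d. dt n * area P * (conv_val \<beta> g d P n * avg \<phi> P n))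
    = (\<Sum>P\<in>cells d. \<Sum>n<nsteps d. area P * ((\<beta> (qval d P (Suc n)) - \<beta> (qval d P n)) * avg \<phi> P n))
      + (\<Sum>P\<in>cells d. \<Sum>n<nsteps d. dt n * (avg \<phi> P n * ?F P n))" .
  have 1: "(\<Sum>P\<in>cells d. \<Sum>n<nsteps d. area P * ((\<beta> (qval d P (Suc n)) - \<beta> (qval d P n)) * avg \<phi> P n))
    = - (\<Sum>P\<in>cells d. area P * \<beta> (qval d P 0) * avg \<phi> P 0)
      - (\<Sum>k\<in>cells d \<times> {1..<nsteps d}. area (fst k) * \<beta> (qval d (fst k) (snd k)) * (avg \<phi> (fst k) (snd k) - avg \<phi> (fst k) (snd k - 1)))"
  proof -
    have z: "avg \<phi> P N = 0" for P using late_average_zero[OF S \<tau> h', of P] N by simp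
    have "(\<Sum>n<nsteps d. area P * ((\<beta> (qval d P (Suc n)) - \<beta> (qval d P n)) * avg \<phi> P n))
      = - (area P * \<beta> (qval d P 0) * avg \<phi> P 0) - (\<Sum>n=1..<nsteps d. area P * \<beta> (qval d P n) * (avg \<phi> P n - avg \<phi> P (n - 1)))" for P
    proof -
      let ?S = "\<Sum>n=1..<Suc N. \<beta> (qval d P n) * (avg \<phi> P n - avg \<phi> P (n - 1))"
      have "(\<Sum>n<Suc N. (\<beta> (qval d P (Suc n)) - \<beta> (qval d P n)) * avg \<phi> P n) = - (\<beta> (qval d P 0) * avg \<phi> P 0) - ?S"
        using summation_by_parts[of "\<lambda>n. \<beta> (qval d P n)" "avg \<phi> P" N] unfolding z by simp
      then have "area P * (\<Sum>n<Suc N. (\<beta> (qval d P (Suc n)) - \<beta> (qval d P n)) * avg \<phi> P n)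
          = area P * (- (\<beta> (qval d P 0) * avg \<phi> P 0) - ?S)" by (rule arg_cong)
      also have "\<dots> = - (area P * \<beta> (qval d P 0) * avg \<phi> P 0) - area P * ?S"
        by (simp only: right_diff_distrib mult_minus_right mult.assoc)
      finally show ?thesis unfolding N by (simp only: sum_distrib_left mult.assoc)
    qed
    then have "(\<Sum>P\<in>cells d. \<Sum>n<nsteps d. area P * ((\<beta> (qval d P (Suc n)) - \<beta> (qval d P n)) * avg \<phi> P n))
      = (\<Sum>P\<in>cells d. - (area P * \<beta> (qval d P 0) * avg \<phi> P 0) - (\<Sum>n=1..<nsteps d. area P * \<beta> (qval d P n) * (avg \<phi> P n - avg \<phi> P (n - 1))))"
      by presburger
    also have "\<dots> = - (\<Sum>P\<in>cells d. area P * \<beta> (qval d P 0) * avg \<phi> P 0)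
       - (\<Sum>P\<in>cells d. \<Sum>n=1..<nsteps d. area P * \<beta> (qval d P n) * (avg \<phi> P n - avg \<phi> P (n - 1)))"
      unfolding sum_subtractf sum_negf ..
    also have "(\<Sum>P\<in>cells d. \<Sum>n=1..<nsteps d. area P * \<beta> (qval d P n) * (avg \<phi> P n - avg \<phi> P (n - 1)))
      = (\<Sum>k\<in>cells d \<times> {1..<nsteps d}. area (fst k) * \<beta> (qval d (fst k) (snd k)) * (avg \<phi> (fst k) (snd k) - avg \<phi> (fst k) (snd k - 1)))"
      by (subst sum.cartesian_product) (simp add: case_prod_unfold)
    finally show ?thesis .
  qed
  have 2: "(\<Sum>P\<in>cells d. \<Sum>n<nsteps d. dt n * (avg \<phi> P n * ?F P n))
    = - (\<Sum>i\<in>UNIV. \<Sum>k\<in>cells d \<times> {..<nsteps d}. dt (snd k) * (\<Sum>\<zeta>\<in>comp_edges i (fst k). ?w (snd k) \<zeta> $ i * ?c i (fst k) \<zeta> (snd k)))"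
  proof -
    have "(\<Sum>P\<in>cells d. \<Sum>n<nsteps d. dt n * (avg \<phi> P n * ?F P n)) = (\<Sum>n<nsteps d. \<Sum>P\<in>cells d. dt n * (avg \<phi> P n * ?F P n))"
      by (rule sum.swap)
    also have "\<dots> = (\<Sum>n<nsteps d. dt n * (\<Sum>P\<in>cells d. avg \<phi> P n * ?F P n))"
      by (simp only: sum_distrib_left)
    also have "\<dots> = (\<Sum>n<nsteps d. dt n * - (\<Sum>i\<in>UNIV. \<Sum>P\<in>cells d. \<Sum>\<zeta>\<in>comp_edges i P. ?w n \<zeta> $ i * ?c i P \<zeta> n))"
      by (intro sum.cong refl arg_cong2[where f = "(*)"] flux_rearranged[OF S \<rho> h])
    also have "\<dots> = - (\<Sum>n<nsteps d. \<Sum>i\<in>UNIV. \<Sum>P\<in>cells d. dt n * (\<Sum>\<zeta>\<in>comp_edges i P. ?w n \<zeta> $ i * ?c i P \<zeta> n))"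
      by (simp only: sum_distrib_left mult_minus_right sum_negf)
    also have "(\<Sum>n<nsteps d. \<Sum>i\<in>UNIV. \<Sum>P\<in>cells d. dt n * (\<Sum>\<zeta>\<in>comp_edges i P. ?w n \<zeta> $ i * ?c i P \<zeta> n))
      = (\<Sum>i\<in>UNIV. \<Sum>n<nsteps d. \<Sum>P\<in>cells d. dt n * (\<Sum>\<zeta>\<in>comp_edges i P. ?w n \<zeta> $ i * ?c i P \<zeta> n))"
      by (rule sum.swap)
    also have "\<dots> = (\<Sum>i\<in>UNIV. \<Sum>P\<in>cells d. \<Sum>n<nsteps d. dt n * (\<Sum>\<zeta>\<in>comp_edges i P. ?w n \<zeta> $ i * ?c i P \<zeta> n))"
      by (intro sum.cong refl sum.swap)
    also have "\<dots> = (\<Sum>i\<in>UNIV. \<Sum>k\<in>cells d \<times> {..<nsteps d}. dt (snd k) * (\<Sum>\<zeta>\<in>comp_edges i (fst k). ?w (snd k) \<zeta> $ i * ?c i (fst k) \<zeta> (snd k)))"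
      by (subst sum.cartesian_product) (simp only: case_prod_unfold)
    finally show ?thesis .
  qed
  have 3: "(\<Sum>i\<in>UNIV. \<Sum>k\<in>cells d \<times> {..<nsteps d}. dt (snd k) * (\<Sum>\<zeta>\<in>comp_edges i (fst k). ?w (snd k) \<zeta> $ i * ?c i (fst k) \<zeta> (snd k)))
    = (\<Sum>i\<in>UNIV. \<Sum>k\<in>cells d \<times> {..<nsteps d}. dt (snd k) * (\<Sum>\<zeta>\<in>comp_edges i (fst k). (g (qval d (fst k) (snd k)) * vval d \<zeta> (snd k) $ i) * ?c i (fst k) \<zeta> (snd k)))
    + (\<Sum>i\<in>UNIV. \<Sum>k\<in>cells d \<times> {..<nsteps d}. dt (snd k) * (\<Sum>\<zeta>\<in>comp_edges i (fst k). (g (qedge d \<zeta> (snd k)) - g (qval d (fst k) (snd k))) * vval d \<zeta> (snd k) $ i * ?c i (fst k) \<zeta> (snd k)))"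
    unfolding sum.distrib[symmetric] distrib_left[symmetric]
    by (intro sum.cong refl arg_cong2[where f = "(*)"]) (simp add: left_diff_distrib)
  show ?thesis unfolding 0 1 2 3 by simp
qed

end

lemma local_lipschitz_bound:
  fixes \<beta> :: "real \<Rightarrow> real"
  assumes l: "local_lipschitz UNIV UNIV (\<lambda>_::real. \<beta>)"
  shows "continuous_on UNIV \<beta>"
    and "\<exists>L\<ge>0. \<forall>a b. \<bar>a\<bar> \<le> C \<longrightarrow> \<bar>b\<bar> \<le> C \<longrightarrow> \<bar>\<beta> a - \<beta> b\<bar> \<le> L * \<bar>a - b\<bar>"
proof -
  show "continuous_on UNIV \<beta>" using local_lipschitz_continuous_on[OF l, of 0] by simp
  have l': "local_lipschitz {0} (cball 0 C) (\<lambda>_::real. \<beta>)" by (rule local_lipschitz_subset[OF l]) auto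
  obtain L where "\<And>t. t \<in> {0::real} \<Longrightarrow> L-lipschitz_on (cball 0 C) \<beta>"
    by (rule local_lipschitz_compact_implies_lipschitz[OF l']) auto
  then have L: "L-lipschitz_on (cball 0 C) \<beta>" by blast
  then show "\<exists>L\<ge>0. \<forall>a b. \<bar>a\<bar> \<le> C \<longrightarrow> \<bar>b\<bar> \<le> C \<longrightarrow> \<bar>\<beta> a - \<beta> b\<bar> \<le> L * \<bar>a - b\<bar>"
    using lipschitz_on_nonneg[OF L] lipschitz_onD[OF L] by (intro exI[of _ L]) (auto simp: dist_real_def)
qed

section \<open>Passage to the limit\<close>

lemma LIMSEQ_if_eventually_le:
  fixes u :: "nat \<Rightarrow> real"
  assumes "\<And>e. 0 < e \<Longrightarrow> \<forall>\<^sub>F m in sequentially. \<bar>u m - l\<bar> \<le> e"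
  shows "u \<longlonglongrightarrow> l"
proof (rule tendstoI)
  fix e :: real assume "0 < e"
  then have "\<forall>\<^sub>F m in sequentially. \<bar>u m - l\<bar> \<le> e / 2" by (intro assms) simp
  then show "\<forall>\<^sub>F m in sequentially. dist (u m) l < e"
    by eventually_elim (use \<open>0 < e\<close> in \<open>simp add: dist_real_def\<close>)
qed

text \<open>The same statement yields the convergence of \<open>\<beta> (q)\<close> (with the second factor 1) and of every component
  of \<open>g (q)\<close> times the velocity.\<close>

lemma L1_limit_product:
  fixes g :: "real \<Rightarrow> real" and q v :: "nat \<Rightarrow> 'a \<Rightarrow> real" and r w :: "'a \<Rightarrow> real"
  assumes M: "finite_measure M" and g: "continuous_on UNIV g"
    and L: "0 \<le> L" "\<forall>a b. \<bar>a\<bar> \<le> C \<longrightarrow> \<bar>b\<bar> \<le> C \<longrightarrow> \<bar>g a - g b\<bar> \<le> L * \<bar>a - b\<bar>" and C: "0 \<le> C"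
    and q: "\<And>m. q m \<in> borel_measurable M" "r \<in> borel_measurable M"
    and qb: "\<And>m. AE z in M. \<bar>q m z\<bar> \<le> C" "AE z in M. \<bar>r z\<bar> \<le> C"
    and v: "\<And>m. v m \<in> borel_measurable M" "w \<in> borel_measurable M"
    and vb: "\<And>m. AE z in M. \<bar>v m z\<bar> \<le> C" "AE z in M. \<bar>w z\<bar> \<le> C"
    and limq: "(\<lambda>m. LINT z|M. \<bar>q m z - r z\<bar>) \<longlonglongrightarrow> 0" and limv: "(\<lambda>m. LINT z|M. \<bar>v m z - w z\<bar>) \<longlonglongrightarrow> 0"
  shows "integrable M (\<lambda>z. g (r z) * w z)" "(\<lambda>z. g (r z) * w z) \<in> borel_measurable M"
    "\<And>m. integrable M (\<lambda>z. g (q m z) * v m z)"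
    "AE z in M. \<bar>g (r z) * w z\<bar> \<le> (\<bar>g 0\<bar> + L * C) * C" "0 \<le> (\<bar>g 0\<bar> + L * C) * C"
    "(\<lambda>m. LINT z|M. \<bar>g (q m z) * v m z - g (r z) * w z\<bar>) \<longlonglongrightarrow> 0"
proof -
  interpret finite_measure M by fact
  let ?B = "\<bar>g 0\<bar> + L * C"
  have gb: "\<bar>g y\<bar> \<le> ?B" if "\<bar>y\<bar> \<le> C" for y
  proof -
    have "\<bar>g y - g 0\<bar> \<le> L * \<bar>y - 0\<bar>" by (rule L(2)[rule_format]) (use that C in auto)
    also have "\<dots> \<le> L * C" using that L by (intro mult_left_mono) auto
    finally show ?thesis by linarith
  qed
  have B0: "0 \<le> ?B" using L C by simp
  then show "0 \<le> ?B * C" using C by simp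
  have bound: "AE z in M. \<bar>g (u z) * x z\<bar> \<le> ?B * C"
    if u: "AE z in M. \<bar>u z\<bar> \<le> C" and x: "AE z in M. \<bar>x z\<bar> \<le> C" for u x :: "'a \<Rightarrow> real"
    using u x
  proof eventually_elim
    fix z assume "\<bar>u z\<bar> \<le> C" "\<bar>x z\<bar> \<le> C"
    from mult_mono[OF gb[OF this(1)] this(2)] B0 show "\<bar>g (u z) * x z\<bar> \<le> ?B * C" by (simp add: abs_mult)
  qed
  have meas: "(\<lambda>z. g (u z) * x z) \<in> borel_measurable M"
    if "u \<in> borel_measurable M" "x \<in> borel_measurable M" for u x :: "'a \<Rightarrow> real"
    by (intro borel_measurable_times borel_measurable_continuous_on[OF g] that)
  have int: "integrable M (\<lambda>z. g (u z) * x z)"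
    if "AE z in M. \<bar>u z\<bar> \<le> C" "AE z in M. \<bar>x z\<bar> \<le> C" "u \<in> borel_measurable M" "x \<in> borel_measurable M" for u x :: "'a \<Rightarrow> real"
    using bound[OF that(1,2)] meas[OF that(3,4)] by (intro integrable_const_bound[of _ "?B * C"]) auto
  show i1: "integrable M (\<lambda>z. g (r z) * w z)" by (rule int[OF qb(2) vb(2) q(2) v(2)])
  show i2: "integrable M (\<lambda>z. g (q m z) * v m z)" for m by (rule int[OF qb(1) vb(1) q(1) v(1)])
  show "(\<lambda>z. g (r z) * w z) \<in> borel_measurable M" by (rule meas[OF q(2) v(2)])
  show "AE z in M. \<bar>g (r z) * w z\<bar> \<le> ?B * C" by (rule bound[OF qb(2) vb(2)])
  have iq: "integrable M (\<lambda>z. \<bar>q m z - r z\<bar>)" for m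
    using q qb by (intro integrable_abs Bochner_Integration.integrable_diff integrable_const_bound[of _ C]) auto
  have iv: "integrable M (\<lambda>z. \<bar>v m z - w z\<bar>)" for m
    using v vb by (intro integrable_abs Bochner_Integration.integrable_diff integrable_const_bound[of _ C]) auto
  have le: "(LINT z|M. \<bar>g (q m z) * v m z - g (r z) * w z\<bar>)
      \<le> L * C * (LINT z|M. \<bar>q m z - r z\<bar>) + ?B * (LINT z|M. \<bar>v m z - w z\<bar>)" for m
  proof -
    have "(LINT z|M. \<bar>g (q m z) * v m z - g (r z) * w z\<bar>) \<le> (LINT z|M. L * C * \<bar>q m z - r z\<bar> + ?B * \<bar>v m z - w z\<bar>)"
    proof (rule integral_mono_AE)
      show "integrable M (\<lambda>z. \<bar>g (q m z) * v m z - g (r z) * w z\<bar>)" using i1 i2 by (intro integrable_abs Bochner_Integration.integrable_diff)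
      show "integrable M (\<lambda>z. L * C * \<bar>q m z - r z\<bar> + ?B * \<bar>v m z - w z\<bar>)"
        using iq iv by (intro Bochner_Integration.integrable_add integrable_mult_right)
      show "AE z in M. \<bar>g (q m z) * v m z - g (r z) * w z\<bar> \<le> L * C * \<bar>q m z - r z\<bar> + ?B * \<bar>v m z - w z\<bar>"
        using qb(1)[of m] qb(2) vb(1)[of m]
      proof eventually_elim
        fix z assume a: "\<bar>q m z\<bar> \<le> C" "\<bar>r z\<bar> \<le> C" "\<bar>v m z\<bar> \<le> C"
        have "\<bar>g (q m z) * v m z - g (r z) * w z\<bar> = \<bar>(g (q m z) - g (r z)) * v m z + g (r z) * (v m z - w z)\<bar>"
          by (simp add: algebra_simps)
        also have "\<dots> \<le> \<bar>g (q m z) - g (r z)\<bar> * \<bar>v m z\<bar> + \<bar>g (r z)\<bar> * \<bar>v m z - w z\<bar>"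
          by (rule order_trans[OF abs_triangle_ineq]) (simp add: abs_mult)
        also have "\<dots> \<le> (L * \<bar>q m z - r z\<bar>) * C + ?B * \<bar>v m z - w z\<bar>"
          using L(2)[rule_format, OF a(1,2)] gb[OF a(2)] a(3) L(1) by (intro add_mono mult_mono mult_right_mono) auto
        finally show "\<bar>g (q m z) * v m z - g (r z) * w z\<bar> \<le> L * C * \<bar>q m z - r z\<bar> + ?B * \<bar>v m z - w z\<bar>"
          by (simp add: mult_ac)
      qed
    qed
    also have "\<dots> = L * C * (LINT z|M. \<bar>q m z - r z\<bar>) + ?B * (LINT z|M. \<bar>v m z - w z\<bar>)"
      using iq[of m] iv[of m] by (subst Bochner_Integration.integral_add) auto
    finally show ?thesis .
  qed
  have "(\<lambda>m. L * C * (LINT z|M. \<bar>q m z - r z\<bar>) + ?B * (LINT z|M. \<bar>v m z - w z\<bar>)) \<longlonglongrightarrow> L * C * 0 + ?B * 0"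
    by (intro tendsto_intros limq limv)
  then have up: "(\<lambda>m. L * C * (LINT z|M. \<bar>q m z - r z\<bar>) + ?B * (LINT z|M. \<bar>v m z - w z\<bar>)) \<longlonglongrightarrow> 0" by simp
  show "(\<lambda>m. LINT z|M. \<bar>g (q m z) * v m z - g (r z) * w z\<bar>) \<longlonglongrightarrow> 0"
    by (rule tendsto_sandwich[OF _ _ tendsto_const up]) (auto intro!: always_eventually le integral_nonneg_AE)
qed

theorem lemma3p1:
  fixes A :: arrangement
    and \<Omega> :: "(real^2) set"
    and T p :: real
    and \<beta> g :: "real \<Rightarrow> real"
    and q0 :: "real^2 \<Rightarrow> real"
    and d :: "nat \<Rightarrow> scheme"
    and qbar :: "(real^2) \<times> real \<Rightarrow> real"
    and vbar :: "(real^2) \<times> real \<Rightarrow> real^2"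
    and \<phi> :: "(real^2) \<times> real \<Rightarrow> real"
  assumes "open \<Omega>" and "bounded \<Omega>" and "polyhedral \<Omega>"
    and "T > 0"
    and "local_lipschitz UNIV UNIV (\<lambda>_::real. \<beta>)"
    and "local_lipschitz UNIV UNIV (\<lambda>_::real. g)"
    and "in_Linf (lebesgue_on \<Omega>) q0"
    and "\<And>m. admissible_scheme A \<Omega> T (d m)"
    and "(\<lambda>m. mesh_size (d m)) \<longlonglongrightarrow> 0"
    and "(\<lambda>m. time_step (d m)) \<longlonglongrightarrow> 0"
    and "\<And>m P. P \<in> cells (d m) \<Longrightarrow> qval (d m) P 0 = 1 / area P * (LINT x:P|lebesgue. q0 x)"
    and "\<exists>\<theta>. \<forall>m. Max {theta1 (d m), theta2 (d m), theta3 (d m)} \<le> \<theta>"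
    and "bounded_in_Linf (lebesgue_on (\<Omega> \<times> {0<..<T})) (\<lambda>m. q_fun (d m))"
    and "bounded_in_Linf (lebesgue_on (\<Omega> \<times> {0<..<T})) (\<lambda>m. v_fun A (d m))"
    and "p \<ge> 1"
    and "in_Linf (lebesgue_on (\<Omega> \<times> {0<..<T})) qbar"
    and "in_Linf (lebesgue_on (\<Omega> \<times> {0<..<T})) vbar"
    and "converges_in_Lp p (lebesgue_on (\<Omega> \<times> {0<..<T})) (\<lambda>m. q_fun (d m)) qbar"
    and "converges_in_Lp p (lebesgue_on (\<Omega> \<times> {0<..<T})) (\<lambda>m. v_fun A (d m)) vbar"
    and "test_function \<Omega> T \<phi>"
  shows "(\<lambda>m. LINT t:{0<..<T}|lebesgue. LINT x:\<Omega>|lebesgue.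
              conv_fun \<beta> g (d m) (x, t) * interpolate (d m) \<phi> (x, t))
         \<longlonglongrightarrow>
         - (LINT x:\<Omega>|lebesgue. \<beta> (q0 x) * \<phi> (x, 0))
         - (LINT t:{0<..<T}|lebesgue. LINT x:\<Omega>|lebesgue.
              \<beta> (qbar (x, t)) * time_deriv \<phi> x t
              + (g (qbar (x, t)) *\<^sub>R vbar (x, t)) \<bullet> space_grad \<phi> x t)"
proof -
  note open_dom = assms(1) and bounded_dom = assms(2) and poly = assms(3) and T_pos = assms(4)
  have sch: "staggered_scheme A \<Omega> T (d m)" for m
    by (rule staggered_scheme.intro[OF open_dom bounded_dom poly T_pos assms(8)])
  let ?S = "\<Omega> \<times> {0<..<T}"
  define X where "X = closure \<Omega> \<times> {0..T}"
  let ?M = "lebesgue_on X"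
  have X: "compact X" unfolding X_def using bounded_dom by (intro compact_Times) auto
  have XL: "X \<in> lmeasurable" by (rule lmeasurable_compact[OF X])
  have Xs: "X \<in> sets lebesgue" using XL by (simp add: fmeasurable_def)
  have finX: "finite_measure ?M" by (rule finite_measure_lebesgue_on[OF XL])
  interpret MX: finite_measure ?M by (rule finX)
  have S: "?S \<in> sets lebesgue" "?S \<subseteq> X" and nX: "negligible (X - ?S)"
    using staggered_scheme.cylinder_sets(2,3)[OF sch[of 0]] staggered_scheme.cyl_difference_negligible(1)[OF sch[of 0]]
    unfolding X_def by auto
  have finS: "finite_measure (lebesgue_on ?S)"
    using fmeasurableI2[OF XL S(2,1)] by (rule finite_measure_lebesgue_on)
  note ext = lebesgue_on_extend[OF S nX]
  have O: "\<Omega> \<in> sets lebesgue" using open_dom by (simp add: borel_open sets_completionI_sets)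
  have nO: "negligible (closure \<Omega> - \<Omega>)"
    using cells_cover(2)[OF staggered_scheme.mesh[OF sch[of 0]] poly] .
  note extO = lebesgue_on_extend[OF O closure_subset nO]
  \<comment> \<open>one constant bounds all discrete and limit functions\<close>
  obtain C1 where C1: "\<And>m. AE z in lebesgue_on ?S. norm (q_fun (d m) z) \<le> C1"
    using assms(13) unfolding bounded_in_Linf_def by blast
  obtain C2 where C2: "\<And>m. AE z in lebesgue_on ?S. norm (v_fun A (d m) z) \<le> C2"
    using assms(14) unfolding bounded_in_Linf_def by blast
  obtain C3 where C3: "AE z in lebesgue_on ?S. norm (qbar z) \<le> C3" using assms(16) unfolding in_Linf_def by blast
  obtain C4 where C4: "AE z in lebesgue_on ?S. norm (vbar z) \<le> C4" using assms(17) unfolding in_Linf_def by blast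
  obtain C5 where C5: "AE x in lebesgue_on \<Omega>. norm (q0 x) \<le> C5" using assms(7) unfolding in_Linf_def by blast
  define C where "C = Max {1, C1, C2, C3, C4, C5}"
  have C: "1 \<le> C" "C1 \<le> C" "C2 \<le> C" "C3 \<le> C" "C4 \<le> C" "C5 \<le> C" unfolding C_def by auto
  then have C0: "0 \<le> C" by linarith
  have mS: "\<And>m. q_fun (d m) \<in> borel_measurable (lebesgue_on ?S)" "\<And>m. v_fun A (d m) \<in> borel_measurable (lebesgue_on ?S)"
    "qbar \<in> borel_measurable (lebesgue_on ?S)" "vbar \<in> borel_measurable (lebesgue_on ?S)"
    using assms(13,14,16,17) unfolding bounded_in_Linf_def in_Linf_def by blast+
  have bS: "AE z in lebesgue_on ?S. norm (q_fun (d m) z) \<le> C" "AE z in lebesgue_on ?S. norm (v_fun A (d m) z) \<le> C"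
    "AE z in lebesgue_on ?S. norm (qbar z) \<le> C" "AE z in lebesgue_on ?S. norm (vbar z) \<le> C" for m
    by (rule eventually_mono[OF C1], erule order_trans[OF _ C(2)])
       (rule eventually_mono[OF C2], erule order_trans[OF _ C(3)],
        rule eventually_mono[OF C3], erule order_trans[OF _ C(4)],
        rule eventually_mono[OF C4], erule order_trans[OF _ C(5)])
  have mX: "q_fun (d m) \<in> borel_measurable ?M" "qbar \<in> borel_measurable ?M" for m
    using ext(2)[OF mS(1)] ext(2)[OF mS(3)] .
  have comp: "(\<lambda>z. f z $ i) \<in> borel_measurable N" if "f \<in> borel_measurable N"
    for f :: "point \<times> real \<Rightarrow> point" and N :: "(point \<times> real) measure" and i
    by (rule borel_measurable_continuous_on[where f = "\<lambda>v. v $ i", OF _ that]) (intro continuous_intros)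
  have vX: "v_fun A (d m) \<in> borel_measurable ?M" "vbar \<in> borel_measurable ?M" for m
    using ext(2)[OF mS(2)] ext(2)[OF mS(4)] .
  have bX: "AE z in ?M. \<bar>q_fun (d m) z\<bar> \<le> C" "AE z in ?M. \<bar>qbar z\<bar> \<le> C" for m
    using ext(3)[OF bS(1)] ext(3)[OF bS(3)] by auto
  have bv: "AE z in ?M. \<bar>v_fun A (d m) z $ i\<bar> \<le> C" "AE z in ?M. \<bar>vbar z $ i\<bar> \<le> C" for m i
  proof -
    show "AE z in ?M. \<bar>v_fun A (d m) z $ i\<bar> \<le> C"
      using ext(3)[OF bS(2)[of m]] by eventually_elim (rule order_trans[OF component_le_norm_cart])
    show "AE z in ?M. \<bar>vbar z $ i\<bar> \<le> C"
      using ext(3)[OF bS(4)] by eventually_elim (rule order_trans[OF component_le_norm_cart])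
  qed
  have q0X: "q0 \<in> borel_measurable (lebesgue_on (closure \<Omega>))" "AE x in lebesgue_on (closure \<Omega>). \<bar>q0 x\<bar> \<le> C"
  proof -
    show "q0 \<in> borel_measurable (lebesgue_on (closure \<Omega>))" using extO(2) assms(7) unfolding in_Linf_def by blast
    show "AE x in lebesgue_on (closure \<Omega>). \<bar>q0 x\<bar> \<le> C"
      using extO(3)[OF C5] by eventually_elim (use C in simp)
  qed
  \<comment> \<open>convergence in the space of integrable functions\<close>
  have Lq: "(\<lambda>m. LINT z|?M. \<bar>q_fun (d m) z - qbar z\<bar>) \<longlonglongrightarrow> 0"
  proof -
    have "(\<lambda>m. LINT z|lebesgue_on ?S. norm (q_fun (d m) z - qbar z)) \<longlonglongrightarrow> 0"
      by (rule Lp_limit_imp_L1_limit[OF finS assms(15) assms(18) mS(1,3) bS(1,3)])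
    moreover have "(LINT z|lebesgue_on ?S. norm (q_fun (d m) z - qbar z)) = (LINT z|?M. norm (q_fun (d m) z - qbar z))" for m
      by (rule ext(4)[OF measurable_compose[OF borel_measurable_diff[OF mS(1) mS(3)] borel_measurable_norm]])
    ultimately show ?thesis by simp
  qed
  have Lv: "(\<lambda>m. LINT z|?M. \<bar>v_fun A (d m) z $ i - vbar z $ i\<bar>) \<longlonglongrightarrow> 0" for i
  proof -
    have 1: "(\<lambda>m. LINT z|lebesgue_on ?S. norm (v_fun A (d m) z - vbar z)) \<longlonglongrightarrow> 0"
      by (rule Lp_limit_imp_L1_limit[OF finS assms(15) assms(19) mS(2,4) bS(2,4)])
    have 2: "(LINT z|lebesgue_on ?S. norm (v_fun A (d m) z - vbar z)) = (LINT z|?M. norm (v_fun A (d m) z - vbar z))" for m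
      by (rule ext(4)[OF measurable_compose[OF borel_measurable_diff[OF mS(2) mS(4)] borel_measurable_norm]])
    have iv: "integrable ?M (\<lambda>z. norm (v_fun A (d m) z - vbar z))" for m
    proof (rule MX.integrable_const_bound[of _ "2 * C"])
      show "(\<lambda>z. norm (v_fun A (d m) z - vbar z)) \<in> borel_measurable ?M"
        by (rule measurable_compose[OF borel_measurable_diff[OF vX(1) vX(2)] borel_measurable_norm])
      show "AE z in ?M. norm (norm (v_fun A (d m) z - vbar z)) \<le> 2 * C"
        using ext(3)[OF bS(2)[of m]] ext(3)[OF bS(4)]
      proof eventually_elim
        fix z assume "norm (v_fun A (d m) z) \<le> C" "norm (vbar z) \<le> C"
        then show "norm (norm (v_fun A (d m) z - vbar z)) \<le> 2 * C"
          using norm_triangle_ineq4[of "v_fun A (d m) z" "vbar z"] by simp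
      qed
    qed
    have le: "\<bar>v_fun A (d m) z $ i - vbar z $ i\<bar> \<le> norm (v_fun A (d m) z - vbar z)" for m z
      using component_le_norm_cart[of "v_fun A (d m) z - vbar z" i] by simp
    have ic: "integrable ?M (\<lambda>z. \<bar>v_fun A (d m) z $ i - vbar z $ i\<bar>)" for m
    proof (rule Bochner_Integration.integrable_bound[OF iv[of m]])
      show "(\<lambda>z. \<bar>v_fun A (d m) z $ i - vbar z $ i\<bar>) \<in> borel_measurable ?M"
        by (intro borel_measurable_abs borel_measurable_diff comp vX)
      show "AE z in ?M. norm \<bar>v_fun A (d m) z $ i - vbar z $ i\<bar> \<le> norm (norm (v_fun A (d m) z - vbar z))"
        using le by (intro AE_I2) simp
    qed
    have "(LINT z|?M. \<bar>v_fun A (d m) z $ i - vbar z $ i\<bar>) \<le> (LINT z|lebesgue_on ?S. norm (v_fun A (d m) z - vbar z))" for m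
      unfolding 2 by (rule integral_mono[OF ic iv le])
    then show ?thesis
      by (intro tendsto_sandwich[OF _ _ tendsto_const 1]) (auto intro!: integral_nonneg_AE always_eventually)
  qed
  obtain L\<beta> where L\<beta>': "0 \<le> L\<beta>" "\<forall>a b. \<bar>a\<bar> \<le> C \<longrightarrow> \<bar>b\<bar> \<le> C \<longrightarrow> \<bar>\<beta> a - \<beta> b\<bar> \<le> L\<beta> * \<bar>a - b\<bar>"
    using local_lipschitz_bound(2)[OF assms(5), of C] by blast
  note L\<beta> = L\<beta>'(1) L\<beta>'(2)[rule_format]
  obtain Lg where Lg': "0 \<le> Lg" "\<forall>a b. \<bar>a\<bar> \<le> C \<longrightarrow> \<bar>b\<bar> \<le> C \<longrightarrow> \<bar>g a - g b\<bar> \<le> Lg * \<bar>a - b\<bar>"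
    using local_lipschitz_bound(2)[OF assms(6), of C] by blast
  note Lg = Lg'(1) Lg'(2)[rule_format]
  note c\<beta> = local_lipschitz_bound(1)[OF assms(5)] and cg = local_lipschitz_bound(1)[OF assms(6)]
  let ?bq = "\<lambda>z. \<beta> (qbar z) * 1" and ?fl = "\<lambda>i z. g (qbar z) * vbar z $ i"
  have one: "AE z in ?M. \<bar>1::real\<bar> \<le> C" using C by simp
  have lim1: "(\<lambda>m::nat. LINT z|?M. \<bar>(1::real) - 1\<bar>) \<longlonglongrightarrow> 0" by simp
  note comp\<beta> = L1_limit_product[OF finX c\<beta> L\<beta>' C0 mX bX, where v = "\<lambda>_ _. 1" and w = "\<lambda>_. 1", OF borel_measurable_const borel_measurable_const one one Lq lim1]
  have compg: "integrable ?M (?fl i)" "?fl i \<in> borel_measurable ?M"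
    "\<And>m. integrable ?M (\<lambda>z. g (q_fun (d m) z) * v_fun A (d m) z $ i)"
    "AE z in ?M. \<bar>?fl i z\<bar> \<le> (\<bar>g 0\<bar> + Lg * C) * C" "0 \<le> (\<bar>g 0\<bar> + Lg * C) * C"
    "(\<lambda>m. LINT z|?M. \<bar>g (q_fun (d m) z) * v_fun A (d m) z $ i - ?fl i z\<bar>) \<longlonglongrightarrow> 0" for i
    by (rule L1_limit_product[OF finX cg Lg' C0 mX bX, where v = "\<lambda>m z. v_fun A (d m) z $ i" and w = "\<lambda>z. vbar z $ i",
      OF comp[OF vX(1)] comp[OF vX(2)] bv Lq Lv])+
  have q_int: "integrable ?M (q_fun (d m))" for m using mX bX by (intro MX.integrable_const_bound[of _ C]) auto
  obtain \<theta> where \<theta>: "\<And>m. Max {theta1 (d m), theta2 (d m), theta3 (d m)} \<le> \<theta>" using assms(12) by blast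
  have th: "theta1 (d m) \<le> \<theta>" "theta2 (d m) \<le> \<theta>" "theta3 (d m) \<le> \<theta>" for m using \<theta>[of m] by auto
  have \<theta>0: "0 \<le> \<theta>" by (rule staggered_scheme.theta_nonneg[OF sch th(1)[of 0]])
  define K where "K = closure {z. \<phi> z \<noteq> 0}"
  obtain G where G: "continuous_on (UNIV \<times> {0..}) G"
    "\<And>z. z \<in> UNIV \<times> {0..} \<Longrightarrow> (\<phi> has_derivative (\<lambda>h. h \<bullet> G z)) (at z within UNIV \<times> {0..})"
    "\<And>z. z \<notin> K \<Longrightarrow> G z = 0"
  proof (rule test_function_gradient[OF open_dom T_pos assms(20), folded K_def])
    fix G :: "point \<times> real \<Rightarrow> point \<times> real"
    assume "continuous_on (UNIV \<times> {0..}) G"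
      "\<And>z. z \<in> UNIV \<times> {0..} \<Longrightarrow> (\<phi> has_derivative (\<lambda>h. h \<bullet> G z)) (at z within UNIV \<times> {0..})"
      "\<And>z. z \<notin> K \<Longrightarrow> G z = 0"
    then show thesis by (rule that)
  qed
  have tf: "test_fun \<Omega> T \<phi> G K"
  proof (rule test_fun.intro[OF open_dom _ _ _ G(3) G(1) G(2)])
    show "compact K" "K \<subseteq> \<Omega> \<times> {0..<T}" using assms(20) unfolding test_function_def K_def by blast+
    show "\<phi> z = 0" if "z \<notin> K" for z using that closure_subset[of "{z. \<phi> z \<noteq> 0}"] unfolding K_def by blast
  qed
  interpret test_fun \<Omega> T \<phi> G K by (rule tf)
  have h0: "(\<lambda>m. mesh_size (d m) + time_step (d m)) \<longlonglongrightarrow> 0" using tendsto_add[OF assms(9,10)] by simp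
  have small: "\<forall>\<^sub>F m in sequentially. mesh_size (d m) + time_step (d m) \<le> \<delta>" if "0 < \<delta>" for \<delta>
    using order_tendstoD(2)[OF h0 that] by (rule eventually_mono) simp
  have small1: "\<forall>\<^sub>F m in sequentially. mesh_size (d m) \<le> \<delta>" "\<forall>\<^sub>F m in sequentially. time_step (d m) \<le> \<delta>" if "0 < \<delta>" for \<delta>
    using order_tendstoD(2)[OF assms(9) that] order_tendstoD(2)[OF assms(10) that] by (auto elim: eventually_mono)
  have le_ev: "\<forall>\<^sub>F m in sequentially. u m \<le> \<delta>" if "u \<longlonglongrightarrow> 0" "0 < \<delta>" for u :: "nat \<Rightarrow> real" and \<delta>
    using order_tendstoD(2)[OF that] by (rule eventually_mono) simp
  \<comment> \<open>bounds on the unknowns, read off the boxes on which the discrete functions are constant\<close>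
  have qC: "\<bar>qval (d m) P n\<bar> \<le> C" if P: "P \<in> cells (d m)" and n: "n < nsteps (d m)" for m P n
  proof -
    interpret sm: staggered_scheme A \<Omega> T "d m" by (rule sch)
    note B = sm.box_facts[OF sm.cell_facts(1)[OF P] subset_refl P n]
    show ?thesis
    proof (rule AE_bound_on_constant[OF Xs bX(1)[of m]])
      show "P \<times> sm.slab n \<in> sets lebesgue" "P \<times> sm.slab n \<subseteq> X" using B unfolding X_def by (auto dest: fmeasurableD)
      show "0 < measure lebesgue (P \<times> sm.slab n)" unfolding B(2) using sm.cell_facts(3)[OF P] sm.dt_pos[OF n] by simp
      show "q_fun (d m) z = qval (d m) P n" if "z \<in> P \<times> sm.slab n" for z
        using sm.q_fun_value[OF P n] that by auto
    qed
  qed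
  have vC: "\<bar>vval (d m) \<zeta> n $ i\<bar> \<le> C" if P: "P \<in> cells (d m)" and z: "\<zeta> \<in> component_edges A (d m) i P" and n: "n < nsteps (d m)" for m P \<zeta> n i
  proof -
    interpret sm: staggered_scheme A \<Omega> T "d m" by (rule sch)
    note B = sm.box_facts[OF sm.subcell_facts(1,2)[OF P z] P n]
    show ?thesis
    proof (rule AE_bound_on_constant[OF Xs bv(1)[of m i]])
      show "subcell (d m) P \<zeta> \<times> sm.slab n \<in> sets lebesgue" "subcell (d m) P \<zeta> \<times> sm.slab n \<subseteq> X"
        using B unfolding X_def by (auto dest: fmeasurableD)
      have "0 < area (subcell (d m) P \<zeta>)" using sm.subcell_facts(3)[OF P z] sm.cell_facts(3)[OF P] by linarith
      then show "0 < measure lebesgue (subcell (d m) P \<zeta> \<times> sm.slab n)" unfolding B(2) using sm.dt_pos[OF n] by simp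
      show "v_fun A (d m) y $ i = vval (d m) \<zeta> n $ i" if "y \<in> subcell (d m) P \<zeta> \<times> sm.slab n" for y
        using sm.v_fun_value[OF P z n] that by auto
    qed
  qed
  \<comment> \<open>limits of the initial, time and flux terms, and of the error from the edge values\<close>
  define I0 where "I0 = (LINT x|lebesgue_on (closure \<Omega>). \<beta> (q0 x) * \<phi> (x, 0))"
  define J0 where "J0 = (LINT z|?M. ?bq z * snd (G z))"
  define J where "J i = (LINT z|?M. ?fl i z * fst (G z) $ i)" for i
  define t0 where "t0 m = (\<Sum>P\<in>cells (d m). area P * \<beta> (qval (d m) P 0) * cell_average (d m) \<phi> P 0)" for m
  define t1 where "t1 m = (\<Sum>k\<in>cells (d m) \<times> {1..<nsteps (d m)}. area (fst k) * \<beta> (qval (d m) (fst k) (snd k)) *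
              (cell_average (d m) \<phi> (fst k) (snd k) - cell_average (d m) \<phi> (fst k) (snd k - 1)))" for m
  define t2 where "t2 i m = (\<Sum>k\<in>cells (d m) \<times> {..<nsteps (d m)}. (tm (d m) (Suc (snd k)) - tm (d m) (snd k)) *
              (\<Sum>\<zeta>\<in>component_edges A (d m) i (fst k). (g (qval (d m) (fst k) (snd k)) * vval (d m) \<zeta> (snd k) $ i) *
                 (diameter \<zeta> * outward_normal (fst k) \<zeta> $ i * (\<phi> (edge_mid \<zeta>, tm (d m) (snd k)) - cell_average (d m) \<phi> (fst k) (snd k)))))" for i m
  define t3 where "t3 i m = (\<Sum>k\<in>cells (d m) \<times> {..<nsteps (d m)}. (tm (d m) (Suc (snd k)) - tm (d m) (snd k)) *
              (\<Sum>\<zeta>\<in>component_edges A (d m) i (fst k). (g (qedge (d m) \<zeta> (snd k)) - g (qval (d m) (fst k) (snd k))) * vval (d m) \<zeta> (snd k) $ i *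
                 (diameter \<zeta> * outward_normal (fst k) \<zeta> $ i * (\<phi> (edge_mid \<zeta>, tm (d m) (snd k)) - cell_average (d m) \<phi> (fst k) (snd k)))))" for i m
  have lim_t0: "t0 \<longlonglongrightarrow> I0"
  proof (rule LIMSEQ_if_eventually_le)
    fix e :: real assume e: "0 < e"
    show "\<forall>\<^sub>F m in sequentially. \<bar>t0 m - I0\<bar> \<le> e"
    proof (rule initial_sum_close[OF bounded_dom q0X C0 e L\<beta>(2) L\<beta>(1) c\<beta>], goal_cases)
      case (3 \<delta>)
      show ?case using small1(1)[OF 3(1)]
      proof eventually_elim
        fix m assume h: "mesh_size (d m) \<le> \<delta>"
        show "\<bar>t0 m - I0\<bar> \<le> e" unfolding t0_def I0_def
          by (rule 3(2)[OF sch h, where a = "\<lambda>P. qval (d m) P 0"]) (rule assms(11))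
      qed
    qed
  qed
  have lim_t1: "t1 \<longlonglongrightarrow> J0"
  proof (rule LIMSEQ_if_eventually_le)
    fix e :: real assume e: "0 < e"
    show "\<forall>\<^sub>F m in sequentially. \<bar>t1 m - J0\<bar> \<le> e"
    proof (rule time_sum_close[OF bounded_dom comp\<beta>(2)[unfolded X_def] comp\<beta>(4)[unfolded X_def] comp\<beta>(5) e \<theta>0], goal_cases)
      case (1 \<delta>)
      show ?case using small[OF 1(1)] le_ev[OF comp\<beta>(6) 1(1)]
      proof eventually_elim
        fix m assume h: "mesh_size (d m) + time_step (d m) \<le> \<delta>"
          and D: "(LINT z|?M. \<bar>\<beta> (q_fun (d m) z) * 1 - ?bq z\<bar>) \<le> \<delta>"
        interpret sm: staggered_scheme A \<Omega> T "d m" by (rule sch)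
        show "\<bar>t1 m - J0\<bar> \<le> e" unfolding t1_def J0_def X_def
          by (rule 1(2)[OF sch th(3) h comp\<beta>(3)[unfolded X_def] D[unfolded X_def], where a = "\<lambda>P n. \<beta> (qval (d m) P n)"])
             (simp add: sm.q_fun_value)
      qed
    qed
  qed
  have lim_t2: "t2 i \<longlonglongrightarrow> J i" for i
  proof (rule LIMSEQ_if_eventually_le)
    fix e :: real assume e: "0 < e"
    show "\<forall>\<^sub>F m in sequentially. \<bar>t2 i m - J i\<bar> \<le> e"
    proof (rule flux_sum_close[OF bounded_dom compg(2)[of i, unfolded X_def] compg(4)[of i, unfolded X_def] compg(5) e \<theta>0, of i], goal_cases)
      case (1 \<delta>)
      show ?case using small[OF 1(1)] le_ev[OF compg(6) 1(1)]
      proof eventually_elim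
        fix m assume h: "mesh_size (d m) + time_step (d m) \<le> \<delta>"
          and D: "(LINT z|?M. \<bar>g (q_fun (d m) z) * v_fun A (d m) z $ i - ?fl i z\<bar>) \<le> \<delta>"
        interpret sm: staggered_scheme A \<Omega> T "d m" by (rule sch)
        show "\<bar>t2 i m - J i\<bar> \<le> e" unfolding t2_def J_def X_def
        proof (rule 1(2)[OF sch th(1) h compg(3)[unfolded X_def] D[unfolded X_def], where a = "\<lambda>P \<zeta> n. g (qval (d m) P n) * vval (d m) \<zeta> n $ i"])
          fix P \<zeta> n x t
          assume P: "P \<in> cells (d m)" and z: "\<zeta> \<in> component_edges A (d m) i P" and n: "n < nsteps (d m)"
            and x: "x \<in> subcell (d m) P \<zeta>" and t: "t \<in> sm.slab n"
          have "x \<in> P" using sm.subcell_facts(2)[OF P z] x by blast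
          from sm.q_fun_value[OF P n this t] sm.v_fun_value[OF P z n x t]
          show "g (q_fun (d m) (x, t)) * v_fun A (d m) (x, t) $ i = g (qval (d m) P n) * vval (d m) \<zeta> n $ i" by simp
        qed
      qed
    qed
  qed
  obtain \<rho> where \<rho>: "0 < \<rho>" "\<forall>z\<in>K. cball (fst z) \<rho> \<subseteq> \<Omega>"
    by (rule space_margin) (metis prod.collapse that)
  obtain \<tau> where \<tau>: "0 < \<tau>" "\<And>x t. T - \<tau> \<le> t \<Longrightarrow> (x, t) \<notin> K" by (rule time_margin, rule that, blast+)
  obtain g0 where g0: "0 \<le> g0" "\<And>z. z \<in> halfspace \<Longrightarrow> norm (G z) \<le> g0" by (rule gradient_bound, rule that, blast+)
  define jump where "jump m = (\<Sum>k\<in>inner_edges (d m) \<times> {..<nsteps (d m)}. area (fst (fst k)) * (tm (d m) (Suc (snd k)) - tm (d m) (snd k)) *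
            \<bar>qval (d m) (fst (fst k)) (snd k) - qval (d m) (neighbour (d m) (fst (fst k)) (snd (fst k))) (snd k)\<bar>)" for m
  have jump0: "0 \<le> jump m" for m
  proof -
    interpret sm: staggered_scheme A \<Omega> T "d m" by (rule sch)
    show ?thesis unfolding jump_def
    proof (intro sum_nonneg mult_nonneg_nonneg)
      fix k assume "k \<in> inner_edges (d m) \<times> {..<nsteps (d m)}"
      then have "snd k < nsteps (d m)" by auto
      then show "0 \<le> sm.dt (snd k)" using sm.dt_pos by (simp add: less_imp_le)
    qed simp_all
  qed
  have lim_jump: "jump \<longlonglongrightarrow> 0"
  proof (rule LIMSEQ_if_eventually_le)
    fix e :: real assume e: "0 < e"
    show "\<forall>\<^sub>F m in sequentially. \<bar>jump m - 0\<bar> \<le> e"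
    proof (rule q_jump_small[OF bounded_dom mX(2)[unfolded X_def] bX(2)[unfolded X_def] C0 e, of \<theta>], goal_cases)
      case (1 \<delta>)
      show ?case using small[OF 1(1)] le_ev[OF Lq 1(1)]
      proof eventually_elim
        fix m assume h: "mesh_size (d m) + time_step (d m) \<le> \<delta>" and D: "(LINT z|?M. \<bar>q_fun (d m) z - qbar z\<bar>) \<le> \<delta>"
        have "jump m \<le> e" unfolding jump_def
          by (rule 1(2)[OF sch th(2) h q_int[unfolded X_def] D[unfolded X_def]])
        then show "\<bar>jump m - 0\<bar> \<le> e" using jump0[of m] by simp
      qed
    qed
  qed
  have lim_t3: "t3 i \<longlonglongrightarrow> 0" for i
  proof (rule Lim_null_comparison[of _ "\<lambda>m. Lg * C * \<theta> * g0 * jump m"])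
    show "\<forall>\<^sub>F m in sequentially. norm (t3 i m) \<le> Lg * C * \<theta> * g0 * jump m"
      using small1(1)[OF \<rho>(1)]
    proof eventually_elim
      fix m assume h: "mesh_size (d m) \<le> \<rho>"
      show "norm (t3 i m) \<le> Lg * C * \<theta> * g0 * jump m"
        unfolding t3_def jump_def real_norm_def
        by (rule edge_value_error[OF sch \<rho>(2) h g0 th(1) \<theta>0 Lg(2,1) C0 qC vC])
    qed
    show "(\<lambda>m. Lg * C * \<theta> * g0 * jump m) \<longlonglongrightarrow> 0" by (rule tendsto_mult_right_zero[OF lim_jump])
  qed
  have "(\<lambda>m. - t0 m - t1 m - (\<Sum>i\<in>UNIV. t2 i m) - (\<Sum>i\<in>UNIV. t3 i m)) \<longlonglongrightarrow> - I0 - J0 - (\<Sum>i\<in>UNIV. J i) - (\<Sum>i\<in>(UNIV::2 set). 0)"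
    by (intro tendsto_diff tendsto_minus tendsto_sum lim_t0 lim_t1 lim_t2 lim_t3)
  then have lim: "(\<lambda>m. - t0 m - t1 m - (\<Sum>i\<in>UNIV. t2 i m) - (\<Sum>i\<in>UNIV. t3 i m)) \<longlonglongrightarrow> - I0 - J0 - (\<Sum>i\<in>UNIV. J i)" by simp
  have ev: "\<forall>\<^sub>F m in sequentially. - t0 m - t1 m - (\<Sum>i\<in>UNIV. t2 i m) - (\<Sum>i\<in>UNIV. t3 i m)
     = (LINT t:{0<..<T}|lebesgue. LINT x:\<Omega>|lebesgue. conv_fun \<beta> g (d m) (x, t) * interpolate (d m) \<phi> (x, t))"
    using small1(1)[OF \<rho>(1)] small1(2)[OF \<tau>(1)]
  proof eventually_elim
    fix m assume h: "mesh_size (d m) \<le> \<rho>" and h': "time_step (d m) \<le> \<tau>"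
    show "- t0 m - t1 m - (\<Sum>i\<in>UNIV. t2 i m) - (\<Sum>i\<in>UNIV. t3 i m)
     = (LINT t:{0<..<T}|lebesgue. LINT x:\<Omega>|lebesgue. conv_fun \<beta> g (d m) (x, t) * interpolate (d m) \<phi> (x, t))"
      unfolding staggered_scheme.scheme_integral[OF sch] t0_def t1_def t2_def t3_def
      by (rule scheme_sum_decomposition[OF sch \<rho>(2) h \<tau>(2) h', symmetric])
  qed
  \<comment> \<open>the limit, rewritten with iterated integrals\<close>
  have I0: "I0 = (LINT x:\<Omega>|lebesgue. \<beta> (q0 x) * \<phi> (x, 0))"
  proof -
    have q0m: "q0 \<in> borel_measurable (lebesgue_on \<Omega>)" using assms(7) unfolding in_Linf_def by blast
    have pm: "(\<lambda>x. \<phi> (x, 0)) \<in> borel_measurable (lebesgue_on \<Omega>)"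
      by (rule continuous_imp_measurable_on_sets_lebesgue[OF continuous_on_subset[OF phi_cont_slice] O]) auto
    have "(\<lambda>x. \<beta> (q0 x) * \<phi> (x, 0)) \<in> borel_measurable (lebesgue_on \<Omega>)"
      by (intro borel_measurable_times borel_measurable_continuous_on[OF c\<beta> q0m] pm)
    from extO(4)[OF this]
    have "I0 = (LINT x|lebesgue_on \<Omega>. \<beta> (q0 x) * \<phi> (x, 0))" unfolding I0_def by simp
    also have "\<dots> = (LINT x:\<Omega>|lebesgue. \<beta> (q0 x) * \<phi> (x, 0))"
      unfolding set_lebesgue_integral_def using O by (subst integral_restrict_space) auto
    finally show ?thesis .
  qed
  let ?F = "\<lambda>z. ?bq z * snd (G z) + (\<Sum>i\<in>UNIV. ?fl i z * fst (G z) $ i)"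
  have JJ: "J0 + (\<Sum>i\<in>UNIV. J i) = (LINT t:{0<..<T}|lebesgue. LINT x:\<Omega>|lebesgue.
              \<beta> (qbar (x, t)) * time_deriv \<phi> x t + (g (qbar (x, t)) *\<^sub>R vbar (x, t)) \<bullet> space_grad \<phi> x t)"
  proof -
    have Xh: "X \<subseteq> halfspace" unfolding X_def by auto
    have ind: "indicator ?S z *\<^sub>R (indicator X z *\<^sub>R y) = indicator ?S z *\<^sub>R (y :: real)" for z y
    proof (cases "z \<in> ?S")
      case True
      then have "z \<in> X" using S(2) by blast
      then show ?thesis using True by simp
    next
      case False
      then show ?thesis by (simp only: indicator_simps scaleR_zero_left not_False_eq_True)
    qed
    have Gb: "\<bar>snd (G z)\<bar> \<le> g0" "\<bar>fst (G z) $ i\<bar> \<le> g0" if "z \<in> X" for z i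
    proof -
      have n: "norm (G z) \<le> g0" using g0(2)[of z] that Xh by blast
      show "\<bar>snd (G z)\<bar> \<le> g0" using norm_snd_le[of "snd (G z)" "fst (G z)"] n by simp
      have "\<bar>fst (G z) $ i\<bar> \<le> norm (fst (G z))" by (rule component_le_norm_cart)
      also have "\<dots> \<le> norm (G z)" using norm_fst_le[of "fst (G z)" "snd (G z)"] by simp
      finally show "\<bar>fst (G z) $ i\<bar> \<le> g0" using n by linarith
    qed
    have bdd: "integrable ?M (\<lambda>z. u z * w z)" if u: "integrable ?M u" and w: "w \<in> borel_measurable ?M" "\<And>z. z \<in> X \<Longrightarrow> \<bar>w z\<bar> \<le> g0" for u w :: "point \<times> real \<Rightarrow> real"
    proof (rule Bochner_Integration.integrable_bound[of ?M "\<lambda>z. g0 * u z"])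
      show "integrable ?M (\<lambda>z. g0 * u z)" using u by simp
      show "(\<lambda>z. u z * w z) \<in> borel_measurable ?M" using u w(1) by simp
      show "AE z in ?M. norm (u z * w z) \<le> norm (g0 * u z)"
      proof (rule AE_I2)
        fix z assume "z \<in> space ?M"
        then have "\<bar>w z\<bar> \<le> g0" using w(2) by simp
        then have "\<bar>u z\<bar> * \<bar>w z\<bar> \<le> \<bar>u z\<bar> * \<bar>g0\<bar>" by (intro mult_left_mono) auto
        then show "norm (u z * w z) \<le> norm (g0 * u z)" by (simp add: abs_mult mult.commute)
      qed
    qed
    have i0: "integrable ?M (\<lambda>z. ?bq z * snd (G z))"
      by (rule bdd[OF comp\<beta>(1) gradient_measurable(1)[OF X Xh] Gb(1)])
    have ii: "integrable ?M (\<lambda>z. ?fl i z * fst (G z) $ i)" for i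
      by (rule bdd[OF compg(1) gradient_measurable(2)[OF X Xh] Gb(2)])
    have iF: "integrable ?M ?F" using i0 ii by (intro Bochner_Integration.integrable_add Bochner_Integration.integrable_sum)
    have "J0 + (\<Sum>i\<in>UNIV. J i) = (LINT z|?M. ?F z)"
      unfolding J0_def J_def using i0 ii
      by (subst Bochner_Integration.integral_add) (auto intro!: Bochner_Integration.integrable_sum Bochner_Integration.integral_sum[symmetric])
    also have "\<dots> = (LINT z|lebesgue. indicator X z *\<^sub>R ?F z)"
      using Xs by (subst integral_restrict_space) auto
    also have "\<dots> = (LINT z|lebesgue. indicator ?S z *\<^sub>R ?F z)"
    proof (rule integral_cong_AE)
      have iX: "integrable lebesgue (\<lambda>z. indicator X z *\<^sub>R ?F z)"
        using iF Xs by (subst (asm) integrable_restrict_space) auto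
      show mXF: "(\<lambda>z. indicator X z *\<^sub>R ?F z) \<in> borel_measurable lebesgue" using iX by (rule borel_measurable_integrable)
      have "(\<lambda>z. indicator ?S z *\<^sub>R (indicator X z *\<^sub>R ?F z)) \<in> borel_measurable lebesgue"
        by (intro borel_measurable_scaleR borel_measurable_indicator S(1) mXF)
            then show "(\<lambda>z. indicator ?S z *\<^sub>R ?F z) \<in> borel_measurable lebesgue" unfolding ind .
      have "AE z in lebesgue. z \<notin> X - ?S" using nX by (intro AE_not_in) (simp add: negligible_iff_null_sets)
      then show "AE z in lebesgue. indicator X z *\<^sub>R ?F z = indicator ?S z *\<^sub>R ?F z"
      proof eventually_elim
        fix z assume "z \<notin> X - ?S"
        then have "z \<in> X \<longleftrightarrow> z \<in> ?S" using S(2) by blast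
        then show "indicator X z *\<^sub>R ?F z = indicator ?S z *\<^sub>R ?F z" by (simp add: indicator_def)
      qed
    qed
    also have "\<dots> = (LINT t|lebesgue. LINT x|lebesgue. indicator ?S (x, t) *\<^sub>R ?F (x, t))"
    proof (rule lebesgue_integral_iterated[symmetric])
      have "integrable lebesgue (\<lambda>z. indicator X z *\<^sub>R ?F z)" using iF Xs by (subst (asm) integrable_restrict_space) auto
      then have "integrable lebesgue (\<lambda>z. indicator ?S z *\<^sub>R (indicator X z *\<^sub>R ?F z))" by (rule integrable_mult_indicator[OF S(1)])
            then show "integrable lebesgue (\<lambda>z. indicator ?S z *\<^sub>R ?F z)" unfolding ind .
    qed
    also have "\<dots> = (LINT t:{0<..<T}|lebesgue. LINT x:\<Omega>|lebesgue.
              \<beta> (qbar (x, t)) * time_deriv \<phi> x t + (g (qbar (x, t)) *\<^sub>R vbar (x, t)) \<bullet> space_grad \<phi> x t)"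
    proof -
      have inner: "(LINT x|lebesgue. indicator ?S (x, t) *\<^sub>R ?F (x, t)) = indicator {0<..<T} t *\<^sub>R (LINT x:\<Omega>|lebesgue.
              \<beta> (qbar (x, t)) * time_deriv \<phi> x t + (g (qbar (x, t)) *\<^sub>R vbar (x, t)) \<bullet> space_grad \<phi> x t)" for t
      proof (cases "t \<in> {0<..<T}")
        case False
        then have "(\<lambda>x. indicator ?S (x, t) *\<^sub>R ?F (x, t)) = (\<lambda>x. 0)" by (auto simp: fun_eq_iff)
        then show ?thesis using False by simp
      next
        case True
        then have H: "(x, t) \<in> halfspace" for x :: point by simp
        have t0: "0 < t" using True by simp
        note D = gradient_partials[OF deriv[OF H] t0]
        have "indicator ?S (x, t) *\<^sub>R ?F (x, t) = indicator \<Omega> x *\<^sub>R (\<beta> (qbar (x, t)) * time_deriv \<phi> x t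
             + (g (qbar (x, t)) *\<^sub>R vbar (x, t)) \<bullet> space_grad \<phi> x t)" for x
          unfolding D using True by (simp add: indicator_def inner_vec_def)
        then show ?thesis using True unfolding set_lebesgue_integral_def by simp
      qed
      show ?thesis unfolding inner unfolding set_lebesgue_integral_def ..
    qed
    finally show ?thesis .
  qed
  have "(\<lambda>m. LINT t:{0<..<T}|lebesgue. LINT x:\<Omega>|lebesgue. conv_fun \<beta> g (d m) (x, t) * interpolate (d m) \<phi> (x, t))
     \<longlonglongrightarrow> - I0 - J0 - (\<Sum>i\<in>UNIV. J i)"
    by (rule Lim_transform_eventually[OF lim ev])
  also have "- I0 - J0 - (\<Sum>i\<in>UNIV. J i) = - I0 - (J0 + (\<Sum>i\<in>UNIV. J i))" by simp
  finally show ?thesis unfolding JJ I0 .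
qed

end
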